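(* The shape optimization problem $$\inf_{S\in \mathscr{O}_{\rm ad}} C(S)$$ has at least one solution.
   Context: A toroidal surface is a subset of $\mathbb{R}^3$ homeomorphic to the standard two-dimensional torus; a toroidal domain is a (bounded) domain of $\mathbb{R}^3$ whose boundary is a toroidal surface. Fixed data: a smooth toroidal domain $P\subset\mathbb{R}^3$, a compact set $D\subset\mathbb{R}^3$, constants $\delta,r_{\min},P_{\max},\lambda>0$, and a vector field $B_T\in L^2(P,\mathbb{R}^3)$. For a $\mathscr{C}^{1,1}$ toroidal surface $S$, $V$ denotes the bounded domain with $\partial V=S$, and $\mu_S$ is the Riemannian surface measure (equal to the two-dimensional Hausdorff measure $\mathscr{H}^2$ on $S$). $\mathscr{F}_S$ is the Hilbert space of square-integrable tangent vector fields on $S$ (viewed as $\mathbb{R}^3$-valued maps), i.e. the completion of the smooth tangent vector fields for the inner product $\langle X_1,X_2\rangle_{\mathscr{F}_S}=\int_S\langle X_1,X_2\rangle\,d\mu_S$. $\mathscr{F}_S^0\subset\mathscr{F}_S$ is the closure of the (tangentially) divergence-free smooth tangent vector fields. With $K(x,y)=\frac{x-y}{|x-y|^3}$, the Biot and Savart operator $\operatorname{BS}_S:\mathscr{F}_S\to L^2(P,\mathbb{R}^3)$ is $\operatorname{BS}_S(X)(y)=\int_S K(x,y)\times X(x)\,d\mu_S(x)$, $y\in P$. The cost is $$C(S)=\inf_{j\in\mathscr{F}_S^0}\left(\|\operatorname{BS}_S j-B_T\|^2_{L^2(P,\mathbb{R}^3)}+\lambda\|j\|^2_{\mathscr{F}_S}\right).$$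 For a set $A\subset\mathbb{R}^3$ let $d_A(x)=\inf_{y\in A}|x-y|$, $U_h(A)=\{x: d_A(x)<h\}$, and $\operatorname{Reach}(A)=\sup\{h>0 : d_A\text{ is differentiable on }U_h(A)\setminus\bar A\}$. The admissible set $\mathscr{O}_{\rm ad}$ is the set of all surfaces $S=\partial V\subset D$ such that: $P\subset V$; $S$ is a $\mathscr{C}^{1,1}$ closed toroidal surface with $\operatorname{Reach}(S)\ge r_{\min}$; $\inf_{x\in S,y\in P}|x-y|\ge\delta$; and $\mathscr{H}^2(S)\le P_{\max}$. A solution is a surface $S_*\in\mathscr{O}_{\rm ad}$ with $C(S_* )=\inf_{S\in\mathscr{O}_{\rm ad}}C(S)$.
   Formalization: The admissible set O_ad is assumed nonempty (otherwise, e.g. for D empty, no solution exists); "smooth" divergence-free tangent fields on a C^{1,1} surface are read as Lipschitz fields with divergence zero almost everywhere. *)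

theory Defs
  imports "HOL-Analysis.Analysis"
begin

unbundle no cross3_syntax

type_synonym space3 = "real^3"


section \<open>Two-dimensional Hausdorff measure\<close>

text \<open>
  The normalisation \<open>pi * (diameter U / 2)\<^sup>2\<close> is the usual one, under which the measure
  of a \<open>C\<^sup>1\<close> surface is its Riemannian area. Boundedness is required because
  \<^const>\<open>diameter\<close> has no meaningful value on unbounded sets.
\<close>

definition hausdorff2_pre :: "real \<Rightarrow> space3 set \<Rightarrow> ennreal" where
  "hausdorff2_pre r A =
     (INF U \<in> {U :: nat \<Rightarrow> space3 set.
                 A \<subseteq> (\<Union>i. U i) \<and> (\<forall>i. bounded (U i) \<and> diameter (U i) \<le> r)}.
        \<Sum>i. ennreal (pi * (diameter (U i) / 2)\<^sup>2))"

definition hausdorff2 :: "space3 set \<Rightarrow> ennreal" where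
  "hausdorff2 A = (SUP r \<in> {0<..}. hausdorff2_pre r A)"

text \<open>
  \<^const>\<open>hausdorff2\<close> is a metric outer measure, hence countably additive on the Borel sets, so
  that \<^const>\<open>measure_of\<close> below assigns to every Borel set \<open>A\<close> the value \<open>hausdorff2 A\<close>.
\<close>

definition surface_measure :: "space3 set \<Rightarrow> space3 measure" where
  "surface_measure S = restrict_space (measure_of UNIV (sets borel) hausdorff2) S"


section \<open>Regularity of functions and surfaces\<close>

definition C11_on :: "(space3 \<Rightarrow> real) \<Rightarrow> space3 set \<Rightarrow> bool" where
  "C11_on f U \<longleftrightarrow>
     (\<exists>g L. (\<forall>x\<in>U. GDERIV f x :> g x) \<and> L-lipschitz_on U g)"

primrec Ck_on :: "nat \<Rightarrow> (space3 \<Rightarrow> real) \<Rightarrow> space3 set \<Rightarrow> bool" where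
  "Ck_on 0 f U \<longleftrightarrow> continuous_on U f"
| "Ck_on (Suc k) f U \<longleftrightarrow>
     (\<exists>g. (\<forall>x\<in>U. GDERIV f x :> g x) \<and> (\<forall>i. Ck_on k (\<lambda>x. g x $ i) U))"

definition smooth_on :: "(space3 \<Rightarrow> real) \<Rightarrow> space3 set \<Rightarrow> bool" where
  "smooth_on f U \<longleftrightarrow> (\<forall>k. Ck_on k f U)"

text \<open>
  Embedded surfaces without boundary of a given regularity class \<open>R\<close>: near each of its points
  the set is a regular level set of a function of class \<open>R\<close>.
\<close>

definition embedded_surface ::
    "((space3 \<Rightarrow> real) \<Rightarrow> space3 set \<Rightarrow> bool) \<Rightarrow> space3 set \<Rightarrow> bool" where
  "embedded_surface R S \<longleftrightarrow>
     (\<forall>p\<in>S. \<exists>U f. open U \<and> p \<in> U \<and> R f U \<and>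
        (\<forall>x\<in>U. \<not> (GDERIV f x :> 0)) \<and> S \<inter> U = {x \<in> U. f x = 0})"

definition toroidal_surface :: "space3 set \<Rightarrow> bool" where
  "toroidal_surface S \<longleftrightarrow>
     S homeomorphic (sphere (0::complex) 1 \<times> sphere (0::complex) 1)"

definition toroidal_domain :: "space3 set \<Rightarrow> bool" where
  "toroidal_domain V \<longleftrightarrow>
     open V \<and> connected V \<and> bounded V \<and> toroidal_surface (frontier V)"

definition smooth_toroidal_domain :: "space3 set \<Rightarrow> bool" where
  "smooth_toroidal_domain V \<longleftrightarrow>
     toroidal_domain V \<and> embedded_surface smooth_on (frontier V)"

definition reach :: "space3 set \<Rightarrow> ereal" where
  "reach A = Sup {ereal h | h. h > 0 \<and>
     (\<forall>x \<in> {x. infdist x A < h} - closure A. (\<lambda>y. infdist y A) differentiable (at x))}"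


section \<open>Tangent vector fields\<close>

text \<open>
  The tangent space consists of the velocities at \<open>p\<close> of curves in \<open>S\<close>.
\<close>

definition tangent_space :: "space3 set \<Rightarrow> space3 \<Rightarrow> space3 set" where
  "tangent_space S p =
     {v. \<exists>c :: real \<Rightarrow> space3. range c \<subseteq> S \<and> c 0 = p \<and> (c has_vector_derivative v) (at 0)}"

definition L2_tangent_fields :: "space3 set \<Rightarrow> (space3 \<Rightarrow> space3) set" where
  "L2_tangent_fields S =
     {X. X \<in> borel_measurable (surface_measure S) \<and>
         (AE p in surface_measure S. X p \<in> tangent_space S p) \<and>
         integrable (surface_measure S) (\<lambda>p. (norm (X p))\<^sup>2)}"

definition L2_norm_sq :: "space3 measure \<Rightarrow> (space3 \<Rightarrow> space3) \<Rightarrow> real" where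
  "L2_norm_sq M X = (LINT p|M. (norm (X p))\<^sup>2)"

text \<open>
  On a \<open>C\<^sup>1\<^sup>,\<^sup>1\<close> surface the tangent spaces vary only in a Lipschitz way. Accordingly a tangent
  field that is smooth in \<open>C\<^sup>1\<^sup>,\<^sup>1\<close> coordinates is, as a map into the ambient space, Lipschitz but in
  general no better; the maximal regularity available for tangent fields is used here.
\<close>

definition regular_tangent_field :: "space3 set \<Rightarrow> (space3 \<Rightarrow> space3) \<Rightarrow> bool" where
  "regular_tangent_field S X \<longleftrightarrow>
     (\<exists>L. L-lipschitz_on S X) \<and> (\<forall>p\<in>S. X p \<in> tangent_space S p)"

text \<open>
  The derivative within \<open>S\<close> is determined only in the tangential directions, and the tangential
  divergence is the trace of its tangential part, computed in an orthonormal basis \<open>e\<^sub>1\<close>, \<open>e\<^sub>2\<close>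
  of the tangent space.
\<close>

definition has_surface_divergence ::
    "space3 set \<Rightarrow> (space3 \<Rightarrow> space3) \<Rightarrow> real \<Rightarrow> space3 \<Rightarrow> bool" where
  "has_surface_divergence S X d p \<longleftrightarrow>
     (\<exists>DX e1 e2. (X has_derivative DX) (at p within S) \<and>
        norm e1 = 1 \<and> norm e2 = 1 \<and> e1 \<bullet> e2 = 0 \<and> span {e1, e2} = tangent_space S p \<and>
        d = e1 \<bullet> DX e1 + e2 \<bullet> DX e2)"

text \<open>Lipschitz fields are differentiable almost everywhere only.\<close>

definition divergence_free :: "space3 set \<Rightarrow> (space3 \<Rightarrow> space3) \<Rightarrow> bool" where
  "divergence_free S X \<longleftrightarrow> (AE p in surface_measure S. has_surface_divergence S X 0 p)"

definition L2_divfree_fields :: "space3 set \<Rightarrow> (space3 \<Rightarrow> space3) set" where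
  "L2_divfree_fields S =
     {j \<in> L2_tangent_fields S. \<forall>\<epsilon>>0. \<exists>X. regular_tangent_field S X \<and> divergence_free S X \<and>
         L2_norm_sq (surface_measure S) (\<lambda>p. j p - X p) < \<epsilon>}"


section \<open>The cost functional and the admissible surfaces\<close>

definition BS_kernel :: "space3 \<Rightarrow> space3 \<Rightarrow> space3" where
  "BS_kernel x y = (1 / norm (x - y) ^ 3) *\<^sub>R (x - y)"

definition BS :: "space3 set \<Rightarrow> (space3 \<Rightarrow> space3) \<Rightarrow> space3 \<Rightarrow> space3" where
  "BS S X y = (LINT x|surface_measure S. cross3 (BS_kernel x y) (X x))"

definition cost :: "space3 set \<Rightarrow> (space3 \<Rightarrow> space3) \<Rightarrow> real \<Rightarrow> space3 set \<Rightarrow> real" where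
  "cost P B\<^sub>T \<Lambda> S =
     (INF j \<in> L2_divfree_fields S.
        L2_norm_sq (lebesgue_on P) (\<lambda>y. BS S j y - B\<^sub>T y) + \<Lambda> * L2_norm_sq (surface_measure S) j)"

definition admissible ::
    "space3 set \<Rightarrow> space3 set \<Rightarrow> real \<Rightarrow> real \<Rightarrow> real \<Rightarrow> space3 set set" where
  "admissible P D \<delta> r_min P_max =
     {S. S \<subseteq> D \<and> (\<exists>V. toroidal_domain V \<and> S = frontier V \<and> P \<subseteq> V) \<and>
         embedded_surface C11_on S \<and> reach S \<ge> ereal r_min \<and> setdist S P \<ge> \<delta> \<and>
         hausdorff2 S \<le> ennreal P_max}"

end

(*
A surface of reach at least r has tangent balls of radius r on both sides. It is therefore the zero
set of a truncated signed distance g whose gradient G satisfies a quadratic Taylor estimate with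
constants depending only on r. By Arzela-Ascoli, the pairs (g_n, G_n) of a minimising sequence S_n
converge uniformly, after passing to a subsequence, to such a pair (g_0, G_0), and S_0 = {g_0 = 0} is
the minimiser.

For large n an explicit diffeomorphism Phi of space, close to the identity together with its
derivative A, maps S_0 onto S_n and satisfies G_n(Phi x) . A(x) v = G_0(x) . v on S_0. Topology and area
bound pass to S_0 through Phi; the reach bound does so because the distance functions converge.

Thanks to the conormal identity, the cofactor matrix of A turns divergence-free tangent fields on S_n
into divergence-free tangent fields on S_0 (the Piola transform). The derivatives involved exist almost
everywhere by Rademacher's theorem, and the contributions of the second derivatives of Phi cancel
because the second fundamental form is symmetric. Transporting almost optimal fields from S_n to S_0
changes the energy by an amount that tends to 0, so the cost of S_0 is at most the infimum. No weak
compactness of the currents is needed.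
*)
theory Submission
  imports Defs "HOL-Complex_Analysis.Great_Picard"
begin

section \<open>Distance functions and tangent balls\<close>

lemma has_derivative_directional_limit:
  fixes f :: "'a::real_normed_vector \<Rightarrow> 'b::real_normed_vector"
  assumes "(f has_derivative D) (at x)"
  shows "((\<lambda>t. (f (x + t *\<^sub>R v) - f x) /\<^sub>R t) \<longlongrightarrow> D v) (at_right 0)"
proof -
  define h where "h = (\<lambda>t. f (x + t *\<^sub>R v))"
  have "((f \<circ> (\<lambda>t. x + t *\<^sub>R v)) has_derivative (D \<circ> (\<lambda>t. t *\<^sub>R v))) (at 0)"
    by (rule diff_chain_at) (use assms in \<open>auto intro!: derivative_eq_intros\<close>)
  moreover have "D \<circ> (\<lambda>t. t *\<^sub>R v) = (\<lambda>t. t *\<^sub>R D v)"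
    using assms by (auto simp: has_derivative_def bounded_linear.linear linear_scale)
  ultimately have "(h has_derivative (\<lambda>t. t *\<^sub>R D v)) (at 0)" by (simp add: h_def o_def)
  then have "((\<lambda>t. norm (h t - h 0 - t *\<^sub>R D v) / norm t) \<longlongrightarrow> 0) (at 0)"
    by (simp add: has_derivative_iff_norm)
  then have "((\<lambda>t. norm (h t - h 0 - t *\<^sub>R D v) / norm t) \<longlongrightarrow> 0) (at_right 0)"
    by (simp add: filterlim_at_split)
  moreover have "norm (h t - h 0 - t *\<^sub>R D v) / norm t = norm ((h t - h 0) /\<^sub>R t - D v)" if "t > 0" for t
  proof -
    have "(h t - h 0) /\<^sub>R t - D v = (h t - h 0 - t *\<^sub>R D v) /\<^sub>R t" using that by (simp add: algebra_simps)
    then show ?thesis using that by (simp add: divide_inverse)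
  qed
  then have "\<forall>\<^sub>F t in at_right 0. norm (h t - h 0 - t *\<^sub>R D v) / norm t = norm ((h t - h 0) /\<^sub>R t - D v)"
    unfolding eventually_at_right_field by (intro exI[of _ 1]) auto
  ultimately have "((\<lambda>t. norm ((h t - h 0) /\<^sub>R t - D v)) \<longlongrightarrow> 0) (at_right 0)"
    using tendsto_cong by fastforce
  then have "((\<lambda>t. (h t - h 0) /\<^sub>R t - D v) \<longlongrightarrow> 0) (at_right 0)" by (rule tendsto_norm_zero_cancel)
  then show ?thesis unfolding h_def by (simp add: LIM_zero_iff)
qed

lemma linear_functional_inner:
  fixes D :: "'a::euclidean_space \<Rightarrow> real"
  assumes "linear D"
  obtains w where "D = (\<lambda>v. w \<bullet> v)"
proof
  show "D = (\<lambda>v. adjoint D 1 \<bullet> v)"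
    using adjoint_works[OF assms, of _ 1] by (auto simp: inner_commute)
qed

lemma infdist_segment:
  fixes a :: "'a::real_normed_vector"
  assumes "a \<in> S" "norm n = 1" "infdist (a + t *\<^sub>R n) S = t" "0 \<le> s" "s \<le> t"
  shows "infdist (a + s *\<^sub>R n) S = s"
proof (rule antisym)
  show "infdist (a + s *\<^sub>R n) S \<le> s"
    using infdist_le[OF assms(1), of "a + s *\<^sub>R n"] assms by (simp add: dist_norm)
  have "infdist (a + t *\<^sub>R n) S \<le> infdist (a + s *\<^sub>R n) S + dist (a + t *\<^sub>R n) (a + s *\<^sub>R n)"
    by (rule infdist_triangle)
  also have "dist (a + t *\<^sub>R n) (a + s *\<^sub>R n) = t - s"
    using assms by (simp add: dist_norm flip: scaleR_diff_left)
  finally show "s \<le> infdist (a + s *\<^sub>R n) S" using assms by simp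
qed

lemma infdist_gradient:
  fixes x a w :: "'a::euclidean_space"
  assumes der: "((\<lambda>y. infdist y S) has_derivative (\<lambda>v. w \<bullet> v)) (at x)"
    and a: "a \<in> S" "infdist x S = dist x a" and pos: "infdist x S > 0"
  shows "w = (x - a) /\<^sub>R infdist x S"
proof -
  define d where "d = infdist x S"
  define n where "n = (x - a) /\<^sub>R d"
  have d: "d > 0" "norm (x - a) = d" using a pos by (auto simp: d_def dist_norm)
  have n1: "norm n = 1" and xa: "x = a + d *\<^sub>R n" using d by (auto simp: n_def)
  have val: "infdist (x - t *\<^sub>R n) S = d - t" if "0 \<le> t" "t \<le> d" for t
  proof -
    have "x - t *\<^sub>R n = a + (d - t) *\<^sub>R n" by (subst xa) (simp add: algebra_simps)
    then show ?thesis
      using infdist_segment[OF a(1) n1, of d "d - t"] that by (simp flip: xa add: d_def[symmetric])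
  qed
  have "w \<bullet> (- n) = -1"
  proof (rule tendsto_unique)
    show "((\<lambda>t. (infdist (x + t *\<^sub>R (- n)) S - infdist x S) /\<^sub>R t) \<longlongrightarrow> w \<bullet> (- n)) (at_right 0)"
      by (rule has_derivative_directional_limit[OF der])
    have "\<forall>\<^sub>F t in at_right 0. (infdist (x + t *\<^sub>R (- n)) S - infdist x S) /\<^sub>R t = -1"
      unfolding eventually_at_right_field using d val
      by (intro exI[of _ d]) (auto simp: d_def field_simps)
    then show "((\<lambda>t. (infdist (x + t *\<^sub>R (- n)) S - infdist x S) /\<^sub>R t) \<longlongrightarrow> -1) (at_right 0)"
      by (rule tendsto_eventually)
  qed simp
  then have wn: "w \<bullet> n = 1" by simp
  have "w \<bullet> w \<le> norm w"
  proof (rule tendsto_upperbound)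
    show "((\<lambda>t. (infdist (x + t *\<^sub>R w) S - infdist x S) /\<^sub>R t) \<longlongrightarrow> w \<bullet> w) (at_right 0)"
      by (rule has_derivative_directional_limit[OF der])
    have "(infdist (x + t *\<^sub>R w) S - infdist x S) /\<^sub>R t \<le> norm w" if "t > 0" for t
    proof -
      have "infdist (x + t *\<^sub>R w) S \<le> infdist x S + dist (x + t *\<^sub>R w) x" by (rule infdist_triangle)
      also have "dist (x + t *\<^sub>R w) x = t * norm w" using that by (simp add: dist_norm)
      finally show ?thesis using that by (simp add: field_simps)
    qed
    then show "\<forall>\<^sub>F t in at_right 0. (infdist (x + t *\<^sub>R w) S - infdist x S) /\<^sub>R t \<le> norm w"
      unfolding eventually_at_right_field by (intro exI[of _ 1]) auto
  qed simp
  then have "norm w * norm w \<le> norm w" by (simp add: dot_square_norm power2_eq_square)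
  then have "norm w \<le> 1" by (cases "w = 0") (simp_all add: mult_le_cancel_right1)
  have "(norm (w - n))\<^sup>2 = (norm w)\<^sup>2 - 1"
    using wn n1 by (simp add: power2_norm_eq_inner inner_diff inner_commute norm_eq_1)
  also have "\<dots> \<le> 0" using \<open>norm w \<le> 1\<close> by (simp add: power_le_one)
  finally have "w = n" by simp
  then show ?thesis by (simp add: n_def d_def)
qed

lemma infdist_ray_step:
  fixes S :: "'a::euclidean_space set"
  assumes S: "closed S" "S \<noteq> {}"
    and diff: "\<And>x. 0 < infdist x S \<Longrightarrow> infdist x S < r \<Longrightarrow> (\<lambda>y. infdist y S) differentiable (at x)"
    and a: "a \<in> S" "norm n = 1" "infdist (a + t *\<^sub>R n) S = t"
    and s: "0 < s" "3 * s < t" "t + 3 * s < r"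
  shows "infdist (a + (t + s) *\<^sub>R n) S = t + s"
proof -
  define d where "d = (\<lambda>y. infdist y S)"
  define x where "x = a + t *\<^sub>R n"
  define \<phi> where "\<phi> = (\<lambda>z. d z - inverse (2 * s) * ((z - x) \<bullet> (z - x)))"
  have dx: "d x = t" using a by (simp add: d_def x_def)
  have Lip: "d z \<le> d y + norm (z - y)" for y z
    using infdist_triangle[of z S y] by (simp add: d_def dist_norm)
  have "continuous_on (cball x (3 * s)) \<phi>"
    unfolding \<phi>_def d_def by (intro continuous_intros) (use s in auto)
  moreover have "cball x (3 * s) \<noteq> {}" using s by auto
  ultimately obtain y where y: "y \<in> cball x (3 * s)" "\<And>z. z \<in> cball x (3 * s) \<Longrightarrow> \<phi> z \<le> \<phi> y"
    using continuous_attains_sup[of "cball x (3 * s)" \<phi>] by auto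
  have "\<phi> x \<le> \<phi> y" using s by (intro y(2)) simp
  then have 1: "t + (norm (y - x))\<^sup>2 / (2 * s) \<le> d y"
    unfolding \<phi>_def dx dot_square_norm by (simp only: diff_self norm_zero divide_inverse mult.commute) simp
  with Lip[of y x] dx have "(norm (y - x))\<^sup>2 / (2 * s) \<le> norm (y - x)" by linarith
  then have "norm (y - x) * norm (y - x) \<le> (2 * s) * norm (y - x)"
    using s by (simp add: divide_le_eq power2_eq_square mult.commute)
  then have yx: "norm (y - x) \<le> 2 * s"
    unfolding mult_le_cancel_right using norm_ge_zero[of "y - x"] s by linarith
  have "0 \<le> (norm (y - x))\<^sup>2 / (2 * s)" using s by simp
  with 1 have "t \<le> d y" by linarith
  moreover have "d y \<le> t + 2 * s" using Lip[of y x] dx yx by linarith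
  ultimately have dy: "t \<le> d y" "d y \<le> t + 2 * s" by auto
  have "d differentiable (at y)" unfolding d_def
    by (rule diff) (use dy s in \<open>auto simp: d_def\<close>)
  then obtain D where "(d has_derivative D) (at y)" by (auto simp: differentiable_def)
  moreover from this obtain w where "D = (\<lambda>v. w \<bullet> v)"
    using linear_functional_inner has_derivative_linear by blast
  ultimately have w: "(d has_derivative (\<lambda>v. w \<bullet> v)) (at y)" by simp
  have "((\<lambda>z. z - x) has_derivative (\<lambda>v. v)) (at y)"
    by (auto intro!: derivative_eq_intros)
  from has_derivative_inner[OF this this]
  have "((\<lambda>z. (z - x) \<bullet> (z - x)) has_derivative (\<lambda>v. (y - x) \<bullet> v + v \<bullet> (y - x))) (at y)" .
  from has_derivative_diff[OF w has_derivative_mult_right[OF this, of "inverse (2 * s)"]]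
  have der: "(\<phi> has_derivative (\<lambda>v. w \<bullet> v - inverse (2 * s) * ((y - x) \<bullet> v + v \<bullet> (y - x)))) (at y)"
    unfolding \<phi>_def .
  have "(\<lambda>v. w \<bullet> v - inverse (2 * s) * ((y - x) \<bullet> v + v \<bullet> (y - x))) = (\<lambda>v. 0)"
  proof -
    have in1: "y \<in> ball x (3 * s)" using yx s by (simp add: dist_norm norm_minus_commute)
    have "\<forall>z\<in>ball x (3 * s). \<phi> z \<le> \<phi> y" using y(2) ball_subset_cball by blast
    then show ?thesis using differential_zero_maxmin[OF in1 open_ball der] by blast
  qed
  from fun_cong[OF this] have crit: "w \<bullet> v = inverse (2 * s) * ((y - x) \<bullet> v + v \<bullet> (y - x))" for v by simp
  have "(w - (y - x) /\<^sub>R s) \<bullet> v = 0" for v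
  proof -
    have 2: "inverse (2 * s) * (q + q) = inverse s * q" for q using s by (simp add: field_simps)
    show ?thesis using crit[of v] unfolding inner_commute[of v] 2 inner_diff_left[of w] inner_scaleR_left
      by linarith
  qed
  then have weq: "w = (y - x) /\<^sub>R s" by (metis all_zero_iff inner_commute right_minus_eq)
  obtain b where b: "b \<in> S" "infdist y S = dist y b" using infdist_attains_inf[OF S] by metis
  have wb: "w = (y - b) /\<^sub>R d y"
    using infdist_gradient[OF w[unfolded d_def] b] dy s by (simp add: d_def)
  have nyb: "norm (y - b) = d y" using b by (simp add: d_def dist_norm)
  then have w1: "norm w = 1" using wb dy s by simp
  have y_eq: "y = x + s *\<^sub>R w" using weq s by simp
  then have "norm (y - x) = s" using w1 s by simp
  have "d y *\<^sub>R w = y - b" using wb dy s by simp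
  then have xb: "x - b = (d y - s) *\<^sub>R w" using y_eq by (simp add: algebra_simps)
  then have nxb: "norm (x - b) = d y - s" using w1 dy s by simp
  have "t \<le> norm (x - b)" using infdist_le[OF b(1), of x] dx by (simp add: d_def dist_norm)
  with nxb Lip[of y x] \<open>norm (y - x) = s\<close> dx have dys: "d y = t + s" by linarith
  have "d differentiable (at x)" unfolding d_def
    by (rule diff) (use dx s in \<open>auto simp: d_def\<close>)
  then obtain D' where "(d has_derivative D') (at x)" by (auto simp: differentiable_def)
  moreover from this obtain w' where "D' = (\<lambda>v. w' \<bullet> v)"
    using linear_functional_inner has_derivative_linear by blast
  ultimately have w': "(d has_derivative (\<lambda>v. w' \<bullet> v)) (at x)" by simp
  have "w' = (x - b) /\<^sub>R infdist x S"
  proof (rule infdist_gradient[OF w'[unfolded d_def] b(1)])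
    show "infdist x S = dist x b" "0 < infdist x S" using dx dys nxb s by (simp_all add: d_def dist_norm)
  qed
  moreover have "w' = (x - a) /\<^sub>R infdist x S"
  proof (rule infdist_gradient[OF w'[unfolded d_def] a(1)])
    show "infdist x S = dist x a" "0 < infdist x S" using dx s a(2) by (simp_all add: d_def x_def dist_norm)
  qed
  moreover have "infdist x S \<noteq> 0" using dx s by (simp add: d_def)
  ultimately have "x - b = x - a" by simp
  moreover have "x - b = t *\<^sub>R w" using xb unfolding dys by simp
  ultimately have "t *\<^sub>R w = t *\<^sub>R n" unfolding x_def by simp
  moreover have "t \<noteq> 0" using s by auto
  ultimately have "w = n" by simp
  then have "y = a + (t + s) *\<^sub>R n" unfolding y_eq x_def by (simp add: algebra_simps)
  then show ?thesis using dys unfolding d_def by simp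
qed

lemma infdist_ray:
  fixes S :: "'a::euclidean_space set"
  assumes S: "closed S" "S \<noteq> {}"
    and diff: "\<And>x. 0 < infdist x S \<Longrightarrow> infdist x S < r \<Longrightarrow> (\<lambda>y. infdist y S) differentiable (at x)"
    and a: "a \<in> S" "norm n = 1" "infdist (a + t0 *\<^sub>R n) S = t0" "0 < t0"
    and t: "0 \<le> t" "t < r"
  shows "infdist (a + t *\<^sub>R n) S = t"
proof (cases "t \<le> t0")
  case True
  then show ?thesis using infdist_segment[OF a(1-3)] t by simp
next
  case False
  define T where "T = {s \<in> {t0..t}. infdist (a + s *\<^sub>R n) S = s}"
  have "closed T" unfolding T_def
    using continuous_closed_preimage_constant[of "{t0..t}" "\<lambda>s. infdist (a + s *\<^sub>R n) S - s" 0]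
    by (simp add: continuous_intros)
  moreover have "bounded T" unfolding T_def by (rule bounded_subset[of "{t0..t}"]) auto
  ultimately have "compact T" by (simp add: compact_eq_bounded_closed)
  moreover have "t0 \<in> T" using a False by (auto simp: T_def)
  ultimately obtain u where u: "u \<in> T" "\<And>s. s \<in> T \<Longrightarrow> s \<le> u"
    using compact_attains_sup[of T] by auto
  have "u = t"
  proof (rule ccontr)
    assume "u \<noteq> t"
    with u have "u < t" "t0 \<le> u" by (auto simp: T_def)
    define s where "s = min u (t - u) / 4"
    have s: "0 < s" "3 * s < u" "u + 3 * s < t" using \<open>u < t\<close> \<open>t0 \<le> u\<close> a(4) by (auto simp: s_def min_def field_simps)
    have "infdist (a + (u + s) *\<^sub>R n) S = u + s"
      by (rule infdist_ray_step[OF S diff a(1,2)]) (use u s t in \<open>auto simp: T_def\<close>)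
    then have "u + s \<in> T" using s \<open>t0 \<le> u\<close> by (auto simp: T_def)
    with u s show False by fastforce
  qed
  then show ?thesis using u by (simp add: T_def)
qed

lemma reach_differentiable:
  assumes "reach S \<ge> ereal r" "closed S" "0 < infdist x S" "infdist x S < r"
  shows "(\<lambda>y. infdist y S) differentiable (at x)"
proof -
  have "ereal (infdist x S) < reach S" using assms by (meson less_ereal.simps(1) less_le_trans)
  then obtain h where h: "h > 0" "infdist x S < h"
    "\<forall>x \<in> {x. infdist x S < h} - closure S. (\<lambda>y. infdist y S) differentiable (at x)"
    unfolding reach_def less_Sup_iff by auto
  moreover have "x \<notin> closure S" using assms in_closure_iff_infdist_zero[of S x]
    by (metis closure_closed closure_empty empty_iff less_irrefl)
  ultimately show ?thesis by auto
qed

definition ray_normal :: "'a::real_normed_vector set \<Rightarrow> real \<Rightarrow> 'a \<Rightarrow> 'a \<Rightarrow> bool" where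
  "ray_normal S r a n \<longleftrightarrow> norm n = 1 \<and> (\<forall>t. 0 \<le> t \<and> t < r \<longrightarrow> infdist (a + t *\<^sub>R n) S = t)"

lemma normalize_eq:
  fixes v :: "'a::real_normed_vector"
  assumes "v = norm v *\<^sub>R n" "v \<noteq> 0"
  shows "n = v /\<^sub>R norm v"
proof -
  have "v /\<^sub>R norm v = (norm v *\<^sub>R n) /\<^sub>R norm v" using assms(1) by simp
  also have "\<dots> = n" using assms(2) by simp
  finally show ?thesis by simp
qed

lemma half_space_normal:
  fixes g n :: "'a::euclidean_space"
  assumes "norm n = 1" "\<And>v. v \<bullet> n > 0 \<Longrightarrow> g \<bullet> v \<ge> 0"
  shows "g = norm g *\<^sub>R n"
proof -
  define h where "h = g - (g \<bullet> n) *\<^sub>R n"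
  have nn: "n \<bullet> n = 1" using assms by (simp add: norm_eq_1)
  have hn: "h \<bullet> n = 0" by (simp add: h_def inner_diff_left nn)
  have gh: "g \<bullet> h = h \<bullet> h" by (simp add: h_def inner_diff nn inner_commute)
  have "h \<bullet> h \<le> e * (g \<bullet> n)" if "e > 0" for e
    using assms(2)[of "e *\<^sub>R n - h"] that gh hn nn by (simp add: inner_diff)
  moreover have gn: "g \<bullet> n \<ge> 0" using assms(2)[of n] nn by simp
  ultimately have "h \<bullet> h \<le> 0"
  proof -
    have "h \<bullet> h \<le> 0 + e" if "e > 0" for e
    proof (cases "g \<bullet> n = 0")
      case True
      then show ?thesis using \<open>\<And>e. e > 0 \<Longrightarrow> h \<bullet> h \<le> e * (g \<bullet> n)\<close>[of 1] that by simp
    next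
      case False
      with gn have "g \<bullet> n > 0" by simp
      then show ?thesis using \<open>\<And>e. e > 0 \<Longrightarrow> h \<bullet> h \<le> e * (g \<bullet> n)\<close>[of "e / (g \<bullet> n)"] that by simp
    qed
    then show ?thesis by (rule field_le_epsilon)
  qed
  then have "h = 0" by (metis antisym inner_ge_zero inner_eq_zero_iff)
  then have "g = (g \<bullet> n) *\<^sub>R n" by (simp add: h_def)
  moreover from this have "norm g = g \<bullet> n" using assms gn by (metis abs_of_nonneg mult.right_neutral norm_scaleR)
  ultimately show ?thesis by simp
qed

lemma touching_ball_gradient:
  fixes n :: "'a::euclidean_space"
  assumes n: "norm n = 1" "t > 0" and f: "GDERIV f a :> g" "f a = 0"
    and pos: "\<And>x. x \<in> ball (a + t *\<^sub>R n) t \<Longrightarrow> f x > 0"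
  shows "g = norm g *\<^sub>R n"
proof (rule half_space_normal[OF n(1)])
  fix v assume v: "v \<bullet> n > 0"
  then have v0: "norm v > 0" by auto
  have f': "(f has_derivative (\<lambda>v. g \<bullet> v)) (at a)" using f(1) by (simp add: gderiv_def inner_commute)
  show "g \<bullet> v \<ge> 0"
  proof (rule tendsto_lowerbound[OF has_derivative_directional_limit[OF f', of v]])
    have "(f (a + e *\<^sub>R v) - f a) /\<^sub>R e \<ge> 0" if e: "0 < e" "e < 2 * t * (v \<bullet> n) / (norm v)\<^sup>2" for e
    proof -
      have "(norm (t *\<^sub>R n - e *\<^sub>R v))\<^sup>2 = t\<^sup>2 - e * (2 * t * (v \<bullet> n) - e * (norm v)\<^sup>2)"
        using n by (simp add: power2_norm_eq_inner inner_diff inner_commute norm_eq_1)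
          (simp add: algebra_simps power2_eq_square)
      also have "\<dots> < t\<^sup>2" using e v0 by (simp add: field_simps)
      finally have "norm (t *\<^sub>R n - e *\<^sub>R v) < t" using n by (simp add: power2_less_imp_less)
      then have "a + e *\<^sub>R v \<in> ball (a + t *\<^sub>R n) t" by (simp add: dist_norm)
      from pos[OF this] show ?thesis using f e by simp
    qed
    moreover have "0 < 2 * t * (v \<bullet> n) / (norm v)\<^sup>2" using v v0 n by simp
    ultimately show "\<forall>\<^sub>F e in at_right 0. 0 \<le> (f (a + e *\<^sub>R v) - f a) /\<^sub>R e"
      unfolding eventually_at_right_field by blast
  qed simp
qed

lemma ball_avoids_infdist:
  assumes "t \<le> infdist x S"
  shows "ball x t \<inter> S = {}"
  using assms infdist_le[of _ S x] by force

lemma connected_sign: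
  fixes f :: "'a::topological_space \<Rightarrow> real"
  assumes "connected C" "continuous_on C f" "\<And>x. x \<in> C \<Longrightarrow> f x \<noteq> 0" "x \<in> C" "f x > 0" "y \<in> C"
  shows "f y > 0"
proof (rule ccontr)
  assume "\<not> f y > 0"
  with assms have "f y < 0" by force
  have "connected (f ` C)" using assms(1,2) by (rule_tac connected_continuous_image)
  then have "0 \<in> f ` C"
    by (rule connectedD_interval[of _ "f y" "f x"]) (use assms \<open>f y < 0\<close> in auto)
  then show False using assms(3) by fastforce
qed

lemma level_set_touching:
  fixes S :: "'a::euclidean_space set"
  assumes U: "open U" "\<And>x. x \<in> U \<Longrightarrow> GDERIV f x :> g x" "S \<inter> U = {x \<in> U. f x = 0}"
    and a: "a \<in> S" "norm n = 1" "0 < t" "infdist (a + t *\<^sub>R n) S \<ge> t" "cball (a + t *\<^sub>R n) t \<subseteq> U"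
    and pos: "f (a + t *\<^sub>R n) > 0"
  shows "g a = norm (g a) *\<^sub>R n"
proof -
  let ?B = "ball (a + t *\<^sub>R n) t"
  have aU: "a \<in> U" using a by (auto simp: dist_norm)
  have BS: "?B \<inter> S = {}" using a ball_avoids_infdist by blast
  have cf: "continuous_on U f"
    using U by (auto intro!: continuous_at_imp_continuous_on has_derivative_continuous simp: gderiv_def)
  have BU: "?B \<subseteq> U" using a ball_subset_cball by blast
  show ?thesis
  proof (rule touching_ball_gradient[OF a(2,3) U(2)[OF aU]])
    show "f a = 0" using U a aU by blast
    fix x assume x: "x \<in> ?B"
    show "f x > 0"
      proof (rule connected_sign[where C="?B" and f=f, OF connected_ball _ _ _ pos x])
      show "continuous_on ?B f" using cf BU continuous_on_subset by blast
      show "a + t *\<^sub>R n \<in> ?B" using a by simp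
      show "f z \<noteq> 0" if "z \<in> ?B" for z using that BS BU U(3) by blast
    qed
  qed
qed

lemma level_set_ray_normal:
  fixes S :: "'a::euclidean_space set"
  assumes S: "closed S"
    and diff: "\<And>x. 0 < infdist x S \<Longrightarrow> infdist x S < r \<Longrightarrow> (\<lambda>y. infdist y S) differentiable (at x)"
    and r: "r > 0"
    and U: "open U" "\<And>x. x \<in> U \<Longrightarrow> GDERIV f x :> g x" "S \<inter> U = {x \<in> U. f x = 0}"
    and g: "continuous_on U g" "\<And>x. x \<in> U \<Longrightarrow> g x \<noteq> 0"
    and a: "a \<in> S" "a \<in> U"
  shows "ray_normal S r a (g a /\<^sub>R norm (g a))"
proof -
  have S0: "S \<noteq> {}" using a by auto
  define \<nu> where "\<nu> = (\<lambda>x. g x /\<^sub>R norm (g x))"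
  have \<nu>1: "norm (\<nu> a) = 1" using g a by (simp add: \<nu>_def)
  have \<nu>c: "continuous_on U \<nu>" unfolding \<nu>_def using g by (intro continuous_intros) auto
  define x where "x = (\<lambda>k::nat. a + (1 / real (Suc k)) *\<^sub>R \<nu> a)"
  define p where "p = (\<lambda>k. SOME b. b \<in> S \<and> infdist (x k) S = dist (x k) b)"
  have p: "p k \<in> S \<and> infdist (x k) S = dist (x k) (p k)" for k
    unfolding p_def by (rule someI_ex) (use infdist_attains_inf[OF S S0] in metis)
  define d where "d = (\<lambda>k. infdist (x k) S)"
  have dk: "d k \<le> 1 / real (Suc k)" for k
    using infdist_le[OF a(1), of "x k"] \<nu>1 by (simp add: d_def x_def dist_norm)
  have dxa: "dist (x k) a = 1 / real (Suc k)" for k using \<nu>1 by (simp add: x_def dist_norm)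
  have pa: "dist (p k) a \<le> 2 / real (Suc k)" for k
    using dist_triangle[of "p k" a "x k"] dk[of k] dxa[of k] p[of k] by (simp add: d_def dist_commute)
  have l0: "(\<lambda>k. 1 / real (Suc k)) \<longlonglongrightarrow> 0" using LIMSEQ_inverse_real_of_nat by (simp add: inverse_eq_divide)
  have l2: "(\<lambda>k. 2 / real (Suc k)) \<longlonglongrightarrow> 0" using tendsto_mult[OF tendsto_const l0, of 2] by simp
  have "(\<lambda>k. dist (p k) a) \<longlonglongrightarrow> 0"
    by (rule tendsto_sandwich[OF _ _ tendsto_const l2]) (use pa in auto)
  then have plim: "p \<longlonglongrightarrow> a" by (rule tendsto_dist_iff[THEN iffD2])
  obtain e where e: "e > 0" "ball a e \<subseteq> U" using U(1) a openE by blast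
  have f': "(f has_derivative (\<lambda>v. g a \<bullet> v)) (at a)" using U(2)[OF a(2)] by (simp add: gderiv_def inner_commute)
  have fa: "f a = 0" using U a by blast
  have "g a \<bullet> \<nu> a = norm (g a)" using g(2)[OF a(2)] by (simp add: \<nu>_def dot_square_norm power2_eq_square)
  then have gpos: "g a \<bullet> \<nu> a > 0" using g a by simp
  have "\<forall>\<^sub>F t in at_right 0. (f (a + t *\<^sub>R \<nu> a) - f a) /\<^sub>R t > 0"
    using has_derivative_directional_limit[OF f', of "\<nu> a"] gpos by (rule order_tendstoD)
  then obtain b where b: "b > 0" "\<And>t. 0 < t \<Longrightarrow> t < b \<Longrightarrow> (f (a + t *\<^sub>R \<nu> a) - f a) /\<^sub>R t > 0"
    unfolding eventually_at_right_field by blast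
  have fpos: "f (a + t *\<^sub>R \<nu> a) > 0" if "0 < t" "t < b" for t
    using b(2)[OF that] fa that by (simp add: zero_less_mult_iff)
  have ev: "\<forall>\<^sub>F k in sequentially. 2 / real (Suc k) < min b (min e r)"
    using order_tendstoD(2)[OF l2, of "min b (min e r)"] b e r by simp
  have key: "ray_normal S r (p k) (\<nu> (p k))" if k: "2 / real (Suc k) < min b (min e r)" for k
  proof -
    have k1: "1 / real (Suc k) < b" "2 / real (Suc k) < e" "d k < r"
      using k dk[of k] divide_right_mono[of 1 2 "real (Suc k)"] by auto
    have fx: "f (x k) > 0" unfolding x_def by (rule fpos) (use k1 in auto)
    have "ball a e \<subseteq> U" by fact
    have "x k \<in> ball a e" using dxa[of k] k1(2) divide_right_mono[of 1 2 "real (Suc k)"] by (simp add: dist_commute)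
    then have "x k \<notin> S" using fx U e by force
    then have dpos: "d k > 0" unfolding d_def using S S0 infdist_pos_not_in_closed by blast
    define n where "n = (x k - p k) /\<^sub>R d k"
    have nrm: "norm (x k - p k) = d k" using p[of k] by (simp add: d_def dist_norm)
    have n1: "norm n = 1" using dpos nrm by (simp add: n_def)
    have xk: "x k = p k + d k *\<^sub>R n" using dpos by (simp add: n_def)
    have cb: "cball (x k) (d k) \<subseteq> U"
    proof
      fix y assume "y \<in> cball (x k) (d k)"
      then have "dist y a \<le> 2 / real (Suc k)"
        using dist_triangle[of y a "x k"] dk[of k] dxa[of k] by (simp add: dist_commute)
      then show "y \<in> U" using e k1 by (auto simp: dist_commute subset_iff)
    qed
    have "g (p k) = norm (g (p k)) *\<^sub>R n"
    proof (rule level_set_touching[OF U(1,2,3) _ n1 dpos])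
      show "p k \<in> S" using p by blast
      show "d k \<le> infdist (p k + d k *\<^sub>R n) S" unfolding xk[symmetric] by (simp add: d_def)
      show "cball (p k + d k *\<^sub>R n) (d k) \<subseteq> U" "f (p k + d k *\<^sub>R n) > 0"
        unfolding xk[symmetric] by (fact cb fx)+
    qed
    moreover have "p k \<in> U" using pa[of k] k1 e by (auto simp: dist_commute subset_iff)
    ultimately have "\<nu> (p k) = n" unfolding \<nu>_def using g(2)
      by (metis scaleR_scaleR left_inverse norm_eq_zero scaleR_one)
    moreover have "infdist (p k + d k *\<^sub>R n) S = d k" unfolding xk[symmetric] by (simp add: d_def)
    ultimately show ?thesis unfolding ray_normal_def
      using infdist_ray[OF S S0 diff, of r "p k" n "d k"] p[of k] n1 dpos by metis
  qed
  show ?thesis unfolding ray_normal_def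
  proof (intro conjI allI impI)
    show "norm (g a /\<^sub>R norm (g a)) = 1" using \<nu>1 by (simp add: \<nu>_def)
    fix t assume t: "0 \<le> t \<and> t < r"
    have "isCont \<nu> a" using \<nu>c U a by (simp add: continuous_on_eq_continuous_at)
    then have "(\<lambda>k. infdist (p k + t *\<^sub>R \<nu> (p k)) S) \<longlonglongrightarrow> infdist (a + t *\<^sub>R \<nu> a) S"
      by (intro tendsto_intros plim isCont_tendsto_compose[of a \<nu>])
    moreover have "(\<lambda>k. infdist (p k + t *\<^sub>R \<nu> (p k)) S) \<longlonglongrightarrow> t"
      by (rule tendsto_eventually, rule eventually_mono[OF ev])
         (use key t in \<open>auto simp: ray_normal_def\<close>)
    ultimately show "infdist (a + t *\<^sub>R (g a /\<^sub>R norm (g a))) S = t"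
      using LIMSEQ_unique unfolding \<nu>_def by blast
  qed
qed

lemma level_set_ray_unique:
  fixes S :: "'a::euclidean_space set"
  assumes U: "open U" "\<And>x. x \<in> U \<Longrightarrow> GDERIV f x :> g x" "S \<inter> U = {x \<in> U. f x = 0}"
    and g: "\<And>x. x \<in> U \<Longrightarrow> g x \<noteq> 0"
    and a: "a \<in> S" "a \<in> U" "norm n = 1" "0 < t" "infdist (a + t *\<^sub>R n) S = t"
  shows "n = g a /\<^sub>R norm (g a) \<or> n = - (g a /\<^sub>R norm (g a))"
proof -
  obtain e where e: "e > 0" "ball a e \<subseteq> U" using U(1) a openE by blast
  define s where "s = min t (e / 3)"
  have s: "0 < s" "s \<le> t" "2 * s < e" using e a by (auto simp: s_def)
  have ds: "infdist (a + s *\<^sub>R n) S = s" using infdist_segment[OF a(1,3,5)] s by simp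
  have cb: "cball (a + s *\<^sub>R n) s \<subseteq> U"
  proof
    fix y assume "y \<in> cball (a + s *\<^sub>R n) s"
    moreover have "dist (a + s *\<^sub>R n) a = s" using a s by (simp add: dist_norm)
    ultimately have "dist y a \<le> 2 * s"
      using dist_triangle[of y a "a + s *\<^sub>R n"] by (simp add: dist_commute)
    then show "y \<in> U" using e s by (auto simp: dist_commute subset_iff)
  qed
  have "a + s *\<^sub>R n \<notin> S" using ds s by (metis infdist_zero less_irrefl)
  moreover have "a + s *\<^sub>R n \<in> U" using cb s by auto
  ultimately have "f (a + s *\<^sub>R n) \<noteq> 0" using U by blast
  then consider "f (a + s *\<^sub>R n) > 0" | "- f (a + s *\<^sub>R n) > 0" by linarith
  then show ?thesis
  proof cases
    case 1
    have "g a = norm (g a) *\<^sub>R n"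
      by (rule level_set_touching[OF U a(1,3) s(1) _ cb 1]) (use ds in auto)
    then have "n = g a /\<^sub>R norm (g a)" using normalize_eq g[OF a(2)] by blast
    then show ?thesis by simp
  next
    case 2
    have "- g a = norm (- g a) *\<^sub>R n"
    proof (rule level_set_touching[where f="\<lambda>x. - f x" and g="\<lambda>x. - g x", OF U(1) _ _ a(1,3) s(1) _ cb 2])
      show "GDERIV (\<lambda>x. - f x) x :> - g x" if "x \<in> U" for x by (intro GDERIV_minus U(2) that)
      show "S \<inter> U = {x \<in> U. - f x = 0}" using U(3) by simp
      show "s \<le> infdist (a + s *\<^sub>R n) S" using ds by simp
    qed
    then have "n = (- g a) /\<^sub>R norm (- g a)"
      by (rule normalize_eq) (use g[OF a(2)] in simp)
    then show ?thesis by simp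
  qed
qed

lemma frontier_side:
  assumes "connected C" "C \<inter> frontier V = {}" "x \<in> C" "y \<in> C" "x \<in> V"
  shows "y \<in> V"
  using connected_Int_frontier[of C V] assms by blast

locale reach_domain =
  fixes V :: "space3 set" and r :: real
  assumes V_open: "open V" and V_bounded: "bounded V" and V_ne: "V \<noteq> {}"
    and con: "connected (frontier V)"
    and surf: "embedded_surface C11_on (frontier V)"
    and r_pos: "r > 0" and reach: "reach (frontier V) \<ge> ereal r"
begin

abbreviation "S \<equiv> frontier V"

lemma V_S: "V \<inter> S = {}" using V_open by (simp add: frontier_def interior_open)

lemma S_ne: "S \<noteq> {}"
  using V_ne V_bounded not_bounded_UNIV by (auto simp: frontier_eq_empty)

lemma S_closed: "closed S" by simp

lemma infdist_S_pos: "x \<notin> S \<Longrightarrow> infdist x S > 0"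
  using infdist_pos_not_in_closed[OF S_closed S_ne] .

lemma reach_diff: "0 < infdist x S \<Longrightarrow> infdist x S < r \<Longrightarrow> (\<lambda>y. infdist y S) differentiable (at x)"
  using reach_differentiable[OF reach S_closed] .

definition unique_ray :: "space3 \<Rightarrow> space3 \<Rightarrow> bool" where
  "unique_ray x n \<longleftrightarrow> (\<forall>m t. norm m = 1 \<and> 0 < t \<and> infdist (x + t *\<^sub>R m) S = t \<longrightarrow> m = n \<or> m = - n)"

lemma local_normal:
  assumes "a \<in> S"
  obtains U \<nu> where "open U" "a \<in> U" "continuous_on U \<nu>"
    "\<And>x. x \<in> S \<inter> U \<Longrightarrow> ray_normal S r x (\<nu> x) \<and> ray_normal S r x (- \<nu> x) \<and> unique_ray x (\<nu> x)"
proof -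
  from bspec[OF surf[unfolded embedded_surface_def] assms] obtain U f where
    U0: "open U \<and> a \<in> U \<and> C11_on f U \<and> (\<forall>x\<in>U. \<not> (GDERIV f x :> 0)) \<and> S \<inter> U = {x \<in> U. f x = 0}"
    by (elim exE)
  note U = U0[THEN conjunct1] U0[THEN conjunct2, THEN conjunct1] U0[THEN conjunct2, THEN conjunct2, THEN conjunct1]
    U0[THEN conjunct2, THEN conjunct2, THEN conjunct2, THEN conjunct2]
  from U0 have Ug: "\<forall>x\<in>U. \<not> (GDERIV f x :> 0)" by (elim conjE)
  from U(3)[unfolded C11_on_def] obtain g L where
    gL: "(\<forall>x\<in>U. GDERIV f x :> g x) \<and> L-lipschitz_on U g" by (elim exE)
  then have g: "\<And>x. x \<in> U \<Longrightarrow> GDERIV f x :> g x" "L-lipschitz_on U g" by simp_all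
  have gc: "continuous_on U g" using g(2) by (rule lipschitz_on_continuous_on)
  have g0: "g x \<noteq> 0" if "x \<in> U" for x 
  proof
    assume "g x = 0"
    with g(1)[OF that] bspec[OF Ug that] show False by simp
  qed
  define \<nu> where "\<nu> = (\<lambda>x. g x /\<^sub>R norm (g x))"
  have nc: "continuous_on U \<nu>" unfolding \<nu>_def
    by (intro continuous_on_scaleR continuous_on_inverse continuous_on_norm gc) (use g0 in simp)
  have "ray_normal S r x (\<nu> x) \<and> ray_normal S r x (- \<nu> x) \<and> unique_ray x (\<nu> x)"
    if x: "x \<in> S \<inter> U" for x
  proof (intro conjI)
    have xS: "x \<in> S" "x \<in> U" using x by auto
    show "ray_normal S r x (\<nu> x)" unfolding \<nu>_def
    proof (rule level_set_ray_normal[where f=f and g=g and U=U and S=S and r=r and a=x, OF S_closed _ r_pos U(1) _ U(4) gc _ xS])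
      show "(\<lambda>y. infdist y S) differentiable (at y)" if "0 < infdist y S" "infdist y S < r" for y
        by (rule reach_diff[OF that])
      show "GDERIV f x :> g x" if "x \<in> U" for x by (rule g(1)[OF that])
      show "g x \<noteq> 0" if "x \<in> U" for x by (rule g0[OF that])
    qed
    have "ray_normal S r x ((- g x) /\<^sub>R norm (- g x))"
    proof (rule level_set_ray_normal[where f="\<lambda>x. - f x" and g="\<lambda>x. - g x" and U=U and S=S and r=r and a=x, OF S_closed _ r_pos U(1) _ _ _ _ xS])
      show "(\<lambda>y. infdist y S) differentiable (at y)" if "0 < infdist y S" "infdist y S < r" for y
        by (rule reach_diff[OF that])
      show "GDERIV (\<lambda>x. - f x) x :> - g x" if "x \<in> U" for x by (intro GDERIV_minus g that)
      show "S \<inter> U = {x \<in> U. - f x = 0}" unfolding neg_equal_0_iff_equal by (fact U(4))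
      show "continuous_on U (\<lambda>x. - g x)" using gc by (rule continuous_on_minus)
      show "- g x \<noteq> 0" if "x \<in> U" for x using g0[OF that] by simp
    qed
    then show "ray_normal S r x (- \<nu> x)" unfolding \<nu>_def norm_minus_cancel scaleR_minus_right .
    show "unique_ray x (\<nu> x)" unfolding unique_ray_def \<nu>_def
    proof (intro allI impI, elim conjE)
      fix m t assume mt: "norm m = 1" "0 < t" "infdist (x + t *\<^sub>R m) S = t"
      show "m = g x /\<^sub>R norm (g x) \<or> m = - (g x /\<^sub>R norm (g x))"
      proof (rule level_set_ray_unique[where U=U and f=f and g=g and S=S and a=x and n=m and t=t, OF U(1) _ U(4) _ xS mt])
        show "GDERIV f x :> g x" if "x \<in> U" for x by (rule g(1)[OF that])
        show "g x \<noteq> 0" if "x \<in> U" for x by (rule g0[OF that])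
      qed
    qed
  qed
  with U(1,2) nc show ?thesis by (rule that)
qed

lemma ray_not_S:
  assumes "ray_normal S r a n" "0 < t" "t < r"
  shows "a + t *\<^sub>R n \<notin> S"
proof
  assume "a + t *\<^sub>R n \<in> S"
  then have "infdist (a + t *\<^sub>R n) S = 0" by simp
  then show False using assms by (simp add: ray_normal_def)
qed

lemma side_ray:
  assumes "ray_normal S r a n" "0 < t" "t < r" "0 < t'" "t' < r" "a + t *\<^sub>R n \<in> V"
  shows "a + t' *\<^sub>R n \<in> V"
proof (rule frontier_side[where C="(\<lambda>t. a + t *\<^sub>R n) ` {0<..<r}"])
  show "connected ((\<lambda>t. a + t *\<^sub>R n) ` {0<..<r})"
    by (intro connected_continuous_image continuous_intros connected_Ioo)
  show "(\<lambda>t. a + t *\<^sub>R n) ` {0<..<r} \<inter> S = {}" using ray_not_S[OF assms(1)] by auto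
qed (use assms in auto)

lemma ball_side:
  assumes "infdist c S \<ge> e" "y \<in> ball c e" "z \<in> ball c e" "y \<in> V"
  shows "z \<in> V"
  by (rule frontier_side[OF connected_ball ball_avoids_infdist[OF assms(1)] assms(2,3,4)])

definition sides :: "space3 \<Rightarrow> space3 \<Rightarrow> bool \<Rightarrow> bool \<Rightarrow> bool" where
  "sides x n P Q \<longleftrightarrow> ray_normal S r x n \<and> ray_normal S r x (- n) \<and> unique_ray x n \<and>
     (\<forall>t. 0 < t \<and> t < r \<longrightarrow> (x + t *\<^sub>R n \<in> V \<longleftrightarrow> P) \<and> (x + t *\<^sub>R (- n) \<in> V \<longleftrightarrow> Q))"

lemma local_sides:
  assumes a: "a \<in> S"
  obtains e P Q where "e > 0" "\<And>x. x \<in> S \<inter> ball a e \<Longrightarrow> \<exists>n. sides x n P Q"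
proof -
  obtain U \<nu> where U: "open U" "a \<in> U" "continuous_on U \<nu>"
    "\<And>x. x \<in> S \<inter> U \<Longrightarrow> ray_normal S r x (\<nu> x) \<and> ray_normal S r x (- \<nu> x) \<and> unique_ray x (\<nu> x)"
    using local_normal[OF a] by blast
  have rn: "ray_normal S r x (s *\<^sub>R \<nu> x)" if "x \<in> S \<inter> U" "s = 1 \<or> s = -1" for x s
    using U(4)[OF that(1)] that(2) by auto
  define c where "c = (\<lambda>s x. x + (r / 2) *\<^sub>R (s *\<^sub>R \<nu> x))"
  have "\<exists>e>0. \<forall>x\<in>U. dist x a < e \<longrightarrow> dist (c s x) (c s a) < r / 2" for s
  proof -
    have "continuous_on U (c s)" unfolding c_def by (intro continuous_intros U)
    then show ?thesis using U(2) r_pos unfolding continuous_on_iff by (meson half_gt_zero)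
  qed
  then obtain e where e: "\<And>s. e s > 0" "\<And>s x. x \<in> U \<Longrightarrow> dist x a < e s \<Longrightarrow> dist (c s x) (c s a) < r / 2"
    by metis
  obtain e0 where e0: "e0 > 0" "ball a e0 \<subseteq> U" using U openE by blast
  define e1 where "e1 = min e0 (min (e 1) (e (-1)))"
  have key: "x + t *\<^sub>R (s *\<^sub>R \<nu> x) \<in> V \<longleftrightarrow> c s a \<in> V"
    if x: "x \<in> S" "dist x a < e1" and s: "s = 1 \<or> s = -1" and t: "0 < t" "t < r" for x s t
  proof -
    have xU: "x \<in> S \<inter> U" "a \<in> S \<inter> U" using x e0 a U by (auto simp: e1_def dist_commute subset_iff)
    have cd: "infdist (c s a) S = r / 2"
    proof -
      have "0 \<le> r / 2 \<and> r / 2 < r" using r_pos by simp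
      then show ?thesis using rn[OF xU(2) s] unfolding c_def ray_normal_def by blast
    qed
    have "dist x a < e s" using x s by (auto simp: e1_def)
    then have cx: "c s x \<in> ball (c s a) (r / 2)" using e(2)[of x s] xU by (simp add: dist_commute)
    have "c s x \<in> V \<longleftrightarrow> c s a \<in> V"
      using ball_side[of "r / 2" "c s a"] cd cx r_pos by (metis centre_in_ball half_gt_zero order_refl)
    moreover have "x + t *\<^sub>R (s *\<^sub>R \<nu> x) \<in> V \<longleftrightarrow> c s x \<in> V"
      unfolding c_def using side_ray[OF rn[OF xU(1) s]] t r_pos by (metis field_sum_of_halves half_gt_zero less_add_same_cancel1)
    ultimately show ?thesis by simp
  qed
  have "\<exists>n. sides x n (c 1 a \<in> V) (c (-1) a \<in> V)" if "x \<in> S \<inter> ball a e1" for x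
  proof
    have "x \<in> S \<inter> U" using that e0 by (auto simp: e1_def)
    moreover have "dist x a < e1" using that by (simp add: dist_commute)
    ultimately show "sides x (\<nu> x) (c 1 a \<in> V) (c (-1) a \<in> V)"
      unfolding sides_def using U(4)[of x] key[of x 1] key[of x "-1"] by simp
  qed
  moreover have "e1 > 0" using e0 e by (simp add: e1_def)
  ultimately show ?thesis using that by blast
qed

lemma sides_foot:
  assumes "\<And>x. x \<in> S \<inter> ball a e \<Longrightarrow> \<exists>n. sides x n P Q" "a \<in> S"
    and y: "dist y a < e / 2" "dist y a < r" "y \<notin> S"
  shows "(y \<in> V \<longleftrightarrow> P) \<or> (y \<in> V \<longleftrightarrow> Q)"
proof -
  obtain x where x: "x \<in> S" "infdist y S = dist y x" using infdist_attains_inf[OF S_closed S_ne] by metis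
  define d where "d = infdist y S"
  have d: "0 < d" "d \<le> dist y a" using infdist_S_pos[OF y(3)] infdist_le[OF assms(2)] by (auto simp: d_def)
  have "dist a x \<le> dist y a + dist y x" by (metis dist_triangle dist_commute)
  then have "x \<in> ball a e" using x d y by (simp add: d_def)
  then obtain n where n: "sides x n P Q" using assms(1) x by blast
  define m where "m = (y - x) /\<^sub>R d"
  have nyx: "norm (y - x) = d" using x by (simp add: d_def dist_norm)
  have m: "norm m = 1" "y = x + d *\<^sub>R m" using d nyx by (simp_all add: m_def)
  have "infdist (x + d *\<^sub>R m) S = d" unfolding m(2)[symmetric] by (simp add: d_def)
  then have "m = n \<or> m = - n" using n m d unfolding sides_def unique_ray_def by blast
  moreover have "d < r" using d y by simp
  ultimately show ?thesis using n m(2) d unfolding sides_def by metis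
qed

lemma outward_normal:
  assumes a: "a \<in> S"
  shows "\<exists>n. sides a n False True"
proof -
  define A where "A = interior (V \<union> S)"
  define B where "B = \<Union>{ball b e | b e. e > 0 \<and> b \<in> S \<and> (\<forall>x \<in> S \<inter> ball b e. x \<notin> A)}"
  have loc: "b \<in> A \<or> (b \<in> B \<and> (\<exists>n. sides b n False True))" if b: "b \<in> S" for b
  proof -
    obtain e P Q where e: "e > 0" and s: "\<And>x. x \<in> S \<inter> ball b e \<Longrightarrow> \<exists>n. sides x n P Q"
      using local_sides[OF b] by blast
    define e' where "e' = min (e / 2) r"
    have e': "e' > 0" using e r_pos by (simp add: e'_def)
    have foot: "(y \<in> V \<longleftrightarrow> P) \<or> (y \<in> V \<longleftrightarrow> Q)" if "y \<in> ball b e'" "y \<notin> S" for y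
    proof (rule sides_foot[OF s b])
      show "dist y b < e / 2" "dist y b < r" using that(1) by (simp_all add: e'_def dist_commute)
      show "y \<notin> S" by (fact that(2))
    qed
    show ?thesis
    proof (cases "P = Q")
      case True
      have "b \<in> closure V" using b by (simp add: frontier_def)
      then obtain y where "y \<in> V" "dist y b < e'" using e' closure_approachable by blast
      moreover from this have "y \<in> ball b e'" "y \<notin> S" using V_S by (auto simp: dist_commute)
      ultimately have P using foot[of y] True by blast
      have "ball b e' \<subseteq> V \<union> S"
      proof
        fix z assume "z \<in> ball b e'"
        then show "z \<in> V \<union> S" using foot[of z] True \<open>P\<close> by blast
      qed
      then have "b \<in> A" unfolding A_def by (rule interiorI[OF open_ball, rotated]) (use e' in simp)
      then show ?thesis by simp
    next
      case False
      have notA: "x \<notin> A" if x: "x \<in> S \<inter> ball b e" for x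
      proof
        assume "x \<in> A"
        then obtain d where d: "d > 0" "ball x d \<subseteq> V \<union> S" unfolding A_def by (meson mem_interior)
        obtain n where n: "sides x n P Q" using s[OF x] by blast
        define t where "t = min d r / 2"
        have t: "0 < t" "t < r" "t < d" using d r_pos by (auto simp: t_def min_def)
        have nn: "norm n = 1" using n by (simp add: sides_def ray_normal_def)
        have "x + t *\<^sub>R n \<in> ball x d" "x + t *\<^sub>R (- n) \<in> ball x d" using t nn by (auto simp: dist_norm)
        then have "x + t *\<^sub>R n \<in> V \<union> S" "x + t *\<^sub>R (- n) \<in> V \<union> S" using d by blast+
        moreover have "x + t *\<^sub>R n \<notin> S" "x + t *\<^sub>R (- n) \<notin> S"
          using n t ray_not_S unfolding sides_def by blast+
        ultimately show False using n t False unfolding sides_def by blast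
      qed
      then have "ball b e \<in> {ball b e | b e. e > 0 \<and> b \<in> S \<and> (\<forall>x \<in> S \<inter> ball b e. x \<notin> A)}"
        using e b by blast
      then have "b \<in> B" unfolding B_def using e by (intro UnionI[of "ball b e"]) auto
      moreover obtain n where n: "sides b n P Q" using s[of b] b e by auto
      have "\<exists>n. sides b n False True"
      proof (cases P)
        case True
        have "unique_ray b (- n)" using n unfolding sides_def unique_ray_def minus_minus by blast
        moreover have "\<not> Q" using True False by blast
        ultimately have "sides b (- n) False True" using n True unfolding sides_def minus_minus by blast
        then show ?thesis by blast
      next
        case P: False
        then have "P = False" "Q = True" using False by simp_all
        then show ?thesis using n by (intro exI[of _ n]) simp
      qed
      ultimately show ?thesis by blast
    qed
  qed
  have "A \<inter> S = {} \<or> B \<inter> S = {}"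
  proof (rule connectedD[OF con])
    show "open A" by (simp add: A_def)
    show "open B" unfolding B_def by (rule open_Union) auto
    show "A \<inter> B \<inter> S = {}" unfolding B_def by blast
    show "S \<subseteq> A \<union> B" using loc by blast
  qed
  moreover have "B \<inter> S \<noteq> {}"
  proof
    assume "B \<inter> S = {}"
    then have "S \<subseteq> A" using loc by blast
    moreover have "V \<subseteq> A" unfolding A_def using V_open by (simp add: interior_maximal)
    ultimately have "V \<union> S \<subseteq> interior (V \<union> S)" by (simp add: A_def)
    then have "interior (V \<union> S) = V \<union> S" using interior_subset by blast
    then have "open (V \<union> S)" using open_interior[of "V \<union> S"] by simp
    moreover have cl: "closure V = V \<union> S" by (rule closure_Un_frontier)
    ultimately have "closure V = UNIV" using clopen[of "closure V"] closed_closure[of V] V_ne by (simp only: closure_eq_empty) simp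
    then show False using bounded_closure[OF V_bounded] not_bounded_UNIV by simp
  qed
  ultimately show ?thesis using loc[OF a] a by blast
qed

definition sd :: "space3 \<Rightarrow> real" where
  "sd x = (if x \<in> V then - infdist x S else infdist x S)"

lemma abs_sd: "\<bar>sd x\<bar> = infdist x S" by (simp add: sd_def infdist_nonneg)

lemma sd_zero_iff: "sd x = 0 \<longleftrightarrow> x \<in> S"
proof -
  have "x \<in> S \<longleftrightarrow> infdist x S = 0" using infdist_S_pos[of x] by force
  then show ?thesis by (simp add: sd_def)
qed

lemma sd_neg_iff: "sd x < 0 \<longleftrightarrow> x \<in> V"
proof -
  have "x \<in> V \<Longrightarrow> infdist x S > 0" using V_S infdist_S_pos by blast
  then show ?thesis using infdist_nonneg[of x S] by (auto simp: sd_def)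
qed

lemma sd_line:
  assumes "a \<in> S"
  obtains n where "norm n = 1" "unique_ray a n" "\<And>t. \<bar>t\<bar> < r \<Longrightarrow> sd (a + t *\<^sub>R n) = t"
proof -
  obtain n where n: "sides a n False True" using outward_normal[OF assms] by blast
  have "sd (a + t *\<^sub>R n) = t" if t: "\<bar>t\<bar> < r" for t
  proof -
    consider "t = 0" | "t > 0" | "- t > 0" by linarith
    then show ?thesis
    proof cases
      case 1 then show ?thesis using assms sd_zero_iff by simp
    next
      case 2 then show ?thesis using n t by (simp add: sides_def sd_def ray_normal_def)
    next
      case 3
      moreover have "0 < - t \<and> - t < r" "0 \<le> - t \<and> - t < r" using 3 t by auto
      ultimately have "a + (- t) *\<^sub>R (- n) \<in> V" "infdist (a + (- t) *\<^sub>R (- n)) S = - t"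
        using n unfolding sides_def ray_normal_def by blast+
      then show ?thesis by (simp add: sd_def)
    qed
  qed
  then show ?thesis using that n by (auto simp: sides_def ray_normal_def)
qed

lemma sd_foot:
  assumes y: "\<bar>sd y\<bar> < r"
  obtains a n where "norm n = 1" "\<And>t. \<bar>t\<bar> < r \<Longrightarrow> sd (a + t *\<^sub>R n) = t" "y = a + sd y *\<^sub>R n"
proof -
  obtain a where a: "a \<in> S" "infdist y S = dist y a" using infdist_attains_inf[OF S_closed S_ne] by metis
  obtain n where n: "norm n = 1" "unique_ray a n" "\<And>t. \<bar>t\<bar> < r \<Longrightarrow> sd (a + t *\<^sub>R n) = t"
    using sd_line[OF a(1)] by blast
  define d where "d = infdist y S"
  have dr: "d < r" "d \<ge> 0" using y abs_sd[of y] infdist_nonneg[of y S] by (auto simp: d_def)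
  have "\<exists>s. \<bar>s\<bar> = d \<and> y = a + s *\<^sub>R n"
  proof (cases "d = 0")
    case True
    then show ?thesis using a by (intro exI[of _ 0]) (simp add: d_def)
  next
    case False
    with dr have d: "d > 0" by simp
    define m where "m = (y - a) /\<^sub>R d"
    have nya: "norm (y - a) = d" using a by (simp add: d_def dist_norm)
    have m: "norm m = 1" "y = a + d *\<^sub>R m" using d nya by (simp_all add: m_def)
    have "infdist (a + d *\<^sub>R m) S = d" unfolding m(2)[symmetric] by (simp add: d_def)
    then have "m = n \<or> m = - n" using n(2) m(1) d unfolding unique_ray_def by blast
    then show ?thesis
    proof
      assume "m = n" then show ?thesis using m(2) d by (intro exI[of _ d]) simp
    next
      assume "m = - n" then show ?thesis using m(2) d by (intro exI[of _ "- d"]) simp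
    qed
  qed
  then obtain s where s: "\<bar>s\<bar> = d" "y = a + s *\<^sub>R n" by blast
  have "sd y = s" unfolding s(2) by (rule n(3)) (use s(1) dr in simp)
  then have "y = a + sd y *\<^sub>R n" using s(2) by simp
  then show ?thesis using that n by blast
qed

lemma sd_lipschitz: "\<bar>sd x - sd y\<bar> \<le> norm (x - y)"
proof -
  have same: "\<bar>infdist x S - infdist y S\<bar> \<le> norm (x - y)" for x y
    using infdist_triangle[of x S y] infdist_triangle[of y S x] by (simp add: dist_norm norm_minus_commute)
  have opp: "infdist x S + infdist y S \<le> norm (x - y)" if "x \<in> V" "y \<notin> V" for x y
  proof -
    have "closed_segment x y \<inter> S \<noteq> {}"
      using connected_Int_frontier[of "closed_segment x y" V] that by auto
    then obtain z where z: "z \<in> closed_segment x y" "z \<in> S" by blast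
    have "dist x y = dist x z + dist z y" using z(1) by (simp add: between_mem_segment[symmetric] between)
    then show ?thesis using infdist_le[OF z(2), of x] infdist_le[OF z(2), of y]
      by (simp add: dist_norm norm_minus_commute)
  qed
  show ?thesis using same[of x y] opp[of x y] opp[of y x] infdist_nonneg[of x S] infdist_nonneg[of y S]
    by (auto simp: sd_def norm_minus_commute)
qed

lemma sd_quad:
  assumes y: "\<bar>sd y\<bar> < r / 2"
  obtains n where "norm n = 1" "\<And>x. \<bar>sd x - sd y - n \<bullet> (x - y)\<bar> \<le> (norm (x - y))\<^sup>2 / (r / 2)"
proof -
  obtain a n where n: "norm n = 1" "\<And>t. \<bar>t\<bar> < r \<Longrightarrow> sd (a + t *\<^sub>R n) = t" "y = a + sd y *\<^sub>R n"
  proof -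
    have "\<bar>sd y\<bar> < r" using y r_pos by simp
    then show ?thesis using sd_foot that by metis
  qed
  define t where "t = r / 4"
  have t: "0 < t" "t < r / 2" using r_pos by (auto simp: t_def)
  have line: "sd (y + s *\<^sub>R n) = sd y + s" if "\<bar>s\<bar> < r / 2" for s
  proof -
    have "y + s *\<^sub>R n = a + (sd y + s) *\<^sub>R n" by (subst n(3)) (simp add: algebra_simps)
    then show ?thesis using n(2)[of "sd y + s"] that y by simp
  qed
  have nb: "norm (w - t *\<^sub>R m) \<le> t - m \<bullet> w + (norm w)\<^sup>2 / (2 * t)" if m: "norm m = 1" for w m :: space3
  proof -
    define z where "z = (norm w)\<^sup>2 - 2 * t * (m \<bullet> w)"
    have e: "(norm (w - t *\<^sub>R m))\<^sup>2 = t\<^sup>2 + z"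
    proof -
      have "(w - t *\<^sub>R m) \<bullet> (w - t *\<^sub>R m) = w \<bullet> w - 2 * t * (m \<bullet> w) + t * t * (m \<bullet> m)"
        by (simp add: inner_diff inner_commute[of w m] algebra_simps)
      then show ?thesis using m unfolding z_def power2_norm_eq_inner norm_eq_1 by (simp add: power2_eq_square)
    qed
    then have z: "z \<ge> - t\<^sup>2" using zero_le_power2[of "norm (w - t *\<^sub>R m)"] by linarith
    have zt: "z / (2 * t) = (norm w)\<^sup>2 / (2 * t) - m \<bullet> w" using t by (simp add: z_def diff_divide_distrib)
    have "- t / 2 = (- t\<^sup>2) / (2 * t)" using t by (simp add: power2_eq_square)
    also have "\<dots> \<le> z / (2 * t)" using z t by (intro divide_right_mono) auto
    finally have pos: "0 \<le> t + z / (2 * t)" using t by linarith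
    have "(t + z / (2 * t))\<^sup>2 = t\<^sup>2 + z + (z / (2 * t))\<^sup>2" using t by (simp add: power2_sum)
    then have "(norm (w - t *\<^sub>R m))\<^sup>2 \<le> (t + z / (2 * t))\<^sup>2" using e by simp
    then have "norm (w - t *\<^sub>R m) \<le> t + z / (2 * t)" using pos by (rule power2_le_imp_le)
    then show ?thesis using zt by linarith
  qed
  have "\<bar>sd x - sd y - n \<bullet> (x - y)\<bar> \<le> (norm (x - y))\<^sup>2 / (r / 2)" for x
  proof -
    define w where "w = x - y"
    have "sd y + t \<le> sd x + norm (w - t *\<^sub>R n)"
      using sd_lipschitz[of x "y + t *\<^sub>R n"] line[of t] t by (simp add: w_def algebra_simps)
    with nb[OF n(1), of w] have 1: "n \<bullet> w - (norm w)\<^sup>2 / (2 * t) \<le> sd x - sd y" by linarith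
    have "sd x \<le> sd y - t + norm (w - t *\<^sub>R (- n))"
      using sd_lipschitz[of x "y + (- t) *\<^sub>R n"] line[of "- t"] t by (simp add: w_def algebra_simps)
    with nb[of "- n" w] n(1) have 2: "sd x - sd y \<le> n \<bullet> w + (norm w)\<^sup>2 / (2 * t)" by simp
    have "2 * t = r / 2" by (simp add: t_def)
    with 1 2 show ?thesis unfolding w_def[symmetric] by (simp only: abs_le_iff) linarith
  qed
  then show ?thesis using that n(1) by blast
qed

lemma sd_far:
  assumes "S \<subseteq> cball 0 R" "norm x \<ge> R + \<rho>" "\<rho> > 0"
  shows "sd x \<ge> \<rho>"
proof -
  have "\<not> - cball 0 R \<subseteq> V"
  proof
    assume "- cball (0::space3) R \<subseteq> V"
    then have "bounded (- cball (0::space3) R)" using V_bounded bounded_subset by blast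
    then have "bounded (- cball (0::space3) R \<union> cball 0 R)" using bounded_Un bounded_cball by blast
    then show False using not_bounded_UNIV unfolding Compl_partition2 by blast
  qed
  moreover have "connected (- cball (0::space3) R)"
    by (rule connected_complement_bounded_convex) auto
  moreover have "- cball 0 R \<inter> S = {}" using assms(1) by blast
  moreover have "x \<in> - cball 0 R" using assms by simp
  ultimately have "x \<notin> V" using frontier_side[of "- cball 0 R" V x] by blast
  moreover have "\<rho> \<le> infdist x S"
  proof -
    obtain z where z: "z \<in> S" "infdist x S = dist x z" using infdist_attains_inf[OF S_closed S_ne] by metis
    have "norm z \<le> R" using z assms by auto
    then show ?thesis using norm_triangle_ineq2[of x z] z assms by (simp add: dist_norm)
  qed
  ultimately show ?thesis by (simp add: sd_def)
qed

end

definition clip_cubic :: "real \<Rightarrow> real" where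
  "clip_cubic s = (let c = max (-1) (min 1 s) in c - c ^ 3 / 3)"

definition clip_cubic' :: "real \<Rightarrow> real" where
  "clip_cubic' s = (if \<bar>s\<bar> < 1 then 1 - s\<^sup>2 else 0)"

lemma clip_cubic_inside: "\<bar>s\<bar> \<le> 1 \<Longrightarrow> clip_cubic s = s - s ^ 3 / 3"
  by (auto simp: clip_cubic_def Let_def max_def min_def)

lemma clip_cubic_above: "1 \<le> s \<Longrightarrow> clip_cubic s = 2 / 3"
  by (simp add: clip_cubic_def)

lemma clip_cubic_minus: "clip_cubic (- s) = - clip_cubic s"
proof -
  have "max (-1) (min 1 (- s)) = - max (-1) (min 1 s)" by (auto simp: max_def min_def)
  then show ?thesis by (simp add: clip_cubic_def Let_def)
qed

lemma clip_cubic'_minus: "clip_cubic' (- s) = clip_cubic' s"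
  by (simp add: clip_cubic'_def)

lemma clip_cubic_quad: "\<bar>clip_cubic s - clip_cubic t - clip_cubic' t * (s - t)\<bar> \<le> 3 * (s - t)\<^sup>2"
proof -
  have key: "\<bar>clip_cubic s - clip_cubic t - clip_cubic' t * (s - t)\<bar> \<le> 3 * (s - t)\<^sup>2" if t: "t > - 1" for s t
  proof -
    have sq: "0 \<le> (s - t)\<^sup>2" by simp
    have t1: "\<bar>t\<bar> < 1" if "t < 1" using that t by simp
    have below: "clip_cubic s = - (2 / 3)" if "s < -1"
      using clip_cubic_above[of "- s"] clip_cubic_minus[of s] that by simp
    consider "t < 1" "\<bar>s\<bar> \<le> 1" | "t < 1" "s > 1" | "t < 1" "s < - 1" | "t \<ge> 1" "s \<ge> 1" | "t \<ge> 1" "\<bar>s\<bar> \<le> 1" | "t \<ge> 1" "s < -1"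
      by linarith
    then show ?thesis
    proof cases
      case 1
      then have "clip_cubic s - clip_cubic t - clip_cubic' t * (s - t) = - ((s - t)\<^sup>2 * ((s + 2 * t) / 3))"
        using t1 by (simp add: clip_cubic_inside clip_cubic'_def field_simps power2_eq_square power3_eq_cube)
      moreover have "\<bar>(s - t)\<^sup>2 * ((s + 2 * t) / 3)\<bar> \<le> (s - t)\<^sup>2 * 1"
        unfolding abs_mult using 1 t by (intro mult_mono) auto
      ultimately show ?thesis using sq by simp
    next
      case 2
      then have e: "clip_cubic s - clip_cubic t - clip_cubic' t * (s - t) = - ((1 - t)\<^sup>2 * ((1 + 2 * t) / 3)) - (1 + t) * ((1 - t) * (s - 1))"
        using t1 by (simp add: clip_cubic_inside clip_cubic_above clip_cubic'_def field_simps power2_eq_square power3_eq_cube)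
      have "\<bar>(1 - t)\<^sup>2 * ((1 + 2 * t) / 3)\<bar> \<le> (1 - t)\<^sup>2 * 1"
        unfolding abs_mult using 2 t by (intro mult_mono) auto
      moreover have "\<bar>(1 + t) * ((1 - t) * (s - 1))\<bar> \<le> 2 * ((s - t) * (s - t))"
        unfolding abs_mult using 2 t by (intro mult_mono) auto
      moreover have "(1 - t)\<^sup>2 \<le> (s - t)\<^sup>2" using 2 by (intro power_mono) auto
      ultimately show ?thesis unfolding e power2_eq_square by linarith
    next
      case 3
      have e: "clip_cubic s - clip_cubic t - clip_cubic' t * (s - t) = ((1 + t)\<^sup>2 * ((1 - 2 * t) / 3)) + (1 - t) * ((1 + t) * (- 1 - s))"
        using 3 t1 below by (simp add: clip_cubic_inside clip_cubic'_def field_simps power2_eq_square power3_eq_cube)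
      have "\<bar>(1 + t)\<^sup>2 * ((1 - 2 * t) / 3)\<bar> \<le> (1 + t)\<^sup>2 * 1"
        unfolding abs_mult using 3 t by (intro mult_mono) auto
      moreover have "\<bar>(1 - t) * ((1 + t) * (- 1 - s))\<bar> \<le> 2 * ((t - s) * (t - s))"
        unfolding abs_mult using 3 t by (intro mult_mono) auto
      moreover have "(1 + t)\<^sup>2 \<le> (t - s)\<^sup>2" using 3 t by (intro power_mono) auto
      moreover have "(t - s)\<^sup>2 = (s - t)\<^sup>2" by (simp add: power2_commute)
      ultimately show ?thesis unfolding e power2_eq_square by linarith
    next
      case 4
      then show ?thesis by (simp add: clip_cubic_above clip_cubic'_def)
    next
      case 5
      then have e: "clip_cubic s - clip_cubic t - clip_cubic' t * (s - t) = - ((1 - s)\<^sup>2 * ((2 + s) / 3))"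
        by (simp add: clip_cubic_inside clip_cubic_above clip_cubic'_def field_simps power2_eq_square power3_eq_cube)
      have "\<bar>(1 - s)\<^sup>2 * ((2 + s) / 3)\<bar> \<le> (1 - s)\<^sup>2 * 1"
        unfolding abs_mult using 5 by (intro mult_mono) auto
      moreover have "(1 - s)\<^sup>2 \<le> (t - s)\<^sup>2" using 5 by (intro power_mono) auto
      moreover have "(t - s)\<^sup>2 = (s - t)\<^sup>2" by (simp add: power2_commute)
      ultimately show ?thesis unfolding e using sq by simp
    next
      case 6
      then have e: "clip_cubic s - clip_cubic t - clip_cubic' t * (s - t) = - (4 / 3)"
        using below by (simp add: clip_cubic_above clip_cubic'_def)
      have "2\<^sup>2 \<le> (t - s)\<^sup>2" using 6 by (intro power_mono) auto
      moreover have "(t - s)\<^sup>2 = (s - t)\<^sup>2" by (simp add: power2_commute)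
      ultimately show ?thesis unfolding e by simp
    qed
  qed
  show ?thesis
  proof (cases "t > - 1")
    case True
    then show ?thesis by (rule key)
  next
    case False
    have "(- s - - t)\<^sup>2 = (s - t)\<^sup>2" by (simp add: power2_commute)
    then show ?thesis
      using key[of "- t" "- s"] False unfolding clip_cubic_minus clip_cubic'_minus
      by (simp add: algebra_simps)
  qed
qed

lemma clip_cubic_lower:
  assumes "0 \<le> s" "s \<le> 1"
  shows "2 / 3 * s \<le> clip_cubic s"
proof -
  have "s * s\<^sup>2 \<le> s * 1" using assms by (intro mult_left_mono power_le_one) auto
  then show ?thesis using assms by (simp add: clip_cubic_inside power2_eq_square power3_eq_cube)
qed

lemma clip_cubic_sgn: "clip_cubic s < 0 \<longleftrightarrow> s < 0" "clip_cubic s = 0 \<longleftrightarrow> s = 0"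
proof -
  have pos: "clip_cubic s > 0" if "s > 0" for s
    using that clip_cubic_lower[of s] clip_cubic_above[of s] by (cases "s \<le> 1") (auto simp: less_le_trans)
  have zero: "clip_cubic 0 = 0" by (simp add: clip_cubic_def)
  show "clip_cubic s < 0 \<longleftrightarrow> s < 0" "clip_cubic s = 0 \<longleftrightarrow> s = 0"
    using pos[of s] pos[of "- s"] clip_cubic_minus[of s] zero by (cases "s = 0"; force)+
qed

lemma clip_cubic_defect: "1 - clip_cubic' s \<le> 9 / 4 * (clip_cubic s)\<^sup>2"
proof -
  have key: "1 - clip_cubic' s \<le> 9 / 4 * (clip_cubic s)\<^sup>2" if "s \<ge> 0" for s
  proof (cases "s < 1")
    case True
    have "(2 / 3 * s)\<^sup>2 \<le> (clip_cubic s)\<^sup>2" using True that clip_cubic_lower by (intro power_mono) auto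
    then show ?thesis using True that by (simp add: clip_cubic'_def power_mult_distrib power_divide)
  next
    case False
    then show ?thesis by (simp add: clip_cubic'_def clip_cubic_above power_divide)
  qed
  show ?thesis using key[of s] key[of "- s"] clip_cubic_minus[of s] clip_cubic'_minus[of s]
    by (cases "s \<ge> 0") auto
qed

lemma clip_cubic'_bounds: "0 \<le> clip_cubic' s" "clip_cubic' s \<le> 1"
  by (auto simp: clip_cubic'_def abs_square_less_1 less_imp_le)

definition defining_pair :: "real \<Rightarrow> real \<Rightarrow> real \<Rightarrow> real \<Rightarrow> (space3 \<Rightarrow> real) \<Rightarrow> (space3 \<Rightarrow> space3) \<Rightarrow> bool" where
  "defining_pair K C R m g G \<longleftrightarrow>
     (\<forall>x y. \<bar>g x - g y - G y \<bullet> (x - y)\<bar> \<le> K * (norm (x - y))\<^sup>2) \<and>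
     (\<forall>x. norm (G x) \<le> 1 \<and> 1 - norm (G x) \<le> C * (g x)\<^sup>2) \<and>
     (\<forall>x. norm x \<ge> R \<longrightarrow> g x = m \<and> G x = 0)"

context reach_domain
begin

lemma defining_pair_exists:
  assumes "S \<subseteq> cball 0 R"
  obtains g G where "defining_pair (8 / r) (9 / r\<^sup>2) (R + r) (r / 3) g G"
    "\<And>x. g x < 0 \<longleftrightarrow> x \<in> V" "\<And>x. g x = 0 \<longleftrightarrow> x \<in> S"
proof -
  define \<rho> where "\<rho> = r / 2"
  have \<rho>: "\<rho> > 0" using r_pos by (simp add: \<rho>_def)
  have "\<exists>n. norm n = 1 \<and> (\<bar>sd y\<bar> < \<rho> \<longrightarrow> (\<forall>x. \<bar>sd x - sd y - n \<bullet> (x - y)\<bar> \<le> (norm (x - y))\<^sup>2 / \<rho>))" for y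
  proof (cases "\<bar>sd y\<bar> < \<rho>")
    case True then show ?thesis using sd_quad[of y] unfolding \<rho>_def by metis
  next
    case False then show ?thesis by (intro exI[of _ "axis 1 1"]) simp
  qed
  then obtain n where n: "\<And>y. norm (n y) = 1"
    "\<And>x y. \<bar>sd y\<bar> < \<rho> \<Longrightarrow> \<bar>sd x - sd y - n y \<bullet> (x - y)\<bar> \<le> (norm (x - y))\<^sup>2 / \<rho>" by metis
  define g where "g = (\<lambda>x. \<rho> * clip_cubic (sd x / \<rho>))"
  define G where "G = (\<lambda>x. clip_cubic' (sd x / \<rho>) *\<^sub>R n x)"
  have nG: "norm (G x) = clip_cubic' (sd x / \<rho>)" for x
    using n(1) clip_cubic'_bounds by (simp add: G_def)
  have "defining_pair (8 / r) (9 / r\<^sup>2) (R + r) (r / 3) g G"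
    unfolding defining_pair_def
  proof (intro conjI allI impI)
    fix x y
    define c where "c = clip_cubic' (sd y / \<rho>)"
    have c: "0 \<le> c" "c \<le> 1" using clip_cubic'_bounds by (auto simp: c_def)
    define q where "q = clip_cubic (sd x / \<rho>) - clip_cubic (sd y / \<rho>) - c * (sd x / \<rho> - sd y / \<rho>)"
    have "\<bar>q\<bar> \<le> 3 * (sd x / \<rho> - sd y / \<rho>)\<^sup>2"
      unfolding q_def c_def by (rule clip_cubic_quad)
    also have "(sd x / \<rho> - sd y / \<rho>)\<^sup>2 = \<bar>sd x - sd y\<bar>\<^sup>2 / \<rho>\<^sup>2" by (simp add: diff_divide_distrib[symmetric] power_divide)
    also have "\<bar>sd x - sd y\<bar>\<^sup>2 / \<rho>\<^sup>2 \<le> (norm (x - y))\<^sup>2 / \<rho>\<^sup>2"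
      using sd_lipschitz[of x y] by (intro divide_right_mono power_mono) auto
    finally have "\<rho> * \<bar>q\<bar> \<le> \<rho> * (3 * ((norm (x - y))\<^sup>2 / \<rho>\<^sup>2))" using \<rho> by (intro mult_left_mono) auto
    also have "\<dots> = 3 / \<rho> * (norm (x - y))\<^sup>2" using \<rho> by (simp add: power2_eq_square)
    finally have 1: "\<bar>\<rho> * q\<bar> \<le> 3 / \<rho> * (norm (x - y))\<^sup>2" using \<rho> by (simp add: abs_mult)
    define p where "p = sd x - sd y - n y \<bullet> (x - y)"
    have 2: "\<bar>c * p\<bar> \<le> 1 / \<rho> * (norm (x - y))\<^sup>2"
    proof (cases "\<bar>sd y\<bar> < \<rho>")
      case True
      have "\<bar>c * p\<bar> \<le> 1 * \<bar>p\<bar>" unfolding abs_mult using c by (intro mult_right_mono) auto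
      also have "\<dots> \<le> (norm (x - y))\<^sup>2 / \<rho>" using n(2)[OF True, of x] by (simp add: p_def)
      finally show ?thesis by simp
    next
      case False
      then have "c = 0" using \<rho> by (simp add: c_def clip_cubic'_def abs_divide)
      then show ?thesis using \<rho> by simp
    qed
    have "g x - g y - G y \<bullet> (x - y) = \<rho> * q + c * p"
    proof -
      have "\<rho> * (c * (sd x / \<rho> - sd y / \<rho>)) = c * (sd x - sd y)" using \<rho> by (simp add: field_simps)
      then show ?thesis unfolding g_def G_def q_def p_def c_def[symmetric] inner_scaleR_left
        by (simp add: right_diff_distrib)
    qed
    then have "\<bar>g x - g y - G y \<bullet> (x - y)\<bar> \<le> 3 / \<rho> * (norm (x - y))\<^sup>2 + 1 / \<rho> * (norm (x - y))\<^sup>2"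
      using 1 2 by linarith
    also have "\<dots> = 8 / r * (norm (x - y))\<^sup>2" by (simp add: \<rho>_def field_simps)
    finally show "\<bar>g x - g y - G y \<bullet> (x - y)\<bar> \<le> 8 / r * (norm (x - y))\<^sup>2" .
  next
    fix x
    show "norm (G x) \<le> 1" unfolding nG by (rule clip_cubic'_bounds)
    have "9 / r\<^sup>2 * (g x)\<^sup>2 = 9 / 4 * (clip_cubic (sd x / \<rho>))\<^sup>2"
      using r_pos by (simp add: g_def \<rho>_def power_mult_distrib power_divide)
    then show "1 - norm (G x) \<le> 9 / r\<^sup>2 * (g x)\<^sup>2" unfolding nG using clip_cubic_defect[of "sd x / \<rho>"] by linarith
  next
    fix x :: space3 assume x: "R + r \<le> norm x"
    have "sd x \<ge> \<rho>" by (rule sd_far[OF assms]) (use x \<rho> r_pos in \<open>auto simp: \<rho>_def\<close>)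
    then have "sd x / \<rho> \<ge> 1" using \<rho> by simp
    moreover from this have "\<not> \<bar>sd x / \<rho>\<bar> < 1" by linarith
    then have "clip_cubic' (sd x / \<rho>) = 0" unfolding clip_cubic'_def by (simp only: if_False)
    ultimately show "g x = r / 3" "G x = 0"
      using clip_cubic_above[of "sd x / \<rho>"] by (simp_all add: g_def G_def) (simp add: \<rho>_def)
  qed
  moreover have "g x < 0 \<longleftrightarrow> x \<in> V" for x
    unfolding sd_neg_iff[symmetric] g_def using \<rho> clip_cubic_sgn(1)[of "sd x / \<rho>"]
    by (simp add: mult_less_0_iff divide_less_0_iff)
  moreover have "g x = 0 \<longleftrightarrow> x \<in> S" for x
    unfolding sd_zero_iff[symmetric] g_def using \<rho> clip_cubic_sgn(2)[of "sd x / \<rho>"] by simp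
  ultimately show ?thesis using that by blast
qed

end

section \<open>Diffeomorphisms close to the identity\<close>

lemma quad_has_derivative:
  fixes f :: "'a::real_normed_vector \<Rightarrow> 'b::real_normed_vector"
  assumes "bounded_linear A" and q: "\<And>x. norm (f x - f y - A (x - y)) \<le> Q * (norm (x - y))\<^sup>2"
  shows "(f has_derivative A) (at y)"
  unfolding has_derivative_at_alt
proof (intro conjI allI impI assms(1))
  fix e :: real assume e: "e > 0"
  define d where "d = e / (\<bar>Q\<bar> + 1)"
  have d: "d > 0" using e by (simp add: d_def)
  have "norm (f x - f y - A (x - y)) \<le> e * norm (x - y)" if "norm (x - y) < d" for x
  proof -
    have "Q * (norm (x - y))\<^sup>2 \<le> (\<bar>Q\<bar> + 1) * norm (x - y) * norm (x - y)"
      unfolding power2_eq_square mult.assoc by (intro mult_right_mono) auto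
    also have "\<dots> \<le> e * norm (x - y)"
    proof (rule mult_right_mono)
      have "(\<bar>Q\<bar> + 1) * norm (x - y) \<le> (\<bar>Q\<bar> + 1) * d" using that by (intro mult_left_mono) auto
      also have "\<dots> = e" by (simp add: d_def)
      finally show "(\<bar>Q\<bar> + 1) * norm (x - y) \<le> e" .
    qed simp
    finally show ?thesis using q[of x] by linarith
  qed
  then show "\<exists>d>0. \<forall>x. norm (x - y) < d \<longrightarrow> norm (f x - f y - A (x - y)) \<le> e * norm (x - y)"
    using d by blast
qed

lemma quad_derivative_lipschitz:
  fixes f :: "'a::real_normed_vector \<Rightarrow> 'b::real_normed_vector"
  assumes lin: "\<And>y. linear (A y)"
    and q: "\<And>x y. norm (f x - f y - A y (x - y)) \<le> Q * (norm (x - y))\<^sup>2"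
  shows "norm (A x v - A y v) \<le> 6 * Q * norm (x - y) * norm v"
proof (cases "x = y \<or> v = 0")
  case True
  then show ?thesis using linear_0[OF lin] by auto
next
  case False
  define h where "h = norm (x - y)"
  define u where "u = (h / norm v) *\<^sub>R v"
  have h: "h > 0" and nu: "norm u = h" using False by (auto simp: h_def u_def)
  define z where "z = y + u"
  have Q0: "0 \<le> Q" using q[of x y] False
    by (metis mult_less_0_iff not_le norm_ge_zero order_trans zero_less_norm_iff zero_less_power right_minus_eq)
  have 1: "norm (f z - f y - A y u) \<le> Q * h\<^sup>2" using q[of z y] nu by (simp add: z_def)
  have zx: "z - x = u + (y - x)" by (simp add: z_def)
  have "norm (z - x) \<le> 2 * h" unfolding zx using norm_triangle_ineq[of u "y - x"] nu by (simp add: h_def norm_minus_commute)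
  then have "Q * (norm (z - x))\<^sup>2 \<le> Q * (2 * h)\<^sup>2" using Q0 by (intro mult_left_mono power_mono) auto
  then have 2: "norm (f z - f x - A x (z - x)) \<le> Q * (4 * h\<^sup>2)" using q[of z x] by (simp add: power_mult_distrib)
  have 3: "norm (f y - f x - A x (y - x)) \<le> Q * h\<^sup>2" using q[of y x] by (simp add: h_def norm_minus_commute)
  have "A x u - A y u = (f z - f y - A y u) - (f z - f x - A x (z - x)) + (f y - f x - A x (y - x))"
    unfolding zx linear_add[OF lin] by simp
  then have "norm (A x u - A y u) \<le> norm (f z - f y - A y u) + norm (f z - f x - A x (z - x)) + norm (f y - f x - A x (y - x))"
    by (metis norm_triangle_ineq norm_triangle_ineq4 add_right_mono order_trans)
  then have "norm (A x u - A y u) \<le> 6 * Q * h * h" using 1 2 3 by (simp add: power2_eq_square)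
  moreover have "A x u - A y u = (h / norm v) *\<^sub>R (A x v - A y v)"
    unfolding u_def linear_scale[OF lin] by (simp add: scaleR_diff_right)
  ultimately have "(h / norm v) * norm (A x v - A y v) \<le> (h / norm v) * (6 * Q * h * norm v)"
  proof -
    have "(h / norm v) * (6 * Q * h * norm v) = 6 * Q * h * h" using False by simp
    moreover have "norm (A x u - A y u) = (h / norm v) * norm (A x v - A y v)"
      unfolding \<open>A x u - A y u = (h / norm v) *\<^sub>R (A x v - A y v)\<close> using h by simp
    ultimately show ?thesis using \<open>norm (A x u - A y u) \<le> 6 * Q * h * h\<close> by simp
  qed
  moreover have "h / norm v > 0" using h False by simp
  ultimately show ?thesis unfolding h_def[symmetric] by (simp only: mult_le_cancel_left_pos)
qed

locale defining =
  fixes K C R m :: real and g :: "space3 \<Rightarrow> real" and G :: "space3 \<Rightarrow> space3"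
  assumes dp: "defining_pair K C R m g G"
begin

lemma quad: "\<bar>g x - g y - G y \<bullet> (x - y)\<bar> \<le> K * (norm (x - y))\<^sup>2"
  and G_le_1: "norm (G x) \<le> 1"
  and G_defect: "1 - norm (G x) \<le> C * (g x)\<^sup>2"
  and far: "norm x \<ge> R \<Longrightarrow> g x = m" "norm x \<ge> R \<Longrightarrow> G x = 0"
  using dp unfolding defining_pair_def by blast+

lemma K_nonneg: "0 \<le> K"
proof -
  have "0 \<le> K * (norm (axis 1 1 - (0::space3)))\<^sup>2" using quad[of "axis 1 1" 0] by linarith
  then show ?thesis by simp
qed

lemma der: "(g has_derivative (\<lambda>v. G y \<bullet> v)) (at y)"
proof (rule quad_has_derivative)
  show "bounded_linear ((\<bullet>) (G y))" by (rule bounded_linear_inner_right)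
  show "norm (g x - g y - G y \<bullet> (x - y)) \<le> K * (norm (x - y))\<^sup>2" for x using quad by simp
qed

lemma gderiv: "GDERIV g y :> G y"
  using der by (simp add: gderiv_def inner_commute)

lemma G_lipschitz: "norm (G x - G y) \<le> 6 * K * norm (x - y)"
proof (cases "G x = G y")
  case True then show ?thesis using K_nonneg by simp
next
  case False
  have q: "norm (g x - g y - G y \<bullet> (x - y)) \<le> K * (norm (x - y))\<^sup>2" for x y using quad[of x y] by simp
  have lin: "linear (\<lambda>v. G y \<bullet> v)" for y using bounded_linear_inner_right bounded_linear.linear by blast
  have "norm (G x \<bullet> (G x - G y) - G y \<bullet> (G x - G y)) \<le> 6 * K * norm (x - y) * norm (G x - G y)"
    by (rule quad_derivative_lipschitz[where f=g and A="\<lambda>y v. G y \<bullet> v", OF lin q])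
  moreover have "G x \<bullet> (G x - G y) - G y \<bullet> (G x - G y) = norm (G x - G y) * norm (G x - G y)"
    by (simp only: inner_diff_left[symmetric] power2_norm_eq_inner[symmetric] power2_eq_square)
  ultimately have "norm (G x - G y) * norm (G x - G y) \<le> (6 * K * norm (x - y)) * norm (G x - G y)" by simp
  then show ?thesis by (rule mult_right_le_imp_le) (use False in simp)
qed

lemma g_lipschitz: "\<bar>g x - g y\<bar> \<le> norm (x - y)"
proof -
  have "norm (g x - g y) \<le> 1 * norm (x - y)"
  proof (rule differentiable_bound[where S=UNIV and f=g and f'="\<lambda>y v. G y \<bullet> v"])
    show "(g has_derivative (\<lambda>v. G x \<bullet> v)) (at x within UNIV)" for x using der by simp
    show "onorm ((\<bullet>) (G x)) \<le> 1" for x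
    proof (rule onorm_le)
      fix v
      have "norm (G x \<bullet> v) \<le> norm (G x) * norm v" by (simp add: Cauchy_Schwarz_ineq2)
      also have "\<dots> \<le> 1 * norm v" by (intro mult_right_mono G_le_1) simp
      finally show "norm (G x \<bullet> v) \<le> 1 * norm v" .
    qed
  qed auto
  then show ?thesis by simp
qed

lemma g_continuous: "continuous_on A g"
  using der by (meson continuous_at_imp_continuous_on has_derivative_continuous)

lemma g_bounded: "\<exists>M>0. \<forall>x. \<bar>g x\<bar> \<le> M"
proof -
  have "\<bar>g x\<bar> \<le> \<bar>g 0\<bar> + \<bar>m\<bar> + \<bar>R\<bar> + 1" for x
  proof (cases "norm x \<ge> R")
    case True then show ?thesis using far by simp
  next
    case False then show ?thesis using g_lipschitz[of x 0] by simp
  qed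
  then show ?thesis by (intro exI[of _ "\<bar>g 0\<bar> + \<bar>m\<bar> + \<bar>R\<bar> + 1"]) auto
qed

lemma lower_bound:
  assumes "C > 0"
  shows "min (1 / 4) (1 / (2 * C)) \<le> (norm (G x))\<^sup>2 + (g x)\<^sup>2"
proof (cases "C * (g x)\<^sup>2 \<le> 1 / 2")
  case True
  then have "1 / 2 \<le> norm (G x)" using G_defect[of x] by linarith
  then have "(1 / 2)\<^sup>2 \<le> (norm (G x))\<^sup>2" by (rule power_mono) simp
  then have "1 / 4 \<le> (norm (G x))\<^sup>2" by (simp add: power_divide)
  moreover have "0 \<le> (g x)\<^sup>2" by simp
  ultimately show ?thesis by linarith
next
  case False
  then have "1 / (2 * C) \<le> (g x)\<^sup>2" using assms by (simp add: field_simps)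
  moreover have "0 \<le> (norm (G x))\<^sup>2" by simp
  ultimately show ?thesis by linarith
qed

lemma G_unit: "g x = 0 \<Longrightarrow> norm (G x) = 1"
  using G_defect[of x] G_le_1[of x] by simp

text \<open>The difference quotients of \<open>g\<close> are a field of class \<open>C\<^sup>1\<^sup>,\<^sup>1\<close> close to the gradient, which is itself only Lipschitz.\<close>

lemma discrete_gradient:
  assumes "\<kappa> > 0"
  obtains N :: "space3 \<Rightarrow> space3" and N' B where "B \<ge> 1" "\<And>x. norm (N x) \<le> 3" "\<And>x. norm (N x - G x) \<le> \<kappa>"
    "\<And>y. linear (N' y)" "\<And>y v. norm (N' y v) \<le> B * norm v"
    "\<And>x y. norm (N x - N y) \<le> B * norm (x - y)"
    "\<And>x y. norm (N x - N y - N' y (x - y)) \<le> B * (norm (x - y))\<^sup>2"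
proof -
  define e where "e = \<kappa> / (3 * K + 1)"
  have e: "e > 0" using assms K_nonneg by (simp add: e_def)
  have Ke: "3 * (K * e) \<le> \<kappa>"
  proof -
    have "3 * (K * e) \<le> (3 * K + 1) * e" using e by (simp add: algebra_simps)
    also have "\<dots> = \<kappa>" using K_nonneg by (simp add: e_def)
    finally show ?thesis .
  qed
  define N :: "space3 \<Rightarrow> space3" where "N = (\<lambda>x. \<chi> i. (g (x + e *\<^sub>R axis i 1) - g x) / e)"
  define N' :: "space3 \<Rightarrow> space3 \<Rightarrow> space3" where "N' = (\<lambda>x v. \<chi> i. ((G (x + e *\<^sub>R axis i 1) - G x) \<bullet> v) / e)"
  define B where "B = max 1 (6 * (K + 1) / e)"
  have nb: "norm w \<le> 3 * b" if "\<And>i. \<bar>w $ i\<bar> \<le> b" for w :: space3 and b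
  proof -
    have "norm w \<le> (\<Sum>i\<in>UNIV. \<bar>w $ i\<bar>)" by (rule norm_le_l1_cart)
    also have "\<dots> \<le> (\<Sum>i\<in>(UNIV::3 set). b)" by (rule sum_mono) (rule that)
    finally show ?thesis by simp
  qed
  have ax: "norm (axis i (1::real) :: space3) = 1" for i by (simp add: norm_axis_1)
  have B1: "6 / e \<le> B" "6 * K / e \<le> B"
  proof -
    have "6 / e \<le> 6 * (K + 1) / e" "6 * K / e \<le> 6 * (K + 1) / e" using e K_nonneg by (auto intro!: divide_right_mono)
    then show "6 / e \<le> B" "6 * K / e \<le> B" by (auto simp: B_def)
  qed
  show ?thesis
  proof
    show "B \<ge> 1" by (simp add: B_def)
    show "norm (N x) \<le> 3" for x
    proof -
      have "\<bar>N x $ i\<bar> \<le> 1" for i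
        using g_lipschitz[of "x + e *\<^sub>R axis i 1" x] e ax by (simp add: N_def abs_divide)
      from nb[OF this] show ?thesis by simp
    qed
    show "norm (N x - G x) \<le> \<kappa>" for x
    proof -
      have "\<bar>(N x - G x) $ i\<bar> \<le> K * e" for i
      proof -
        have "\<bar>g (x + e *\<^sub>R axis i 1) - g x - e * G x $ i\<bar> \<le> K * e\<^sup>2"
          using quad[of "x + e *\<^sub>R axis i 1" x] e ax by (simp add: inner_axis)
        moreover have "(N x - G x) $ i = (g (x + e *\<^sub>R axis i 1) - g x - e * G x $ i) / e"
          using e by (simp add: N_def diff_divide_distrib)
        ultimately have "\<bar>(N x - G x) $ i\<bar> \<le> K * e\<^sup>2 / e" using e by (simp add: abs_divide divide_right_mono)
        then show ?thesis using e by (simp add: power2_eq_square)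
      qed
      from nb[OF this] show ?thesis using Ke by simp
    qed
    show "linear (N' y)" for y
      by (rule linearI) (simp_all add: N'_def vec_eq_iff inner_add_right add_divide_distrib)
    show "norm (N' y v) \<le> B * norm v" for y v
    proof -
      have "\<bar>N' y v $ i\<bar> \<le> 2 / e * norm v" for i
      proof -
        have "norm (G (y + e *\<^sub>R axis i 1) - G y) \<le> 2"
          using norm_triangle_ineq4[of "G (y + e *\<^sub>R axis i 1)" "G y"] G_le_1[of y] G_le_1[of "y + e *\<^sub>R axis i 1"] by linarith
        then have "\<bar>(G (y + e *\<^sub>R axis i 1) - G y) \<bullet> v\<bar> \<le> 2 * norm v"
          using Cauchy_Schwarz_ineq2[of "G (y + e *\<^sub>R axis i 1) - G y" v] mult_right_mono[of _ 2 "norm v"] by (meson norm_ge_zero order_trans)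
        then have "\<bar>(G (y + e *\<^sub>R axis i 1) - G y) \<bullet> v\<bar> / e \<le> 2 * norm v / e" using e by (intro divide_right_mono) auto
        then show ?thesis using e by (simp add: N'_def abs_divide)
      qed
      from nb[OF this] have "norm (N' y v) \<le> 6 / e * norm v" by simp
      also have "\<dots> \<le> B * norm v" using B1 by (intro mult_right_mono) auto
      finally show ?thesis .
    qed
    show "norm (N x - N y) \<le> B * norm (x - y)" for x y
    proof -
      have "\<bar>(N x - N y) $ i\<bar> \<le> 2 / e * norm (x - y)" for i
      proof -
        define p where "p = g (x + e *\<^sub>R axis i 1) - g (y + e *\<^sub>R axis i 1) - (g x - g y)"
        have "\<bar>p\<bar> \<le> 2 * norm (x - y)"
          using g_lipschitz[of "x + e *\<^sub>R axis i 1" "y + e *\<^sub>R axis i 1"] g_lipschitz[of x y] by (simp add: p_def)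
        then have "\<bar>p\<bar> / e \<le> 2 * norm (x - y) / e" using e by (intro divide_right_mono) auto
        moreover have "(N x - N y) $ i = p / e" by (simp add: N_def p_def diff_divide_distrib)
        ultimately show ?thesis using e by (simp add: abs_divide)
      qed
      from nb[OF this] have "norm (N x - N y) \<le> 6 / e * norm (x - y)" by simp
      also have "\<dots> \<le> B * norm (x - y)" using B1 by (intro mult_right_mono) auto
      finally show ?thesis .
    qed
    show "norm (N x - N y - N' y (x - y)) \<le> B * (norm (x - y))\<^sup>2" for x y
    proof -
      have "\<bar>(N x - N y - N' y (x - y)) $ i\<bar> \<le> 2 * K / e * (norm (x - y))\<^sup>2" for i
      proof -
        define p where "p = (g (x + e *\<^sub>R axis i 1) - g (y + e *\<^sub>R axis i 1) - G (y + e *\<^sub>R axis i 1) \<bullet> (x - y)) - (g x - g y - G y \<bullet> (x - y))"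
        have "\<bar>p\<bar> \<le> 2 * K * (norm (x - y))\<^sup>2"
          using quad[of "x + e *\<^sub>R axis i 1" "y + e *\<^sub>R axis i 1"] quad[of x y] by (simp add: p_def)
        then have "\<bar>p\<bar> / e \<le> 2 * K * (norm (x - y))\<^sup>2 / e" using e by (intro divide_right_mono) auto
        moreover have "(N x - N y - N' y (x - y)) $ i = p / e"
          by (simp add: N_def N'_def p_def diff_divide_distrib inner_diff_left)
        ultimately show ?thesis using e by (simp add: abs_divide)
      qed
      from nb[OF this] have "norm (N x - N y - N' y (x - y)) \<le> 6 * K / e * (norm (x - y))\<^sup>2" by simp
      also have "\<dots> \<le> B * (norm (x - y))\<^sup>2" using B1 by (intro mult_right_mono) auto
      finally show ?thesis .
    qed
  qed
qed

end

definition near_identity :: "real \<Rightarrow> (space3 \<Rightarrow> space3) \<Rightarrow> (space3 \<Rightarrow> space3 \<Rightarrow> space3) \<Rightarrow> bool" where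
  "near_identity \<epsilon> \<Phi> A \<longleftrightarrow>
     (\<exists>Q. \<forall>x y. norm (\<Phi> x - \<Phi> y - A y (x - y)) \<le> Q * (norm (x - y))\<^sup>2) \<and>
     (\<forall>y. linear (A y)) \<and> (\<forall>y v. norm (A y v - v) \<le> \<epsilon> * norm v) \<and> (\<forall>x. norm (\<Phi> x - x) \<le> \<epsilon>)"

definition intertwines :: "(space3 \<Rightarrow> real) \<Rightarrow> (space3 \<Rightarrow> space3) \<Rightarrow> (space3 \<Rightarrow> real) \<Rightarrow> (space3 \<Rightarrow> space3) \<Rightarrow>
    (space3 \<Rightarrow> space3) \<Rightarrow> (space3 \<Rightarrow> space3 \<Rightarrow> space3) \<Rightarrow> bool" where
  "intertwines g0 G0 g G \<Phi> A \<longleftrightarrow> (\<forall>x. (g (\<Phi> x) = 0 \<longleftrightarrow> g0 x = 0) \<and> (g (\<Phi> x) < 0 \<longleftrightarrow> g0 x < 0)) \<and>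
     (\<forall>x v. g0 x = 0 \<longrightarrow> G (\<Phi> x) \<bullet> A x v = G0 x \<bullet> v)"

text \<open>The diffeomorphism moves \<open>x\<close> by \<open>\<tau> x\<close> along the discrete gradient of \<open>g0\<close>, where \<open>\<tau> x\<close> solves
  \<open>g (x + \<tau> N x) = g0 x - (g0 x)\<^sup>2 \<tau>\<close>. The quadratic term makes the equation uniquely solvable also
  where the gradient of \<open>g0\<close> vanishes, without affecting the zero sets.\<close>

lemma near_identity_diffeo:
  assumes dp0: "defining_pair K C R m g0 G0" and C: "C > 0" and eps: "\<epsilon> > 0"
  obtains \<eta> where "\<eta> > 0" "\<And>g G. defining_pair K C R m g G \<Longrightarrow> (\<And>x. \<bar>g x - g0 x\<bar> \<le> \<eta>) \<Longrightarrow>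
    (\<And>x. norm (G x - G0 x) \<le> \<eta>) \<Longrightarrow> \<exists>\<Phi> A. near_identity \<epsilon> \<Phi> A \<and> intertwines g0 G0 g G \<Phi> A"
proof -
  interpret D0: defining K C R m g0 G0 by unfold_locales (rule dp0)
  define c where "c = min (1 / 4) (1 / (2 * C)) / 2"
  have c: "c > 0" using C by (simp add: c_def)
  have c2: "2 * c \<le> (norm (G0 x))\<^sup>2 + (g0 x)\<^sup>2" for x using D0.lower_bound[OF C, of x] by (simp add: c_def)
  obtain N N' B where B: "B \<ge> 1" and N3: "\<And>x. norm (N x) \<le> 3" and NG: "\<And>x. norm (N x - G0 x) \<le> c / 4"
    and N'lin: "\<And>y. linear (N' y)" and N'b: "\<And>y v. norm (N' y v) \<le> B * norm v"
    and Nlip: "\<And>x y. norm (N x - N y) \<le> B * norm (x - y)"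
    and Nq: "\<And>x y. norm (N x - N y - N' y (x - y)) \<le> B * (norm (x - y))\<^sup>2"
  proof -
    have "c / 4 > 0" using c by simp
    from D0.discrete_gradient[OF this] show ?thesis using that by metis
  qed
  obtain M where M: "M > 0" "\<And>x. \<bar>g0 x\<bar> \<le> M" using D0.g_bounded by blast
  have K0: "0 \<le> K" by (rule D0.K_nonneg)
  define \<tau>0 where "\<tau>0 = min 1 (min (c / (4 * (54 * K + 1))) (1 / (2 * M)))"
  have \<tau>0: "0 < \<tau>0" "\<tau>0 \<le> 1" "\<tau>0 \<le> c / (4 * (54 * K + 1))" "\<tau>0 \<le> 1 / (2 * M)"
    using c K0 M by (auto simp: \<tau>0_def)
  have K\<tau>0: "54 * K * \<tau>0 \<le> c / 4"
  proof -
    have "54 * K * \<tau>0 \<le> (54 * K + 1) * \<tau>0" using \<tau>0 by (simp add: algebra_simps)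
    also have "\<dots> \<le> (54 * K + 1) * (c / (4 * (54 * K + 1)))" using \<tau>0 K0 by (intro mult_left_mono) auto
    also have "\<dots> = c / 4" using K0 by (simp add: field_simps)
    finally show ?thesis .
  qed
  have M\<tau>0: "M * \<tau>0 \<le> 1 / 2"
  proof -
    have "M * \<tau>0 \<le> M * (1 / (2 * M))" using \<tau>0 M by (intro mult_left_mono) auto
    also have "\<dots> = 1 / 2" using M by simp
    finally show ?thesis .
  qed
  define \<Omega> where "\<Omega> = (18 * K + B + 2 * M) / c + 1"
  define \<Gamma> where "\<Gamma> = 3 * \<Omega> / c + B / c + 3 / c"
  have \<Omega>: "\<Omega> > 0" using K0 B M c by (simp add: \<Omega>_def add_nonneg_pos)
  have \<Gamma>: "\<Gamma> > 0" using \<Omega> B c by (simp add: \<Gamma>_def add_pos_pos)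
  define \<eta> where "\<eta> = min (min (c * \<tau>0) (c / 12)) (\<epsilon> / \<Gamma>)"
  have \<eta>: "0 < \<eta>" "\<eta> \<le> c * \<tau>0" "3 * \<eta> \<le> c / 4" "\<Gamma> * \<eta> \<le> \<epsilon>"
  proof -
    show "0 < \<eta>" "\<eta> \<le> c * \<tau>0" using c \<tau>0 eps \<Gamma> by (auto simp: \<eta>_def)
    have "\<eta> \<le> c / 12" unfolding \<eta>_def by linarith
    then show "3 * \<eta> \<le> c / 4" by simp
    have "\<eta> \<le> \<epsilon> / \<Gamma>" by (simp add: \<eta>_def)
    then show "\<Gamma> * \<eta> \<le> \<epsilon>" using \<Gamma> by (simp add: field_simps)
  qed
  have main: "\<exists>\<Phi> A. near_identity \<epsilon> \<Phi> A \<and> intertwines g0 G0 g G \<Phi> A"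
    if dpg: "defining_pair K C R m g G" and gg: "\<And>x. \<bar>g x - g0 x\<bar> \<le> \<eta>" and GG: "\<And>x. norm (G x - G0 x) \<le> \<eta>" for g G
  proof -
    interpret D: defining K C R m g G by unfold_locales (rule dpg)
    define E where "E = (\<lambda>x t. g (x + t *\<^sub>R N x) - g0 x + (g0 x)\<^sup>2 * t)"
    define E\<tau> where "E\<tau> = (\<lambda>x t. G (x + t *\<^sub>R N x) \<bullet> N x + (g0 x)\<^sup>2)"
    have derE: "(E x has_real_derivative E\<tau> x t) (at t)" for x t
    proof -
      have "((g \<circ> (\<lambda>t. x + t *\<^sub>R N x)) has_derivative ((\<lambda>v. G (x + t *\<^sub>R N x) \<bullet> v) \<circ> (\<lambda>s. s *\<^sub>R N x))) (at t)"
        by (rule diff_chain_at) (auto intro!: derivative_eq_intros D.der)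
      moreover have "(\<lambda>v. G (x + t *\<^sub>R N x) \<bullet> v) \<circ> (\<lambda>s. s *\<^sub>R N x) = (*) (G (x + t *\<^sub>R N x) \<bullet> N x)"
        by (auto simp: fun_eq_iff)
      ultimately have d: "((\<lambda>t. g (x + t *\<^sub>R N x)) has_real_derivative (G (x + t *\<^sub>R N x) \<bullet> N x)) (at t)"
        by (simp add: has_field_derivative_def o_def)
      show ?thesis unfolding E_def E\<tau>_def by (rule derivative_eq_intros d refl)+ simp
    qed
    have slope: "c \<le> E\<tau> x t" if t: "\<bar>t\<bar> \<le> \<tau>0" for x t
    proof -
      define z where "z = x + t *\<^sub>R N x"
      have "norm (G z - G x) \<le> 6 * K * norm (z - x)" by (rule D.G_lipschitz)
      also have "norm (z - x) \<le> \<tau>0 * 3" unfolding z_def using t N3[of x] by (simp add: mult_mono)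
      then have "6 * K * norm (z - x) \<le> 6 * K * (\<tau>0 * 3)" using K0 by (intro mult_left_mono) auto
      finally have 1: "norm (G z - G0 x) \<le> 18 * K * \<tau>0 + \<eta>"
        using GG[of x] norm_triangle_ineq[of "G z - G x" "G x - G0 x"] by simp
      have "\<bar>(G z - G0 x) \<bullet> N x\<bar> \<le> norm (G z - G0 x) * norm (N x)" by (rule Cauchy_Schwarz_ineq2)
      also have "\<dots> \<le> (18 * K * \<tau>0 + \<eta>) * 3" using 1 N3 by (intro mult_mono) (auto intro: order_trans[OF norm_ge_zero])
      finally have 2: "\<bar>(G z - G0 x) \<bullet> N x\<bar> \<le> c / 2" using K\<tau>0 \<eta> by simp
      have "\<bar>G0 x \<bullet> (N x - G0 x)\<bar> \<le> norm (G0 x) * norm (N x - G0 x)" by (rule Cauchy_Schwarz_ineq2)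
      also have "\<dots> \<le> 1 * (c / 4)" using D0.G_le_1 NG by (intro mult_mono) auto
      finally have 3: "\<bar>G0 x \<bullet> (N x - G0 x)\<bar> \<le> c / 4" by simp
      have "E\<tau> x t = (G z - G0 x) \<bullet> N x + G0 x \<bullet> (N x - G0 x) + ((norm (G0 x))\<^sup>2 + (g0 x)\<^sup>2)"
        unfolding E\<tau>_def z_def[symmetric] power2_norm_eq_inner by (simp add: inner_diff_left inner_diff_right)
      then show ?thesis using 2 3 c2[of x] c by linarith
    qed
    have incr: "c * \<bar>t - s\<bar> \<le> \<bar>E x t - E x s\<bar>" if st: "\<bar>s\<bar> \<le> \<tau>0" "\<bar>t\<bar> \<le> \<tau>0" for x s t
    proof -
      have lt: "c * (t - s) \<le> E x t - E x s" if l: "s < t" "\<bar>s\<bar> \<le> \<tau>0" "\<bar>t\<bar> \<le> \<tau>0" for s t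
      proof -
        obtain z where z: "s < z" "z < t" "E x t - E x s = (t - s) * E\<tau> x z"
          using MVT2[OF l(1), of "E x" "E\<tau> x"] derE by blast
        have "(t - s) * c \<le> (t - s) * E\<tau> x z" using l z by (intro mult_left_mono slope) auto
        then show ?thesis unfolding z(3) by (simp add: mult.commute)
      qed
      have ab: "a \<le> b \<Longrightarrow> a \<le> \<bar>b\<bar>" for a b :: real by linarith
      consider "s < t" | "s = t" | "t < s" by linarith
      then show ?thesis
      proof cases
        case 1 then show ?thesis using ab[OF lt[OF 1 st]] by simp
      next
        case 3 then show ?thesis using ab[OF lt[OF 3 st(2,1)]] by (simp add: abs_minus_commute)
      qed simp
    qed
    have "\<exists>t. \<bar>t\<bar> \<le> \<tau>0 \<and> E x t = 0" for x
    proof -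
      have E0: "\<bar>E x 0\<bar> \<le> \<eta>" using gg[of x] by (simp add: E_def)
      have cont: "continuous_on {- \<tau>0..\<tau>0} (E x)"
        using derE by (meson DERIV_continuous_on has_field_derivative_at_within)
      have up: "E x 0 + c * \<tau>0 \<le> E x \<tau>0" and lo: "E x (- \<tau>0) \<le> E x 0 - c * \<tau>0"
      proof -
        obtain z where z: "0 < z" "z < \<tau>0" "E x \<tau>0 - E x 0 = (\<tau>0 - 0) * E\<tau> x z"
          using MVT2[OF \<tau>0(1), of "E x" "E\<tau> x"] derE by blast
        have "\<tau>0 * c \<le> \<tau>0 * E\<tau> x z" using \<tau>0(1) z by (intro mult_left_mono slope) auto
        then show "E x 0 + c * \<tau>0 \<le> E x \<tau>0" using z(3) by (simp add: algebra_simps)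
        have "- \<tau>0 < 0" using \<tau>0(1) by simp
        from MVT2[OF this, of "E x" "E\<tau> x"] derE
        obtain z where z: "- \<tau>0 < z" "z < 0" "E x 0 - E x (- \<tau>0) = (0 - - \<tau>0) * E\<tau> x z" by blast
        have "\<tau>0 * c \<le> \<tau>0 * E\<tau> x z" using \<tau>0(1) z by (intro mult_left_mono slope) auto
        then show "E x (- \<tau>0) \<le> E x 0 - c * \<tau>0" using z(3) by (simp add: algebra_simps)
      qed
      have "\<exists>t\<ge>- \<tau>0. t \<le> \<tau>0 \<and> E x t = 0"
        by (rule IVT') (use up lo E0 \<eta> \<tau>0 cont in auto)
      then show ?thesis by (metis abs_le_iff minus_le_iff)
    qed
    then obtain \<tau> where \<tau>: "\<And>x. \<bar>\<tau> x\<bar> \<le> \<tau>0" "\<And>x. E x (\<tau> x) = 0" by metis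
    have \<tau>\<eta>: "\<bar>\<tau> x\<bar> \<le> \<eta> / c" for x
    proof -
      have "c * \<bar>\<tau> x - 0\<bar> \<le> \<bar>E x (\<tau> x) - E x 0\<bar>" by (rule incr) (use \<tau> \<tau>0 in auto)
      also have "\<dots> \<le> \<eta>" using gg[of x] \<tau>(2)[of x] by (simp add: E_def)
      finally show ?thesis using c by (simp add: field_simps)
    qed
    have \<tau>1: "\<bar>\<tau> x\<bar> \<le> 1" for x using \<tau>(1)[of x] \<tau>0 by linarith
    define \<Phi> where "\<Phi> = (\<lambda>x. x + \<tau> x *\<^sub>R N x)"
    define Ex where "Ex = (\<lambda>y v. G (\<Phi> y) \<bullet> (v + \<tau> y *\<^sub>R N' y v) - G0 y \<bullet> v + 2 * g0 y * \<tau> y * (G0 y \<bullet> v))"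
    define Et where "Et = (\<lambda>y. E\<tau> y (\<tau> y))"
    define T where "T = (\<lambda>y v. - Ex y v / Et y)"
    define A where "A = (\<lambda>y v. v + T y v *\<^sub>R N y + \<tau> y *\<^sub>R N' y v)"
    have Et: "c \<le> Et y" for y unfolding Et_def by (rule slope) (rule \<tau>)
    have Et_eq: "Et y = G (\<Phi> y) \<bullet> N y + (g0 y)\<^sup>2" for y by (simp add: Et_def E\<tau>_def \<Phi>_def)
    have Exlin: "linear (Ex y)" for y
      by (rule linearI) (simp_all add: Ex_def linear_add[OF N'lin] linear_scale[OF N'lin] inner_add_right algebra_simps)
    have Tlin: "linear (T y)" for y
      by (rule linearI) (simp_all add: T_def linear_add[OF Exlin] linear_scale[OF Exlin] diff_divide_distrib add_divide_distrib)
    have Alin: "linear (A y)" for y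
      by (rule linearI) (simp_all add: A_def linear_add[OF N'lin] linear_scale[OF N'lin] linear_add[OF Tlin] linear_scale[OF Tlin] algebra_simps)
    have geq: "g (\<Phi> x) = g0 x * (1 - g0 x * \<tau> x)" for x
      using \<tau>(2)[of x] by (simp add: E_def \<Phi>_def algebra_simps power2_eq_square)
    have pos: "1 - g0 x * \<tau> x > 0" for x
    proof -
      have "\<bar>g0 x * \<tau> x\<bar> \<le> M * \<tau>0" unfolding abs_mult using M \<tau>(1) by (intro mult_mono) auto
      then show ?thesis using M\<tau>0 by linarith
    qed
    have inter: "intertwines g0 G0 g G \<Phi> A"
      unfolding intertwines_def
    proof (intro conjI allI impI)
      fix x
      show "g (\<Phi> x) = 0 \<longleftrightarrow> g0 x = 0" unfolding geq using pos[of x] by auto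
      show "g (\<Phi> x) < 0 \<longleftrightarrow> g0 x < 0" unfolding geq using pos[of x] by (auto simp: mult_less_0_iff)
      fix v assume g0: "g0 x = 0"
      have "Et x \<noteq> 0" using Et[of x] c by linarith
      then have "T x v * Et x = - Ex x v" by (simp add: T_def)
      then show "G (\<Phi> x) \<bullet> A x v = G0 x \<bullet> v"
        using g0 by (simp add: Et_eq Ex_def A_def inner_add_right)
    qed
    have Tb: "\<bar>T y v\<bar> \<le> \<Omega> * \<eta> / c * norm v" for y v
    proof -
      have "norm (G (\<Phi> y) - G0 y) \<le> 18 * K * (\<eta> / c) + \<eta>"
      proof -
        have "norm (\<Phi> y - y) \<le> \<eta> / c * 3" unfolding \<Phi>_def add_diff_cancel_left' norm_scaleR
          by (rule mult_mono[OF \<tau>\<eta> N3]) (use \<eta> c in auto)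
        then have "6 * K * norm (\<Phi> y - y) \<le> 6 * K * (\<eta> / c * 3)" using K0 by (intro mult_left_mono) auto
        then show ?thesis
          using D.G_lipschitz[of "\<Phi> y" y] GG[of y] norm_triangle_ineq[of "G (\<Phi> y) - G y" "G y - G0 y"] by simp
      qed
      then have "norm (G (\<Phi> y) - G0 y) * norm v \<le> (18 * K * (\<eta> / c) + \<eta>) * norm v" by (rule mult_right_mono) simp
      then have 1: "\<bar>(G (\<Phi> y) - G0 y) \<bullet> v\<bar> \<le> (18 * K * (\<eta> / c) + \<eta>) * norm v"
        using Cauchy_Schwarz_ineq2[of "G (\<Phi> y) - G0 y" v] by linarith
      have "\<bar>\<tau> y * (G (\<Phi> y) \<bullet> N' y v)\<bar> \<le> (\<eta> / c) * (1 * (B * norm v))"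
        unfolding abs_mult
      proof (intro mult_mono \<tau>\<eta> abs_ge_zero)
        have "\<bar>G (\<Phi> y) \<bullet> N' y v\<bar> \<le> norm (G (\<Phi> y)) * norm (N' y v)" by (rule Cauchy_Schwarz_ineq2)
        also have "\<dots> \<le> 1 * (B * norm v)" by (intro mult_mono D.G_le_1 N'b) auto
        finally show "\<bar>G (\<Phi> y) \<bullet> N' y v\<bar> \<le> 1 * (B * norm v)" .
      qed (use \<eta> c in auto)
      then have 2: "\<bar>\<tau> y * (G (\<Phi> y) \<bullet> N' y v)\<bar> \<le> B * (\<eta> / c) * norm v" by (simp add: mult_ac)
      have "\<bar>g0 y * (\<tau> y * (G0 y \<bullet> v))\<bar> \<le> M * ((\<eta> / c) * norm v)"
        unfolding abs_mult
      proof (intro mult_mono \<tau>\<eta> abs_ge_zero M)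
        have "\<bar>G0 y \<bullet> v\<bar> \<le> norm (G0 y) * norm v" by (rule Cauchy_Schwarz_ineq2)
        also have "\<dots> \<le> 1 * norm v" by (intro mult_right_mono D0.G_le_1) auto
        finally show "\<bar>G0 y \<bullet> v\<bar> \<le> norm v" by simp
      qed (use \<eta> c M in auto)
      moreover have "Ex y v = (G (\<Phi> y) - G0 y) \<bullet> v + \<tau> y * (G (\<Phi> y) \<bullet> N' y v) + 2 * (g0 y * (\<tau> y * (G0 y \<bullet> v)))"
        by (simp add: Ex_def inner_add_right inner_diff_left mult_ac)
      ultimately have "\<bar>Ex y v\<bar> \<le> (18 * K * (\<eta> / c) + \<eta>) * norm v + B * (\<eta> / c) * norm v + 2 * (M * ((\<eta> / c) * norm v))"
        using 1 2 by linarith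
      also have "\<dots> = \<Omega> * \<eta> * norm v" using c by (simp add: \<Omega>_def field_simps)
      finally have Exb: "\<bar>Ex y v\<bar> \<le> \<Omega> * \<eta> * norm v" .
      have "\<bar>T y v\<bar> = \<bar>Ex y v\<bar> / Et y" using Et[of y] c by (simp add: T_def abs_divide)
      also have "\<dots> \<le> (\<Omega> * \<eta> * norm v) / c" using Exb Et[of y] c by (intro frac_le) auto
      finally show ?thesis by simp
    qed
    have Ab: "norm (A y v - v) \<le> \<epsilon> * norm v" for y v
    proof -
      have "norm (A y v - v) \<le> \<bar>T y v\<bar> * norm (N y) + \<bar>\<tau> y\<bar> * norm (N' y v)"
        using norm_triangle_ineq[of "T y v *\<^sub>R N y" "\<tau> y *\<^sub>R N' y v"] by (simp add: A_def)
      also have "\<dots> \<le> (\<Omega> * \<eta> / c * norm v) * 3 + (\<eta> / c) * (B * norm v)"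
        using Tb N3 \<tau>\<eta> N'b \<eta> c \<Omega> by (intro add_mono mult_mono) auto
      also have "\<dots> = (3 * \<Omega> / c + B / c) * \<eta> * norm v" by (simp add: field_simps)
      also have "\<dots> \<le> (\<Gamma> * \<eta>) * norm v" using \<eta> c by (intro mult_right_mono) (auto simp: \<Gamma>_def)
      also have "\<dots> \<le> \<epsilon> * norm v" using \<eta> by (intro mult_right_mono) auto
      finally show ?thesis .
    qed
    have Pb: "norm (\<Phi> x - x) \<le> \<epsilon>" for x
    proof -
      have "norm (\<Phi> x - x) \<le> (\<eta> / c) * 3" unfolding \<Phi>_def add_diff_cancel_left' norm_scaleR
        by (rule mult_mono[OF \<tau>\<eta> N3]) (use \<eta> c in auto)
      also have "\<dots> = (3 / c) * \<eta>" by simp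
      also have "\<dots> \<le> \<Gamma> * \<eta>" using \<eta> c \<Omega> B by (intro mult_right_mono) (auto simp: \<Gamma>_def)
      finally show ?thesis using \<eta> by linarith
    qed
    define \<Lambda> where "\<Lambda> = (2 + B + 2 * M) / c"
    have \<Lambda>: "\<Lambda> \<ge> 0" using B M c by (simp add: \<Lambda>_def)
    have \<tau>lip: "\<bar>\<tau> x - \<tau> y\<bar> \<le> \<Lambda> * norm (x - y)" for x y
    proof -
      have "c * \<bar>\<tau> x - \<tau> y\<bar> \<le> \<bar>E x (\<tau> x) - E x (\<tau> y)\<bar>" by (rule incr) (use \<tau> in auto)
      also have "\<dots> = \<bar>E x (\<tau> y) - E y (\<tau> y)\<bar>" using \<tau>(2) by simp
      also have "\<dots> \<le> (2 + B + 2 * M) * norm (x - y)"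
      proof -
        have "norm ((x + \<tau> y *\<^sub>R N x) - (y + \<tau> y *\<^sub>R N y)) \<le> norm (x - y) + norm (\<tau> y *\<^sub>R (N x - N y))"
          using norm_triangle_ineq[of "x - y" "\<tau> y *\<^sub>R (N x - N y)"] by (simp add: algebra_simps)
        also have "norm (\<tau> y *\<^sub>R (N x - N y)) \<le> 1 * (B * norm (x - y))"
          unfolding norm_scaleR using \<tau>1 Nlip by (intro mult_mono) auto
        finally have 1: "\<bar>g (x + \<tau> y *\<^sub>R N x) - g (y + \<tau> y *\<^sub>R N y)\<bar> \<le> norm (x - y) + B * norm (x - y)"
          using D.g_lipschitz[of "x + \<tau> y *\<^sub>R N x" "y + \<tau> y *\<^sub>R N y"] by simp
        have "\<bar>g0 x + g0 y\<bar> * \<bar>g0 x - g0 y\<bar> \<le> (2 * M) * norm (x - y)"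
          using M(2)[of x] M(2)[of y] D0.g_lipschitz[of x y] by (intro mult_mono) auto
        then have "\<bar>((g0 x)\<^sup>2 - (g0 y)\<^sup>2)\<bar> \<le> 2 * M * norm (x - y)"
          unfolding abs_mult[symmetric] by (simp add: power2_eq_square algebra_simps)
        then have "\<bar>((g0 x)\<^sup>2 - (g0 y)\<^sup>2)\<bar> * \<bar>\<tau> y\<bar> \<le> (2 * M * norm (x - y)) * 1"
          using \<tau>1 M by (intro mult_mono) auto
        then have 2: "\<bar>((g0 x)\<^sup>2 - (g0 y)\<^sup>2) * \<tau> y\<bar> \<le> 2 * M * norm (x - y)" unfolding abs_mult by simp
        have "E x (\<tau> y) - E y (\<tau> y) = (g (x + \<tau> y *\<^sub>R N x) - g (y + \<tau> y *\<^sub>R N y)) - (g0 x - g0 y) + ((g0 x)\<^sup>2 - (g0 y)\<^sup>2) * \<tau> y"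
          by (simp add: E_def algebra_simps)
        then show ?thesis using 1 2 D0.g_lipschitz[of x y] by (simp add: algebra_simps) 
      qed
      finally have "\<bar>\<tau> x - \<tau> y\<bar> \<le> (2 + B + 2 * M) * norm (x - y) / c" using c by (simp add: pos_le_divide_eq mult.commute)
      then show ?thesis by (simp add: \<Lambda>_def)
    qed
    define C' where "C' = K * (1 + 3 * \<Lambda> + B)\<^sup>2 + (\<Lambda> * B + B) + K + (1 + 2 * M * K) + 2 * M * \<Lambda>"
    have quadP: "norm (\<Phi> x - \<Phi> y - A y (x - y)) \<le> (3 * C' / c + (\<Lambda> * B + B)) * (norm (x - y))\<^sup>2" for x y
    proof -
      define w where "w = x - y"
      define W where "W = norm w"
      define \<delta> where "\<delta> = \<tau> x - \<tau> y"
      have W0: "0 \<le> W" by (simp add: W_def)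
      have \<delta>: "\<bar>\<delta>\<bar> \<le> \<Lambda> * W" unfolding \<delta>_def W_def w_def by (rule \<tau>lip)
      define r2 where "r2 = \<delta> *\<^sub>R (N x - N y) + \<tau> y *\<^sub>R (N x - N y - N' y w)"
      have r2: "norm r2 \<le> (\<Lambda> * B + B) * W\<^sup>2"
      proof -
        have "norm (\<delta> *\<^sub>R (N x - N y)) \<le> (\<Lambda> * W) * (B * W)"
          unfolding norm_scaleR using \<delta> Nlip[of x y] \<Lambda> W0 by (intro mult_mono) (auto simp: W_def w_def)
        moreover have "norm (\<tau> y *\<^sub>R (N x - N y - N' y w)) \<le> 1 * (B * W\<^sup>2)"
          unfolding norm_scaleR using \<tau>1 Nq[of x y] by (intro mult_mono) (auto simp: W_def w_def)
        ultimately show ?thesis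
          using norm_triangle_ineq[of "\<delta> *\<^sub>R (N x - N y)" "\<tau> y *\<^sub>R (N x - N y - N' y w)"]
          by (simp add: r2_def power2_eq_square algebra_simps)
      qed
      have zz: "\<Phi> x - \<Phi> y = w + \<tau> y *\<^sub>R N' y w + \<delta> *\<^sub>R N y + r2"
        by (simp add: \<Phi>_def w_def \<delta>_def r2_def algebra_simps)
      have nzz: "norm (\<Phi> x - \<Phi> y) \<le> (1 + 3 * \<Lambda> + B) * W"
      proof -
        have e: "\<Phi> x - \<Phi> y = w + (\<delta> *\<^sub>R N x + \<tau> y *\<^sub>R (N x - N y))"
          by (simp add: \<Phi>_def w_def \<delta>_def algebra_simps)
        have "norm (\<delta> *\<^sub>R N x) \<le> (\<Lambda> * W) * 3" unfolding norm_scaleR using \<delta> N3 \<Lambda> W0 by (intro mult_mono) auto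
        moreover have "norm (\<tau> y *\<^sub>R (N x - N y)) \<le> 1 * (B * W)"
          unfolding norm_scaleR using \<tau>1 Nlip[of x y] by (intro mult_mono) (auto simp: W_def w_def)
        ultimately show ?thesis unfolding e
          using norm_triangle_ineq[of w "\<delta> *\<^sub>R N x + \<tau> y *\<^sub>R (N x - N y)"] norm_triangle_ineq[of "\<delta> *\<^sub>R N x" "\<tau> y *\<^sub>R (N x - N y)"]
          by (simp add: W_def algebra_simps)
      qed
      define r1 where "r1 = g (\<Phi> x) - g (\<Phi> y) - G (\<Phi> y) \<bullet> (\<Phi> x - \<Phi> y)"
      have r1: "\<bar>r1\<bar> \<le> K * (1 + 3 * \<Lambda> + B)\<^sup>2 * W\<^sup>2"
      proof -
        have "\<bar>r1\<bar> \<le> K * (norm (\<Phi> x - \<Phi> y))\<^sup>2" unfolding r1_def by (rule D.quad)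
        also have "\<dots> \<le> K * ((1 + 3 * \<Lambda> + B) * W)\<^sup>2" using nzz K0 by (intro mult_left_mono power_mono) auto
        finally show ?thesis by (simp add: power_mult_distrib mult.assoc)
      qed
      have Gr2: "\<bar>G (\<Phi> y) \<bullet> r2\<bar> \<le> (\<Lambda> * B + B) * W\<^sup>2"
      proof -
        have "\<bar>G (\<Phi> y) \<bullet> r2\<bar> \<le> norm (G (\<Phi> y)) * norm r2" by (rule Cauchy_Schwarz_ineq2)
        also have "\<dots> \<le> 1 * norm r2" by (intro mult_right_mono D.G_le_1) simp
        finally show ?thesis using r2 by simp
      qed
      define r3 where "r3 = g0 x - g0 y - G0 y \<bullet> w"
      have r3: "\<bar>r3\<bar> \<le> K * W\<^sup>2" unfolding r3_def W_def w_def by (rule D0.quad)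
      define r4 where "r4 = (g0 x)\<^sup>2 - (g0 y)\<^sup>2 - 2 * g0 y * (G0 y \<bullet> w)"
      have r4: "\<bar>r4\<bar> \<le> (1 + 2 * M * K) * W\<^sup>2"
      proof -
        have e: "r4 = (g0 x - g0 y)\<^sup>2 + 2 * (g0 y * r3)" by (simp add: r4_def r3_def power2_eq_square algebra_simps)
        have "\<bar>g0 x - g0 y\<bar>\<^sup>2 \<le> W\<^sup>2" unfolding W_def w_def by (intro power_mono D0.g_lipschitz) simp
        moreover have "\<bar>g0 y * r3\<bar> \<le> M * (K * W\<^sup>2)" unfolding abs_mult using M r3 by (intro mult_mono) auto
        ultimately have "\<bar>r4\<bar> \<le> W\<^sup>2 + 2 * (M * (K * W\<^sup>2))" unfolding e power2_abs using zero_le_power2[of "g0 x - g0 y"] by linarith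
        then show ?thesis by (simp add: algebra_simps)
      qed
      have r4t: "\<bar>r4 * \<tau> y\<bar> \<le> (1 + 2 * M * K) * W\<^sup>2"
      proof -
        have "\<bar>r4 * \<tau> y\<bar> \<le> \<bar>r4\<bar> * 1" unfolding abs_mult using \<tau>1 by (intro mult_left_mono) auto
        then show ?thesis using r4 by simp
      qed
      define r5 where "r5 = ((g0 x)\<^sup>2 - (g0 y)\<^sup>2) * \<delta>"
      have r5: "\<bar>r5\<bar> \<le> 2 * M * \<Lambda> * W\<^sup>2"
      proof -
        have "\<bar>g0 x + g0 y\<bar> * \<bar>g0 x - g0 y\<bar> \<le> (2 * M) * W"
          using M(2)[of x] M(2)[of y] D0.g_lipschitz[of x y] by (intro mult_mono) (auto simp: W_def w_def)
        then have "(\<bar>g0 x + g0 y\<bar> * \<bar>g0 x - g0 y\<bar>) * \<bar>\<delta>\<bar> \<le> ((2 * M) * W) * (\<Lambda> * W)"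
          by (rule mult_mono[OF _ \<delta>]) (use M W0 in auto)
        moreover have "r5 = ((g0 x + g0 y) * (g0 x - g0 y)) * \<delta>" by (simp add: r5_def power2_eq_square algebra_simps)
        ultimately show ?thesis unfolding abs_mult by (simp add: abs_mult power2_eq_square mult_ac)
      qed
      define \<rho> where "\<rho> = r1 + G (\<Phi> y) \<bullet> r2 - r3 + r4 * \<tau> y + r5"
      have \<rho>: "\<bar>\<rho>\<bar> \<le> C' * W\<^sup>2"
      proof -
        have "\<bar>\<rho>\<bar> \<le> K * (1 + 3 * \<Lambda> + B)\<^sup>2 * W\<^sup>2 + (\<Lambda> * B + B) * W\<^sup>2 + K * W\<^sup>2 + (1 + 2 * M * K) * W\<^sup>2 + 2 * M * \<Lambda> * W\<^sup>2"
          using r1 Gr2 r3 r4t r5 unfolding \<rho>_def by linarith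
        then show ?thesis unfolding C'_def distrib_right .
      qed
      have "0 = E x (\<tau> x) - E y (\<tau> y)" using \<tau>(2) by simp
      also have "\<dots> = (g (\<Phi> x) - g (\<Phi> y)) - (g0 x - g0 y) + ((g0 y)\<^sup>2 * \<delta> + ((g0 x)\<^sup>2 - (g0 y)\<^sup>2) * \<tau> y + r5)"
        by (simp add: E_def \<Phi>_def r5_def \<delta>_def algebra_simps)
      also have "\<dots> = (r1 + G (\<Phi> y) \<bullet> (\<Phi> x - \<Phi> y)) - (r3 + G0 y \<bullet> w) + ((g0 y)\<^sup>2 * \<delta> + (r4 + 2 * g0 y * (G0 y \<bullet> w)) * \<tau> y + r5)"
        by (simp add: r1_def r3_def r4_def)
      also have "\<dots> = Ex y w + Et y * \<delta> + \<rho>"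
        unfolding zz by (simp add: \<rho>_def Ex_def Et_eq inner_add_right algebra_simps)
      finally have eq: "Et y * \<delta> = - Ex y w - \<rho>" by linarith
      have E0: "Et y > 0" using Et[of y] c by linarith
      then have "\<delta> - T y w = - \<rho> / Et y"
      proof -
        have "\<delta> = (- Ex y w - \<rho>) / Et y" using eq E0 by (simp add: field_simps)
        then show ?thesis by (simp add: T_def diff_divide_distrib)
      qed
      then have "\<bar>\<delta> - T y w\<bar> = \<bar>\<rho>\<bar> / Et y" using E0 by (simp add: abs_divide)
      also have "\<dots> \<le> (C' * W\<^sup>2) / c" using \<rho> Et[of y] c by (intro frac_le) auto
      finally have dT: "\<bar>\<delta> - T y w\<bar> \<le> C' * W\<^sup>2 / c" .
      have "\<Phi> x - \<Phi> y - A y w = (\<delta> - T y w) *\<^sub>R N y + r2"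
        unfolding zz by (simp add: A_def algebra_simps)
      then have "norm (\<Phi> x - \<Phi> y - A y w) \<le> \<bar>\<delta> - T y w\<bar> * norm (N y) + norm r2"
        using norm_triangle_ineq[of "(\<delta> - T y w) *\<^sub>R N y" r2] by simp
      also have "\<dots> \<le> (C' * W\<^sup>2 / c) * 3 + (\<Lambda> * B + B) * W\<^sup>2"
      proof (intro add_mono mult_mono dT N3 r2)
        show "0 \<le> C' * W\<^sup>2 / c" using dT by (meson abs_ge_zero order_trans)
      qed simp
      also have "\<dots> = (3 * C' / c + (\<Lambda> * B + B)) * W\<^sup>2" by (simp add: algebra_simps)
      finally show ?thesis unfolding w_def W_def .
    qed
    have "near_identity \<epsilon> \<Phi> A"
      unfolding near_identity_def using quadP Alin Ab Pb by blast
    then show ?thesis using inter by blast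
  qed
  show ?thesis using \<eta>(1) main by (rule that)
qed

section \<open>Hausdorff measure\<close>

lemma hausdorff2_pre_mono: "A \<subseteq> B \<Longrightarrow> hausdorff2_pre r A \<le> hausdorff2_pre r B"
  unfolding hausdorff2_pre_def by (rule INF_superset_mono) auto

lemma hausdorff2_mono: "A \<subseteq> B \<Longrightarrow> hausdorff2 A \<le> hausdorff2 B"
  unfolding hausdorff2_def by (intro SUP_mono') (rule hausdorff2_pre_mono)

lemma hausdorff2_pre_le:
  assumes "A \<subseteq> (\<Union>i. U i)" "\<And>i. bounded (U i)" "\<And>i. diameter (U i) \<le> r"
  shows "hausdorff2_pre r A \<le> (\<Sum>i. ennreal (pi * (diameter (U i) / 2)\<^sup>2))"
  unfolding hausdorff2_pre_def by (rule INF_lower) (use assms in auto)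

lemma diameter_lipschitz_image:
  fixes f :: "'a::metric_space \<Rightarrow> 'b::real_normed_vector"
  assumes f: "L-lipschitz_on A f" and U: "bounded U"
  shows "bounded (f ` (U \<inter> A))" "diameter (f ` (U \<inter> A)) \<le> L * diameter U"
proof -
  have L: "0 \<le> L" by (rule lipschitz_on_nonneg[OF f])
  have *: "norm (x - y) \<le> L * diameter U" if xy: "x \<in> f ` (U \<inter> A)" "y \<in> f ` (U \<inter> A)" for x y
  proof -
    obtain a b where ab: "a \<in> U" "a \<in> A" "x = f a" "b \<in> U" "b \<in> A" "y = f b" using xy by blast
    have "dist x y \<le> L * dist a b" using lipschitz_onD[OF f ab(2,5)] ab by simp
    also have "\<dots> \<le> L * diameter U" by (intro mult_left_mono diameter_bounded_bound U ab L)
    finally show ?thesis by (simp add: dist_norm)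
  qed
  show "diameter (f ` (U \<inter> A)) \<le> L * diameter U"
    by (rule diameter_le[OF _ *]) (use L diameter_ge_0[OF U] in simp_all)
  show "bounded (f ` (U \<inter> A))"
    unfolding bounded_two_points using * by (auto simp: dist_norm)
qed

lemma hausdorff2_pre_lipschitz_image:
  fixes f :: "space3 \<Rightarrow> space3"
  assumes f: "L-lipschitz_on A f" and L: "L > 0"
  shows "hausdorff2_pre (L * r) (f ` A) \<le> ennreal (L\<^sup>2) * hausdorff2_pre r A"
proof -
  have c1: "ennreal (L\<^sup>2) * ennreal (1 / L\<^sup>2) = 1"
    using L by (simp flip: ennreal_mult' ennreal_1)
  have "ennreal (1 / L\<^sup>2) * hausdorff2_pre (L * r) (f ` A) \<le> hausdorff2_pre r A"
    unfolding hausdorff2_pre_def[of r]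
  proof (rule INF_greatest)
    fix U :: "nat \<Rightarrow> space3 set" assume "U \<in> {U. A \<subseteq> (\<Union>i. U i) \<and> (\<forall>i. bounded (U i) \<and> diameter (U i) \<le> r)}"
    then have U: "A \<subseteq> (\<Union>i. U i)" "\<And>i. bounded (U i)" "\<And>i. diameter (U i) \<le> r" by auto
    have "hausdorff2_pre (L * r) (f ` A) \<le> (\<Sum>i. ennreal (pi * (diameter (f ` (U i \<inter> A)) / 2)\<^sup>2))"
    proof (rule hausdorff2_pre_le)
      show "f ` A \<subseteq> (\<Union>i. f ` (U i \<inter> A))" using U(1) by blast
      show "bounded (f ` (U i \<inter> A))" for i by (rule diameter_lipschitz_image[OF f U(2)])
      have "L * diameter (U i) \<le> L * r" for i using U(3) L by (intro mult_left_mono) auto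
      then show "diameter (f ` (U i \<inter> A)) \<le> L * r" for i
        using diameter_lipschitz_image(2)[OF f U(2)] order_trans by blast
    qed
    also have "\<dots> \<le> (\<Sum>i. ennreal (L\<^sup>2) * ennreal (pi * (diameter (U i) / 2)\<^sup>2))"
    proof (intro suminf_le summableI)
      fix i
      have 0: "0 \<le> diameter (f ` (U i \<inter> A))" by (rule diameter_ge_0[OF diameter_lipschitz_image(1)[OF f U(2)]])
      have "(diameter (f ` (U i \<inter> A)) / 2)\<^sup>2 \<le> (L * diameter (U i) / 2)\<^sup>2"
        using diameter_lipschitz_image(2)[OF f U(2)[of i]] 0 by (intro power_mono divide_right_mono) auto
      then have "pi * (diameter (f ` (U i \<inter> A)) / 2)\<^sup>2 \<le> pi * (L * diameter (U i) / 2)\<^sup>2"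
        by (intro mult_left_mono) auto
      also have "\<dots> = L\<^sup>2 * (pi * (diameter (U i) / 2)\<^sup>2)" by (simp add: power_mult_distrib power_divide)
      finally show "ennreal (pi * (diameter (f ` (U i \<inter> A)) / 2)\<^sup>2) \<le> ennreal (L\<^sup>2) * ennreal (pi * (diameter (U i) / 2)\<^sup>2)"
        by (subst ennreal_mult[symmetric]) (auto intro!: ennreal_leI)
    qed
    also have "\<dots> = ennreal (L\<^sup>2) * (\<Sum>i. ennreal (pi * (diameter (U i) / 2)\<^sup>2))" by simp
    finally have "ennreal (1 / L\<^sup>2) * hausdorff2_pre (L * r) (f ` A)
        \<le> ennreal (1 / L\<^sup>2) * (ennreal (L\<^sup>2) * (\<Sum>i. ennreal (pi * (diameter (U i) / 2)\<^sup>2)))"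
      by (rule mult_left_mono) simp
    also have "\<dots> = (ennreal (L\<^sup>2) * ennreal (1 / L\<^sup>2)) * (\<Sum>i. ennreal (pi * (diameter (U i) / 2)\<^sup>2))"
      by (simp only: mult_ac)
    also have "\<dots> = (\<Sum>i. ennreal (pi * (diameter (U i) / 2)\<^sup>2))" unfolding c1 by simp
    finally show "ennreal (1 / L\<^sup>2) * hausdorff2_pre (L * r) (f ` A) \<le> (\<Sum>i. ennreal (pi * (diameter (U i) / 2)\<^sup>2))" .
  qed
  then have "ennreal (L\<^sup>2) * (ennreal (1 / L\<^sup>2) * hausdorff2_pre (L * r) (f ` A)) \<le> ennreal (L\<^sup>2) * hausdorff2_pre r A"
    by (rule mult_left_mono) simp
  then show ?thesis unfolding mult.assoc[symmetric] c1 by simp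
qed

lemma hausdorff2_lipschitz_image:
  fixes f :: "space3 \<Rightarrow> space3"
  assumes f: "L-lipschitz_on A f" and L: "L > 0"
  shows "hausdorff2 (f ` A) \<le> ennreal (L\<^sup>2) * hausdorff2 A"
  unfolding hausdorff2_def[of "f ` A"]
proof (rule SUP_least)
  fix r :: real assume "r \<in> {0<..}"
  then have r: "r / L \<in> {0<..}" using L by simp
  have "hausdorff2_pre r (f ` A) = hausdorff2_pre (L * (r / L)) (f ` A)" using L by simp
  also have "\<dots> \<le> ennreal (L\<^sup>2) * hausdorff2_pre (r / L) A" by (rule hausdorff2_pre_lipschitz_image[OF f L])
  also have "\<dots> \<le> ennreal (L\<^sup>2) * hausdorff2 A"
    unfolding hausdorff2_def by (intro mult_left_mono SUP_upper r) simp
  finally show "hausdorff2_pre r (f ` A) \<le> ennreal (L\<^sup>2) * hausdorff2 A" .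
qed

lemma hausdorff2_null_superset:
  assumes "hausdorff2 A = 0"
  obtains B where "B \<in> sets borel" "A \<subseteq> B" "hausdorff2 B = 0"
proof -
  have "\<exists>U. A \<subseteq> (\<Union>i. U i) \<and> (\<forall>i. bounded (U i) \<and> diameter (U i) \<le> 1 / real (Suc k)) \<and>
    (\<Sum>i. ennreal (pi * (diameter (U i) / 2)\<^sup>2)) < ennreal (1 / real (Suc k))" for k
  proof -
    have "hausdorff2_pre (1 / real (Suc k)) A \<le> hausdorff2 A" unfolding hausdorff2_def by (rule SUP_upper) simp
    then have "hausdorff2_pre (1 / real (Suc k)) A < ennreal (1 / real (Suc k))" using assms by simp
    then show ?thesis unfolding hausdorff2_pre_def INF_less_iff by blast
  qed
  then obtain U where U: "\<And>k. A \<subseteq> (\<Union>i. U k i)" "\<And>k i. bounded (U k i)" "\<And>k i. diameter (U k i) \<le> 1 / real (Suc k)"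
    "\<And>k. (\<Sum>i. ennreal (pi * (diameter (U k i) / 2)\<^sup>2)) < ennreal (1 / real (Suc k))" by metis
  define B where "B = (\<Inter>k::nat. \<Union>i::nat. closure (U k i))"
  have "B \<in> sets borel" unfolding B_def by (intro sets.countable_INT sets.countable_UN) auto
  moreover have "A \<subseteq> (\<Union>i. closure (U k i))" for k
    by (rule subset_trans[OF U(1)[of k]]) (intro UN_mono order_refl closure_subset)
  then have AB: "A \<subseteq> B" unfolding B_def by (rule INT_greatest)
  moreover have "hausdorff2 B = 0"
  proof -
    have "hausdorff2_pre r B \<le> 0" if r: "r > 0" for r
    proof (rule ennreal_le_epsilon)
      fix e :: real assume e: "e > 0"
      obtain k where "inverse (real (Suc k)) < min r e" using reals_Archimedean[of "min r e"] r e by auto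
      then have k: "1 / real (Suc k) < r" "1 / real (Suc k) < e" by (simp_all add: inverse_eq_divide)
      have "hausdorff2_pre r B \<le> (\<Sum>i. ennreal (pi * (diameter (closure (U k i)) / 2)\<^sup>2))"
      proof (rule hausdorff2_pre_le)
        show "B \<subseteq> (\<Union>i. closure (U k i))" unfolding B_def by blast
        show "bounded (closure (U k i))" for i using U(2) by (rule bounded_closure)
        show "diameter (closure (U k i)) \<le> r" for i
          using U(3)[of k i] k unfolding diameter_closure[OF U(2)] by linarith
      qed
      also have "\<dots> \<le> ennreal (1 / real (Suc k))" unfolding diameter_closure[OF U(2)] using U(4)[of k] by simp
      also have "\<dots> \<le> ennreal e" using k by (intro ennreal_leI) simp
      finally show "hausdorff2_pre r B \<le> 0 + ennreal e" by simp
    qed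
    then have "hausdorff2 B \<le> 0" unfolding hausdorff2_def by (intro SUP_least) auto
    then show ?thesis by simp
  qed
  ultimately show ?thesis using AB that by blast
qed

lemma hausdorff2_null_image:
  fixes h :: "real \<times> real \<Rightarrow> space3"
  assumes h: "L-lipschitz_on E h" and N: "negligible N"
  shows "hausdorff2 (h ` (N \<inter> E)) = 0"
proof -
  have L: "0 \<le> L" by (rule lipschitz_on_nonneg[OF h])
  have "hausdorff2_pre r (h ` (N \<inter> E)) \<le> 0" if r: "r > 0" for r
  proof (rule ennreal_le_epsilon)
    fix e :: real assume e: "e > 0"
    define e' where "e' = e / (25 * L\<^sup>2 + 1)"
    have c0: "0 < 25 * L\<^sup>2 + 1" by (rule add_nonneg_pos) auto
    have e': "e' > 0" using e c0 by (simp add: e'_def)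
    have Nl: "N \<in> null_sets lebesgue" using N by (simp add: negligible_iff_null_sets)
    then have "N \<in> sets lebesgue" by auto
    then obtain T where T: "open T" "N \<subseteq> T" "(T - N) \<in> lmeasurable" "emeasure lebesgue (T - N) < ennreal e'"
      using sets_lebesgue_outer_open[OF _ e'] by blast
    have Tm: "emeasure lborel T \<le> ennreal e'"
    proof -
      have "emeasure lebesgue T \<le> emeasure lebesgue ((T - N) \<union> N)" using T Nl by (intro emeasure_mono) auto
      also have "\<dots> \<le> emeasure lebesgue (T - N) + emeasure lebesgue N"
        using T Nl by (intro emeasure_subadditive) auto
      also have "\<dots> = emeasure lebesgue (T - N)" using Nl by auto
      finally show ?thesis using T by simp
    qed
    define \<rho>0 where "\<rho>0 = r / (10 * (L + 1))"
    have \<rho>0: "\<rho>0 > 0" using r L by (simp add: \<rho>0_def)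
    have "\<exists>\<rho>>0. \<rho> \<le> \<rho>0 \<and> ball x \<rho> \<subseteq> T" if xN: "x \<in> N" for x
    proof -
      have "x \<in> T" using T(2) xN by blast
      obtain d where d: "d > 0" "ball x d \<subseteq> T" using openE[OF T(1) \<open>x \<in> T\<close>] by blast
      have "ball x (min d \<rho>0) \<subseteq> ball x d" by (rule subset_ball) simp
      then show ?thesis using \<rho>0 d by (intro exI[of _ "min d \<rho>0"]) simp
    qed
    then obtain \<rho> where \<rho>: "\<And>x. x \<in> N \<Longrightarrow> \<rho> x > 0" "\<And>x. x \<in> N \<Longrightarrow> \<rho> x \<le> \<rho>0" "\<And>x. x \<in> N \<Longrightarrow> ball x (\<rho> x) \<subseteq> T"
      by metis
    have c1: "N \<subseteq> (\<Union>x\<in>N. ball x (\<rho> x))" using \<rho>(1) by force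
    have c2: "0 < \<rho> x \<and> \<rho> x \<le> \<rho>0" if "x \<in> N" for x using \<rho> that by blast
    obtain C where C: "countable C" "C \<subseteq> N"
      "pairwise (\<lambda>i j. disjnt (ball i (\<rho> i)) (ball j (\<rho> j))) C" "N \<subseteq> (\<Union>x\<in>C. ball x (5 * \<rho> x))"
      by (rule Vitali_covering_lemma_balls[where S=N and K=N and a="\<lambda>x. x" and r=\<rho> and B=\<rho>0, OF c1 c2]) (assumption | rule that)+
    define f where "f = from_nat_into C"
    define J where "J = to_nat_on C ` C"
    have fJ: "f n \<in> C" if "n \<in> J" for n using that C(1) by (auto simp: f_def J_def)
    have ff: "f (to_nat_on C x) = x" if "x \<in> C" for x using that C(1) by (simp add: f_def)
    define Bl where "Bl = (\<lambda>n. if n \<in> J then ball (f n) (\<rho> (f n)) else {})"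
    have "disjoint_family Bl"
    proof (unfold disjoint_family_on_def, intro ballI impI)
      fix n k :: nat assume "n \<noteq> k"
      show "Bl n \<inter> Bl k = {}"
      proof (cases "n \<in> J \<and> k \<in> J")
        case True
        then have "f n \<noteq> f k" using \<open>n \<noteq> k\<close> ff by (auto simp: J_def)
        then have "disjnt (ball (f n) (\<rho> (f n))) (ball (f k) (\<rho> (f k)))"
          using C(3) fJ True unfolding pairwise_def by blast
        then show ?thesis using True by (simp add: Bl_def disjnt_def)
      qed (auto simp: Bl_def)
    qed
    then have sB: "(\<Sum>n. emeasure lborel (Bl n)) = emeasure lborel (\<Union>n. Bl n)"
      by (intro suminf_emeasure) (auto simp: Bl_def)
    have "Bl n \<subseteq> T" for n
    proof (cases "n \<in> J")
      case True
      then have "f n \<in> N" using fJ C(2) by blast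
      then show ?thesis using \<rho>(3) True by (simp add: Bl_def)
    qed (simp add: Bl_def)
    then have "(\<Union>n. Bl n) \<subseteq> T" by blast
    then have "emeasure lborel (\<Union>n. Bl n) \<le> emeasure lborel T" by (rule emeasure_mono) (simp add: T(1))
    then have sT: "emeasure lborel (\<Union>n. Bl n) \<le> ennreal e'" using Tm by (rule order_trans)
    define U where "U = (\<lambda>n. if n \<in> J then h ` (ball (f n) (5 * \<rho> (f n)) \<inter> E) else {})"
    have dU: "bounded (U n)" "diameter (U n) \<le> L * (10 * \<rho> (f n))" if "n \<in> J" for n
    proof -
      have p: "\<rho> (f n) > 0" using \<rho> fJ[OF that] C(2) by blast
      have b: "bounded (ball (f n) (5 * \<rho> (f n)))" by simp
      show "bounded (U n)" using diameter_lipschitz_image(1)[OF h b] that by (simp add: U_def)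
      have "diameter (ball (f n) (5 * \<rho> (f n))) \<le> 10 * \<rho> (f n)"
      proof (rule diameter_le)
        show "ball (f n) (5 * \<rho> (f n)) \<noteq> {} \<or> 0 \<le> 10 * \<rho> (f n)" using p by simp
        fix x y assume "x \<in> ball (f n) (5 * \<rho> (f n))" "y \<in> ball (f n) (5 * \<rho> (f n))"
        then show "norm (x - y) \<le> 10 * \<rho> (f n)"
          using dist_triangle2[of x y "f n"] by (simp add: dist_norm dist_commute norm_minus_commute)
      qed
      then have "L * diameter (ball (f n) (5 * \<rho> (f n))) \<le> L * (10 * \<rho> (f n))" using L by (rule mult_left_mono)
      then show "diameter (U n) \<le> L * (10 * \<rho> (f n))"
        using diameter_lipschitz_image(2)[OF h b] that by (simp add: U_def)
    qed
    have "hausdorff2_pre r (h ` (N \<inter> E)) \<le> (\<Sum>n. ennreal (pi * (diameter (U n) / 2)\<^sup>2))"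
    proof (rule hausdorff2_pre_le)
      show "h ` (N \<inter> E) \<subseteq> (\<Union>n. U n)"
      proof
        fix z assume "z \<in> h ` (N \<inter> E)"
        then obtain x where x: "x \<in> N" "x \<in> E" "z = h x" by blast
        then obtain c where c: "c \<in> C" "x \<in> ball c (5 * \<rho> c)" using C(4) by blast
        then have "z \<in> U (to_nat_on C c)" using x by (simp add: U_def J_def ff)
        then show "z \<in> (\<Union>n. U n)" by blast
      qed
      show "bounded (U n)" for n using dU(1)[of n] by (cases "n \<in> J") (auto simp: U_def)
      show "diameter (U n) \<le> r" for n
      proof (cases "n \<in> J")
        case True
        have "\<rho> (f n) \<le> \<rho>0" using \<rho> fJ[OF True] C(2) by blast
        then have "L * (10 * \<rho> (f n)) \<le> L * (10 * \<rho>0)" using L by (intro mult_left_mono) auto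
        also have "\<dots> \<le> (L + 1) * (10 * \<rho>0)" using \<rho>0 by (intro mult_right_mono) auto
        also have "\<dots> = r"
        proof -
          have "L + 1 \<noteq> 0" using L by linarith
          then show ?thesis unfolding \<rho>0_def by (simp add: field_simps)
        qed
        finally show ?thesis using dU(2)[OF True] by linarith
      qed (use r in \<open>simp add: U_def\<close>)
    qed
    also have "\<dots> \<le> (\<Sum>n. ennreal (25 * L\<^sup>2) * emeasure lborel (Bl n))"
    proof (intro suminf_le summableI)
      fix n
      show "ennreal (pi * (diameter (U n) / 2)\<^sup>2) \<le> ennreal (25 * L\<^sup>2) * emeasure lborel (Bl n)"
      proof (cases "n \<in> J")
        case True
        have p: "0 \<le> \<rho> (f n)" using \<rho>(1)[of "f n"] fJ[OF True] C(2) by force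
        have "(diameter (U n) / 2)\<^sup>2 \<le> (L * (10 * \<rho> (f n)) / 2)\<^sup>2"
          using dU[OF True] diameter_ge_0[OF dU(1)[OF True]] by (intro power_mono divide_right_mono) auto
        then have "pi * (diameter (U n) / 2)\<^sup>2 \<le> pi * (L * (10 * \<rho> (f n)) / 2)\<^sup>2" by (intro mult_left_mono) auto
        also have "\<dots> = (25 * L\<^sup>2) * (pi * (\<rho> (f n))\<^sup>2)" by (simp add: power_mult_distrib power_divide)
        finally have "ennreal (pi * (diameter (U n) / 2)\<^sup>2) \<le> ennreal ((25 * L\<^sup>2) * (pi * (\<rho> (f n))\<^sup>2))" by (rule ennreal_leI)
        also have "\<dots> = ennreal (25 * L\<^sup>2) * ennreal (pi * (\<rho> (f n))\<^sup>2)" by (intro ennreal_mult) auto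
        also have "ennreal (pi * (\<rho> (f n))\<^sup>2) = emeasure lborel (Bl n)"
          using p True by (simp add: Bl_def emeasure_ball eval_unit_ball_vol power2_eq_square)
        finally show ?thesis .
      qed (simp add: U_def)
    qed
    also have "\<dots> = ennreal (25 * L\<^sup>2) * emeasure lborel (\<Union>n. Bl n)" by (simp add: sB)
    also have "\<dots> \<le> ennreal (25 * L\<^sup>2) * ennreal e'" by (intro mult_left_mono sT) simp
    also have "\<dots> = ennreal (25 * L\<^sup>2 * e')" using e' by (simp add: ennreal_mult)
    also have "\<dots> \<le> ennreal e"
    proof (rule ennreal_leI)
      have "25 * L\<^sup>2 * e' \<le> (25 * L\<^sup>2 + 1) * e'" using e' by (intro mult_right_mono) auto
      also have "\<dots> = e" using c0 by (simp add: e'_def)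
      finally show "25 * L\<^sup>2 * e' \<le> e" .
    qed
    finally show "hausdorff2_pre r (h ` (N \<inter> E)) \<le> 0 + ennreal e" by simp
  qed
  then have "hausdorff2 (h ` (N \<inter> E)) \<le> 0" unfolding hausdorff2_def by (intro SUP_least) auto
  then show ?thesis by simp
qed

lemma space_surface_measure [simp]: "space (surface_measure S) = S"
  by (simp add: surface_measure_def space_restrict_space)

lemma sets_surface_measure: "closed S \<Longrightarrow> A \<in> sets (surface_measure S) \<longleftrightarrow> A \<subseteq> S \<and> A \<in> sets borel"
  unfolding surface_measure_def by (subst sets_restrict_space_iff) (auto simp: sets.sets_measure_of_eq[of borel, simplified])

text \<open>The comparisons below are stated for inequalities between values of \<^const>\<open>hausdorff2\<close>, hence
  they do not depend on its countable additivity.\<close>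

lemma emeasure_surface_measure_le:
  assumes S: "closed S" "closed T" and A: "A \<subseteq> S" "A \<in> sets borel" and B: "B \<subseteq> T" "B \<in> sets borel"
    and le: "hausdorff2 A \<le> c * hausdorff2 B"
  shows "emeasure (surface_measure S) A \<le> c * emeasure (surface_measure T) B"
proof -
  have ss: "sigma_sets UNIV (sets (borel :: space3 measure)) = sets borel"
    using sets.sigma_sets_eq[of "borel :: space3 measure"] by simp
  have e: "emeasure (surface_measure S) A = (if measure_space UNIV (sets borel) hausdorff2 then hausdorff2 A else 0)"
    if "closed S" "A \<subseteq> S" "A \<in> sets borel" for S A :: "space3 set"
  proof -
    have "emeasure (surface_measure S) A = emeasure (measure_of UNIV (sets borel) hausdorff2) A"
      unfolding surface_measure_def
      by (rule emeasure_restrict_space) (use that in \<open>auto simp: sets_measure_of_conv ss\<close>)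
    then show ?thesis using that by (simp add: emeasure_measure_of_conv ss)
  qed
  show ?thesis unfolding e[OF S(1) A] e[OF S(2) B] using le by simp
qed

lemma emeasure_surface_measure_le_hausdorff2:
  assumes "closed S"
  shows "emeasure (surface_measure S) S \<le> hausdorff2 S"
proof -
  have ss: "sigma_sets UNIV (sets (borel :: space3 measure)) = sets borel"
    using sets.sigma_sets_eq[of "borel :: space3 measure"] by simp
  have "emeasure (surface_measure S) S = emeasure (measure_of UNIV (sets borel) hausdorff2) S"
    unfolding surface_measure_def
    by (rule emeasure_restrict_space) (use assms in \<open>auto simp: sets_measure_of_conv ss\<close>)
  then show ?thesis by (simp add: emeasure_measure_of_conv ss)
qed

lemma AE_surface_measure_null:
  assumes S: "closed S" and Z: "hausdorff2 Z = 0"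
  shows "AE p in surface_measure S. p \<notin> Z"
proof -
  obtain B where B: "B \<in> sets borel" "Z \<subseteq> B" "hausdorff2 B = 0" using hausdorff2_null_superset[OF Z] by blast
  have SB: "B \<inter> S \<subseteq> S" "B \<inter> S \<in> sets borel" using B S by auto
  have "hausdorff2 (B \<inter> S) \<le> hausdorff2 B" by (rule hausdorff2_mono) blast
  then have "hausdorff2 (B \<inter> S) \<le> 0 * hausdorff2 (B \<inter> S)" using B(3) by simp
  then have "emeasure (surface_measure S) (B \<inter> S) \<le> 0 * emeasure (surface_measure S) (B \<inter> S)"
    by (rule emeasure_surface_measure_le[OF S S SB SB])
  then have "B \<inter> S \<in> null_sets (surface_measure S)"
    using SB S by (simp add: null_sets_def sets_surface_measure)
  then show ?thesis by (rule AE_I') (use B(2) in auto)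
qed

locale bilipschitz =
  fixes S0 S :: "space3 set" and \<Phi> :: "space3 \<Rightarrow> space3" and L :: real
  assumes closed: "closed S0" "closed S" and L: "L \<ge> 1"
    and cont: "continuous_on UNIV \<Phi>"
    and image: "\<Phi> ` S0 = S"
    and upper: "\<And>x y. norm (\<Phi> x - \<Phi> y) \<le> L * norm (x - y)"
    and lower: "\<And>x y. norm (x - y) \<le> L * norm (\<Phi> x - \<Phi> y)"
begin

lemma inj: "inj \<Phi>"
proof (rule injI)
  fix x y assume "\<Phi> x = \<Phi> y" then show "x = y" using lower[of x y] by simp
qed

lemma lipschitz: "L-lipschitz_on A \<Phi>"
  using upper L by (intro lipschitz_onI) (auto simp: dist_norm)

lemma hausdorff2_image: "hausdorff2 (\<Phi> ` A) \<le> ennreal (L\<^sup>2) * hausdorff2 A"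
  using L by (intro hausdorff2_lipschitz_image lipschitz) auto

lemma hausdorff2_le_image: "hausdorff2 A \<le> ennreal (L\<^sup>2) * hausdorff2 (\<Phi> ` A)"
proof -
  define \<Psi> where "\<Psi> = inv_into UNIV \<Phi>"
  have \<Psi>: "\<Psi> (\<Phi> x) = x" for x unfolding \<Psi>_def using inj by simp
  have "L-lipschitz_on (\<Phi> ` A) \<Psi>"
    using lower L by (intro lipschitz_onI) (auto simp: dist_norm \<Psi>)
  moreover have "\<Psi> ` \<Phi> ` A = A" by (simp add: image_image \<Psi>)
  ultimately show ?thesis using hausdorff2_lipschitz_image[of L "\<Phi> ` A" \<Psi>] L by simp
qed

lemma measurable: "\<Phi> \<in> measurable (surface_measure S0) (surface_measure S)"
proof (rule measurableI)
  show "\<Phi> x \<in> space (surface_measure S)" if "x \<in> space (surface_measure S0)" for x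
    using that image by auto
  fix A assume "A \<in> sets (surface_measure S)"
  then have A: "A \<subseteq> S" "A \<in> sets borel" using sets_surface_measure[OF closed(2)] by auto
  have "\<Phi> -` A \<in> sets borel"
    using measurable_sets_borel[OF borel_measurable_continuous_onI[OF cont] A(2)] .
  then show "\<Phi> -` A \<inter> space (surface_measure S0) \<in> sets (surface_measure S0)"
    using closed(1) by (simp add: sets_surface_measure)
qed

abbreviation "\<nu> \<equiv> distr (surface_measure S0) (surface_measure S) \<Phi>"

lemma image_preimage:
  assumes "A \<subseteq> S"
  shows "\<Phi> ` (\<Phi> -` A \<inter> S0) = A"
  using assms image by auto

lemma emeasure_compare:
  assumes A: "A \<in> sets (surface_measure S)"
  shows "emeasure \<nu> A \<le> ennreal (L\<^sup>2) * emeasure (surface_measure S) A"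
    and "emeasure (surface_measure S) A \<le> ennreal (L\<^sup>2) * emeasure \<nu> A"
proof -
  have A': "A \<subseteq> S" "A \<in> sets borel" using A sets_surface_measure[OF closed(2)] by auto
  have "\<Phi> -` A \<inter> S0 \<in> sets (surface_measure S0)"
    using measurable_sets[OF measurable A] by simp
  then have P: "\<Phi> -` A \<inter> S0 \<subseteq> S0" "\<Phi> -` A \<inter> S0 \<in> sets borel" using sets_surface_measure[OF closed(1)] by auto
  have \<nu>: "emeasure \<nu> A = emeasure (surface_measure S0) (\<Phi> -` A \<inter> S0)"
    using emeasure_distr[OF measurable A] by simp
  show "emeasure \<nu> A \<le> ennreal (L\<^sup>2) * emeasure (surface_measure S) A"
    unfolding \<nu> by (rule emeasure_surface_measure_le[OF closed P A'])
      (use hausdorff2_le_image[of "\<Phi> -` A \<inter> S0"] image_preimage[OF A'(1)] in simp)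
  show "emeasure (surface_measure S) A \<le> ennreal (L\<^sup>2) * emeasure \<nu> A"
    unfolding \<nu> by (rule emeasure_surface_measure_le[OF closed(2,1) A' P])
      (use hausdorff2_image[of "\<Phi> -` A \<inter> S0"] image_preimage[OF A'(1)] in simp)
qed

lemma AE_pullback:
  assumes "AE q in surface_measure S. P q"
  shows "AE p in surface_measure S0. P (\<Phi> p)"
proof -
  obtain N where N: "{q \<in> space (surface_measure S). \<not> P q} \<subseteq> N" "N \<in> null_sets (surface_measure S)"
    using assms unfolding eventually_ae_filter by blast
  have Ns: "N \<in> sets (surface_measure S)" and N0: "emeasure (surface_measure S) N = 0" using N(2) by auto
  have "emeasure \<nu> N = 0" using emeasure_compare(1)[OF Ns] N0 by simp
  then have "\<Phi> -` N \<inter> S0 \<in> null_sets (surface_measure S0)"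
    using emeasure_distr[OF measurable Ns] measurable_sets[OF measurable Ns] by (simp add: null_sets_def)
  then show ?thesis
  proof (rule AE_I')
    show "{p \<in> space (surface_measure S0). \<not> P (\<Phi> p)} \<subseteq> \<Phi> -` N \<inter> S0" using N(1) image by auto
  qed
qed

end

lemma nn_integral_le_scaled:
  assumes sets: "sets M = sets N" and le: "\<And>A. A \<in> sets M \<Longrightarrow> emeasure M A \<le> c * emeasure N A"
    and f: "f \<in> borel_measurable N"
  shows "integral\<^sup>N M f \<le> c * integral\<^sup>N N f"
proof -
  have "integral\<^sup>N M f \<le> integral\<^sup>N (scale_measure c N) f"
  proof (rule nn_integral_mono_measure)
    show "sets M = sets (scale_measure c N)" using sets by simp
    show "M \<le> scale_measure c N" unfolding le_measure[OF \<open>sets M = sets (scale_measure c N)\<close>] using le by simp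
  qed
  also have "\<dots> = c * integral\<^sup>N N f" by (rule nn_integral_scale_measure[OF f])
  finally show ?thesis .
qed

section \<open>Rademacher's theorem in the plane\<close>

lemma bounded_borel_integral:
  fixes v :: "'a::euclidean_space \<Rightarrow> real"
  assumes v[measurable]: "v \<in> borel_measurable borel" and b: "\<And>x. 0 \<le> v x" "\<And>x. v x \<le> B"
  shows "v integrable_on cbox a b"
    and "(\<integral>\<^sup>+x. ennreal (v x) * indicator (cbox a b) x \<partial>lborel) = ennreal (integral (cbox a b) v)"
proof -
  define w where "w = (\<lambda>x. if x \<in> cbox a b then v x else 0)"
  have w[measurable]: "w \<in> borel_measurable borel" unfolding w_def by measurable
  have w_ind: "ennreal (w x) = ennreal (v x) * indicator (cbox a b) x" for x
    by (simp add: w_def indicator_def)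
  have B0: "B \<ge> 0" using b(1)[of undefined] b(2)[of undefined] by linarith
  have "(\<integral>\<^sup>+x. ennreal (w x) \<partial>lborel) \<le> (\<integral>\<^sup>+x. ennreal B * indicator (cbox a b) x \<partial>lborel)"
    unfolding w_ind by (intro nn_integral_mono mult_right_mono ennreal_leI b) simp
  also have "\<dots> = ennreal B * emeasure lborel (cbox a b)" by (simp add: nn_integral_cmult_indicator)
  also have "\<dots> < \<infinity>" using emeasure_lborel_cbox_finite[of a b] by (simp add: ennreal_mult_less_top)
  finally have "(\<integral>\<^sup>+x. ennreal (w x) \<partial>lborel) < \<infinity>" .
  then obtain r where r: "(\<integral>\<^sup>+x. ennreal (w x) \<partial>lborel) = ennreal r" "0 \<le> r"
    by (cases "\<integral>\<^sup>+x. ennreal (w x) \<partial>lborel") auto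
  have "(w has_integral r) UNIV" by (rule nn_integral_has_integral[OF w _ r]) (simp add: w_def b)
  then have "(v has_integral r) (cbox a b)" unfolding w_def has_integral_restrict_UNIV .
  then show "v integrable_on cbox a b" "(\<integral>\<^sup>+x. ennreal (v x) * indicator (cbox a b) x \<partial>lborel) = ennreal (integral (cbox a b) v)"
    using r(1) unfolding w_ind by (auto simp: integral_unique)
qed

lemma lipschitz_real_density:
  fixes f :: "real \<Rightarrow> real"
  assumes f: "L-lipschitz_on UNIV f"
  obtains g where "\<And>a b. a \<le> b \<Longrightarrow> (g has_integral f b - f a) {a..b}"
proof -
  have L: "0 \<le> L" using lipschitz_on_nonneg[OF f] .
  have fl: "\<bar>f x - f y\<bar> \<le> L * \<bar>x - y\<bar>" for x y
    using lipschitz_onD[OF f, of x y] by (simp add: dist_real_def)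
  define F where "F = (\<lambda>x. f x + (L + 1) * x)"
  have F1: "y - x \<le> F y - F x" "F y - F x \<le> (2 * L + 1) * (y - x)" if "x \<le> y" for x y
    using fl[of y x] that by (auto simp: F_def algebra_simps abs_le_iff)
  have Fabs: "\<bar>x - y\<bar> \<le> \<bar>F x - F y\<bar>" "\<bar>F x - F y\<bar> \<le> (2 * L + 1) * \<bar>x - y\<bar>" for x y
    using F1[of x y] F1[of y x] by (cases "x \<le> y"; force)+
  have Fc: "continuous_on UNIV F"
    unfolding F_def using lipschitz_on_continuous_on[OF f] by (intro continuous_intros)
  have inj: "inj F"
  proof (rule injI)
    fix x y assume "F x = F y" then show "x = y" using Fabs(1)[of x y] by simp
  qed
  have surj: "surj F"
    unfolding surj_def
  proof
    fix y
    define c where "c = \<bar>y - F 0\<bar>"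
    have "F (- c) \<le> y" "y \<le> F c" "- c \<le> c" using F1(1)[of "- c" 0] F1(1)[of 0 c] by (auto simp: c_def)
    moreover have "continuous_on {- c..c} F" using Fc continuous_on_subset by blast
    ultimately have "\<exists>x. - c \<le> x \<and> x \<le> c \<and> F x = y" by (intro IVT')
    then show "\<exists>x. y = F x" by blast
  qed
  define H where "H = inv F"
  have HF: "H (F x) = x" for x using inj by (simp add: H_def)
  have FH: "F (H x) = x" for x using surj by (simp add: H_def surj_f_inv_f)
  have "1-lipschitz_on UNIV H"
  proof (rule lipschitz_onI)
    fix x y show "dist (H x) (H y) \<le> 1 * dist x y"
      using Fabs(1)[of "H x" "H y"] FH by (simp add: dist_real_def)
  qed simp
  then have "continuous_on UNIV H" by (rule lipschitz_on_continuous_on)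
  then have Hm[measurable]: "H \<in> borel_measurable borel" by (rule borel_measurable_continuous_onI)
  have vim: "H -` A = F ` A" for A
  proof
    show "H -` A \<subseteq> F ` A" using FH by (metis image_iff subsetI vimage_eq)
    show "F ` A \<subseteq> H -` A" using HF by auto
  qed
  define \<nu> where "\<nu> = distr lborel borel H"
  have \<nu>: "emeasure \<nu> A = emeasure lborel (F ` A)" if "A \<in> sets borel" for A
    unfolding \<nu>_def using that by (subst emeasure_distr) (auto simp: vim)
  have "absolutely_continuous lborel \<nu>" unfolding absolutely_continuous_def
  proof
    fix N :: "real set" assume N: "N \<in> null_sets lborel"
    then have Nb: "N \<in> sets borel" by auto
    have "negligible N" using N by (simp add: negligible_iff_null_sets null_sets_completionI)
    then have "negligible (F ` N)"
    proof (rule negligible_locally_Lipschitz_image[OF order_refl])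
      fix x assume "x \<in> N"
      show "\<exists>T B. open T \<and> x \<in> T \<and> (\<forall>y\<in>N \<inter> T. norm (F y - F x) \<le> B * norm (y - x))"
        using Fabs(2) by (intro exI[of _ UNIV] exI[of _ "2 * L + 1"]) simp
    qed
    moreover have "F ` N \<in> sets lborel"
      using measurable_sets_borel[OF Hm Nb] by (simp add: vim)
    ultimately have "F ` N \<in> null_sets lborel"
      using null_sets_completion_iff unfolding negligible_iff_null_sets by blast
    then show "N \<in> null_sets \<nu>" using \<nu>[OF Nb] Nb by (simp add: null_sets_def \<nu>_def)
  qed
  then obtain h where h[measurable]: "h \<in> borel_measurable lborel" and dh: "density lborel h = \<nu>"
    using sigma_finite_measure.Radon_Nikodym[OF lborel.sigma_finite_measure_axioms, of \<nu>] by (auto simp: \<nu>_def)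
  define g where "g = (\<lambda>x. enn2real (h x))"
  have gm[measurable]: "g \<in> borel_measurable borel" unfolding g_def using h by measurable
  have gi: "(g has_integral F b - F a) {a..b}" if ab: "a \<le> b" for a b
  proof -
    have img: "F ` {a..b} = {F a..F b}"
    proof
      show "F ` {a..b} \<subseteq> {F a..F b}" using F1(1) by force
      show "{F a..F b} \<subseteq> F ` {a..b}"
      proof
        fix y assume "y \<in> {F a..F b}"
        moreover have "continuous_on {a..b} F" using Fc continuous_on_subset by blast
        ultimately show "y \<in> F ` {a..b}" using IVT'[of F a y b] ab by auto
      qed
    qed
    have FF: "0 \<le> F b - F a" using F1(1)[OF ab] ab by simp
    have "(\<integral>\<^sup>+x. h x * indicator {a..b} x \<partial>lborel) = emeasure \<nu> {a..b}"
      unfolding dh[symmetric] by (subst emeasure_density) auto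
    also have "\<dots> = ennreal (F b - F a)" using \<nu>[of "{a..b}"] FF by (simp add: img)
    finally have hi: "(\<integral>\<^sup>+x. h x * indicator {a..b} x \<partial>lborel) = ennreal (F b - F a)" .
    have "AE x in lborel. h x * indicator {a..b} x \<noteq> \<infinity>"
      by (rule nn_integral_PInf_AE) (use hi in auto)
    then have ae: "AE x in lborel. ennreal (g x * indicator {a..b} x) = h x * indicator {a..b} x"
    proof eventually_elim
      case (elim x)
      then show ?case by (cases "x \<in> {a..b}") (auto simp: g_def less_top)
    qed
    have "((\<lambda>x. g x * indicator {a..b} x) has_integral F b - F a) UNIV"
    proof (rule nn_integral_has_integral)
      show "(\<integral>\<^sup>+x. ennreal (g x * indicator {a..b} x) \<partial>lborel) = ennreal (F b - F a)"
        using nn_integral_cong_AE[OF ae] hi by simp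
    qed (use FF in \<open>auto simp: g_def\<close>)
    moreover have "(\<lambda>x. g x * indicator {a..b} x) = (\<lambda>x. if x \<in> {a..b} then g x else 0)" by (auto simp: fun_eq_iff)
    ultimately show ?thesis by (metis has_integral_restrict_UNIV)
  qed
  have "((\<lambda>x. g x - (L + 1)) has_integral f b - f a) {a..b}" if ab: "a \<le> b" for a b
  proof -
    have "((\<lambda>x. g x - (L + 1)) has_integral (F b - F a) - (b - a) *\<^sub>R (L + 1)) {a..b}"
      using has_integral_diff[OF gi[OF ab] has_integral_const_real[of "L + 1" a b]] ab by simp
    then show ?thesis by (simp add: F_def algebra_simps)
  qed
  then show ?thesis using that by blast
qed

lemma lipschitz_real_derivative_integral:
  fixes f :: "real \<Rightarrow> real"
  assumes f: "L-lipschitz_on UNIV f" and ab: "a \<le> b"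
  shows "((\<lambda>x. max (- L) (min L (lim (\<lambda>n. (f (x + inverse (real (Suc n))) - f x) * real (Suc n)))))
    has_integral f b - f a) {a..b}"
proof -
  obtain g where g: "\<And>a b. a \<le> b \<Longrightarrow> (g has_integral f b - f a) {a..b}"
    using lipschitz_real_density[OF f] by blast
  have gint: "g integrable_on cbox a b" for a b
    using g[of a b] by (cases "a \<le> b") auto
  obtain N where N: "negligible N" "\<And>x e. x \<notin> N \<Longrightarrow> 0 < e \<Longrightarrow>
      \<exists>d>0. \<forall>h. 0 < h \<and> h < d \<longrightarrow> norm (integral (cbox x (x + h *\<^sub>R One)) g /\<^sub>R h ^ DIM(real) - g x) < e"
    using integrable_ccontinuous_explicit[of g, OF gint] by blast
  show ?thesis
  proof (rule has_integral_spike[OF N(1) _ g[OF ab]])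
    fix x assume "x \<in> {a..b} - N"
    then have x: "x \<notin> N" by simp
    define q where "q = (\<lambda>n. (f (x + inverse (real (Suc n))) - f x) * real (Suc n))"
    have ql: "\<bar>q n\<bar> \<le> L" for n
    proof -
      have "\<bar>f (x + inverse (real (Suc n))) - f x\<bar> \<le> L * inverse (real (Suc n))"
        using lipschitz_onD[OF f, of "x + inverse (real (Suc n))" x] by (simp add: dist_real_def)
      then have "\<bar>f (x + inverse (real (Suc n))) - f x\<bar> * real (Suc n) \<le> (L * inverse (real (Suc n))) * real (Suc n)"
        by (rule mult_right_mono) simp
      also have "\<dots> = L" by (simp add: field_simps)
      finally show ?thesis by (simp add: q_def abs_mult)
    qed
    have lim: "q \<longlonglongrightarrow> g x"
    proof (rule LIMSEQ_I)
      fix e :: real assume "e > 0"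
      then obtain d where d: "d > 0" "\<And>h. 0 < h \<Longrightarrow> h < d \<Longrightarrow> norm (integral (cbox x (x + h *\<^sub>R One)) g /\<^sub>R h ^ DIM(real) - g x) < e"
        using N(2)[OF x] by meson
      obtain n0 where n0: "inverse (real (Suc n0)) < d" using reals_Archimedean[OF d(1)] by auto
      have "norm (q n - g x) < e" if "n \<ge> n0" for n
      proof -
        define h where "h = inverse (real (Suc n))"
        have "h \<le> inverse (real (Suc n0))" unfolding h_def using that by (intro le_imp_inverse_le) auto
        then have "h < d" using n0 by linarith
        moreover have "0 < h" by (simp add: h_def)
        ultimately have h: "0 < h" "h < d" by auto
        have "integral {x..x + h} g = f (x + h) - f x" using g[of x "x + h"] h by (simp add: integral_unique)
        then have "integral (cbox x (x + h *\<^sub>R One)) g /\<^sub>R h ^ DIM(real) = q n"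
          by (simp add: q_def h_def)
        then show ?thesis using d(2)[OF h] by simp
      qed
      then show "\<exists>no. \<forall>n\<ge>no. norm (q n - g x) < e" by blast
    qed
    have "\<bar>g x\<bar> \<le> L"
      by (rule LIMSEQ_le_const2[OF tendsto_rabs[OF lim]]) (use ql in blast)
    moreover have eq: "lim (\<lambda>n. (f (x + inverse (real (Suc n))) - f x) * real (Suc n)) = g x"
      using limI[OF lim] unfolding q_def .
    ultimately show "max (- L) (min L (lim (\<lambda>n. (f (x + inverse (real (Suc n))) - f x) * real (Suc n)))) = g x"
      unfolding eq by linarith
  qed
qed

lemma corner_lebesgue_point:
  fixes u :: "real \<times> real \<Rightarrow> real"
  assumes u[measurable]: "u \<in> borel_measurable borel" and bd: "\<And>x. \<bar>u x\<bar> \<le> B"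
  obtains N where "negligible N" "\<And>x e. x \<notin> N \<Longrightarrow> 0 < e \<Longrightarrow> \<exists>d>0. \<forall>h. 0 < h \<and> h < d \<longrightarrow>
    (\<integral>\<^sup>+z. ennreal \<bar>u z - u x\<bar> * indicator (cbox x (x + h *\<^sub>R One)) z \<partial>lborel) < ennreal (e * h\<^sup>2)"
proof -
  define v where "v = (\<lambda>(q::rat) z. \<bar>u z - of_rat q\<bar>)"
  have vm[measurable]: "v q \<in> borel_measurable borel" for q unfolding v_def by measurable
  have vb: "0 \<le> v q z" "v q z \<le> B + \<bar>of_rat q\<bar>" for q z
    using bd[of z] abs_triangle_ineq4[of "u z" "of_rat q"] unfolding v_def by linarith+
  note vi = bounded_borel_integral[OF vm vb]
  have "\<exists>N. negligible N \<and> (\<forall>x e. x \<notin> N \<longrightarrow> 0 < e \<longrightarrow>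
      (\<exists>d>0. \<forall>h. 0 < h \<and> h < d \<longrightarrow> norm (integral (cbox x (x + h *\<^sub>R One)) (v q) /\<^sub>R h ^ DIM(real \<times> real) - v q x) < e))" for q
    using integrable_ccontinuous_explicit[of "v q", OF vi(1)] by metis
  then obtain M where M: "\<And>q. negligible (M q)" "\<And>q x e. x \<notin> M q \<Longrightarrow> 0 < e \<Longrightarrow>
      \<exists>d>0. \<forall>h. 0 < h \<and> h < d \<longrightarrow> norm (integral (cbox x (x + h *\<^sub>R One)) (v q) /\<^sub>R h ^ DIM(real \<times> real) - v q x) < e"
    by metis
  define N where "N = (\<Union>n. M (from_nat n :: rat))"
  have "negligible N" unfolding N_def by (rule negligible_Union_nat) (rule M)
  moreover have "\<exists>d>0. \<forall>h. 0 < h \<and> h < d \<longrightarrow>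
    (\<integral>\<^sup>+z. ennreal \<bar>u z - u x\<bar> * indicator (cbox x (x + h *\<^sub>R One)) z \<partial>lborel) < ennreal (e * h\<^sup>2)"
    if x: "x \<notin> N" and e: "0 < e" for x e
  proof -
    obtain q :: rat where q: "u x < of_rat q" "of_rat q < u x + e / 4" using of_rat_dense[of "u x" "u x + e / 4"] e by auto
    have "x \<notin> M q" using x unfolding N_def by (metis UN_I UNIV_I from_nat_to_nat)
    then obtain d where d: "d > 0" "\<And>h. 0 < h \<Longrightarrow> h < d \<Longrightarrow> norm (integral (cbox x (x + h *\<^sub>R One)) (v q) /\<^sub>R h ^ DIM(real \<times> real) - v q x) < e / 4"
      using M(2)[of x q "e / 4"] e by (meson divide_pos_pos zero_less_numeral)
    have "(\<integral>\<^sup>+z. ennreal \<bar>u z - u x\<bar> * indicator (cbox x (x + h *\<^sub>R One)) z \<partial>lborel) < ennreal (e * h\<^sup>2)"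
      if h: "0 < h" "h < d" for h
    proof -
      define Q where "Q = cbox x (x + h *\<^sub>R One)"
      have "emeasure lborel Q = ennreal (\<Prod>b\<in>Basis. (x + h *\<^sub>R One - x) \<bullet> b)"
        unfolding Q_def using h by (intro emeasure_lborel_cbox) (simp add: inner_add_left)
      also have "(\<Prod>b\<in>(Basis::(real \<times> real) set). (x + h *\<^sub>R One - x) \<bullet> b) = h * h" by simp
      finally have Qm: "emeasure lborel Q = ennreal (h\<^sup>2)" unfolding power2_eq_square .
      have "integral Q (v q) /\<^sub>R h\<^sup>2 < v q x + e / 4"
      proof -
        have "norm (integral Q (v q) /\<^sub>R h ^ DIM(real \<times> real) - v q x) < e / 4" unfolding Q_def by (rule d(2)[OF h])
        moreover have "h ^ DIM(real \<times> real) = h\<^sup>2" by (simp add: power2_eq_square)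
        ultimately have "\<bar>integral Q (v q) /\<^sub>R h\<^sup>2 - v q x\<bar> < e / 4" by (simp only: real_norm_def)
        then show ?thesis by linarith
      qed
      also have "\<dots> < e / 2" using q by (simp add: v_def)
      finally have iv: "integral Q (v q) < e / 2 * h\<^sup>2" using h by (simp add: field_simps)
      have "(\<integral>\<^sup>+z. ennreal \<bar>u z - u x\<bar> * indicator Q z \<partial>lborel)
          \<le> (\<integral>\<^sup>+z. ennreal (v q z) * indicator Q z + ennreal (e / 4) * indicator Q z \<partial>lborel)"
      proof (rule nn_integral_mono)
        fix z
        have "\<bar>u z - u x\<bar> \<le> v q z + e / 4" using q by (simp add: v_def)
        then have "ennreal \<bar>u z - u x\<bar> \<le> ennreal (v q z) + ennreal (e / 4)"
          using e vb(1)[of q z] by (simp add: ennreal_leI flip: ennreal_plus)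
        then show "ennreal \<bar>u z - u x\<bar> * indicator Q z \<le> ennreal (v q z) * indicator Q z + ennreal (e / 4) * indicator Q z"
          by (auto simp: indicator_def)
      qed
      also have "\<dots> = ennreal (integral Q (v q)) + ennreal (e / 4) * ennreal (h\<^sup>2)"
        by (subst nn_integral_add) (auto simp: Q_def vi(2) nn_integral_cmult_indicator Qm[unfolded Q_def])
      also have "\<dots> = ennreal (integral Q (v q) + e / 4 * h\<^sup>2)"
      proof -
        have "0 \<le> integral Q (v q)" unfolding Q_def by (rule integral_nonneg[OF vi(1)]) (simp add: vb)
        moreover have "ennreal (e / 4) * ennreal (h\<^sup>2) = ennreal (e / 4 * h\<^sup>2)"
          by (rule ennreal_mult[symmetric]) (use e in auto)
        ultimately show ?thesis using e by (simp only:) (rule ennreal_plus[symmetric], auto)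
      qed
      also have "\<dots> < ennreal (e * h\<^sup>2)"
      proof (rule ennreal_lessI)
        have "0 < e / 4 * h\<^sup>2" using e h by simp
        then show "integral Q (v q) + e / 4 * h\<^sup>2 < e * h\<^sup>2" using iv by (simp add: field_simps)
        show "0 < e * h\<^sup>2" using e h by simp
      qed
      finally show ?thesis by (simp add: Q_def)
    qed
    then show ?thesis using d(1) by blast
  qed
  ultimately show ?thesis using that by blast
qed

lemma good_line_snd:
  fixes W :: "real \<times> real \<Rightarrow> ennreal"
  assumes [measurable]: "W \<in> borel_measurable borel" and W: "integral\<^sup>N lborel W < ennreal (m * l)"
    and ml: "0 \<le> m" "0 \<le> l"
  obtains t where "c \<le> t" "t \<le> c + l" "(\<integral>\<^sup>+s. W (s, t) \<partial>lborel) < ennreal m"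
proof (rule ccontr)
  assume "\<not> thesis"
  then have le: "ennreal m \<le> (\<integral>\<^sup>+s. W (s, t) \<partial>lborel)" if "t \<in> {c..c + l}" for t
    using that by (metis atLeastAtMost_iff linorder_not_le \<open>\<And>t. c \<le> t \<Longrightarrow> t \<le> c + l \<Longrightarrow> (\<integral>\<^sup>+s. W (s, t) \<partial>lborel) < ennreal m \<Longrightarrow> thesis\<close>)
  have Wm: "W \<in> borel_measurable (lborel \<Otimes>\<^sub>M lborel)" by (simp add: lborel_prod)
  have "ennreal (m * l) = (\<integral>\<^sup>+t. ennreal m * indicator {c..c + l} t \<partial>lborel)"
    using ml by (simp add: nn_integral_cmult_indicator ennreal_mult')
  also have "\<dots> \<le> (\<integral>\<^sup>+t. (\<integral>\<^sup>+s. W (s, t) \<partial>lborel) \<partial>lborel)"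
    using le by (intro nn_integral_mono) (auto simp: indicator_def)
  also have "\<dots> = integral\<^sup>N lborel W"
    using lborel_pair.nn_integral_snd[OF Wm] by (simp add: lborel_prod)
  finally show False using W by simp
qed

lemma good_line_fst:
  fixes W :: "real \<times> real \<Rightarrow> ennreal"
  assumes [measurable]: "W \<in> borel_measurable borel" and W: "integral\<^sup>N lborel W < ennreal (m * l)"
    and ml: "0 \<le> m" "0 \<le> l"
  obtains s where "c \<le> s" "s \<le> c + l" "(\<integral>\<^sup>+t. W (s, t) \<partial>lborel) < ennreal m"
proof (rule ccontr)
  assume "\<not> thesis"
  then have le: "ennreal m \<le> (\<integral>\<^sup>+t. W (s, t) \<partial>lborel)" if "s \<in> {c..c + l}" for s
    using that by (metis atLeastAtMost_iff linorder_not_le \<open>\<And>s. c \<le> s \<Longrightarrow> s \<le> c + l \<Longrightarrow> (\<integral>\<^sup>+t. W (s, t) \<partial>lborel) < ennreal m \<Longrightarrow> thesis\<close>)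
  have Wm: "W \<in> borel_measurable (lborel \<Otimes>\<^sub>M lborel)" by (simp add: lborel_prod)
  have "ennreal (m * l) = (\<integral>\<^sup>+s. ennreal m * indicator {c..c + l} s \<partial>lborel)"
    using ml by (simp add: nn_integral_cmult_indicator ennreal_mult')
  also have "\<dots> \<le> (\<integral>\<^sup>+s. (\<integral>\<^sup>+t. W (s, t) \<partial>lborel) \<partial>lborel)"
    using le by (intro nn_integral_mono) (auto simp: indicator_def)
  also have "\<dots> = integral\<^sup>N lborel W"
    using lborel.nn_integral_fst[OF Wm] by (simp add: lborel_prod)
  finally show False using W by simp
qed

lemma line_increment_bound:
  fixes v F :: "real \<Rightarrow> real"
  assumes v[measurable]: "v \<in> borel_measurable borel" and bd: "\<And>x. \<bar>v x\<bar> \<le> B"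
    and F: "\<And>a b. a \<le> b \<Longrightarrow> (v has_integral F b - F a) {a..b}"
    and M: "(\<integral>\<^sup>+x. ennreal \<bar>v x - \<alpha>\<bar> * indicator {c..d} x \<partial>lborel) \<le> ennreal M" "0 \<le> M"
    and ab: "a \<in> {c..d}" "b \<in> {c..d}"
  shows "\<bar>F b - F a - \<alpha> * (b - a)\<bar> \<le> M"
proof -
  define w where "w = (\<lambda>x. \<bar>v x - \<alpha>\<bar>)"
  have wm[measurable]: "w \<in> borel_measurable borel" unfolding w_def by measurable
  have wb: "0 \<le> w x" "w x \<le> B + \<bar>\<alpha>\<bar>" for x using bd[of x] by (auto simp: w_def)
  note wi = bounded_borel_integral[OF wm wb]
  have key: "\<bar>F b - F a - \<alpha> * (b - a)\<bar> \<le> M" if ab: "c \<le> a" "a \<le> b" "b \<le> d" for a b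
  proof -
    have "ennreal (integral (cbox a b) w) \<le> (\<integral>\<^sup>+x. ennreal (w x) * indicator {c..d} x \<partial>lborel)"
      unfolding wi(2)[symmetric] using ab by (intro nn_integral_mono mult_left_mono) (auto simp: indicator_def)
    also have "\<dots> \<le> ennreal M" using M(1) by (simp add: w_def)
    finally have wM: "integral {a..b} w \<le> M" using M(2) by (simp add: ennreal_le_iff)
    have i: "((\<lambda>x. v x - \<alpha>) has_integral (F b - F a) - (b - a) *\<^sub>R \<alpha>) {a..b}"
      using has_integral_diff[OF F[OF ab(2)] has_integral_const_real[of \<alpha> a b]] ab by simp
    have "norm (integral {a..b} (\<lambda>x. v x - \<alpha>)) \<le> integral {a..b} w"
    proof (rule Henstock_Kurzweil_Integration.integral_norm_bound_integral)
      show "(\<lambda>x. v x - \<alpha>) integrable_on {a..b}" using i by blast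
      show "w integrable_on {a..b}" using wi(1)[of a b] by simp
    qed (simp add: w_def)
    then show ?thesis using wM unfolding integral_unique[OF i] by (simp add: algebra_simps)
  qed
  show ?thesis
  proof (cases "a \<le> b")
    case True then show ?thesis using key ab by simp
  next
    case False
    then have "\<bar>F a - F b - \<alpha> * (a - b)\<bar> \<le> M" using key[of b a] ab by simp
    moreover have "F b - F a - \<alpha> * (b - a) = - (F a - F b - \<alpha> * (a - b))" by (simp add: algebra_simps)
    ultimately show ?thesis by linarith
  qed
qed

lemma quadrant_differentiable:
  fixes f u1 u2 :: "real \<times> real \<Rightarrow> real"
  assumes f: "L-lipschitz_on UNIV f"
    and u1[measurable]: "u1 \<in> borel_measurable borel" and u2[measurable]: "u2 \<in> borel_measurable borel"
    and b: "\<And>x. \<bar>u1 x\<bar> \<le> L" "\<And>x. \<bar>u2 x\<bar> \<le> L"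
    and F1: "\<And>t a b. a \<le> b \<Longrightarrow> ((\<lambda>s. u1 (s, t)) has_integral f (b, t) - f (a, t)) {a..b}"
    and F2: "\<And>s a b. a \<le> b \<Longrightarrow> ((\<lambda>t. u2 (s, t)) has_integral f (s, b) - f (s, a)) {a..b}"
  obtains N where "negligible N" "\<And>x e. x \<notin> N \<Longrightarrow> 0 < e \<Longrightarrow> \<exists>d>0. \<forall>y. fst x \<le> fst y \<and> snd x \<le> snd y \<and> norm (y - x) < d \<longrightarrow>
    \<bar>f y - f x - (u1 x * (fst y - fst x) + u2 x * (snd y - snd x))\<bar> \<le> e * norm (y - x)"
proof -
  have L: "0 \<le> L" using lipschitz_on_nonneg[OF f] .
  obtain N1 where N1: "negligible N1" "\<And>x e. x \<notin> N1 \<Longrightarrow> 0 < e \<Longrightarrow> \<exists>d>0. \<forall>h. 0 < h \<and> h < d \<longrightarrow>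
    (\<integral>\<^sup>+z. ennreal \<bar>u1 z - u1 x\<bar> * indicator (cbox x (x + h *\<^sub>R One)) z \<partial>lborel) < ennreal (e * h\<^sup>2)"
    using corner_lebesgue_point[OF u1 b(1)] by blast
  obtain N2 where N2: "negligible N2" "\<And>x e. x \<notin> N2 \<Longrightarrow> 0 < e \<Longrightarrow> \<exists>d>0. \<forall>h. 0 < h \<and> h < d \<longrightarrow>
    (\<integral>\<^sup>+z. ennreal \<bar>u2 z - u2 x\<bar> * indicator (cbox x (x + h *\<^sub>R One)) z \<partial>lborel) < ennreal (e * h\<^sup>2)"
    using corner_lebesgue_point[OF u2 b(2)] by blast
  have main: "\<exists>d>0. \<forall>y. fst x \<le> fst y \<and> snd x \<le> snd y \<and> norm (y - x) < d \<longrightarrow>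
    \<bar>f y - f x - (u1 x * (fst y - fst x) + u2 x * (snd y - snd x))\<bar> \<le> e * norm (y - x)"
    if x: "x \<notin> N1 \<union> N2" and e: "0 < e" for x e
  proof -
    obtain x1 x2 where xx: "x = (x1, x2)" by (cases x)
    define \<eta> where "\<eta> = min 1 (e / (4 * L + 2))"
    have \<eta>: "0 < \<eta>" "\<eta> \<le> 1" using e L unfolding \<eta>_def by (simp_all add: add_nonneg_pos)
    have "\<eta> \<le> e / (4 * L + 2)" by (simp add: \<eta>_def)
    then have \<eta>e: "(4 * L + 2) * \<eta> \<le> e" using L by (simp add: pos_le_divide_eq mult.commute)
    have c: "0 < \<eta>\<^sup>2 / 4" using \<eta> by simp
    have x12: "x \<notin> N1" "x \<notin> N2" using x by auto
    from N1(2)[OF x12(1) c] obtain d1 where d1: "d1 > 0" "\<forall>h. 0 < h \<and> h < d1 \<longrightarrow>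
      (\<integral>\<^sup>+z. ennreal \<bar>u1 z - u1 x\<bar> * indicator (cbox x (x + h *\<^sub>R One)) z \<partial>lborel) < ennreal (\<eta>\<^sup>2 / 4 * h\<^sup>2)"
      by (elim exE conjE)
    from N2(2)[OF x12(2) c] obtain d2 where d2: "d2 > 0" "\<forall>h. 0 < h \<and> h < d2 \<longrightarrow>
      (\<integral>\<^sup>+z. ennreal \<bar>u2 z - u2 x\<bar> * indicator (cbox x (x + h *\<^sub>R One)) z \<partial>lborel) < ennreal (\<eta>\<^sup>2 / 4 * h\<^sup>2)"
      by (elim exE conjE)
    have "\<bar>f y - f x - (u1 x * (fst y - fst x) + u2 x * (snd y - snd x))\<bar> \<le> e * norm (y - x)"
      if y: "fst x \<le> fst y" "snd x \<le> snd y" "norm (y - x) < min d1 d2 / 2" for y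
    proof (cases "y = x")
      case False
      obtain y1 y2 where yy: "y = (y1, y2)" by (cases y)
      define h where "h = norm (y - x)"
      have h: "0 < h" "2 * h < d1" "2 * h < d2" using False y by (auto simp: h_def)
      have "\<bar>y1 - x1\<bar> \<le> h" "\<bar>y2 - x2\<bar> \<le> h"
        using norm_fst_le[of "y1 - x1" "y2 - x2"] norm_snd_le[of "y2 - x2" "y1 - x1"] by (simp_all add: h_def xx yy)
      then have y12: "x1 \<le> y1" "y1 \<le> x1 + h" "x2 \<le> y2" "y2 \<le> x2 + h" using y xx yy by auto
      define Q where "Q = cbox x (x + (2 * h) *\<^sub>R One)"
      have One2: "(One :: real \<times> real) = (1, 1)" by (simp add: Basis_prod_def sum.union_disjoint zero_prod_def sum.reindex)
      have Qin: "indicator Q (s, t) = (indicator {x1..x1 + 2 * h} s * indicator {x2..x2 + 2 * h} t :: ennreal)" for s t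
        unfolding Q_def One2 xx by (simp add: cbox_Pair_eq indicator_def)
      have Qs: "Q \<in> sets borel" by (simp add: Q_def)
      define W1 where "W1 = (\<lambda>z. ennreal \<bar>u1 z - u1 x\<bar> * indicator Q z)"
      define W2 where "W2 = (\<lambda>z. ennreal \<bar>u2 z - u2 x\<bar> * indicator Q z)"
      have [measurable]: "W1 \<in> borel_measurable borel" "W2 \<in> borel_measurable borel"
        unfolding W1_def W2_def using Qs by measurable
      have e4: "\<eta>\<^sup>2 / 4 * (2 * h)\<^sup>2 = (\<eta> * h) * (\<eta> * h)" by (simp add: power2_eq_square)
      have W1: "integral\<^sup>N lborel W1 < ennreal ((\<eta> * h) * (\<eta> * h))"
        using d1(2)[rule_format, of "2 * h"] h unfolding W1_def Q_def e4 by simp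
      have W2: "integral\<^sup>N lborel W2 < ennreal ((\<eta> * h) * (\<eta> * h))"
        using d2(2)[rule_format, of "2 * h"] h unfolding W2_def Q_def e4 by simp
      have \<eta>h: "0 \<le> \<eta> * h" "\<eta> * h \<le> h" using \<eta> h mult_right_mono[of \<eta> 1 h] by auto
      obtain s where s: "x2 \<le> s" "s \<le> x2 + \<eta> * h" "(\<integral>\<^sup>+\<sigma>. W1 (\<sigma>, s) \<partial>lborel) < ennreal (\<eta> * h)"
        using good_line_snd[OF _ W1 \<eta>h(1) \<eta>h(1), of x2] by auto
      obtain t where t: "y1 \<le> t" "t \<le> y1 + \<eta> * h" "(\<integral>\<^sup>+\<tau>. W2 (t, \<tau>) \<partial>lborel) < ennreal (\<eta> * h)"
        using good_line_fst[OF _ W2 \<eta>h(1) \<eta>h(1), of y1] by auto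
      have sI: "s \<in> {x2..x2 + 2 * h}" using s(1,2) \<eta>h h(1) unfolding atLeastAtMost_iff by linarith
      have tI: "t \<in> {x1..x1 + 2 * h}" using t(1,2) y12(1,2) \<eta>h h(1) unfolding atLeastAtMost_iff by linarith
      have W1s: "(\<integral>\<^sup>+\<sigma>. ennreal \<bar>u1 (\<sigma>, s) - u1 x\<bar> * indicator {x1..x1 + 2 * h} \<sigma> \<partial>lborel) \<le> ennreal (\<eta> * h)"
        using s(3) sI unfolding W1_def Qin by simp
      have W2t: "(\<integral>\<^sup>+\<tau>. ennreal \<bar>u2 (t, \<tau>) - u2 x\<bar> * indicator {x2..x2 + 2 * h} \<tau> \<partial>lborel) \<le> ennreal (\<eta> * h)"
        using t(3) tI unfolding W2_def Qin by simp
      have A: "\<bar>f (t, s) - f (x1, s) - u1 x * (t - x1)\<bar> \<le> \<eta> * h"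
      proof (rule line_increment_bound[where F="\<lambda>\<sigma>. f (\<sigma>, s)", OF _ _ _ W1s \<eta>h(1)])
        show "(\<lambda>\<sigma>. u1 (\<sigma>, s)) \<in> borel_measurable borel" by measurable
        show "\<bar>u1 (\<sigma>, s)\<bar> \<le> L" for \<sigma> by (rule b)
        show "((\<lambda>\<sigma>. u1 (\<sigma>, s)) has_integral f (b, s) - f (a, s)) {a..b}" if "a \<le> b" for a b by (rule F1[OF that])
        show "x1 \<in> {x1..x1 + 2 * h}" using h by simp
      qed (rule tI)
      have Bb: "\<bar>f (t, y2) - f (t, s) - u2 x * (y2 - s)\<bar> \<le> \<eta> * h"
      proof (rule line_increment_bound[where F="\<lambda>\<tau>. f (t, \<tau>)", OF _ _ _ W2t \<eta>h(1)])
        show "(\<lambda>\<tau>. u2 (t, \<tau>)) \<in> borel_measurable borel" by measurable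
        show "\<bar>u2 (t, \<tau>)\<bar> \<le> L" for \<tau> by (rule b)
        show "((\<lambda>\<tau>. u2 (t, \<tau>)) has_integral f (t, b) - f (t, a)) {a..b}" if "a \<le> b" for a b by (rule F2[OF that])
        show "y2 \<in> {x2..x2 + 2 * h}" using y12 h by simp
      qed (rule sI)
      have C: "\<bar>f (y1, y2) - f (t, y2)\<bar> \<le> L * (\<eta> * h)"
      proof -
        have "\<bar>f (y1, y2) - f (t, y2)\<bar> \<le> L * \<bar>y1 - t\<bar>"
          using lipschitz_onD[OF f, of "(y1, y2)" "(t, y2)"] by (simp add: dist_real_def dist_Pair_Pair)
        also have "\<dots> \<le> L * (\<eta> * h)" using t L by (intro mult_left_mono) auto
        finally show ?thesis .
      qed
      have D: "\<bar>f (x1, s) - f (x1, x2)\<bar> \<le> L * (\<eta> * h)"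
      proof -
        have "\<bar>f (x1, s) - f (x1, x2)\<bar> \<le> L * \<bar>s - x2\<bar>"
          using lipschitz_onD[OF f, of "(x1, s)" "(x1, x2)"] by (simp add: dist_real_def dist_Pair_Pair)
        also have "\<dots> \<le> L * (\<eta> * h)" using s L by (intro mult_left_mono) auto
        finally show ?thesis .
      qed
      have E: "\<bar>u1 x * (t - y1)\<bar> \<le> L * (\<eta> * h)" "\<bar>u2 x * (s - x2)\<bar> \<le> L * (\<eta> * h)"
      proof -
        have "\<bar>t - y1\<bar> \<le> \<eta> * h" "\<bar>s - x2\<bar> \<le> \<eta> * h" using s(1,2) t(1,2) by linarith+
        then show "\<bar>u1 x * (t - y1)\<bar> \<le> L * (\<eta> * h)" "\<bar>u2 x * (s - x2)\<bar> \<le> L * (\<eta> * h)"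
          unfolding abs_mult using mult_mono[OF b(1) _ L abs_ge_zero] mult_mono[OF b(2) _ L abs_ge_zero] by blast+
      qed
      have "f (y1, y2) - f (x1, x2) - (u1 x * (y1 - x1) + u2 x * (y2 - x2)) =
         (f (y1, y2) - f (t, y2)) + (f (t, y2) - f (t, s) - u2 x * (y2 - s)) + (f (t, s) - f (x1, s) - u1 x * (t - x1))
         + (f (x1, s) - f (x1, x2)) + u1 x * (t - y1) - u2 x * (s - x2)"
        by (simp add: algebra_simps)
      then have "\<bar>f (y1, y2) - f (x1, x2) - (u1 x * (y1 - x1) + u2 x * (y2 - x2))\<bar> \<le> 4 * (L * (\<eta> * h)) + 2 * (\<eta> * h)"
        using A Bb C D E by linarith
      also have "\<dots> = ((4 * L + 2) * \<eta>) * h" by (simp add: algebra_simps)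
      also have "\<dots> \<le> e * h" using \<eta>e h by (intro mult_right_mono) auto
      finally show ?thesis by (simp add: xx yy h_def)
    qed simp
    then show ?thesis using d1(1) d2(1) by (intro exI[of _ "min d1 d2 / 2"] conjI) simp_all
  qed
  have "negligible (N1 \<union> N2)" using N1(1) N2(1) by (rule negligible_Un)
  then show ?thesis using main by (rule that)
qed

theorem Rademacher_plane:
  fixes f :: "real \<times> real \<Rightarrow> real"
  assumes f: "L-lipschitz_on UNIV f"
  obtains N where "negligible N" "\<And>x. x \<notin> N \<Longrightarrow> f differentiable (at x)"
proof -
  have L: "0 \<le> L" using lipschitz_on_nonneg[OF f] .
  have fc: "continuous_on UNIV f" by (rule lipschitz_on_continuous_on[OF f])
  then have fm[measurable]: "f \<in> borel_measurable borel" by (rule borel_measurable_continuous_onI)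
  define u1 where "u1 = (\<lambda>z. max (- L) (min L (lim (\<lambda>n. (f (fst z + inverse (real (Suc n)), snd z) - f z) * real (Suc n)))))"
  define u2 where "u2 = (\<lambda>z. max (- L) (min L (lim (\<lambda>n. (f (fst z, snd z + inverse (real (Suc n))) - f z) * real (Suc n)))))"
  have m1: "(\<lambda>z. f (fst z + inverse (real (Suc n)), snd z)) \<in> borel_measurable borel"
    "(\<lambda>z. f (fst z, snd z + inverse (real (Suc n)))) \<in> borel_measurable borel" for n
    by (rule borel_measurable_continuous_onI, rule continuous_on_compose2[OF fc], auto intro!: continuous_intros)+
  have um: "u1 \<in> borel_measurable borel" "u2 \<in> borel_measurable borel"
    unfolding u1_def u2_def using m1 by measurable
  have ub: "\<bar>u1 z\<bar> \<le> L" "\<bar>u2 z\<bar> \<le> L" for z using L by (auto simp: u1_def u2_def)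
  have lip1: "L-lipschitz_on UNIV (\<lambda>s. f (s, t))" "L-lipschitz_on UNIV (\<lambda>s. f (t, s))" for t
  proof -
    show "L-lipschitz_on UNIV (\<lambda>s. f (s, t))"
    proof (rule lipschitz_onI[OF _ L])
      fix x y show "dist (f (x, t)) (f (y, t)) \<le> L * dist x y"
        using lipschitz_onD[OF f, of "(x, t)" "(y, t)"] by (simp add: dist_Pair_Pair)
    qed
    show "L-lipschitz_on UNIV (\<lambda>s. f (t, s))"
    proof (rule lipschitz_onI[OF _ L])
      fix x y show "dist (f (t, x)) (f (t, y)) \<le> L * dist x y"
        using lipschitz_onD[OF f, of "(t, x)" "(t, y)"] by (simp add: dist_Pair_Pair)
    qed
  qed
  have F1: "((\<lambda>s. u1 (s, t)) has_integral f (b, t) - f (a, t)) {a..b}" if "a \<le> b" for a b t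
    using lipschitz_real_derivative_integral[OF lip1(1) that, of t] by (simp add: u1_def)
  have F2: "((\<lambda>s. u2 (t, s)) has_integral f (t, b) - f (t, a)) {a..b}" if "a \<le> b" for a b t
    using lipschitz_real_derivative_integral[OF lip1(2) that, of t] by (simp add: u2_def)
  define T where "T = (\<lambda>(\<sigma>::real) (\<tau>::real) (z::real \<times> real). (\<sigma> * fst z, \<tau> * snd z))"
  define sg where "sg = {-1, 1 :: real}"
  have sq: "\<sigma> * \<sigma> = 1" "\<bar>\<sigma>\<bar> = 1" if "\<sigma> \<in> sg" for \<sigma> using that by (auto simp: sg_def)
  have TT: "T \<sigma> \<tau> (T \<sigma> \<tau> z) = z" if "\<sigma> \<in> sg" "\<tau> \<in> sg" for \<sigma> \<tau> z
    using that by (auto simp: sg_def T_def)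
  have Tn: "norm (T \<sigma> \<tau> y - T \<sigma> \<tau> x) = norm (y - x)" if "\<sigma> \<in> sg" "\<tau> \<in> sg" for \<sigma> \<tau> x y
  proof -
    have "T \<sigma> \<tau> y - T \<sigma> \<tau> x = (\<sigma> * (fst y - fst x), \<tau> * (snd y - snd x))" by (simp add: T_def right_diff_distrib)
    moreover have "norm (\<sigma> * a, \<tau> * b) = norm (a, b)" for a b :: real
      unfolding norm_Pair real_norm_def abs_mult sq(2)[OF that(1)] sq(2)[OF that(2)] by simp
    moreover have "y - x = (fst y - fst x, snd y - snd x)" by (simp add: prod_eq_iff)
    ultimately show ?thesis by simp
  qed
  have Tc: "continuous_on UNIV (T \<sigma> \<tau>)" for \<sigma> \<tau> unfolding T_def by (intro continuous_intros)
  have ex: "\<exists>N. negligible N \<and> (\<forall>x e. x \<notin> N \<longrightarrow> 0 < e \<longrightarrow> (\<exists>d>0. \<forall>y. fst x \<le> fst y \<and> snd x \<le> snd y \<and> norm (y - x) < d \<longrightarrow>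
    \<bar>f (T \<sigma> \<tau> y) - f (T \<sigma> \<tau> x) - (\<sigma> * u1 (T \<sigma> \<tau> x) * (fst y - fst x) + \<tau> * u2 (T \<sigma> \<tau> x) * (snd y - snd x))\<bar> \<le> e * norm (y - x)))"
    if st: "\<sigma> \<in> sg" "\<tau> \<in> sg" for \<sigma> \<tau>
  proof -
    have Tm: "T \<sigma> \<tau> \<in> borel_measurable borel" by (rule borel_measurable_continuous_onI[OF Tc])
    have flip: "((\<lambda>s. \<sigma> * v (\<sigma> * s)) has_integral F (\<sigma> * b) - F (\<sigma> * a)) {a..b}"
      if \<sigma>: "\<sigma> \<in> sg" and ab: "a \<le> b" and v: "\<And>a b. a \<le> b \<Longrightarrow> (v has_integral F b - F a) {a..b}" for \<sigma> a b :: real and v F :: "real \<Rightarrow> real"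
    proof (cases "\<sigma> = 1")
      case True then show ?thesis using v[OF ab] by simp
    next
      case False
      then have \<sigma>1: "\<sigma> = - 1" using \<sigma> by (simp add: sg_def)
      have "((\<lambda>s. v (- s)) has_integral F (- a) - F (- b)) {a..b}"
        using v[of "- b" "- a"] ab has_integral_reflect_real[where f=v and a="- b" and b="- a" and i="F (- a) - F (- b)"] by simp
      from has_integral_neg[OF this] show ?thesis unfolding \<sigma>1 by simp
    qed
    obtain N where N: "negligible N" "\<And>x e. x \<notin> N \<Longrightarrow> 0 < e \<Longrightarrow> \<exists>d>0. \<forall>y. fst x \<le> fst y \<and> snd x \<le> snd y \<and> norm (y - x) < d \<longrightarrow>
      \<bar>f (T \<sigma> \<tau> y) - f (T \<sigma> \<tau> x) - (\<sigma> * u1 (T \<sigma> \<tau> x) * (fst y - fst x) + \<tau> * u2 (T \<sigma> \<tau> x) * (snd y - snd x))\<bar> \<le> e * norm (y - x)"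
    proof (rule quadrant_differentiable[where f="\<lambda>z. f (T \<sigma> \<tau> z)" and L=L and ?u1.0="\<lambda>z. \<sigma> * u1 (T \<sigma> \<tau> z)" and ?u2.0="\<lambda>z. \<tau> * u2 (T \<sigma> \<tau> z)"])
      show "L-lipschitz_on UNIV (\<lambda>z. f (T \<sigma> \<tau> z))"
      proof (rule lipschitz_onI[OF _ L])
        fix x y show "dist (f (T \<sigma> \<tau> x)) (f (T \<sigma> \<tau> y)) \<le> L * dist x y"
          using lipschitz_onD[OF f, of "T \<sigma> \<tau> x" "T \<sigma> \<tau> y"] Tn[OF st, of x y] by (simp add: dist_norm)
      qed
      show "(\<lambda>z. \<sigma> * u1 (T \<sigma> \<tau> z)) \<in> borel_measurable borel" "(\<lambda>z. \<tau> * u2 (T \<sigma> \<tau> z)) \<in> borel_measurable borel"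
        using measurable_compose[OF Tm um(1)] measurable_compose[OF Tm um(2)] by (auto intro!: borel_measurable_times)
      show "\<bar>\<sigma> * u1 (T \<sigma> \<tau> z)\<bar> \<le> L" "\<bar>\<tau> * u2 (T \<sigma> \<tau> z)\<bar> \<le> L" for z
        using ub sq(2)[OF st(1)] sq(2)[OF st(2)] by (simp_all add: abs_mult)
      show "((\<lambda>s. \<sigma> * u1 (T \<sigma> \<tau> (s, t))) has_integral f (T \<sigma> \<tau> (b, t)) - f (T \<sigma> \<tau> (a, t))) {a..b}" if "a \<le> b" for t a b
        using flip[OF st(1) that, of "\<lambda>s. u1 (s, \<tau> * t)" "\<lambda>s. f (s, \<tau> * t)"] F1 by (simp add: T_def)
      show "((\<lambda>t. \<tau> * u2 (T \<sigma> \<tau> (s, t))) has_integral f (T \<sigma> \<tau> (s, b)) - f (T \<sigma> \<tau> (s, a))) {a..b}" if "a \<le> b" for s a b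
        using flip[OF st(2) that, of "\<lambda>t. u2 (\<sigma> * s, t)" "\<lambda>t. f (\<sigma> * s, t)"] F2 by (simp add: T_def)
    qed (rule that)
    show ?thesis by (intro exI[of _ N] conjI allI impI N(1)) (rule N(2))
  qed
  obtain M where M: "\<And>\<sigma> \<tau>. \<sigma> \<in> sg \<Longrightarrow> \<tau> \<in> sg \<Longrightarrow> negligible (M \<sigma> \<tau>)"
    "\<And>\<sigma> \<tau> x e. \<sigma> \<in> sg \<Longrightarrow> \<tau> \<in> sg \<Longrightarrow> x \<notin> M \<sigma> \<tau> \<Longrightarrow> 0 < e \<Longrightarrow> \<exists>d>0. \<forall>y. fst x \<le> fst y \<and> snd x \<le> snd y \<and> norm (y - x) < d \<longrightarrow>
    \<bar>f (T \<sigma> \<tau> y) - f (T \<sigma> \<tau> x) - (\<sigma> * u1 (T \<sigma> \<tau> x) * (fst y - fst x) + \<tau> * u2 (T \<sigma> \<tau> x) * (snd y - snd x))\<bar> \<le> e * norm (y - x)"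
    using ex by metis
  define N where "N = (\<Union>\<sigma>\<in>sg. \<Union>\<tau>\<in>sg. T \<sigma> \<tau> ` M \<sigma> \<tau>)"
  have "negligible (T \<sigma> \<tau> ` M \<sigma> \<tau>)" if st: "\<sigma> \<in> sg" "\<tau> \<in> sg" for \<sigma> \<tau>
  proof (rule negligible_locally_Lipschitz_image[OF order_refl M(1)[OF st]])
    fix x show "\<exists>U B. open U \<and> x \<in> U \<and> (\<forall>y\<in>M \<sigma> \<tau> \<inter> U. norm (T \<sigma> \<tau> y - T \<sigma> \<tau> x) \<le> B * norm (y - x))"
      using Tn[OF st] by (intro exI[of _ UNIV] exI[of _ 1]) simp
  qed
  moreover have "finite sg" by (simp add: sg_def)
  ultimately have "negligible N" unfolding N_def by (intro negligible_Union) auto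
  moreover have "f differentiable (at x)" if x: "x \<notin> N" for x
  proof -
    have "(f has_derivative (\<lambda>v. u1 x * fst v + u2 x * snd v)) (at x)"
      unfolding has_derivative_at_alt
    proof (intro conjI allI impI)
      show "bounded_linear (\<lambda>v. u1 x * fst v + u2 x * snd v)"
        by (intro bounded_linear_add bounded_linear_const_mult bounded_linear_fst bounded_linear_snd)
      fix e :: real assume e: "e > 0"
      define P where "P = (\<lambda>\<sigma> \<tau> d. \<forall>y. 0 \<le> \<sigma> * (fst y - fst x) \<longrightarrow> 0 \<le> \<tau> * (snd y - snd x) \<longrightarrow> norm (y - x) < d \<longrightarrow>
        \<bar>f y - f x - (u1 x * (fst y - fst x) + u2 x * (snd y - snd x))\<bar> \<le> e * norm (y - x))"
      have P: "\<exists>d>0. P \<sigma> \<tau> d" if st: "\<sigma> \<in> sg" "\<tau> \<in> sg" for \<sigma> \<tau>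
      proof -
        have "T \<sigma> \<tau> x \<notin> M \<sigma> \<tau>"
        proof
          assume "T \<sigma> \<tau> x \<in> M \<sigma> \<tau>"
          then have "T \<sigma> \<tau> (T \<sigma> \<tau> x) \<in> T \<sigma> \<tau> ` M \<sigma> \<tau>" by (rule imageI)
          then have "x \<in> T \<sigma> \<tau> ` M \<sigma> \<tau>" unfolding TT[OF st] .
          with st have "x \<in> N" unfolding N_def by blast
          with x show False by blast
        qed
        from M(2)[OF st this e, unfolded TT[OF st]] obtain d where d: "d > 0"
          "\<forall>y. fst (T \<sigma> \<tau> x) \<le> fst y \<and> snd (T \<sigma> \<tau> x) \<le> snd y \<and> norm (y - T \<sigma> \<tau> x) < d \<longrightarrow>
          \<bar>f (T \<sigma> \<tau> y) - f x - (\<sigma> * u1 x * (fst y - fst (T \<sigma> \<tau> x)) + \<tau> * u2 x * (snd y - snd (T \<sigma> \<tau> x)))\<bar> \<le> e * norm (y - T \<sigma> \<tau> x)"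
          by (elim exE conjE)
        have "P \<sigma> \<tau> d" unfolding P_def
        proof (intro allI impI)
          fix y assume y: "0 \<le> \<sigma> * (fst y - fst x)" "0 \<le> \<tau> * (snd y - snd x)" "norm (y - x) < d"
          have pre: "fst (T \<sigma> \<tau> x) \<le> fst (T \<sigma> \<tau> y) \<and> snd (T \<sigma> \<tau> x) \<le> snd (T \<sigma> \<tau> y) \<and> norm (T \<sigma> \<tau> y - T \<sigma> \<tau> x) < d"
            using y unfolding Tn[OF st] by (simp add: T_def right_diff_distrib)
          have "\<bar>f (T \<sigma> \<tau> (T \<sigma> \<tau> y)) - f x - (\<sigma> * u1 x * (fst (T \<sigma> \<tau> y) - fst (T \<sigma> \<tau> x)) + \<tau> * u2 x * (snd (T \<sigma> \<tau> y) - snd (T \<sigma> \<tau> x)))\<bar> \<le> e * norm (T \<sigma> \<tau> y - T \<sigma> \<tau> x)"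
            by (rule d(2)[rule_format, OF pre])
          moreover have "\<sigma> * u1 x * (fst (T \<sigma> \<tau> y) - fst (T \<sigma> \<tau> x)) = (\<sigma> * \<sigma>) * (u1 x * (fst y - fst x))"
            "\<tau> * u2 x * (snd (T \<sigma> \<tau> y) - snd (T \<sigma> \<tau> x)) = (\<tau> * \<tau>) * (u2 x * (snd y - snd x))"
            by (simp_all add: T_def algebra_simps)
          ultimately show "\<bar>f y - f x - (u1 x * (fst y - fst x) + u2 x * (snd y - snd x))\<bar> \<le> e * norm (y - x)"
            unfolding TT[OF st] Tn[OF st] sq(1)[OF st(1)] sq(1)[OF st(2)] by simp
        qed
        then show ?thesis using d(1) by blast
      qed
      have s1: "1 \<in> sg" "- 1 \<in> sg" by (auto simp: sg_def)
      obtain a where a: "a > 0" "P 1 1 a" using P[OF s1(1) s1(1)] by blast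
      obtain b where b: "b > 0" "P 1 (- 1) b" using P[OF s1(1) s1(2)] by blast
      obtain c where c: "c > 0" "P (- 1) 1 c" using P[OF s1(2) s1(1)] by blast
      obtain d where d: "d > 0" "P (- 1) (- 1) d" using P[OF s1(2) s1(2)] by blast
      define d0 where "d0 = min (min a b) (min c d)"
      have "d0 > 0" using a b c d by (simp add: d0_def)
      moreover have "norm (f y - f x - (u1 x * fst (y - x) + u2 x * snd (y - x))) \<le> e * norm (y - x)" if y: "norm (y - x) < d0" for y
      proof -
        have yy: "norm (y - x) < a" "norm (y - x) < b" "norm (y - x) < c" "norm (y - x) < d" using y by (auto simp: d0_def)
        have "\<bar>f y - f x - (u1 x * (fst y - fst x) + u2 x * (snd y - snd x))\<bar> \<le> e * norm (y - x)"
        proof (cases "fst x \<le> fst y")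
          case True
          show ?thesis
          proof (cases "snd x \<le> snd y")
            case True2: True
            show ?thesis by (rule a(2)[unfolded P_def, rule_format]) (use True True2 yy in simp_all)
          next
            case False
            show ?thesis by (rule b(2)[unfolded P_def, rule_format]) (use True False yy in simp_all)
          qed
        next
          case False
          show ?thesis
          proof (cases "snd x \<le> snd y")
            case True
            show ?thesis by (rule c(2)[unfolded P_def, rule_format]) (use True False yy in simp_all)
          next
            case False2: False
            show ?thesis by (rule d(2)[unfolded P_def, rule_format]) (use False False2 yy in simp_all)
          qed
        qed
        then show ?thesis by simp
      qed
      ultimately show "\<exists>d>0. \<forall>y. norm (y - x) < d \<longrightarrow> norm (f y - f x - (u1 x * fst (y - x) + u2 x * snd (y - x))) \<le> e * norm (y - x)"
        by blast
    qed
    then show ?thesis by (rule differentiableI)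
  qed
  ultimately show ?thesis using that by blast
qed

section \<open>Tangent spaces\<close>

context defining
begin

abbreviation "S \<equiv> {x. g x = 0}"

definition \<delta>0 :: real where "\<delta>0 = 1 / (K * (K + 1)\<^sup>2 + 1)"

lemma \<delta>0: "0 < \<delta>0" "\<delta>0 \<le> 1" "K * (K + 1)\<^sup>2 * \<delta>0 \<le> 1"
proof -
  have p: "0 \<le> K * (K + 1)\<^sup>2" using K_nonneg by simp
  then show "0 < \<delta>0" "\<delta>0 \<le> 1" by (auto simp: \<delta>0_def)
  have "K * (K + 1)\<^sup>2 * \<delta>0 \<le> (K * (K + 1)\<^sup>2 + 1) * \<delta>0" using \<open>0 < \<delta>0\<close> by (intro mult_right_mono) auto
  also have "\<dots> = 1" using p by (simp add: \<delta>0_def)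
  finally show "K * (K + 1)\<^sup>2 * \<delta>0 \<le> 1" .
qed

lemma near_tangent_plane:
  assumes p: "g p = 0" and v: "G p \<bullet> v = 0" "norm v < \<delta>0"
  obtains x where "g x = 0" "norm (x - (p + v)) \<le> (K + 1) * (norm v)\<^sup>2"
proof -
  define \<sigma> where "\<sigma> = (K + 1) * (norm v)\<^sup>2"
  have \<sigma>0: "0 \<le> \<sigma>" using K_nonneg by (simp add: \<sigma>_def)
  have n: "norm (G p) = 1" by (rule G_unit[OF p])
  define \<phi> where "\<phi> = (\<lambda>s. g (p + v + s *\<^sub>R G p))"
  have bound: "\<bar>\<phi> s - s\<bar> \<le> \<sigma>" if s: "\<bar>s\<bar> = \<sigma>" for s
  proof -
    have "\<bar>g (p + (v + s *\<^sub>R G p)) - g p - G p \<bullet> (v + s *\<^sub>R G p)\<bar> \<le> K * (norm (v + s *\<^sub>R G p))\<^sup>2"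
      using quad[of "p + (v + s *\<^sub>R G p)" p] by simp
    moreover have "G p \<bullet> (v + s *\<^sub>R G p) = s" using v n by (simp add: inner_add_right norm_eq_1)
    moreover have "(norm (v + s *\<^sub>R G p))\<^sup>2 = (norm v)\<^sup>2 + \<sigma>\<^sup>2"
    proof -
      have "(norm (v + s *\<^sub>R G p))\<^sup>2 = v \<bullet> v + s * s"
      proof -
        have "v \<bullet> G p = 0" "G p \<bullet> G p = 1" using v(1) n by (simp_all add: inner_commute norm_eq_1)
        then show ?thesis using v(1) unfolding power2_norm_eq_inner by (simp add: inner_add_left inner_add_right)
      qed
      moreover have "s * s = \<sigma>\<^sup>2" using s by (metis abs_mult_self_eq power2_eq_square)
      ultimately show ?thesis by (simp add: power2_norm_eq_inner)
    qed
    moreover have "K * ((norm v)\<^sup>2 + \<sigma>\<^sup>2) \<le> \<sigma>"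
    proof -
      have "(norm v)\<^sup>2 \<le> \<delta>0 * 1" unfolding power2_eq_square using v \<delta>0 by (intro mult_mono) auto
      then have "K * (K + 1)\<^sup>2 * (norm v)\<^sup>2 \<le> K * (K + 1)\<^sup>2 * \<delta>0" using K_nonneg by (intro mult_left_mono) auto
      then have "K * (K + 1)\<^sup>2 * (norm v)\<^sup>2 \<le> 1" using \<delta>0(3) by linarith
      then have "(norm v)\<^sup>2 * (K * (K + 1)\<^sup>2 * (norm v)\<^sup>2) \<le> (norm v)\<^sup>2 * 1" by (rule mult_left_mono) simp
      moreover have "K * \<sigma>\<^sup>2 = (norm v)\<^sup>2 * (K * (K + 1)\<^sup>2 * (norm v)\<^sup>2)"
        unfolding \<sigma>_def power2_eq_square by (simp only: ac_simps)
      ultimately have "K * \<sigma>\<^sup>2 \<le> (norm v)\<^sup>2" by (simp only: mult_1_right)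
      moreover have "\<sigma> = K * (norm v)\<^sup>2 + (norm v)\<^sup>2" by (simp add: \<sigma>_def distrib_right)
      ultimately show ?thesis unfolding distrib_left by linarith
    qed
    ultimately show ?thesis using p by (simp add: \<phi>_def add.assoc)
  qed
  have "\<phi> (- \<sigma>) \<le> 0" "0 \<le> \<phi> \<sigma>" using bound[of "- \<sigma>"] bound[of \<sigma>] \<sigma>0 by auto
  moreover have "- \<sigma> \<le> \<sigma>" using \<sigma>0 by simp
  moreover have "continuous_on {- \<sigma>..\<sigma>} \<phi>"
    unfolding \<phi>_def by (rule continuous_on_compose2[OF g_continuous[of UNIV]]) (auto intro!: continuous_intros)
  ultimately obtain s where s: "- \<sigma> \<le> s" "s \<le> \<sigma>" "\<phi> s = 0" using IVT'[of \<phi> "- \<sigma>" 0 \<sigma>] by blast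
  have "norm ((p + v + s *\<^sub>R G p) - (p + v)) \<le> \<sigma>" using s(1,2) n by simp
  then show ?thesis using that s(3) unfolding \<phi>_def \<sigma>_def by blast
qed

lemma tangent_space_eq:
  assumes p: "g p = 0"
  shows "tangent_space S p = {v. G p \<bullet> v = 0}"
proof
  show "tangent_space S p \<subseteq> {v. G p \<bullet> v = 0}"
  proof
    fix v assume "v \<in> tangent_space S p"
    then obtain c where c: "range c \<subseteq> S" "c 0 = p" "(c has_vector_derivative v) (at 0)"
      unfolding tangent_space_def by blast
    have "((g \<circ> c) has_derivative ((\<lambda>w. G p \<bullet> w) \<circ> (\<lambda>t. t *\<^sub>R v))) (at 0)"
    proof (rule diff_chain_at)
      show "(c has_derivative (\<lambda>t. t *\<^sub>R v)) (at 0)" using c(3) by (simp add: has_vector_derivative_def)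
      show "(g has_derivative (\<lambda>w. G p \<bullet> w)) (at (c 0))" unfolding c(2) by (rule der)
    qed
    moreover have "g \<circ> c = (\<lambda>_. 0)" using c(1) by (auto simp: fun_eq_iff)
    ultimately have "((\<lambda>w. G p \<bullet> w) \<circ> (\<lambda>t. t *\<^sub>R v)) = (\<lambda>_. 0)"
      using has_derivative_unique has_derivative_const by metis
    from fun_cong[OF this, of 1] show "v \<in> {v. G p \<bullet> v = 0}" by simp
  qed
  show "{v. G p \<bullet> v = 0} \<subseteq> tangent_space S p"
  proof
    fix v assume "v \<in> {v. G p \<bullet> v = 0}"
    then have v: "G p \<bullet> v = 0" by simp
    have "\<exists>x. g x = 0 \<and> (norm (t *\<^sub>R v) < \<delta>0 \<longrightarrow> norm (x - (p + t *\<^sub>R v)) \<le> (K + 1) * (norm (t *\<^sub>R v))\<^sup>2)" for t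
    proof (cases "norm (t *\<^sub>R v) < \<delta>0")
      case True
      have "G p \<bullet> (t *\<^sub>R v) = 0" using v by simp
      from near_tangent_plane[OF p this True] obtain x where
        "g x = 0" "norm (x - (p + t *\<^sub>R v)) \<le> (K + 1) * (norm (t *\<^sub>R v))\<^sup>2" .
      then show ?thesis by (intro exI[of _ x]) simp
    next
      case False
      then show ?thesis using p by (intro exI[of _ p]) simp
    qed
    then obtain c where c: "\<And>t. g (c t) = 0" "\<And>t. norm (t *\<^sub>R v) < \<delta>0 \<Longrightarrow> norm (c t - (p + t *\<^sub>R v)) \<le> (K + 1) * (norm (t *\<^sub>R v))\<^sup>2"
      by metis
    have c0: "c 0 = p" using c(2)[of 0] \<delta>0(1) by simp
    have "(c has_derivative (\<lambda>t. t *\<^sub>R v)) (at 0)"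
      unfolding has_derivative_at_alt
    proof (intro conjI allI impI)
      show "bounded_linear (\<lambda>t. t *\<^sub>R v)" by (rule bounded_linear_scaleR_left)
      fix e :: real assume e: "e > 0"
      define q where "q = (K + 1) * (norm v)\<^sup>2 + 1"
      have q: "q > 0" using K_nonneg by (simp add: q_def add_nonneg_pos)
      define d where "d = min (\<delta>0 / (norm v + 1)) (e / q)"
      have d: "d > 0" using \<delta>0 e q by (simp add: d_def add_nonneg_pos)
      have "norm (c y - c 0 - (y - 0) *\<^sub>R v) \<le> e * norm (y - 0)" if y: "norm (y - 0) < d" for y
      proof -
        have ab: "\<bar>y\<bar> < \<delta>0 / (norm v + 1)" "\<bar>y\<bar> < e / q" using y by (auto simp: d_def)
        have "norm (y *\<^sub>R v) \<le> \<bar>y\<bar> * (norm v + 1)" by (simp add: mult_left_mono)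
        also have "\<dots> < \<delta>0" using ab(1) by (simp add: pos_less_divide_eq add_nonneg_pos)
        finally have "norm (c y - (p + y *\<^sub>R v)) \<le> (K + 1) * (norm (y *\<^sub>R v))\<^sup>2" by (rule c(2))
        also have "\<dots> = ((K + 1) * (norm v)\<^sup>2) * \<bar>y\<bar> * \<bar>y\<bar>" by (simp add: power_mult_distrib power2_eq_square)
        also have "\<dots> \<le> q * \<bar>y\<bar> * \<bar>y\<bar>" by (intro mult_right_mono) (auto simp: q_def)
        also have "\<dots> \<le> e * \<bar>y\<bar>" using ab(2) q by (intro mult_right_mono) (auto simp: pos_less_divide_eq mult.commute)
        finally show ?thesis by (simp add: c0 algebra_simps)
      qed
      then show "\<exists>d>0. \<forall>y. norm (y - 0) < d \<longrightarrow> norm (c y - c 0 - (y - 0) *\<^sub>R v) \<le> e * norm (y - 0)"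
        using d by blast
    qed
    then show "v \<in> tangent_space S p"
      unfolding tangent_space_def using c(1) c0
      by (intro CollectI exI[of _ c]) (auto simp: has_vector_derivative_def)
  qed
qed

end

lemma tangent_derivative_unique:
  fixes F :: "space3 \<Rightarrow> 'b::real_normed_vector"
  assumes v: "v \<in> tangent_space S p"
    and D: "(F has_derivative D) (at p within S)" and D': "(F' has_derivative D') (at p within S)"
    and eq: "\<And>x. x \<in> S \<Longrightarrow> F x = F' x"
  shows "D v = D' v"
proof -
  obtain c where c: "range c \<subseteq> S" "c 0 = p" "(c has_vector_derivative v) (at 0)"
    using v unfolding tangent_space_def by blast
  have vec: "((H \<circ> c) has_vector_derivative E v) (at 0)" if H: "(H has_derivative E) (at p within S)" for H :: "space3 \<Rightarrow> 'b" and E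
  proof -
    have "((H \<circ> c) has_derivative (E \<circ> (\<lambda>t. t *\<^sub>R v))) (at 0 within UNIV)"
    proof (rule diff_chain_within)
      show "(c has_derivative (\<lambda>t. t *\<^sub>R v)) (at 0 within UNIV)" using c(3) by (simp add: has_vector_derivative_def)
      show "(H has_derivative E) (at (c 0) within range c)" unfolding c(2) using H c(1) by (rule has_derivative_subset)
    qed
    moreover have "E \<circ> (\<lambda>t. t *\<^sub>R v) = (\<lambda>t. t *\<^sub>R E v)"
      using has_derivative_linear[OF H] by (auto simp: fun_eq_iff linear_scale)
    ultimately show ?thesis by (simp add: has_vector_derivative_def)
  qed
  have "F \<circ> c = F' \<circ> c" using eq c(1) by (auto simp: fun_eq_iff)
  then show ?thesis using vec[OF D] vec[OF D'] vector_derivative_unique_at by metis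
qed

context defining
begin

lemma tangent_plane_expansion:
  fixes F :: "space3 \<Rightarrow> 'b::real_normed_vector"
  assumes p: "g p = 0" and D: "(F has_derivative D) (at p within S)"
    and lip: "\<And>x y. norm (F x - F y) \<le> \<Lambda> * norm (x - y)" and e: "e > 0"
  obtains d where "d > 0" "\<And>v. G p \<bullet> v = 0 \<Longrightarrow> norm v < d \<Longrightarrow> norm (F (p + v) - F p - D v) \<le> e * norm v"
proof -
  have bl: "bounded_linear D" using D by (rule has_derivative_bounded_linear)
  obtain B where B: "B > 0" "\<And>w. norm (D w) \<le> norm w * B" using bounded_linear.pos_bounded[OF bl] by blast
  have \<Lambda>: "0 \<le> \<Lambda>"
  proof -
    have "0 \<le> \<Lambda> * norm (axis 1 1 - (0::space3))" using lip[of "axis 1 1" 0] norm_ge_zero order_trans by blast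
    then show ?thesis by simp
  qed
  define e' where "e' = e / 4"
  have e': "e' > 0" using e by (simp add: e'_def)
  obtain d1 where d1: "d1 > 0" "\<And>x. x \<in> S \<Longrightarrow> norm (x - p) < d1 \<Longrightarrow> norm (F x - F p - D (x - p)) \<le> e' * norm (x - p)"
    using D e' unfolding has_derivative_within_alt by blast
  define q where "q = (\<Lambda> + B) * (K + 1) + (K + 1)"
  have q: "q > 0" using \<Lambda> B K_nonneg by (simp add: q_def add_nonneg_pos)
  define d where "d = min \<delta>0 (min (d1 / 2) (min (e / (2 * q)) (1 / q)))"
  have d: "d > 0" using \<delta>0 d1 e q by (simp add: d_def)
  have "norm (F (p + v) - F p - D v) \<le> e * norm v" if v: "G p \<bullet> v = 0" "norm v < d" for v
  proof -
    have vd: "norm v < \<delta>0" "norm v < d1 / 2" "norm v < e / (2 * q)" "norm v < 1 / q" using v by (auto simp: d_def)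
    obtain x where x: "g x = 0" "norm (x - (p + v)) \<le> (K + 1) * (norm v)\<^sup>2"
      using near_tangent_plane[OF p v(1) vd(1)] by blast
    define r where "r = x - (p + v)"
    have qv: "q * norm v \<le> 1" "q * norm v \<le> e / 2" using vd q by (auto simp: pos_less_divide_eq mult.commute field_simps)
    have "(K + 1) * norm v \<le> q * norm v" using \<Lambda> B K_nonneg by (intro mult_right_mono) (auto simp: q_def)
    then have "(K + 1) * norm v * norm v \<le> 1 * norm v" using qv by (intro mult_right_mono) auto
    then have r1: "norm r \<le> norm v" using x(2) by (simp add: r_def power2_eq_square)
    have xp: "x - p = v + r" by (simp add: r_def)
    then have nxp: "norm (x - p) \<le> 2 * norm v" using r1 norm_triangle_ineq[of v r] by simp
    then have "norm (x - p) < d1" using vd by linarith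
    then have a: "norm (F x - F p - D (x - p)) \<le> e' * norm (x - p)" using d1(2) x(1) by simp
    have "e' * norm (x - p) \<le> e' * (2 * norm v)" using nxp e' by (intro mult_left_mono) auto
    with a have 1: "norm (F x - F p - D (x - p)) \<le> e / 2 * norm v" by (simp add: e'_def)
    have 2: "norm (F (p + v) - F x) \<le> \<Lambda> * norm r" using lip[of "p + v" x] by (simp add: r_def norm_minus_commute)
    have 3: "norm (D r) \<le> B * norm r" using B(2)[of r] by (simp add: mult.commute)
    have "(\<Lambda> + B) * norm r \<le> (\<Lambda> + B) * ((K + 1) * (norm v)\<^sup>2)" using x(2) \<Lambda> B by (intro mult_left_mono) (auto simp: r_def)
    also have "\<dots> = ((\<Lambda> + B) * (K + 1)) * norm v * norm v" by (simp add: power2_eq_square)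
    also have "\<dots> \<le> q * norm v * norm v" using K_nonneg by (intro mult_right_mono) (auto simp: q_def)
    also have "\<dots> \<le> e / 2 * norm v" using qv by (intro mult_right_mono) auto
    finally have 4: "\<Lambda> * norm r + B * norm r \<le> e / 2 * norm v" by (simp add: distrib_right)
    have Dl: "D (x - p) = D v + D r" unfolding xp using bounded_linear.linear[OF bl] by (rule linear_add)
    have "F (p + v) - F p - D v = (F (p + v) - F x) + (F x - F p - D (x - p)) + D r" unfolding Dl by simp
    also have "norm \<dots> \<le> norm (F (p + v) - F x) + norm (F x - F p - D (x - p)) + norm (D r)"
      by (intro norm_triangle_le add_mono order_refl norm_triangle_ineq)
    also have "\<dots> \<le> e * norm v" using 1 2 3 4 by (simp add: field_simps)
    finally show ?thesis .
  qed
  then show ?thesis using that d by blast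
qed

text \<open>Only the derivatives of \<open>A\<close> along the surface enter, but they determine the second differences of
  \<open>\<Phi>\<close> in the tangent plane.\<close>

lemma tangential_symmetry:
  fixes \<Phi> :: "space3 \<Rightarrow> 'b::real_normed_vector"
  assumes p: "g p = 0" and der\<Phi>: "\<And>x. (\<Phi> has_derivative A x) (at x)"
    and lip: "\<And>x y w. norm (A x w - A y w) \<le> \<Lambda> * norm (x - y) * norm w"
    and u: "G p \<bullet> u = 0" and v: "G p \<bullet> v = 0"
    and Du: "((\<lambda>x. A x u) has_derivative Du) (at p within S)"
    and Dv: "((\<lambda>x. A x v) has_derivative Dv) (at p within S)"
  shows "Du v = Dv u"
proof -
  define q where "q = norm u + norm v + 1"
  have q: "q > 0" using norm_ge_zero[of u] norm_ge_zero[of v] unfolding q_def by linarith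
  have Alin: "linear (A x)" for x using der\<Phi> has_derivative_linear by blast
  have half: "\<exists>d>0. \<forall>t. 0 < t \<and> t < d \<longrightarrow>
      norm (\<Phi> (p + t *\<^sub>R u + t *\<^sub>R v) - \<Phi> (p + t *\<^sub>R u) - \<Phi> (p + t *\<^sub>R v) + \<Phi> p - (t * t) *\<^sub>R Du v) \<le> (e * (2 * q)) * (t * t)"
    if e: "e > 0" and u: "G p \<bullet> u = 0" and v: "G p \<bullet> v = 0" and Du: "((\<lambda>x. A x u) has_derivative Du) (at p within S)"
      and quv: "norm u + norm v \<le> q" for e u v and Du :: "space3 \<Rightarrow> 'b"
  proof -
    have lipu: "norm (A x u - A y u) \<le> (\<Lambda> * norm u) * norm (x - y)" for x y using lip[of x u y] by (simp add: mult_ac)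
    obtain d where d: "d > 0" "\<And>w. G p \<bullet> w = 0 \<Longrightarrow> norm w < d \<Longrightarrow> norm (A (p + w) u - A p u - Du w) \<le> e * norm w"
      using tangent_plane_expansion[OF p Du lipu e] by blast
    have Dul: "linear Du" using Du has_derivative_linear by blast
    have "norm (\<Phi> (p + t *\<^sub>R u + t *\<^sub>R v) - \<Phi> (p + t *\<^sub>R u) - \<Phi> (p + t *\<^sub>R v) + \<Phi> p - (t * t) *\<^sub>R Du v) \<le> (e * (2 * q)) * (t * t)"
      if t: "0 < t" "t < d / (q + 1)" for t
    proof -
      define \<psi> where "\<psi> = (\<lambda>s. \<Phi> (p + s *\<^sub>R u + t *\<^sub>R v) - \<Phi> (p + s *\<^sub>R u) - s *\<^sub>R (t *\<^sub>R Du v))"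
      define \<psi>' where "\<psi>' = (\<lambda>s. A (p + s *\<^sub>R u + t *\<^sub>R v) u - A (p + s *\<^sub>R u) u - t *\<^sub>R Du v)"
      have "norm (\<psi> t - \<psi> 0) \<le> (e * (2 * q) * t) * norm (t - 0)"
      proof (rule differentiable_bound[where S="{0..t}" and f=\<psi> and f'="\<lambda>s h. h *\<^sub>R \<psi>' s"])
        show "convex {0..t}" by simp
        show "t \<in> {0..t}" "0 \<in> {0..t}" using t by auto
        fix s assume s: "s \<in> {0..t}"
        have chain: "((\<lambda>s. \<Phi> (a + s *\<^sub>R u)) has_derivative (\<lambda>h. h *\<^sub>R A (a + s *\<^sub>R u) u)) (at s within {0..t})" for a
        proof -
          have "(\<Phi> \<circ> (\<lambda>s. a + s *\<^sub>R u) has_derivative (A (a + s *\<^sub>R u) \<circ> (\<lambda>h. h *\<^sub>R u))) (at s)"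
            by (rule diff_chain_at) (auto intro!: derivative_eq_intros der\<Phi>)
          moreover have "A (a + s *\<^sub>R u) \<circ> (\<lambda>h. h *\<^sub>R u) = (\<lambda>h. h *\<^sub>R A (a + s *\<^sub>R u) u)"
            by (auto simp: fun_eq_iff linear_scale[OF Alin])
          ultimately show ?thesis by (simp add: o_def has_derivative_at_withinI)
        qed
        have c1: "((\<lambda>s. \<Phi> (p + s *\<^sub>R u + t *\<^sub>R v)) has_derivative (\<lambda>h. h *\<^sub>R A (p + s *\<^sub>R u + t *\<^sub>R v) u)) (at s within {0..t})"
          using chain[of "p + t *\<^sub>R v"] by (simp add: add_ac)
        have c3: "((\<lambda>s. s *\<^sub>R (t *\<^sub>R Du v)) has_derivative (\<lambda>h. h *\<^sub>R (t *\<^sub>R Du v))) (at s within {0..t})"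
          by (auto intro!: derivative_eq_intros)
        have "(\<psi> has_derivative (\<lambda>h. h *\<^sub>R A (p + s *\<^sub>R u + t *\<^sub>R v) u - h *\<^sub>R A (p + s *\<^sub>R u) u - h *\<^sub>R (t *\<^sub>R Du v))) (at s within {0..t})"
          unfolding \<psi>_def by (intro has_derivative_diff c1 chain c3)
        then show "(\<psi> has_derivative (\<lambda>h. h *\<^sub>R \<psi>' s)) (at s within {0..t})"
          by (simp add: \<psi>'_def scaleR_diff_right)
        define w1 where "w1 = s *\<^sub>R u + t *\<^sub>R v"
        define w2 where "w2 = s *\<^sub>R u"
        have sa: "norm (s *\<^sub>R u) \<le> t * norm u" using s by (simp add: mult_right_mono)
        have tq: "t * norm u + t * norm v \<le> t * q" using quv t by (simp add: distrib_left[symmetric])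
        have ntv: "norm (t *\<^sub>R v) = t * norm v" using t by simp
        have nw: "norm w1 \<le> t * q" "norm w2 \<le> t * q"
          unfolding w1_def w2_def using sa tq ntv norm_triangle_ineq[of "s *\<^sub>R u" "t *\<^sub>R v"] norm_ge_zero[of "t *\<^sub>R v"] by linarith+
        have "t * q < d"
        proof -
          have "t * q < t * (q + 1)" using t by simp
          also have "\<dots> < d" using t q by (simp add: pos_less_divide_eq add_pos_pos)
          finally show ?thesis .
        qed
        then have nd: "norm w1 < d" "norm w2 < d" using nw by linarith+
        have tw: "G p \<bullet> w1 = 0" "G p \<bullet> w2 = 0" using u v by (simp_all add: w1_def w2_def inner_add_right)
        have "\<psi>' s = (A (p + w1) u - A p u - Du w1) - (A (p + w2) u - A p u - Du w2)"
          by (simp add: \<psi>'_def w1_def w2_def linear_add[OF Dul] linear_scale[OF Dul] add.assoc)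
        also have "norm \<dots> \<le> e * norm w1 + e * norm w2"
          using d(2)[OF tw(1) nd(1)] d(2)[OF tw(2) nd(2)] norm_triangle_ineq4[of "A (p + w1) u - A p u - Du w1" "A (p + w2) u - A p u - Du w2"] by linarith
        also have "\<dots> \<le> e * (t * q) + e * (t * q)" using nw e by (intro add_mono mult_left_mono) auto
        finally have n\<psi>: "norm (\<psi>' s) \<le> e * (2 * q) * t" by (simp add: algebra_simps)
        show "onorm (\<lambda>h. h *\<^sub>R \<psi>' s) \<le> e * (2 * q) * t"
        proof (rule onorm_le)
          fix h :: real
          have "norm (h *\<^sub>R \<psi>' s) \<le> \<bar>h\<bar> * (e * (2 * q) * t)" unfolding norm_scaleR using n\<psi> by (intro mult_left_mono) auto
          then show "norm (h *\<^sub>R \<psi>' s) \<le> e * (2 * q) * t * norm h" by (simp add: mult_ac)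
        qed
      qed
      moreover have "\<psi> t - \<psi> 0 = \<Phi> (p + t *\<^sub>R u + t *\<^sub>R v) - \<Phi> (p + t *\<^sub>R u) - \<Phi> (p + t *\<^sub>R v) + \<Phi> p - (t * t) *\<^sub>R Du v"
        by (simp add: \<psi>_def)
      ultimately show ?thesis using t by (simp add: mult_ac)
    qed
    moreover have "d / (q + 1) > 0" using d q by simp
    ultimately show ?thesis by blast
  qed
  have "norm (Du v - Dv u) \<le> 0 + e" if e: "e > 0" for e
  proof -
    define e1 where "e1 = e / (4 * q)"
    have e1: "e1 > 0" using e q by (simp add: e1_def)
    have quv: "norm u + norm v \<le> q" "norm v + norm u \<le> q" by (auto simp: q_def)
    obtain d1 where d1: "d1 > 0" "\<And>t. 0 < t \<Longrightarrow> t < d1 \<Longrightarrow>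
      norm (\<Phi> (p + t *\<^sub>R u + t *\<^sub>R v) - \<Phi> (p + t *\<^sub>R u) - \<Phi> (p + t *\<^sub>R v) + \<Phi> p - (t * t) *\<^sub>R Du v) \<le> (e1 * (2 * q)) * (t * t)"
      using half[OF e1 u v Du quv(1)] by blast
    obtain d2 where d2: "d2 > 0" "\<And>t. 0 < t \<Longrightarrow> t < d2 \<Longrightarrow>
      norm (\<Phi> (p + t *\<^sub>R v + t *\<^sub>R u) - \<Phi> (p + t *\<^sub>R v) - \<Phi> (p + t *\<^sub>R u) + \<Phi> p - (t * t) *\<^sub>R Dv u) \<le> (e1 * (2 * q)) * (t * t)"
      using half[OF e1 v u Dv quv(2)] by blast
    define t where "t = min d1 d2 / 2"
    have t: "0 < t" "t < d1" "t < d2" using d1(1) d2(1) by (auto simp: t_def min_def)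
    define a where "a = \<Phi> (p + t *\<^sub>R u + t *\<^sub>R v) - \<Phi> (p + t *\<^sub>R u) - \<Phi> (p + t *\<^sub>R v) + \<Phi> p"
    have "norm (a - (t * t) *\<^sub>R Du v) \<le> (e1 * (2 * q)) * (t * t)" unfolding a_def by (rule d1(2)[OF t(1,2)])
    moreover have "norm (a - (t * t) *\<^sub>R Dv u) \<le> (e1 * (2 * q)) * (t * t)"
    proof -
      have "a = \<Phi> (p + t *\<^sub>R v + t *\<^sub>R u) - \<Phi> (p + t *\<^sub>R v) - \<Phi> (p + t *\<^sub>R u) + \<Phi> p"
        by (simp add: a_def add.assoc add.commute[of "t *\<^sub>R u"])
      then show ?thesis using d2(2)[OF t(1,3)] by simp
    qed
    moreover have "(t * t) *\<^sub>R (Du v - Dv u) = (a - (t * t) *\<^sub>R Dv u) - (a - (t * t) *\<^sub>R Du v)" by (simp add: scaleR_diff_right)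
    ultimately have "norm ((t * t) *\<^sub>R (Du v - Dv u)) \<le> (e1 * (4 * q)) * (t * t)"
      using norm_triangle_ineq4[of "a - (t * t) *\<^sub>R Dv u" "a - (t * t) *\<^sub>R Du v"] by simp
    then have "norm (Du v - Dv u) * (t * t) \<le> e * (t * t)" using q by (simp add: e1_def mult.commute)
    then show ?thesis using t by (simp add: mult_le_cancel_right)
  qed
  then have "norm (Du v - Dv u) \<le> 0" by (rule field_le_epsilon)
  then show ?thesis by simp
qed

end

lemmas vec3_simps = inner_vec_def sum_3 cross3_simps vector_3

lemma cross_parallel:
  fixes n v :: space3
  assumes "norm n = 1" "cross3 n v = 0"
  shows "v = (n \<bullet> v) *\<^sub>R n"
proof -
  have "cross3 n (cross3 n v) = (n \<bullet> v) *\<^sub>R n - (n \<bullet> n) *\<^sub>R v" by (simp add: Lagrange)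
  then show ?thesis using assms by (simp add: norm_eq_1)
qed

lemma cross_orthogonal_parallel:
  fixes n a b :: space3
  assumes "norm n = 1" "n \<bullet> a = 0" "n \<bullet> b = 0"
  shows "cross3 a b = (n \<bullet> cross3 a b) *\<^sub>R n"
proof (rule cross_parallel[OF assms(1)])
  have "cross3 n (cross3 a b) = (n \<bullet> b) *\<^sub>R a - (n \<bullet> a) *\<^sub>R b" by (simp add: Lagrange)
  then show "cross3 n (cross3 a b) = 0" using assms by simp
qed

text \<open>The trace of a derivative over the tangent plane, computed in an arbitrary basis \<open>f1\<close>, \<open>f2\<close>.\<close>

lemma trace_basis_change:
  fixes e1 e2 f1 f2 n :: space3
  assumes e: "norm e1 = 1" "norm e2 = 1" "e1 \<bullet> e2 = 0"
    and n: "norm n = 1" "n \<bullet> e1 = 0" "n \<bullet> e2 = 0"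
    and f: "f1 \<in> span {e1, e2}" "f2 \<in> span {e1, e2}" and D: "linear D"
    and tr: "e1 \<bullet> D e1 + e2 \<bullet> D e2 = 0"
  shows "cross3 f2 n \<bullet> D f1 + cross3 n f1 \<bullet> D f2 = 0"
proof -
  have ee: "e1 \<bullet> e1 = 1" "e2 \<bullet> e2 = 1" using e by (simp_all add: norm_eq_1)
  define \<sigma> where "\<sigma> = n \<bullet> cross3 e1 e2"
  have c12: "cross3 e1 e2 = \<sigma> *\<^sub>R n" unfolding \<sigma>_def by (rule cross_orthogonal_parallel[OF n])
  have L1: "\<sigma> *\<^sub>R cross3 e1 n = - e2" 
  proof -
    have "cross3 e1 (cross3 e1 e2) = (e1 \<bullet> e2) *\<^sub>R e1 - (e1 \<bullet> e1) *\<^sub>R e2" by (simp add: Lagrange)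
    then show ?thesis using e ee unfolding c12 by (simp add: cross_mult_right)
  qed
  have L2: "\<sigma> *\<^sub>R cross3 e2 n = e1"
  proof -
    have "cross3 e2 (cross3 e1 e2) = (e2 \<bullet> e2) *\<^sub>R e1 - (e2 \<bullet> e1) *\<^sub>R e2" by (simp add: Lagrange)
    then show ?thesis using e ee unfolding c12 by (simp add: cross_mult_right inner_commute)
  qed
  obtain a b where f1: "f1 = a *\<^sub>R e1 + b *\<^sub>R e2" using f(1) by (auto simp: span_insert span_singleton algebra_simps)
  obtain c d where f2: "f2 = c *\<^sub>R e1 + d *\<^sub>R e2" using f(2) by (auto simp: span_insert span_singleton algebra_simps)
  have D1: "D f1 = a *\<^sub>R D e1 + b *\<^sub>R D e2" and D2: "D f2 = c *\<^sub>R D e1 + d *\<^sub>R D e2"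
    unfolding f1 f2 using D by (simp_all add: linear_add linear_scale)
  have s0: "\<sigma> \<noteq> 0" using L2 ee by auto
  have X: "\<sigma> *\<^sub>R cross3 f2 n = d *\<^sub>R e1 - c *\<^sub>R e2"
  proof -
    have "\<sigma> *\<^sub>R cross3 f2 n = c *\<^sub>R (\<sigma> *\<^sub>R cross3 e1 n) + d *\<^sub>R (\<sigma> *\<^sub>R cross3 e2 n)"
      by (simp add: f2 cross_add_left cross_mult_left scaleR_add_right mult.commute)
    then show ?thesis unfolding L1 L2 by simp
  qed
  have Y: "\<sigma> *\<^sub>R cross3 n f1 = a *\<^sub>R e2 - b *\<^sub>R e1"
  proof -
    have "\<sigma> *\<^sub>R cross3 n f1 = - (a *\<^sub>R (\<sigma> *\<^sub>R cross3 e1 n) + b *\<^sub>R (\<sigma> *\<^sub>R cross3 e2 n))"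
    proof -
      have "cross3 n f1 = - cross3 f1 n" by (rule cross_skew)
      also have "cross3 f1 n = a *\<^sub>R cross3 e1 n + b *\<^sub>R cross3 e2 n"
        by (simp add: f1 cross_add_left cross_mult_left)
      finally show ?thesis by (simp only: scaleR_minus_right scaleR_add_right scaleR_left_commute)
    qed
    then show ?thesis unfolding L1 L2 by simp
  qed
  have "\<sigma> * (cross3 f2 n \<bullet> D f1 + cross3 n f1 \<bullet> D f2) = (\<sigma> *\<^sub>R cross3 f2 n) \<bullet> D f1 + (\<sigma> *\<^sub>R cross3 n f1) \<bullet> D f2"
    by (simp add: distrib_left)
  also have "\<dots> = (a * d - b * c) * (e1 \<bullet> D e1 + e2 \<bullet> D e2)"
    unfolding X Y D1 D2 by (simp add: inner_add_right inner_diff_left algebra_simps)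
  finally show ?thesis using tr s0 by simp
qed

text \<open>At a point of the surface, \<open>f1\<close>, \<open>f2\<close>, \<open>m\<close> are the images of an orthonormal frame under the derivative of the
  diffeomorphism, \<open>b12\<close>, \<open>b1n\<close>, \<open>b2n\<close> its second derivatives, \<open>Y1\<close>, \<open>Y2\<close> and \<open>H1\<close>, \<open>H2\<close> the derivatives of the
  field and of the unit normal \<open>n\<close> of the image surface. The contributions of the second derivatives cancel
  because the second fundamental form is symmetric.\<close>

lemma piola_divergence_algebra:
  fixes f1 f2 m n X b12 b1n b2n Y1 Y2 H1 H2 :: space3
  assumes n: "norm n = 1" "n \<bullet> f1 = 0" "n \<bullet> f2 = 0"
    and m: "m = n + l *\<^sub>R f1 + k *\<^sub>R f2" and X: "X = \<alpha> *\<^sub>R f1 + \<beta> *\<^sub>R f2"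
    and H: "H1 \<bullet> n = 0" "H2 \<bullet> n = 0" "H1 \<bullet> f2 = H2 \<bullet> f1"
    and Y: "n \<bullet> Y1 = - (H1 \<bullet> X)" "n \<bullet> Y2 = - (H2 \<bullet> X)"
    and b: "n \<bullet> (\<alpha> *\<^sub>R b1n + \<beta> *\<^sub>R b2n) = - ((\<alpha> *\<^sub>R H1 + \<beta> *\<^sub>R H2) \<bullet> m)"
    and tr: "cross3 f2 n \<bullet> Y1 + cross3 n f1 \<bullet> Y2 = 0"
  shows "(cross3 b12 m + cross3 f2 b1n) \<bullet> X + cross3 f2 m \<bullet> Y1 + ((cross3 b2n f1 + cross3 m b12) \<bullet> X + cross3 m f1 \<bullet> Y2) = 0"
proof -
  define c where "c = n \<bullet> cross3 f1 f2"
  have c: "cross3 f1 f2 = c *\<^sub>R n" unfolding c_def by (rule cross_orthogonal_parallel[OF n])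
  have c': "cross3 f2 f1 = - (c *\<^sub>R n)" using c cross_skew[of f2 f1] by simp
  have 1: "cross3 b12 m \<bullet> X + cross3 m b12 \<bullet> X = 0"
    using cross_skew[of m b12] by simp
  have 2: "cross3 f2 b1n \<bullet> X + cross3 b2n f1 \<bullet> X = cross3 f1 f2 \<bullet> (\<alpha> *\<^sub>R b1n + \<beta> *\<^sub>R b2n)"
    unfolding X by (simp add: vec3_simps algebra_simps)
  have 3: "cross3 f2 m = cross3 f2 n - (l * c) *\<^sub>R n" unfolding m
    by (simp add: cross_add_right cross_mult_right c')
  have 4: "cross3 m f1 = cross3 n f1 - (k * c) *\<^sub>R n" unfolding m
    by (simp add: cross_add_left cross_mult_left c')
  have "(cross3 b12 m + cross3 f2 b1n) \<bullet> X + cross3 f2 m \<bullet> Y1 + ((cross3 b2n f1 + cross3 m b12) \<bullet> X + cross3 m f1 \<bullet> Y2)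
    = (cross3 b12 m \<bullet> X + cross3 m b12 \<bullet> X) + (cross3 f2 b1n \<bullet> X + cross3 b2n f1 \<bullet> X)
      + (cross3 f2 m \<bullet> Y1 + cross3 m f1 \<bullet> Y2)" by (simp add: inner_add_left)
  also have "\<dots> = cross3 f1 f2 \<bullet> (\<alpha> *\<^sub>R b1n + \<beta> *\<^sub>R b2n) + ((cross3 f2 n \<bullet> Y1 + cross3 n f1 \<bullet> Y2) - c * (l * (n \<bullet> Y1) + k * (n \<bullet> Y2)))"
    unfolding 1 2 unfolding 3 4 by (simp add: inner_diff_left algebra_simps)
  also have "\<dots> = c * (n \<bullet> (\<alpha> *\<^sub>R b1n + \<beta> *\<^sub>R b2n) - (l * (n \<bullet> Y1) + k * (n \<bullet> Y2)))"
    unfolding tr c by (simp add: inner_add_right algebra_simps)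
  also have "n \<bullet> (\<alpha> *\<^sub>R b1n + \<beta> *\<^sub>R b2n) - (l * (n \<bullet> Y1) + k * (n \<bullet> Y2)) = 0"
    unfolding b Y m X using H by (simp add: inner_add_left inner_add_right algebra_simps)
  finally show ?thesis by simp
qed

section \<open>Rademacher's theorem on surfaces\<close>

lemma mcshane_extension:
  fixes f :: "'a::metric_space \<Rightarrow> real"
  assumes f: "L-lipschitz_on E f" and E: "E \<noteq> {}"
  obtains h where "L-lipschitz_on UNIV h" "\<And>x. x \<in> E \<Longrightarrow> h x = f x"
proof -
  have L: "L \<ge> 0" using f by (rule lipschitz_on_nonneg)
  define h where "h = (\<lambda>x. INF y\<in>E. f y + L * dist x y)"
  have fd: "f y \<le> f z + L * dist y z" if "y \<in> E" "z \<in> E" for y z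
    using lipschitz_onD[OF f that] by (simp add: dist_real_def abs_le_iff)
  have bdd: "bdd_below ((\<lambda>y. f y + L * dist x y) ` E)" for x
  proof -
    obtain z where z: "z \<in> E" using E by blast
    have "f z - L * dist x z \<le> f y + L * dist x y" if y: "y \<in> E" for y
    proof -
      have "L * dist z y \<le> L * (dist x z + dist x y)" using L dist_triangle3[of z y x] by (intro mult_left_mono)
      then show ?thesis using fd[OF z y] by (simp add: distrib_left)
    qed
    then show ?thesis by (intro bdd_belowI[of _ "f z - L * dist x z"]) auto
  qed
  have step: "h x \<le> h x' + L * dist x x'" for x x'
  proof -
    have "h x - L * dist x x' \<le> f y + L * dist x' y" if y: "y \<in> E" for y
    proof -
      have "h x \<le> f y + L * dist x y" unfolding h_def by (rule cINF_lower[OF bdd y])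
      also have "L * dist x y \<le> L * (dist x x' + dist x' y)" using L dist_triangle by (intro mult_left_mono)
      finally show ?thesis by (simp add: distrib_left)
    qed
    then have "h x - L * dist x x' \<le> h x'" unfolding h_def[of] by (intro cINF_greatest E)
    then show ?thesis by simp
  qed
  show ?thesis
  proof
    show "L-lipschitz_on UNIV h"
    proof (rule lipschitz_onI[OF _ L])
      fix x y
      show "dist (h x) (h y) \<le> L * dist x y"
        using step[of x y] step[of y x] by (simp add: dist_real_def abs_le_iff dist_commute)
    qed
    fix x assume x: "x \<in> E"
    have "h x \<le> f x + L * dist x x" unfolding h_def by (rule cINF_lower[OF bdd x])
    moreover have "f x \<le> h x" unfolding h_def using fd[OF x] by (intro cINF_greatest E)
    ultimately show "h x = f x" by simp
  qed
qed

lemma orthonormal_frame: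
  fixes n :: space3
  assumes n: "norm n = 1"
  obtains u v where "norm u = 1" "norm v = 1" "u \<bullet> v = 0" "n \<bullet> u = 0" "n \<bullet> v = 0"
    "v = cross3 n u" "u = cross3 v n" "span {u, v} = {w. n \<bullet> w = 0}"
    "\<And>x. (norm x)\<^sup>2 = (x \<bullet> u)\<^sup>2 + (x \<bullet> v)\<^sup>2 + (x \<bullet> n)\<^sup>2"
proof -
  obtain f :: "space3 \<Rightarrow> space3" where f: "orthogonal_transformation f" "f (axis 3 1) = n"
    using orthogonal_transformation_exists_1[of "axis 3 1 :: space3" n] n by (auto simp: norm_axis_1)
  define u where "u = f (axis 1 1)"
  define w where "w = f (axis 2 1)"
  have fi: "f x \<bullet> f y = x \<bullet> y" for x y using f(1) by (simp add: orthogonal_transformation_def)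
  have lin: "linear f" using f(1) by (simp add: orthogonal_transformation_def)
  have surj: "\<exists>y. x = f y" for x using orthogonal_transformation_surj[OF f(1)] by (metis surj_def)
  have uu: "u \<bullet> u = 1" "w \<bullet> w = 1" "u \<bullet> w = 0" "n \<bullet> u = 0" "n \<bullet> w = 0"
    unfolding u_def w_def f(2)[symmetric] fi by (simp_all add: inner_axis_axis)
  have nn: "n \<bullet> n = 1" using n by (simp add: norm_eq_1)
  have dec: "x = (x \<bullet> u) *\<^sub>R u + (x \<bullet> w) *\<^sub>R w + (x \<bullet> n) *\<^sub>R n" for x
  proof -
    obtain y where y: "x = f y" using surj by blast
    have "y = (y $ 1) *\<^sub>R axis 1 1 + (y $ 2) *\<^sub>R axis 2 1 + (y $ 3) *\<^sub>R axis 3 (1::real)"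
      by (simp add: vec_eq_iff forall_3 axis_def)
    then have "f y = f ((y $ 1) *\<^sub>R axis 1 1 + (y $ 2) *\<^sub>R axis 2 1 + (y $ 3) *\<^sub>R axis 3 1)" by (rule arg_cong)
    also have "\<dots> = (y $ 1) *\<^sub>R u + (y $ 2) *\<^sub>R w + (y $ 3) *\<^sub>R n"
      by (simp add: linear_add[OF lin] linear_scale[OF lin] u_def w_def f(2))
    finally have "f y = (y $ 1) *\<^sub>R u + (y $ 2) *\<^sub>R w + (y $ 3) *\<^sub>R n" .
    moreover have "x \<bullet> u = y $ 1" "x \<bullet> w = y $ 2" "x \<bullet> n = y $ 3"
      unfolding y u_def w_def f(2)[symmetric] fi by (simp_all add: inner_axis)
    ultimately show ?thesis using y by simp
  qed
  have sq: "(norm x)\<^sup>2 = (x \<bullet> u)\<^sup>2 + (x \<bullet> w)\<^sup>2 + (x \<bullet> n)\<^sup>2" for x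
  proof -
    have "(norm x)\<^sup>2 = x \<bullet> ((x \<bullet> u) *\<^sub>R u + (x \<bullet> w) *\<^sub>R w + (x \<bullet> n) *\<^sub>R n)"
      unfolding power2_norm_eq_inner using dec[of x] by simp
    then show ?thesis by (simp only: inner_add_right inner_scaleR_right power2_eq_square)
  qed
  define v where "v = cross3 n u"
  have ov: "v \<bullet> u = 0" "v \<bullet> n = 0" by (simp_all add: v_def dot_cross_self)
  define s where "s = v \<bullet> w"
  have vs: "v = s *\<^sub>R w" using dec[of v] ov by (simp add: s_def)
  have uvn: "cross3 v n = u"
  proof -
    have "cross3 n (cross3 n u) = (n \<bullet> u) *\<^sub>R n - (n \<bullet> n) *\<^sub>R u" by (rule Lagrange)
    then have "cross3 n v = - u" using uu nn by (simp add: v_def)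
    then show ?thesis using cross_skew[of v n] by simp
  qed
  have nv: "norm v = 1"
  proof -
    have "(norm v)\<^sup>2 + (n \<bullet> u)\<^sup>2 = (norm n * norm u)\<^sup>2"
      unfolding v_def by (rule norm_cross_dot)
    moreover have "norm u = 1" using uu by (simp add: norm_eq_1)
    ultimately have "(norm v)\<^sup>2 = 1" using n uu by simp
    then show ?thesis using norm_ge_zero[of v] by (auto simp: power2_eq_1_iff simp del: norm_ge_zero)
  qed
  have ss: "s\<^sup>2 = 1"
  proof -
    have "v \<bullet> v = s * s * (w \<bullet> w)" unfolding vs by simp
    then show ?thesis using nv uu by (simp add: norm_eq_1 power2_eq_square)
  qed
  have sw: "s *\<^sub>R v = w" using ss unfolding vs by (simp add: power2_eq_square)
  have xw: "(x \<bullet> v)\<^sup>2 = (x \<bullet> w)\<^sup>2" for x using ss unfolding vs by (simp add: power_mult_distrib)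
  show ?thesis
  proof
    show "norm u = 1" "norm v = 1" using uu nv by (simp_all add: norm_eq_1)
    show "u \<bullet> v = 0" "n \<bullet> u = 0" "n \<bullet> v = 0" using ov uu by (simp_all add: inner_commute)
    show "v = cross3 n u" "u = cross3 v n" using uvn by (simp_all add: v_def)
    show "(norm x)\<^sup>2 = (x \<bullet> u)\<^sup>2 + (x \<bullet> v)\<^sup>2 + (x \<bullet> n)\<^sup>2" for x unfolding xw by (rule sq)
    show "span {u, v} = {w. n \<bullet> w = 0}"
    proof
      show "span {u, v} \<subseteq> {w. n \<bullet> w = 0}"
        using uu ov by (intro span_minimal subspace_hyperplane) (auto simp: inner_commute)
      show "{w. n \<bullet> w = 0} \<subseteq> span {u, v}"
      proof
        fix x assume "x \<in> {w. n \<bullet> w = 0}"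
        then have "x = (x \<bullet> u) *\<^sub>R u + ((x \<bullet> w) * s) *\<^sub>R v"
          using dec[of x] sw by (simp add: inner_commute[of x n] flip: scaleR_scaleR)
        moreover have "(x \<bullet> u) *\<^sub>R u \<in> span {u, v}" "((x \<bullet> w) * s) *\<^sub>R v \<in> span {u, v}"
          by (intro span_scale span_base, simp)+
        ultimately show "x \<in> span {u, v}" using span_add[of "(x \<bullet> u) *\<^sub>R u" "{u, v}" "((x \<bullet> w) * s) *\<^sub>R v"] by metis
      qed
    qed
  qed
qed

context defining
begin

lemma closed_S: "closed S"
proof -
  have "closed (g -` {0})" using g_continuous[of UNIV] by (simp add: continuous_closed_vimage continuous_on_eq_continuous_at)
  then show ?thesis by (simp add: vimage_def)
qed

lemma compact_S:
  assumes "m > 0"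
  shows "compact S"
proof -
  have "S \<subseteq> cball 0 R"
  proof
    fix x assume "x \<in> S" then have "\<not> norm x \<ge> R" using far[of x] assms by auto
    then show "x \<in> cball 0 R" by simp
  qed
  then show ?thesis using closed_S bounded_subset[OF bounded_cball] by (auto simp: compact_eq_bounded_closed)
qed

lemma local_chart:
  assumes p: "g p0 = 0" and frame: "\<And>x. (norm x)\<^sup>2 = (x \<bullet> u)\<^sup>2 + (x \<bullet> v)\<^sup>2 + (x \<bullet> G p0)\<^sup>2"
    and x: "g x = 0" "dist p0 x < 1 / (16 * (K + 1))" and y: "g y = 0" "dist p0 y < 1 / (16 * (K + 1))"
  shows "dist x y \<le> 2 * dist (x \<bullet> u, x \<bullet> v) (y \<bullet> u, y \<bullet> v)"
proof -
  define \<rho> where "\<rho> = 1 / (16 * (K + 1))"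
  have K\<rho>: "K * \<rho> \<le> 1 / 16" using K_nonneg by (simp add: \<rho>_def field_simps)
  define d where "d = norm (x - y)"
  have d0: "0 \<le> d" by (simp add: d_def)
  have d2: "d \<le> 2 * \<rho>" using x(2) y(2) dist_triangle[of x y p0] by (simp add: d_def \<rho>_def dist_norm dist_commute norm_minus_commute)
  have 1: "\<bar>G y \<bullet> (x - y)\<bar> \<le> d / 8"
  proof -
    have "\<bar>g x - g y - G y \<bullet> (x - y)\<bar> \<le> K * (norm (x - y))\<^sup>2" by (rule quad)
    then have "\<bar>G y \<bullet> (x - y)\<bar> \<le> K * d * d" using x y by (simp add: d_def power2_eq_square)
    also have "K * d \<le> K * (2 * \<rho>)" using d2 K_nonneg by (rule mult_left_mono)
    then have "K * d * d \<le> (K * (2 * \<rho>)) * d" using d0 by (rule mult_right_mono)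
    also have "K * (2 * \<rho>) \<le> 1 / 8" using K\<rho> by simp
    then have "(K * (2 * \<rho>)) * d \<le> 1 / 8 * d" using d0 by (rule mult_right_mono)
    finally show ?thesis by simp
  qed
  have 2: "\<bar>(G p0 - G y) \<bullet> (x - y)\<bar> \<le> 3 / 8 * d"
  proof -
    have "norm (G p0 - G y) \<le> 6 * K * norm (p0 - y)" by (rule G_lipschitz)
    also have "\<dots> \<le> 6 * K * \<rho>" using y(2) K_nonneg by (intro mult_left_mono) (auto simp: \<rho>_def dist_norm)
    also have "\<dots> \<le> 3 / 8" using K\<rho> by simp
    finally have "norm (G p0 - G y) * d \<le> 3 / 8 * d" using d0 by (rule mult_right_mono)
    then show ?thesis using Cauchy_Schwarz_ineq2[of "G p0 - G y" "x - y"] unfolding d_def by linarith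
  qed
  have "\<bar>(x - y) \<bullet> G p0\<bar> \<le> d / 2" 
  proof -
    have "(x - y) \<bullet> G p0 = (G p0 - G y) \<bullet> (x - y) + G y \<bullet> (x - y)"
      unfolding inner_commute[of "x - y" "G p0"] inner_diff_left[of "G p0" "G y"] by simp
    then show ?thesis using 1 2 by linarith
  qed
  then have "((x - y) \<bullet> G p0)\<^sup>2 \<le> (d / 2)\<^sup>2" by (metis abs_ge_zero power2_abs power_mono)
  moreover have "d\<^sup>2 = ((x - y) \<bullet> u)\<^sup>2 + ((x - y) \<bullet> v)\<^sup>2 + ((x - y) \<bullet> G p0)\<^sup>2" unfolding d_def by (rule frame)
  moreover have "a \<le> d\<^sup>2 / 2\<^sup>2 \<Longrightarrow> d\<^sup>2 = b + c + a \<Longrightarrow> 0 \<le> b \<Longrightarrow> 0 \<le> c \<Longrightarrow> d\<^sup>2 \<le> 2\<^sup>2 * (b + c)" for a b c :: real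
    by simp
  ultimately have "d\<^sup>2 \<le> 2\<^sup>2 * (((x - y) \<bullet> u)\<^sup>2 + ((x - y) \<bullet> v)\<^sup>2)"
    unfolding power_divide using zero_le_power2 by blast
  then have "sqrt (d\<^sup>2) \<le> sqrt (2\<^sup>2 * (((x - y) \<bullet> u)\<^sup>2 + ((x - y) \<bullet> v)\<^sup>2))" by (rule real_sqrt_le_mono)
  then have "d \<le> 2 * sqrt (((x - y) \<bullet> u)\<^sup>2 + ((x - y) \<bullet> v)\<^sup>2)"
    using d0 unfolding real_sqrt_mult by simp
  then show ?thesis by (simp only: d_def dist_norm norm_Pair inner_diff_left real_norm_def diff_Pair power2_abs)
qed

lemma rademacher_surface_real:
  fixes F :: "space3 \<Rightarrow> real"
  assumes m: "m > 0" and F: "L-lipschitz_on S F"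
  shows "AE p in surface_measure S. F differentiable (at p within S)"
proof -
  define \<rho> where "\<rho> = 1 / (16 * (K + 1))"
  have \<rho>: "\<rho> > 0" using K_nonneg by (simp add: \<rho>_def)
  have local: "AE p in surface_measure S. p \<in> ball p0 \<rho> \<longrightarrow> F differentiable (at p within S)" if p0: "g p0 = 0" for p0
  proof -
    obtain u v where uv: "norm u = 1" "norm v = 1" "\<And>x. (norm x)\<^sup>2 = (x \<bullet> u)\<^sup>2 + (x \<bullet> v)\<^sup>2 + (x \<bullet> G p0)\<^sup>2"
      using orthonormal_frame[OF G_unit[OF p0]] by metis
    define \<pi> where "\<pi> = (\<lambda>x :: space3. (x \<bullet> u, x \<bullet> v))"
    define E where "E = \<pi> ` (S \<inter> ball p0 \<rho>)"
    have chart: "dist x y \<le> 2 * dist (\<pi> x) (\<pi> y)" if "x \<in> S \<inter> ball p0 \<rho>" "y \<in> S \<inter> ball p0 \<rho>" for x y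
      unfolding \<pi>_def using local_chart[OF p0 uv(3), of x y] that by (simp add: \<rho>_def)
    have inj: "inj_on \<pi> (S \<inter> ball p0 \<rho>)"
    proof (rule inj_onI)
      fix x y assume *: "x \<in> S \<inter> ball p0 \<rho>" "y \<in> S \<inter> ball p0 \<rho>" "\<pi> x = \<pi> y"
      show "x = y" using chart[OF *(1,2)] *(3) by simp
    qed
    define \<psi> where "\<psi> = inv_into (S \<inter> ball p0 \<rho>) \<pi>"
    have \<psi>: "\<psi> (\<pi> x) = x" if "x \<in> S \<inter> ball p0 \<rho>" for x unfolding \<psi>_def using inj that by (rule inv_into_f_f)
    have \<psi>lip: "2-lipschitz_on E \<psi>"
    proof (rule lipschitz_onI)
      fix a b assume "a \<in> E" "b \<in> E"
      then obtain x y where "a = \<pi> x" "x \<in> S \<inter> ball p0 \<rho>" "b = \<pi> y" "y \<in> S \<inter> ball p0 \<rho>" unfolding E_def by blast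
      then show "dist (\<psi> a) (\<psi> b) \<le> 2 * dist a b" using chart[of x y] \<psi> by simp
    qed simp
    have "E \<noteq> {}" using p0 \<rho> by (auto simp: E_def)
    have \<psi>E: "\<psi> ` E \<subseteq> S" using \<psi> by (auto simp: E_def)
    have "(L * 2)-lipschitz_on E (F \<circ> \<psi>)"
      by (rule lipschitz_on_compose[OF \<psi>lip lipschitz_on_subset[OF F \<psi>E]])
    then obtain h where h: "(L * 2)-lipschitz_on UNIV h" "\<And>a. a \<in> E \<Longrightarrow> h a = (F \<circ> \<psi>) a"
      using mcshane_extension \<open>E \<noteq> {}\<close> by metis
    obtain N where N: "negligible N" "\<And>a. a \<notin> N \<Longrightarrow> h differentiable (at a)" using Rademacher_plane[OF h(1)] by metis
    have "AE p in surface_measure S. p \<notin> \<psi> ` (N \<inter> E)"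
      by (rule AE_surface_measure_null[OF closed_S hausdorff2_null_image[OF \<psi>lip N(1)]])
    then show ?thesis
    proof (rule AE_mp, intro AE_I2 impI)
      fix p assume "p \<in> space (surface_measure S)" and np: "p \<notin> \<psi> ` (N \<inter> E)" and pb: "p \<in> ball p0 \<rho>"
      then have pS: "p \<in> S \<inter> ball p0 \<rho>" by simp
      have "\<pi> p \<notin> N"
      proof
        assume "\<pi> p \<in> N"
        then have "\<psi> (\<pi> p) \<in> \<psi> ` (N \<inter> E)" using pS by (auto simp: E_def)
        then show False using np \<psi>[OF pS] by simp
      qed
      then obtain D where D: "(h has_derivative D) (at (\<pi> p))" using N(2) unfolding differentiable_def by blast
      have \<pi>d: "(\<pi> has_derivative \<pi>) (at p within S)"
      proof -
        have "bounded_linear \<pi>"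
          unfolding \<pi>_def by (rule bounded_linear_Pair) (rule bounded_linear_inner_left)+
        then show ?thesis by (rule bounded_linear_imp_has_derivative)
      qed
      have "((h \<circ> \<pi>) has_derivative (D \<circ> \<pi>)) (at p within S)"
        by (rule diff_chain_within[OF \<pi>d]) (rule has_derivative_at_withinI[OF D])
      then have "(F has_derivative (D \<circ> \<pi>)) (at p within S)"
      proof (rule has_derivative_transform_within)
        show "0 < \<rho> - dist p0 p" using pb by simp
        show "p \<in> S" using pS by simp
        fix x assume x: "x \<in> S" "dist x p < \<rho> - dist p0 p"
        then have "x \<in> S \<inter> ball p0 \<rho>" using dist_triangle[of p0 x p] by (simp add: dist_commute)
        then show "(h \<circ> \<pi>) x = F x" using h(2)[of "\<pi> x"] \<psi>[of x] by (simp add: E_def)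
      qed
      then show "F differentiable (at p within S)" by (rule differentiableI)
    qed
  qed
  have "S \<subseteq> \<Union> ((\<lambda>p. ball p \<rho>) ` S)" using \<rho> by auto
  then obtain T where T: "T \<subseteq> S" "finite T" "S \<subseteq> \<Union> ((\<lambda>p. ball p \<rho>) ` T)"
    using compactE_image[OF compact_S[OF m], of S "\<lambda>p. ball p \<rho>"] by (metis open_ball)
  have "AE p in surface_measure S. \<forall>p0\<in>T. p \<in> ball p0 \<rho> \<longrightarrow> F differentiable (at p within S)"
    using T(1) by (intro AE_finite_allI T(2) local) auto
  then show ?thesis by (rule AE_mp) (use T(3) in \<open>auto intro!: AE_I2\<close>)
qed

lemma rademacher_surface:
  fixes F :: "space3 \<Rightarrow> 'b::euclidean_space"
  assumes m: "m > 0" and F: "L-lipschitz_on S F"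
  shows "AE p in surface_measure S. F differentiable (at p within S)"
proof -
  have "L-lipschitz_on S (\<lambda>x. F x \<bullet> b)" if b: "b \<in> Basis" for b
  proof (rule lipschitz_onI)
    show "0 \<le> L" using F by (rule lipschitz_on_nonneg)
    fix x y assume xy: "x \<in> S" "y \<in> S"
    have "dist (F x \<bullet> b) (F y \<bullet> b) = \<bar>(F x - F y) \<bullet> b\<bar>" by (simp add: dist_real_def inner_diff_left)
    also have "\<dots> \<le> dist (F x) (F y)" using Basis_le_norm[OF b] by (simp add: dist_norm)
    also have "\<dots> \<le> L * dist x y" by (rule lipschitz_onD[OF F xy])
    finally show "dist (F x \<bullet> b) (F y \<bullet> b) \<le> L * dist x y" .
  qed
  then have "AE p in surface_measure S. \<forall>b\<in>Basis. (\<lambda>x. F x \<bullet> b) differentiable (at p within S)"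
    by (intro AE_finite_allI finite_Basis rademacher_surface_real[OF m])
  then show ?thesis unfolding differentiable_componentwise_within[of F] .
qed

end

locale near_id =
  fixes \<epsilon> :: real and \<Phi> :: "space3 \<Rightarrow> space3" and A :: "space3 \<Rightarrow> space3 \<Rightarrow> space3"
  assumes near: "near_identity \<epsilon> \<Phi> A" and eps: "\<epsilon> \<le> 1 / 2"
begin

lemma lin: "linear (A y)" and A_near: "norm (A y v - v) \<le> \<epsilon> * norm v" and \<Phi>_near: "norm (\<Phi> x - x) \<le> \<epsilon>"
  using near unfolding near_identity_def by blast+

lemma eps_nonneg: "0 \<le> \<epsilon>" using \<Phi>_near[of 0] norm_ge_zero order_trans by blast

lemma der: "(\<Phi> has_derivative A y) (at y)"
proof -
  obtain Q where Q: "\<And>x y. norm (\<Phi> x - \<Phi> y - A y (x - y)) \<le> Q * (norm (x - y))\<^sup>2"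
    using near unfolding near_identity_def by blast
  show ?thesis by (rule quad_has_derivative[OF _ Q]) (use lin in \<open>simp add: linear_conv_bounded_linear\<close>)
qed

lemma A_lipschitz: "\<exists>\<Lambda>. \<forall>x y v. norm (A x v - A y v) \<le> \<Lambda> * norm (x - y) * norm v"
proof -
  obtain Q where Q: "\<And>x y. norm (\<Phi> x - \<Phi> y - A y (x - y)) \<le> Q * (norm (x - y))\<^sup>2"
    using near unfolding near_identity_def by blast
  show ?thesis using quad_derivative_lipschitz[OF lin Q] by (intro exI[of _ "6 * Q"]) blast
qed

lemma displacement: "norm ((\<Phi> x - x) - (\<Phi> y - y)) \<le> \<epsilon> * norm (x - y)"
proof (rule differentiable_bound[where S=UNIV and f'="\<lambda>x v. A x v - v"])
  fix x
  show "((\<lambda>x. \<Phi> x - x) has_derivative (\<lambda>v. A x v - v)) (at x within UNIV)"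
    by (intro has_derivative_diff has_derivative_ident) (simp add: der)
  show "onorm (\<lambda>v. A x v - v) \<le> \<epsilon>" by (rule onorm_le) (rule A_near)
qed auto

lemma surj: "surj \<Phi>"
proof -
  have "\<exists>x. \<Phi> x = y" for y
  proof -
  have "\<exists>!x. y - (\<Phi> x - x) = x"
  proof (rule banach_fix_type)
    show "\<forall>x z. dist (y - (\<Phi> x - x)) (y - (\<Phi> z - z)) \<le> \<epsilon> * dist x z"
    proof (intro allI)
      fix x z
      have "norm ((y - (\<Phi> x - x)) - (y - (\<Phi> z - z))) = norm ((\<Phi> z - z) - (\<Phi> x - x))" by (simp add: algebra_simps)
      then show "dist (y - (\<Phi> x - x)) (y - (\<Phi> z - z)) \<le> \<epsilon> * dist x z"
        using displacement[of z x] by (simp only: dist_norm norm_minus_commute[of x z])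
    qed
  qed (use eps eps_nonneg in auto)
  then obtain x where "y - (\<Phi> x - x) = x" by blast
  then have "\<Phi> x = y" by (simp add: algebra_simps)
  then show "\<exists>x. \<Phi> x = y" by blast
  qed
  then show ?thesis unfolding surj_def by metis
qed

lemma upper: "norm (\<Phi> x - \<Phi> y) \<le> (1 + 2 * \<epsilon>) * norm (x - y)"
proof -
  have "\<Phi> x - \<Phi> y = ((\<Phi> x - x) - (\<Phi> y - y)) + (x - y)" by simp
  then have "norm (\<Phi> x - \<Phi> y) \<le> \<epsilon> * norm (x - y) + norm (x - y)"
    using displacement[of x y] norm_triangle_ineq[of "(\<Phi> x - x) - (\<Phi> y - y)" "x - y"] by simp
  moreover have "\<epsilon> * norm (x - y) + norm (x - y) \<le> (1 + 2 * \<epsilon>) * norm (x - y)"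
    using eps_nonneg by (simp add: distrib_right)
  ultimately show ?thesis by linarith
qed

lemma lower: "norm (x - y) \<le> (1 + 2 * \<epsilon>) * norm (\<Phi> x - \<Phi> y)"
proof -
  have "(1 - \<epsilon>) * norm (x - y) \<le> norm (\<Phi> x - \<Phi> y)"
  proof -
    have "x - y = (\<Phi> x - \<Phi> y) - ((\<Phi> x - x) - (\<Phi> y - y))" by simp
    then have "norm (x - y) \<le> norm (\<Phi> x - \<Phi> y) + \<epsilon> * norm (x - y)"
      using displacement[of x y] norm_triangle_ineq4[of "\<Phi> x - \<Phi> y" "(\<Phi> x - x) - (\<Phi> y - y)"] by simp
    then show ?thesis by (simp add: left_diff_distrib)
  qed
  then have "(1 + 2 * \<epsilon>) * ((1 - \<epsilon>) * norm (x - y)) \<le> (1 + 2 * \<epsilon>) * norm (\<Phi> x - \<Phi> y)"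
    using eps_nonneg by (intro mult_left_mono) auto
  moreover have "norm (x - y) \<le> (1 + 2 * \<epsilon>) * ((1 - \<epsilon>) * norm (x - y))"
  proof -
    have "2 * \<epsilon> * \<epsilon> \<le> 2 * \<epsilon> * (1 / 2)" using eps eps_nonneg by (intro mult_left_mono) auto
    then have "1 \<le> (1 + 2 * \<epsilon>) * (1 - \<epsilon>)" by (simp add: algebra_simps)
    then have "1 * norm (x - y) \<le> ((1 + 2 * \<epsilon>) * (1 - \<epsilon>)) * norm (x - y)" by (rule mult_right_mono) simp
    then show ?thesis by (simp only: mult.assoc mult_1_left)
  qed
  ultimately show ?thesis by linarith
qed

lemma bij: "bij \<Phi>"
proof (rule bijI[OF injI surj])
  fix x y assume "\<Phi> x = \<Phi> y" then show "x = y" using lower[of x y] by simp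
qed

lemma homeomorphism: "homeomorphism UNIV UNIV \<Phi> (inv \<Phi>)"
proof -
  have c: "continuous_on UNIV \<Phi>"
    by (rule lipschitz_on_continuous_on[of "1 + 2 * \<epsilon>"])
      (use eps_nonneg upper in \<open>auto intro!: lipschitz_onI simp: dist_norm\<close>)
  have "(1 + 2 * \<epsilon>)-lipschitz_on UNIV (inv \<Phi>)"
  proof (rule lipschitz_onI)
    fix x y
    show "dist (inv \<Phi> x) (inv \<Phi> y) \<le> (1 + 2 * \<epsilon>) * dist x y"
      using lower[of "inv \<Phi> x" "inv \<Phi> y"] by (simp add: dist_norm surj_f_inv_f[OF surj])
  qed (use eps_nonneg in simp)
  then have "continuous_on UNIV (inv \<Phi>)" by (rule lipschitz_on_continuous_on)
  with c show ?thesis using bij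
    by (auto intro!: homeomorphismI simp: bij_is_inj bij_is_surj surj_f_inv_f)
qed

lemma bilipschitz:
  assumes "closed S0" "closed S" "\<Phi> ` S0 = S"
  shows "bilipschitz S0 S \<Phi> (1 + 2 * \<epsilon>)"
  by (unfold_locales)
    (use assms eps_nonneg upper lower homeomorphism in \<open>auto simp: homeomorphism_def\<close>)

end

definition cofactor :: "(space3 \<Rightarrow> space3) \<Rightarrow> space3 \<Rightarrow> space3" where
  "cofactor T w = vector [cross3 (T (axis 2 1)) (T (axis 3 1)) \<bullet> w,
     cross3 (T (axis 3 1)) (T (axis 1 1)) \<bullet> w, cross3 (T (axis 1 1)) (T (axis 2 1)) \<bullet> w]"

lemma linear_axis_expansion:
  fixes T :: "space3 \<Rightarrow> 'b::real_vector"
  assumes "linear T"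
  shows "T u = (u $ 1) *\<^sub>R T (axis 1 1) + (u $ 2) *\<^sub>R T (axis 2 1) + (u $ 3) *\<^sub>R T (axis 3 1)"
proof -
  have "u = (u $ 1) *\<^sub>R axis 1 1 + (u $ 2) *\<^sub>R axis 2 1 + (u $ 3) *\<^sub>R axis 3 1"
    by (simp add: vec_eq_iff forall_3 axis_def)
  then have "T u = T ((u $ 1) *\<^sub>R axis 1 1 + (u $ 2) *\<^sub>R axis 2 1 + (u $ 3) *\<^sub>R axis 3 1)" by (rule arg_cong)
  then show ?thesis by (simp add: linear_add[OF assms] linear_scale[OF assms])
qed

lemma cofactor_cross:
  assumes "linear T"
  shows "cofactor T w \<bullet> cross3 u v = cross3 (T u) (T v) \<bullet> w"
proof -
  define a b c where "a = T (axis 1 1)" and "b = T (axis 2 1)" and "c = T (axis 3 1)"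
  have T: "T x = (x $ 1) *\<^sub>R a + (x $ 2) *\<^sub>R b + (x $ 3) *\<^sub>R c" for x
    unfolding a_def b_def c_def by (rule linear_axis_expansion[OF assms])
  have "cross3 (T u) (T v) = (u $ 2 * v $ 3 - u $ 3 * v $ 2) *\<^sub>R cross3 b c
     + (u $ 3 * v $ 1 - u $ 1 * v $ 3) *\<^sub>R cross3 c a + (u $ 1 * v $ 2 - u $ 2 * v $ 1) *\<^sub>R cross3 a b"
    unfolding T by (simp add: vec_eq_iff forall_3 cross3_def algebra_simps)
  moreover have "cofactor T w \<bullet> cross3 u v = (u $ 2 * v $ 3 - u $ 3 * v $ 2) * (cross3 b c \<bullet> w)
     + (u $ 3 * v $ 1 - u $ 1 * v $ 3) * (cross3 c a \<bullet> w) + (u $ 1 * v $ 2 - u $ 2 * v $ 1) * (cross3 a b \<bullet> w)"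
    unfolding cofactor_def a_def b_def c_def inner_vec_def sum_3 by (simp add: cross3_def)
  ultimately show ?thesis by (simp only: inner_add_left inner_scaleR_left)
qed

lemma cross3_diff: "cross3 (x - y) z = cross3 x z - cross3 y z" "cross3 z (x - y) = cross3 z x - cross3 z y"
  by (simp_all add: cross3_simps)

lemma norm_cross3_le: "norm (cross3 a b) \<le> norm a * norm b"
proof -
  have "(norm (cross3 a b))\<^sup>2 \<le> (norm a * norm b)\<^sup>2" using norm_cross_dot[of a b] by (metis le_add_same_cancel1 zero_le_power2)
  then show ?thesis by (rule power2_le_imp_le) simp
qed

lemma cofactor_diff:
  assumes T: "\<And>i. norm (T (axis i 1)) \<le> 2" "\<And>i. norm (T' (axis i 1)) \<le> 2"
    and a: "\<And>i. norm (T (axis i 1) - T' (axis i 1)) \<le> a" and w: "norm w \<le> M" "norm (w - w') \<le> b"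
  shows "norm (cofactor T w - cofactor T' w') \<le> 12 * (a * M + b)"
proof -
  have comp: "\<bar>cross3 x y \<bullet> w - cross3 x' y' \<bullet> w'\<bar> \<le> 4 * (a * M + b)"
    if "norm x' \<le> 2" "norm y \<le> 2" "norm y' \<le> 2" "norm (x - x') \<le> a" "norm (y - y') \<le> a" for x y x' y'
  proof -
    have 0: "0 \<le> a" "0 \<le> M" "0 \<le> b" using that(4) w norm_ge_zero order_trans by blast+
    have "cross3 x y \<bullet> w - cross3 x' y' \<bullet> w' = cross3 (x - x') y \<bullet> w + cross3 x' (y - y') \<bullet> w + cross3 x' y' \<bullet> (w - w')"
      by (simp add: cross3_diff inner_diff_left inner_diff_right)
    moreover have "\<bar>cross3 (x - x') y \<bullet> w\<bar> \<le> (a * 2) * M"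
    proof -
      have "\<bar>cross3 (x - x') y \<bullet> w\<bar> \<le> norm (cross3 (x - x') y) * norm w" by (rule Cauchy_Schwarz_ineq2)
      also have "norm (cross3 (x - x') y) \<le> a * 2" using norm_cross3_le mult_mono[OF that(4,2) 0(1) norm_ge_zero] order_trans by blast
      then have "norm (cross3 (x - x') y) * norm w \<le> (a * 2) * M" using w 0 by (intro mult_mono) auto
      finally show ?thesis .
    qed
    moreover have "\<bar>cross3 x' (y - y') \<bullet> w\<bar> \<le> (2 * a) * M"
    proof -
      have "\<bar>cross3 x' (y - y') \<bullet> w\<bar> \<le> norm (cross3 x' (y - y')) * norm w" by (rule Cauchy_Schwarz_ineq2)
      also have "norm (cross3 x' (y - y')) \<le> 2 * a" using norm_cross3_le mult_mono[OF that(1,5) _ norm_ge_zero] order_trans by fastforce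
      then have "norm (cross3 x' (y - y')) * norm w \<le> (2 * a) * M" using w 0 by (intro mult_mono) auto
      finally show ?thesis .
    qed
    moreover have "\<bar>cross3 x' y' \<bullet> (w - w')\<bar> \<le> (2 * 2) * b"
    proof -
      have "\<bar>cross3 x' y' \<bullet> (w - w')\<bar> \<le> norm (cross3 x' y') * norm (w - w')" by (rule Cauchy_Schwarz_ineq2)
      also have "norm (cross3 x' y') \<le> 2 * 2" using norm_cross3_le mult_mono[OF that(1,3) _ norm_ge_zero] order_trans by fastforce
      then have "norm (cross3 x' y') * norm (w - w') \<le> (2 * 2) * b" using w 0 by (intro mult_mono) auto
      finally show ?thesis .
    qed
    ultimately show ?thesis by (simp add: algebra_simps)
  qed
  have "norm (cofactor T w - cofactor T' w') \<le> (\<Sum>i\<in>UNIV. \<bar>(cofactor T w - cofactor T' w') $ i\<bar>)" by (rule norm_le_l1_cart)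
  also have "\<dots> \<le> 4 * (a * M + b) + 4 * (a * M + b) + 4 * (a * M + b)"
    unfolding sum_3 cofactor_def vector_minus_component vector_3 by (intro add_mono comp T a)
  also have "\<dots> = 12 * (a * M + b)" by simp
  finally show ?thesis .
qed

lemma cofactor_id: "cofactor (\<lambda>v. v) w = w"
  by (simp add: cofactor_def vec_eq_iff forall_3 cross3_def inner_vec_def sum_3 axis_def)

section \<open>The Piola transform\<close>

locale transport = near_id \<epsilon> \<Phi> A + D0: defining K C R m g0 G0 + D: defining K C R m g G
  for \<epsilon> \<Phi> A K C R m g0 G0 g G +
  assumes m_pos: "m > 0" and inter: "intertwines g0 G0 g G \<Phi> A"
begin

abbreviation "S0 \<equiv> {x. g0 x = 0}"
abbreviation "S1 \<equiv> {x. g x = 0}"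

lemma zero_iff: "g (\<Phi> x) = 0 \<longleftrightarrow> g0 x = 0" and neg_iff: "g (\<Phi> x) < 0 \<longleftrightarrow> g0 x < 0"
  and conormal: "g0 x = 0 \<Longrightarrow> G (\<Phi> x) \<bullet> A x v = G0 x \<bullet> v"
  using inter unfolding intertwines_def by blast+

lemma image_zero: "\<Phi> ` S0 = S1"
proof
  show "\<Phi> ` S0 \<subseteq> S1" using zero_iff by auto
  show "S1 \<subseteq> \<Phi> ` S0"
  proof
    fix y assume y: "y \<in> S1"
    have "y = \<Phi> (inv \<Phi> y)" by (simp add: surj_f_inv_f[OF surj])
    moreover have "inv \<Phi> y \<in> S0" using y zero_iff[of "inv \<Phi> y"] by (simp add: surj_f_inv_f[OF surj])
    ultimately show "y \<in> \<Phi> ` S0" by blast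
  qed
qed

sublocale B: bilipschitz S0 S1 \<Phi> "1 + 2 * \<epsilon>"
  by (rule bilipschitz[OF D0.closed_S D.closed_S image_zero])

definition piola :: "(space3 \<Rightarrow> space3) \<Rightarrow> space3 \<Rightarrow> space3" where
  "piola X x = cofactor (A x) (X (\<Phi> x))"

lemma A_axis: "norm (A x (axis i 1)) \<le> 2"
  using A_near[of x "axis i 1"] norm_triangle_ineq2[of "A x (axis i 1)" "axis i 1"] eps by simp

lemma piola_near: "norm (piola X x - X (\<Phi> x)) \<le> 12 * \<epsilon> * norm (X (\<Phi> x))"
proof -
  have "norm (cofactor (A x) (X (\<Phi> x)) - cofactor (\<lambda>v. v) (X (\<Phi> x))) \<le> 12 * (\<epsilon> * norm (X (\<Phi> x)) + 0)"
  proof (rule cofactor_diff)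
    show "norm (A x (axis i 1) - axis i 1) \<le> \<epsilon>" for i using A_near[of x "axis i 1"] by simp
  qed (simp_all add: A_axis)
  then show ?thesis by (simp add: piola_def cofactor_id)
qed

lemma piola_lipschitz:
  assumes X: "L-lipschitz_on S1 X"
  shows "\<exists>L'. L'-lipschitz_on S0 (piola X)"
proof -
  have "compact (X ` S1)" by (rule compact_continuous_image[OF lipschitz_on_continuous_on[OF X] D.compact_S[OF m_pos]])
  then obtain M where M: "M > 0" "\<And>y. g y = 0 \<Longrightarrow> norm (X y) \<le> M"
  proof -
    obtain M where "M > 0" "\<forall>z\<in>X ` S1. norm z \<le> M" using compact_imp_bounded[OF \<open>compact (X ` S1)\<close>] unfolding bounded_pos by blast
    then show ?thesis by (intro that[of M]) auto
  qed
  obtain \<Lambda> where \<Lambda>: "\<And>x y v. norm (A x v - A y v) \<le> \<Lambda> * norm (x - y) * norm v" using A_lipschitz by blast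
  have \<Lambda>0: "0 \<le> \<Lambda>" using order_trans[OF norm_ge_zero \<Lambda>[of "axis 1 1" "axis 1 1" 0]] by simp
  have L0: "0 \<le> L" using X by (rule lipschitz_on_nonneg)
  define L' where "L' = 12 * (\<Lambda> * M + L * (1 + 2 * \<epsilon>))"
  have "L'-lipschitz_on S0 (piola X)"
  proof (rule lipschitz_onI)
    show "0 \<le> L'" using \<Lambda>0 M L0 eps_nonneg by (simp add: L'_def)
    fix x y assume xy: "x \<in> S0" "y \<in> S0"
    have Sx: "\<Phi> x \<in> S1" "\<Phi> y \<in> S1" using xy zero_iff by auto
    have "norm (cofactor (A x) (X (\<Phi> x)) - cofactor (A y) (X (\<Phi> y)))
      \<le> 12 * ((\<Lambda> * norm (x - y)) * M + L * ((1 + 2 * \<epsilon>) * norm (x - y)))"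
    proof (rule cofactor_diff)
      show "norm (A x (axis i 1) - A y (axis i 1)) \<le> \<Lambda> * norm (x - y)" for i using \<Lambda>[of x "axis i 1" y] by simp
      show "norm (X (\<Phi> x)) \<le> M" using M(2) Sx by simp
      have "norm (X (\<Phi> x) - X (\<Phi> y)) \<le> L * norm (\<Phi> x - \<Phi> y)" using lipschitz_onD[OF X Sx] by (simp add: dist_norm)
      also have "\<dots> \<le> L * ((1 + 2 * \<epsilon>) * norm (x - y))" by (intro mult_left_mono upper L0)
      finally show "norm (X (\<Phi> x) - X (\<Phi> y)) \<le> L * ((1 + 2 * \<epsilon>) * norm (x - y))" .
    qed (simp_all add: A_axis)
    then show "dist (piola X x) (piola X y) \<le> L' * dist x y"
      unfolding piola_def L'_def dist_norm by (simp only: algebra_simps)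
  qed
  then show ?thesis by blast
qed

lemma tangent_image:
  assumes x: "g0 x = 0" and v: "G0 x \<bullet> v = 0"
  shows "G (\<Phi> x) \<bullet> A x v = 0"
  using conormal[OF x] v by simp

lemma piola_tangent:
  assumes x: "g0 x = 0" and X: "G (\<Phi> x) \<bullet> X (\<Phi> x) = 0"
  shows "G0 x \<bullet> piola X x = 0"
proof -
  obtain u v where uv: "G0 x \<bullet> u = 0" "G0 x \<bullet> v = 0" "v = cross3 (G0 x) u" "norm u = 1"
    using orthonormal_frame[OF D0.G_unit[OF x]] by metis
  have "cross3 u v = G0 x"
  proof -
    have "u \<bullet> G0 x = 0" "u \<bullet> u = 1" using uv(1,4) by (simp_all add: inner_commute norm_eq_1)
    then show ?thesis unfolding uv(3) Lagrange by simp
  qed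
  then have "piola X x \<bullet> G0 x = cross3 (A x u) (A x v) \<bullet> X (\<Phi> x)"
    unfolding piola_def using cofactor_cross[OF lin] by metis
  moreover have "cross3 (A x u) (A x v) = (G (\<Phi> x) \<bullet> cross3 (A x u) (A x v)) *\<^sub>R G (\<Phi> x)"
    using x zero_iff by (intro cross_orthogonal_parallel D.G_unit tangent_image uv) auto
  then have "cross3 (A x u) (A x v) \<bullet> X (\<Phi> x) = (G (\<Phi> x) \<bullet> cross3 (A x u) (A x v)) * (G (\<Phi> x) \<bullet> X (\<Phi> x))"
    by (metis inner_scaleR_left)
  ultimately show ?thesis using X by (simp add: inner_commute)
qed

lemma piola_regular:
  assumes "regular_tangent_field S1 X"
  shows "regular_tangent_field S0 (piola X)"
proof -
  have "piola X x \<in> tangent_space S0 x" if x: "x \<in> S0" for x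
  proof -
    have "\<Phi> x \<in> S1" using x zero_iff by simp
    moreover from this have "X (\<Phi> x) \<in> tangent_space S1 (\<Phi> x)" using assms by (simp add: regular_tangent_field_def)
    ultimately have "G (\<Phi> x) \<bullet> X (\<Phi> x) = 0" using D.tangent_space_eq[of "\<Phi> x"] by simp
    then show ?thesis using piola_tangent x D0.tangent_space_eq[of x] by simp
  qed
  then show ?thesis using piola_lipschitz assms by (auto simp: regular_tangent_field_def)
qed

end

lemma bounded_bilinear_cross3: "bounded_bilinear cross3"
  by (rule bounded_bilinear.intro)
    (auto simp: cross_add_left cross_add_right cross_mult_left cross_mult_right intro!: exI[of _ 1] norm_cross3_le)

context transport
begin

lemma piola_divergence_at:
  assumes p: "g0 p = 0" and X: "\<And>x. g x = 0 \<Longrightarrow> G x \<bullet> X x = 0" and div: "has_surface_divergence S1 X 0 (\<Phi> p)"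
    and G: "G differentiable (at (\<Phi> p) within S1)" and G0: "G0 differentiable (at p within S0)"
    and A: "\<And>i. (\<lambda>x. A x (axis i 1)) differentiable (at p within S0)"
  shows "has_surface_divergence S0 (piola X) 0 p"
proof -
  define q where "q = \<Phi> p"
  have q: "g q = 0" using p zero_iff by (simp add: q_def)
  define n where "n = G q"
  have n: "norm n = 1" unfolding n_def by (rule D.G_unit[OF q])
  obtain DX d1 d2 where DX: "(X has_derivative DX) (at q within S1)" and d: "norm d1 = 1" "norm d2 = 1" "d1 \<bullet> d2 = 0"
    and sp: "span {d1, d2} = tangent_space S1 q" and tr: "0 = d1 \<bullet> DX d1 + d2 \<bullet> DX d2"
    using div unfolding has_surface_divergence_def q_def by blast
  have sp': "span {d1, d2} = {v. n \<bullet> v = 0}" using sp D.tangent_space_eq[OF q] by (simp add: n_def)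
  obtain H where H: "(G has_derivative H) (at q within S1)" using G by (auto simp: differentiable_def q_def)
  obtain H0 where H0: "(G0 has_derivative H0) (at p within S0)" using G0 by (auto simp: differentiable_def)
  have "\<forall>i. \<exists>B. ((\<lambda>x. A x (axis i 1)) has_derivative B) (at p within S0)" using A by (simp add: differentiable_def)
  then obtain B0 where B0: "\<And>i. ((\<lambda>x. A x (axis i 1)) has_derivative B0 i) (at p within S0)" by metis
  define B where "B = (\<lambda>(v :: space3) w. (v $ 1) *\<^sub>R B0 1 w + (v $ 2) *\<^sub>R B0 2 w + (v $ 3) *\<^sub>R B0 3 w)"
  have B: "((\<lambda>x. A x v) has_derivative B v) (at p within S0)" for v
    unfolding linear_axis_expansion[OF lin, of _ v] B_def by (intro has_derivative_add has_derivative_scaleR_right B0)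
  have X\<Phi>: "((\<lambda>x. F (\<Phi> x)) has_derivative (\<lambda>w. F' (A p w))) (at p within S0)"
    if F: "(F has_derivative F') (at q within S1)" for F F' :: "space3 \<Rightarrow> space3"
  proof -
    have "((F \<circ> \<Phi>) has_derivative (F' \<circ> A p)) (at p within S0)"
    proof (rule diff_chain_within)
      show "(\<Phi> has_derivative A p) (at p within S0)" by (rule has_derivative_at_withinI[OF der])
      show "(F has_derivative F') (at (\<Phi> p) within \<Phi> ` S0)" unfolding image_zero using F by (simp add: q_def)
    qed
    then show ?thesis by (simp add: o_def)
  qed
  define E where "E = (\<lambda>a b w. cross3 (A p a) (A p b) \<bullet> DX (A p w) + (cross3 (A p a) (B b w) + cross3 (B a w) (A p b)) \<bullet> X q)"
  have E: "((\<lambda>x. cross3 (A x a) (A x b) \<bullet> X (\<Phi> x)) has_derivative E a b) (at p within S0)" for a b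
  proof -
    have "((\<lambda>x. cross3 (A x a) (A x b)) has_derivative (\<lambda>w. cross3 (A p a) (B b w) + cross3 (B a w) (A p b))) (at p within S0)"
      by (rule bounded_bilinear.FDERIV[OF bounded_bilinear_cross3 B B])
    from has_derivative_inner[OF this X\<Phi>[OF DX]] show ?thesis by (simp add: E_def q_def)
  qed
  define DP where "DP = (\<lambda>w. E (axis 2 1) (axis 3 1) w *\<^sub>R axis 1 (1::real) + E (axis 3 1) (axis 1 1) w *\<^sub>R axis 2 1
     + E (axis 1 1) (axis 2 1) w *\<^sub>R axis 3 1 :: space3)"
  have DP: "(piola X has_derivative DP) (at p within S0)"
  proof -
    have "piola X = (\<lambda>x. (cross3 (A x (axis 2 1)) (A x (axis 3 1)) \<bullet> X (\<Phi> x)) *\<^sub>R axis 1 (1::real)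
       + (cross3 (A x (axis 3 1)) (A x (axis 1 1)) \<bullet> X (\<Phi> x)) *\<^sub>R axis 2 1
       + (cross3 (A x (axis 1 1)) (A x (axis 2 1)) \<bullet> X (\<Phi> x)) *\<^sub>R axis 3 1)"
      by (simp add: fun_eq_iff piola_def cofactor_def vec_eq_iff forall_3 axis_def)
    then show ?thesis unfolding DP_def by (simp only:) (intro has_derivative_add has_derivative_scaleR_left E)
  qed
  have DPE: "DP w \<bullet> cross3 u v = E u v w" if w: "G0 p \<bullet> w = 0" for u v w
  proof (rule tangent_derivative_unique)
    show "w \<in> tangent_space S0 p" using w D0.tangent_space_eq[OF p] by simp
    show "((\<lambda>x. piola X x \<bullet> cross3 u v) has_derivative (\<lambda>w. DP w \<bullet> cross3 u v)) (at p within S0)"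
      by (rule has_derivative_inner_left[OF DP])
    show "((\<lambda>x. cross3 (A x u) (A x v) \<bullet> X (\<Phi> x)) has_derivative E u v) (at p within S0)" by (rule E)
    show "piola X x \<bullet> cross3 u v = cross3 (A x u) (A x v) \<bullet> X (\<Phi> x)" for x
      unfolding piola_def by (rule cofactor_cross[OF lin])
  qed
  define n0 where "n0 = G0 p"
  have n0: "norm n0 = 1" unfolding n0_def by (rule D0.G_unit[OF p])
  obtain e1 e2 where e: "norm e1 = 1" "norm e2 = 1" "e1 \<bullet> e2 = 0" "n0 \<bullet> e1 = 0" "n0 \<bullet> e2 = 0"
    "e2 = cross3 n0 e1" "e1 = cross3 e2 n0" "span {e1, e2} = {w. n0 \<bullet> w = 0}"
    by (rule orthonormal_frame[OF n0]) (rule that)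
  define f1 f2 \<mu> where "f1 = A p e1" and "f2 = A p e2" and "\<mu> = A p n0"
  have nf: "n \<bullet> f1 = 0" "n \<bullet> f2 = 0"
    unfolding n_def f1_def f2_def q_def by (rule tangent_image[OF p e(4)[unfolded n0_def]], rule tangent_image[OF p e(5)[unfolded n0_def]])
  have n\<mu>: "n \<bullet> \<mu> = 1" unfolding n_def \<mu>_def q_def conormal[OF p] using n0 by (simp add: n0_def norm_eq_1)
  have inj: "inj (A p)"
  proof (rule injI)
    fix x y assume "A p x = A p y"
    then have "A p (x - y) = 0" by (simp add: linear_diff[OF lin])
    then have "norm (x - y) \<le> \<epsilon> * norm (x - y)" using A_near[of p "x - y"] by (simp add: norm_minus_commute)
    also have "\<dots> \<le> 1 / 2 * norm (x - y)" using eps by (intro mult_right_mono) auto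
    finally show "x = y" by simp
  qed
  have surjA: "\<exists>x. A p x = y" for y
  proof -
    obtain x where "y = A p x" using surjD[OF linear_injective_imp_surjective[OF lin inj]] by blast
    then show ?thesis by (intro exI[of _ x]) simp
  qed
  have basis: "\<exists>\<alpha> \<beta>. y = \<alpha> *\<^sub>R f1 + \<beta> *\<^sub>R f2" if y: "n \<bullet> y = 0" for y
  proof -
    obtain x where x: "A p x = y" using surjA by blast
    have "n0 \<bullet> x = 0" using conormal[OF p, of x] y x by (simp add: n_def q_def n0_def)
    then have "x \<in> span {e1, e2}" using e(8) by simp
    then obtain \<alpha> \<beta> where "x = \<alpha> *\<^sub>R e1 + \<beta> *\<^sub>R e2" by (auto simp: span_insert span_singleton algebra_simps)
    then have "y = \<alpha> *\<^sub>R f1 + \<beta> *\<^sub>R f2" using x by (simp add: f1_def f2_def linear_add[OF lin] linear_scale[OF lin])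
    then show ?thesis by blast
  qed
  have unit: "N p' \<bullet> DN v = 0" if "v \<in> tangent_space S p'" "(N has_derivative DN) (at p' within S)" "\<And>x. x \<in> S \<Longrightarrow> norm (N x) = 1"
    for N DN v S and p' :: space3
  proof -
    have "N p' \<bullet> DN v + DN v \<bullet> N p' = 0"
    proof (rule tangent_derivative_unique[OF that(1) has_derivative_inner[OF that(2) that(2)]])
      show "((\<lambda>x. 1) has_derivative (\<lambda>v. 0)) (at p' within S)" by (rule has_derivative_const)
      show "N x \<bullet> N x = 1" if "x \<in> S" for x using \<open>\<And>x. x \<in> S \<Longrightarrow> norm (N x) = 1\<close>[OF that] by (simp add: norm_eq_1)
    qed
    then show ?thesis by (simp add: inner_commute)
  qed
  have Hn: "H v \<bullet> n = 0" if "n \<bullet> v = 0" for v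
    using unit[OF _ H, of v] that D.tangent_space_eq[OF q] D.G_unit by (simp add: n_def inner_commute)
  have H0n: "H0 v \<bullet> n0 = 0" if "n0 \<bullet> v = 0" for v
    using unit[OF _ H0, of v] that D0.tangent_space_eq[OF p] D0.G_unit by (simp add: n0_def inner_commute)
  have nY: "n \<bullet> DX v = - (H v \<bullet> X q)" if v: "n \<bullet> v = 0" for v
  proof -
    have "G q \<bullet> DX v + H v \<bullet> X q = 0"
    proof (rule tangent_derivative_unique[OF _ has_derivative_inner[OF H DX]])
      show "v \<in> tangent_space S1 q" using v D.tangent_space_eq[OF q] by (simp add: n_def)
      show "((\<lambda>x. 0) has_derivative (\<lambda>v. 0)) (at q within S1)" by (rule has_derivative_const)
      show "G x \<bullet> X x = 0" if "x \<in> S1" for x using X that by simp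
    qed
    then show ?thesis by (simp add: n_def)
  qed
  have nB: "n \<bullet> B n0 v = - (H (A p v) \<bullet> \<mu>)" if v: "n0 \<bullet> v = 0" for v
  proof -
    have "G (\<Phi> p) \<bullet> B n0 v + H (A p v) \<bullet> A p n0 = H0 v \<bullet> n0"
    proof (rule tangent_derivative_unique[OF _ has_derivative_inner[OF X\<Phi>[OF H] B] has_derivative_inner_left[OF H0]])
      show "v \<in> tangent_space S0 p" using v D0.tangent_space_eq[OF p] by (simp add: n0_def)
      show "G (\<Phi> x) \<bullet> A x n0 = G0 x \<bullet> n0" if "x \<in> S0" for x using conormal that by simp
    qed
    then show ?thesis using H0n[OF v] by (simp add: n_def q_def \<mu>_def)
  qed
  have Hsym: "H f1 \<bullet> f2 = H f2 \<bullet> f1"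
  proof (rule D.tangential_symmetry[OF q D.der, where u=f2 and v=f1 and Du="\<lambda>v. H v \<bullet> f2" and Dv="\<lambda>v. H v \<bullet> f1"])
    show "norm (G x \<bullet> w - G y \<bullet> w) \<le> (6 * K) * norm (x - y) * norm w" for x y w
    proof -
      have "norm (G x \<bullet> w - G y \<bullet> w) \<le> norm (G x - G y) * norm w"
        using Cauchy_Schwarz_ineq2[of "G x - G y" w] by (simp add: inner_diff_left)
      also have "\<dots> \<le> (6 * K * norm (x - y)) * norm w" by (intro mult_right_mono D.G_lipschitz) simp
      finally show ?thesis .
    qed
    show "((\<lambda>x. G x \<bullet> f2) has_derivative (\<lambda>v. H v \<bullet> f2)) (at q within S1)" by (rule has_derivative_inner_left[OF H])
    show "((\<lambda>x. G x \<bullet> f1) has_derivative (\<lambda>v. H v \<bullet> f1)) (at q within S1)" by (rule has_derivative_inner_left[OF H])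
  qed (use nf in \<open>simp_all add: n_def\<close>)
  obtain \<Lambda> where \<Lambda>: "\<And>x y v. norm (A x v - A y v) \<le> \<Lambda> * norm (x - y) * norm v" using A_lipschitz by blast
  have Bsym: "B e1 e2 = B e2 e1"
    by (rule D0.tangential_symmetry[OF p der \<Lambda> _ _ B B]) (use e(4,5) in \<open>simp_all add: n0_def\<close>)
  obtain l k where lk: "\<mu> - n = l *\<^sub>R f1 + k *\<^sub>R f2"
    using basis[of "\<mu> - n"] n\<mu> n by (auto simp: inner_diff_right norm_eq_1)
  have "n \<bullet> X q = 0" using X[OF q] by (simp add: n_def)
  then obtain \<alpha> \<beta> where Xq: "X q = \<alpha> *\<^sub>R f1 + \<beta> *\<^sub>R f2" using basis by blast
  have DXlin: "linear DX" using DX by (rule has_derivative_linear)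
  have "(cross3 (B e2 e1) \<mu> + cross3 f2 (B n0 e1)) \<bullet> X q + cross3 f2 \<mu> \<bullet> DX f1
     + ((cross3 (B n0 e2) f1 + cross3 \<mu> (B e2 e1)) \<bullet> X q + cross3 \<mu> f1 \<bullet> DX f2) = 0"
  proof (rule piola_divergence_algebra[where n=n and ?H1.0="H f1" and ?H2.0="H f2", OF n nf _ Xq])
    show "\<mu> = n + l *\<^sub>R f1 + k *\<^sub>R f2" using lk by (simp add: algebra_simps)
    show "H f1 \<bullet> n = 0" "H f2 \<bullet> n = 0" using Hn nf by auto
    show "n \<bullet> DX f1 = - (H f1 \<bullet> X q)" "n \<bullet> DX f2 = - (H f2 \<bullet> X q)" using nY nf by auto
    show "n \<bullet> (\<alpha> *\<^sub>R B n0 e1 + \<beta> *\<^sub>R B n0 e2) = - ((\<alpha> *\<^sub>R H f1 + \<beta> *\<^sub>R H f2) \<bullet> \<mu>)"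
      using nB[OF e(4)] nB[OF e(5)] by (simp add: inner_add_right inner_add_left f1_def f2_def)
    have "d1 \<in> span {d1, d2}" "d2 \<in> span {d1, d2}" by (simp_all add: span_base)
    then have "n \<bullet> d1 = 0" "n \<bullet> d2 = 0" unfolding sp' by simp_all
    then show "cross3 f2 n \<bullet> DX f1 + cross3 n f1 \<bullet> DX f2 = 0"
      using nf sp' tr by (intro trace_basis_change[OF d n _ _ _ _ DXlin]) auto
  qed (rule Hsym)
  moreover have "e1 \<bullet> DP e1 = E e2 n0 e1"
    using DPE[of e1 e2 n0] e(4,7) by (simp add: n0_def inner_commute)
  moreover have "e2 \<bullet> DP e2 = E n0 e1 e2"
    using DPE[of e2 n0 e1] e(5,6) by (simp add: n0_def inner_commute)
  ultimately have "0 = e1 \<bullet> DP e1 + e2 \<bullet> DP e2"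
    using Bsym by (simp add: E_def f1_def f2_def \<mu>_def inner_add_left)
  then show ?thesis
    unfolding has_surface_divergence_def
    using DP e(1-3) e(8) D0.tangent_space_eq[OF p] n0_def by blast
qed

lemma piola_divergence_free:
  assumes X: "regular_tangent_field S1 X" "divergence_free S1 X"
  shows "divergence_free S0 (piola X)"
proof -
  have Xt: "G x \<bullet> X x = 0" if "g x = 0" for x
    using X(1) that D.tangent_space_eq[OF that] by (auto simp: regular_tangent_field_def)
  obtain \<Lambda> where \<Lambda>: "\<And>x y v. norm (A x v - A y v) \<le> \<Lambda> * norm (x - y) * norm v" using A_lipschitz by blast
  have Ai: "AE p in surface_measure S0. (\<lambda>x. A x (axis i 1)) differentiable (at p within S0)" for i
  proof (rule D0.rademacher_surface[OF m_pos, where L="\<bar>\<Lambda>\<bar>"], rule lipschitz_onI)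
    fix x y
    have "norm (A x (axis i 1) - A y (axis i 1)) \<le> \<Lambda> * norm (x - y)" using \<Lambda>[of x "axis i 1" y] by simp
    also have "\<dots> \<le> \<bar>\<Lambda>\<bar> * norm (x - y)" by (intro mult_right_mono) auto
    finally show "dist (A x (axis i 1)) (A y (axis i 1)) \<le> \<bar>\<Lambda>\<bar> * dist x y" by (simp add: dist_norm)
  qed simp
  have "AE p in surface_measure S0. \<forall>i\<in>UNIV. (\<lambda>x. A x (axis i 1)) differentiable (at p within S0)"
    by (intro AE_finite_allI Ai) simp
  moreover have "AE p in surface_measure S0. G0 differentiable (at p within S0)"
    by (rule D0.rademacher_surface[OF m_pos, where L="6 * K"], rule lipschitz_onI)
      (use D0.G_lipschitz D0.K_nonneg in \<open>auto simp: dist_norm\<close>)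
  moreover have "AE p in surface_measure S0. G differentiable (at (\<Phi> p) within S1)"
  proof (rule B.AE_pullback)
    show "AE p in surface_measure S1. G differentiable (at p within S1)"
    by (rule D.rademacher_surface[OF m_pos, where L="6 * K"], rule lipschitz_onI)
      (use D.G_lipschitz D.K_nonneg in \<open>auto simp: dist_norm\<close>)
  qed
  moreover have "AE p in surface_measure S0. has_surface_divergence S1 X 0 (\<Phi> p)"
    using X(2) unfolding divergence_free_def by (rule B.AE_pullback)
  moreover have "AE p in surface_measure S0. p \<in> S0" using AE_space[of "surface_measure S0"] by simp
  ultimately show ?thesis
    unfolding divergence_free_def
  proof eventually_elim
    case (elim p)
    show ?case
    proof (rule piola_divergence_at)
      show "g0 p = 0" using elim(5) by simp
      show "(\<lambda>x. A x (axis i 1)) differentiable at p within S0" for i using elim(1) by blast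
    qed (use elim Xt in auto)
  qed
qed

end

section \<open>Limits of admissible surfaces\<close>

lemma infdist_differentiable_between:
  fixes x :: "'a::euclidean_space"
  assumes a: "a \<in> S" "dist x a = infdist x S" "0 < infdist x S"
    and z: "infdist z S = infdist x S + dist x z" "x \<noteq> z"
  shows "(\<lambda>y. infdist y S) differentiable (at x)"
proof -
  define t where "t = infdist x S"
  define n where "n = (x - a) /\<^sub>R t"
  have t: "t > 0" "norm (x - a) = t" using a by (auto simp: t_def dist_norm)
  have eq: "norm ((z - x) + (x - a)) = norm (z - x) + norm (x - a)"
  proof (rule antisym[OF norm_triangle_ineq])
    have "infdist z S \<le> dist z a" by (rule infdist_le[OF a(1)])
    then show "norm (z - x) + norm (x - a) \<le> norm ((z - x) + (x - a))"
      using z(1) t by (simp add: t_def dist_norm norm_minus_commute)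
  qed
  then have par: "norm (z - x) *\<^sub>R (x - a) = norm (x - a) *\<^sub>R (z - x)" by (simp only: norm_triangle_eq)
  have zx: "norm (z - x) > 0" using z(2) by simp
  have n': "n = (z - x) /\<^sub>R norm (z - x)"
  proof -
    have "(z - x) /\<^sub>R norm (z - x) = (norm (x - a) *\<^sub>R (z - x)) /\<^sub>R (t * norm (z - x))" using t by simp
    also have "\<dots> = (norm (z - x) *\<^sub>R (x - a)) /\<^sub>R (t * norm (z - x))" by (simp only: par)
    also have "\<dots> = n" using zx by (simp add: n_def)
    finally show ?thesis by simp
  qed
  have norm_der: "((\<lambda>y. norm (y - b)) has_derivative (\<lambda>v. v \<bullet> sgn (x - b))) (at x)" if "x \<noteq> b" for b
  proof -
    have "(norm has_derivative (\<lambda>v. v \<bullet> sgn (x - b))) (at (x - b))"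
      using has_derivative_norm[of "x - b"] that by simp
    moreover have "((\<lambda>y. y - b) has_derivative (\<lambda>v. v)) (at x)" by (auto intro!: derivative_eq_intros)
    ultimately have "(norm \<circ> (\<lambda>y. y - b) has_derivative (\<lambda>v. v \<bullet> sgn (x - b)) \<circ> (\<lambda>v. v)) (at x)"
      by (intro diff_chain_at)
    then show ?thesis by (simp only: o_def)
  qed
  have up: "((\<lambda>y. norm (y - a)) has_derivative (\<lambda>v. n \<bullet> v)) (at x)"
  proof -
    have "((\<lambda>y. norm (y - a)) has_derivative (\<lambda>v. v \<bullet> sgn (x - a))) (at x)"
      by (rule norm_der) (use t in auto)
    then show ?thesis using t by (simp add: sgn_div_norm n_def inner_commute)
  qed
  have lo: "((\<lambda>y. infdist z S - norm (y - z)) has_derivative (\<lambda>v. n \<bullet> v)) (at x)"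
  proof -
    have "((\<lambda>y. infdist z S - norm (y - z)) has_derivative (\<lambda>v. 0 - v \<bullet> sgn (x - z))) (at x)"
      by (intro has_derivative_diff has_derivative_const norm_der z(2))
    moreover have "0 - v \<bullet> sgn (x - z) = n \<bullet> v" for v
    proof -
      have "sgn (z - x) = - sgn (x - z)" using sgn_minus[of "x - z"] by simp
      then show ?thesis unfolding n' sgn_div_norm[symmetric] by (simp add: inner_commute)
    qed
    ultimately show ?thesis by simp
  qed
  have "((\<lambda>y. infdist y S) has_derivative (\<lambda>v. n \<bullet> v)) (at x)"
    unfolding has_derivative_at_alt
  proof (intro conjI allI impI)
    show "bounded_linear ((\<bullet>) n)" by (rule bounded_linear_inner_right)
    fix e :: real assume e: "0 < e"
    obtain d1 where d1: "d1 > 0" "\<And>y. norm (y - x) < d1 \<Longrightarrow> norm (norm (y - a) - norm (x - a) - n \<bullet> (y - x)) \<le> e * norm (y - x)"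
      using up e unfolding has_derivative_at_alt by blast
    obtain d2 where d2: "d2 > 0" "\<And>y. norm (y - x) < d2 \<Longrightarrow>
        norm (infdist z S - norm (y - z) - (infdist z S - norm (x - z)) - n \<bullet> (y - x)) \<le> e * norm (y - x)"
      using lo e unfolding has_derivative_at_alt by blast
    have "norm (infdist y S - infdist x S - n \<bullet> (y - x)) \<le> e * norm (y - x)" if y: "norm (y - x) < min d1 d2" for y
    proof -
      have "infdist y S \<le> norm (y - a)" using infdist_le[OF a(1), of y] by (simp add: dist_norm)
      moreover have "infdist z S - norm (y - z) \<le> infdist y S"
        using infdist_triangle[of z S y] by (simp add: dist_norm norm_minus_commute)
      moreover have "infdist x S = norm (x - a)" "infdist x S = infdist z S - norm (x - z)"
        using a z by (simp_all add: dist_norm)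
      moreover have "\<bar>norm (y - a) - norm (x - a) - n \<bullet> (y - x)\<bar> \<le> e * norm (y - x)" using d1(2)[of y] y by simp
      moreover have "\<bar>infdist z S - norm (y - z) - (infdist z S - norm (x - z)) - n \<bullet> (y - x)\<bar> \<le> e * norm (y - x)" using d2(2)[of y] y by simp
      ultimately show ?thesis unfolding real_norm_def by linarith
    qed
    then show "\<exists>d>0. \<forall>y. norm (y - x) < d \<longrightarrow> norm (infdist y S - infdist x S - n \<bullet> (y - x)) \<le> e * norm (y - x)"
      using d1(1) d2(1) by (intro exI[of _ "min d1 d2"]) simp
  qed
  then show ?thesis by (rule differentiableI)
qed

lemma reach_geI:
  assumes r: "r > 0" and diff: "\<And>x. 0 < infdist x S \<Longrightarrow> infdist x S < r \<Longrightarrow> (\<lambda>y. infdist y S) differentiable (at x)"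
    and S: "S \<noteq> {}"
  shows "reach S \<ge> ereal r"
proof -
  have "(\<lambda>y. infdist y S) differentiable (at x)" if "x \<in> {x. infdist x S < r} - closure S" for x
  proof (rule diff)
    show "0 < infdist x S" using that S infdist_nonneg[of x S] in_closure_iff_infdist_zero[OF S, of x] by (auto simp: less_le)
  qed (use that in simp)
  then show ?thesis unfolding reach_def using r by (intro Sup_upper) auto
qed

lemma reach_limit:
  fixes S0 :: "space3 set"
  assumes r: "r > 0" and S0: "closed S0" "S0 \<noteq> {}"
    and approx: "\<And>e. e > 0 \<Longrightarrow> \<exists>S. closed S \<and> S \<noteq> {} \<and> reach S \<ge> ereal r \<and> (\<forall>y. \<bar>infdist y S - infdist y S0\<bar> \<le> e)"
  shows "reach S0 \<ge> ereal r"
proof (rule reach_geI[OF r _ S0(2)])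
  fix x assume x: "0 < infdist x S0" "infdist x S0 < r"
  define t0 where "t0 = infdist x S0"
  define t where "t = (t0 + r) / 2"
  have t: "0 < t0" "t0 < t" "t < r" using x by (auto simp: t_def t0_def)
  obtain a where a: "a \<in> S0" "dist x a = infdist x S0" using infdist_attains_inf[OF S0, of x] by metis
  have "\<exists>z. dist x z \<le> t - t0 + e \<and> t - e \<le> infdist z S0" if e: "e > 0" for e
  proof -
    define e' where "e' = min e (min (t0 / 2) ((r - t0) / 2))"
    have "0 < e'" "e' \<le> e" "e' \<le> t0 / 2" "e' \<le> (r - t0) / 2"
      using e x by (simp_all add: e'_def t0_def min_less_iff_conj min.coboundedI2 del: le_divide_eq_numeral1 min_divide_distrib_right)
    moreover have "t0 / 2 < t0" "(r - t0) / 2 < r - t0" using t by simp_all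
    ultimately have e': "0 < e'" "e' \<le> e" "e' < t0" "e' < r - t0" by simp_all
    obtain S where S: "closed S" "S \<noteq> {}" "reach S \<ge> ereal r" "\<And>y. \<bar>infdist y S - infdist y S0\<bar> \<le> e'"
      using approx[OF e'(1)] by blast
    define s where "s = infdist x S"
    have s: "0 < s" "s < r" "\<bar>s - t0\<bar> \<le> e'" using S(4)[of x] e' by (auto simp: s_def t0_def)
    obtain b where b: "b \<in> S" "infdist x S = dist x b" using infdist_attains_inf[OF S(1,2), of x] by blast
    define n where "n = (x - b) /\<^sub>R s"
    have n: "norm n = 1" "b + s *\<^sub>R n = x" using b s by (auto simp: n_def s_def dist_norm)
    have "infdist (b + t *\<^sub>R n) S = t"
    proof (rule infdist_ray[OF S(1,2) _ b(1) n(1) _ s(1)])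
      show "(\<lambda>y. infdist y S) differentiable (at y)" if "0 < infdist y S" "infdist y S < r" for y
        by (rule reach_differentiable[OF S(3,1) that])
      show "infdist (b + s *\<^sub>R n) S = s" unfolding n(2) by (simp add: s_def)
    qed (use t in auto)
    moreover have "dist x (b + t *\<^sub>R n) \<le> t - t0 + e"
    proof -
      have "x - (b + t *\<^sub>R n) = (s - t) *\<^sub>R n" using n(2) by (simp add: scaleR_diff_left algebra_simps)
      then have "dist x (b + t *\<^sub>R n) = \<bar>s - t\<bar>" using n(1) by (simp add: dist_norm)
      moreover have "\<bar>s - t\<bar> \<le> t - t0 + e" using s(3) e' t by linarith
      ultimately show ?thesis by simp
    qed
    ultimately show ?thesis using S(4)[of "b + t *\<^sub>R n"] e'(2) by (intro exI[of _ "b + t *\<^sub>R n"]) linarith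
  qed
  then have "\<forall>k. \<exists>z. dist x z \<le> t - t0 + 1 / real (Suc k) \<and> t - 1 / real (Suc k) \<le> infdist z S0" by simp
  then obtain z where z: "\<And>k. dist x (z k) \<le> t - t0 + 1 / real (Suc k)" "\<And>k. t - 1 / real (Suc k) \<le> infdist (z k) S0"
    by metis
  have "z k \<in> cball x (t - t0 + 1)" for k
  proof -
    have "1 / real (Suc k) \<le> 1" by simp
    then have "dist x (z k) \<le> t - t0 + 1" using z(1)[of k] by linarith
    then show ?thesis by simp
  qed
  then obtain l \<rho> where l: "strict_mono (\<rho> :: nat \<Rightarrow> nat)" "(z \<circ> \<rho>) \<longlonglongrightarrow> l"
    using compact_cball[of x "t - t0 + 1"] unfolding compact_def by meson
  have h: "(\<lambda>k. 1 / real (Suc (\<rho> k))) \<longlonglongrightarrow> 0"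
    using LIMSEQ_subseq_LIMSEQ[OF LIMSEQ_Suc[OF lim_1_over_n] l(1)] by (simp add: o_def)
  have 1: "dist x l \<le> t - t0"
  proof (rule LIMSEQ_le)
    show "(\<lambda>k. dist x (z (\<rho> k))) \<longlonglongrightarrow> dist x l" using l(2) by (intro tendsto_intros) (simp add: o_def)
    show "(\<lambda>k. t - t0 + 1 / real (Suc (\<rho> k))) \<longlonglongrightarrow> t - t0" using tendsto_add[OF tendsto_const h, of "t - t0"] by simp
  qed (use z(1) in blast)
  have 2: "t \<le> infdist l S0"
  proof (rule LIMSEQ_le)
    show "(\<lambda>k. infdist (z (\<rho> k)) S0) \<longlonglongrightarrow> infdist l S0" using l(2) by (intro tendsto_infdist) (simp add: o_def)
    show "(\<lambda>k. t - 1 / real (Suc (\<rho> k))) \<longlonglongrightarrow> t" using tendsto_diff[OF tendsto_const h, of t] by simp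
  qed (use z(2) in blast)
  have 3: "infdist l S0 \<le> t0 + dist x l" using infdist_triangle[of l S0 x] by (simp add: t0_def dist_commute)
  show "(\<lambda>y. infdist y S0) differentiable (at x)"
  proof (rule infdist_differentiable_between[OF a x(1)])
    show "infdist l S0 = infdist x S0 + dist x l" using 1 2 3 by (simp add: t0_def)
    show "x \<noteq> l" using 2 t by (auto simp: t0_def)
  qed
qed

context defining
begin

lemma embedded_surface_zero_set: "embedded_surface C11_on {x. g x = 0}"
  unfolding embedded_surface_def
proof (intro ballI)
  fix p assume "p \<in> {x. g x = 0}"
  then have p: "g p = 0" by simp
  have Glip: "(6 * K)-lipschitz_on U G" for U
    by (rule lipschitz_onI) (use G_lipschitz K_nonneg in \<open>auto simp: dist_norm\<close>)
  define U where "U = {x. G x \<noteq> 0}"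
  have "open U"
  proof -
    have "open (G -` (- {0}))" using lipschitz_on_continuous_on[OF Glip[of UNIV]] open_vimage by blast
    then show ?thesis by (simp add: U_def vimage_def)
  qed
  moreover have "p \<in> U" using G_unit[OF p] by (auto simp: U_def)
  moreover have "C11_on g U" unfolding C11_on_def using gderiv Glip by blast
  moreover have "\<forall>x\<in>U. \<not> (GDERIV g x :> 0)"
  proof
    fix x assume x: "x \<in> U"
    show "\<not> (GDERIV g x :> 0)"
    proof
      assume "GDERIV g x :> 0"
      then have "(g has_derivative (\<lambda>h. h \<bullet> 0)) (at x)" by (simp only: gderiv_def)
      from has_derivative_unique[OF this der] have "(\<lambda>h. h \<bullet> 0) = (\<lambda>v. G x \<bullet> v)" .
      from fun_cong[OF this, of "G x"] have "G x = 0" by simp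
      then show False using x by (simp add: U_def)
    qed
  qed
  ultimately show "\<exists>U f. open U \<and> p \<in> U \<and> C11_on f U \<and> (\<forall>x\<in>U. \<not> (GDERIV f x :> 0)) \<and> {x. g x = 0} \<inter> U = {x \<in> U. f x = 0}"
    by (intro exI[of _ U] exI[of _ g]) auto
qed

lemma frontier_negative: "frontier {x. g x < 0} = {x. g x = 0}"
proof -
  have op: "open {x. g x < 0}" using g_continuous[of UNIV] by (intro open_Collect_less) auto
  have cl: "closed {x. g x \<le> 0}" using g_continuous[of UNIV] by (intro closed_Collect_le) auto
  have "closure {x. g x < 0} \<subseteq> {x. g x \<le> 0}" by (rule closure_minimal[OF _ cl]) auto
  moreover have "p \<in> closure {x. g x < 0}" if p: "g p = 0" for p
    unfolding closure_approachable
  proof (intro allI impI)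
    fix e :: real assume e: "0 < e"
    define t where "t = min (e / 2) (1 / (2 * (K + 1)))"
    have t: "0 < t" "t < e" using e K_nonneg by (auto simp: t_def min_def add_nonneg_pos)
    have Kt: "K * t < 1"
    proof -
      have "K * t \<le> K * (1 / (2 * (K + 1)))" using K_nonneg by (intro mult_left_mono) (auto simp: t_def)
      also have "\<dots> < 1" using K_nonneg by (simp add: field_simps)
      finally show ?thesis .
    qed
    have n: "norm (G p) = 1" by (rule G_unit[OF p])
    have "\<bar>g (p - t *\<^sub>R G p) - g p - G p \<bullet> (p - t *\<^sub>R G p - p)\<bar> \<le> K * (norm (p - t *\<^sub>R G p - p))\<^sup>2" by (rule quad)
    moreover have "p - t *\<^sub>R G p - p = - (t *\<^sub>R G p)" by simp
    ultimately have "\<bar>g (p - t *\<^sub>R G p) + t\<bar> \<le> (K * t) * t" using p n t by (simp add: norm_eq_1 power2_eq_square)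
    moreover have "(K * t) * t < 1 * t" using Kt t by (intro mult_strict_right_mono) auto
    ultimately have "g (p - t *\<^sub>R G p) < 0" by linarith
    moreover have "dist (p - t *\<^sub>R G p) p < e" using n t by (simp add: dist_norm)
    ultimately show "\<exists>y\<in>{x. g x < 0}. dist y p < e" by blast
  qed
  ultimately show ?thesis unfolding frontier_def interior_open[OF op] by force
qed

end

section \<open>Comparing energies\<close>

lemma BS_kernel_norm:
  assumes "\<delta> > 0" "\<delta> \<le> dist x y"
  shows "norm (BS_kernel x y) \<le> 1 / \<delta>\<^sup>2"
proof -
  define a where "a = norm (x - y)"
  have a: "0 < a" "\<delta> \<le> a" using assms by (auto simp: a_def dist_norm)
  have "norm (BS_kernel x y) = a / a ^ 3" using a by (simp add: BS_kernel_def a_def)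
  also have "\<dots> = 1 / a\<^sup>2" using a by (simp add: power2_eq_square power3_eq_cube)
  also have "\<dots> \<le> 1 / \<delta>\<^sup>2" using assms(1) a by (intro divide_left_mono power_mono) auto
  finally show ?thesis .
qed

lemma BS_kernel_lipschitz:
  assumes \<delta>: "\<delta> > 0" "\<delta> \<le> dist x y" "\<delta> \<le> dist x' y'"
  shows "norm (BS_kernel x y - BS_kernel x' y') \<le> 4 / \<delta> ^ 3 * norm ((x - y) - (x' - y'))"
proof -
  define v w where "v = x - y" and "w = x' - y'"
  define a b where "a = norm v" and "b = norm w"
  have ab: "\<delta> \<le> a" "\<delta> \<le> b" "0 < a" "0 < b" using \<delta> by (auto simp: a_def b_def v_def w_def dist_norm)
  have "1 / a ^ 3 - 1 / b ^ 3 = (b - a) * (1 / (a * b\<^sup>2) + 1 / (a\<^sup>2 * b) + 1 / a ^ 3) / b"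
    using ab by (simp add: field_simps power2_eq_square power3_eq_cube)
  then have "\<bar>1 / a ^ 3 - 1 / b ^ 3\<bar> = \<bar>b - a\<bar> * (1 / (a * b\<^sup>2) + 1 / (a\<^sup>2 * b) + 1 / a ^ 3) / b"
    using ab by (simp add: abs_mult)
  then have eq: "\<bar>1 / a ^ 3 - 1 / b ^ 3\<bar> * b = \<bar>b - a\<bar> * (1 / (a * b\<^sup>2) + 1 / (a\<^sup>2 * b) + 1 / a ^ 3)" using ab by simp
  have p3: "\<delta> * \<delta>\<^sup>2 = \<delta> ^ 3" "\<delta>\<^sup>2 * \<delta> = \<delta> ^ 3" by (simp_all add: power2_eq_square power3_eq_cube)
  have "\<delta> ^ 3 \<le> a * b\<^sup>2" unfolding p3(1)[symmetric] using ab \<delta>(1) by (intro mult_mono power_mono) auto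
  moreover have "\<delta> ^ 3 \<le> a\<^sup>2 * b" unfolding p3(2)[symmetric] using ab \<delta>(1) by (intro mult_mono power_mono) auto
  moreover have "\<delta> ^ 3 \<le> a ^ 3" using ab \<delta>(1) by (intro power_mono) auto
  ultimately have inv: "1 / (a * b\<^sup>2) \<le> 1 / \<delta> ^ 3" "1 / (a\<^sup>2 * b) \<le> 1 / \<delta> ^ 3" "1 / a ^ 3 \<le> 1 / \<delta> ^ 3"
    using \<delta>(1) ab by (simp_all add: frac_le)
  have ba: "\<bar>b - a\<bar> \<le> norm (v - w)" unfolding a_def b_def using norm_triangle_ineq3[of w v] by (simp add: norm_minus_commute)
  have sum3: "1 / (a * b\<^sup>2) + 1 / (a\<^sup>2 * b) + 1 / a ^ 3 \<le> 3 / \<delta> ^ 3" using inv by simp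
  have "BS_kernel x y - BS_kernel x' y' = (1 / a ^ 3) *\<^sub>R (v - w) + (1 / a ^ 3 - 1 / b ^ 3) *\<^sub>R w"
    unfolding BS_kernel_def v_def[symmetric] w_def[symmetric] a_def[symmetric] b_def[symmetric]
    by (simp add: scaleR_diff_left scaleR_diff_right)
  then have "norm (BS_kernel x y - BS_kernel x' y') \<le> 1 / a ^ 3 * norm (v - w) + \<bar>1 / a ^ 3 - 1 / b ^ 3\<bar> * b"
    using ab norm_triangle_ineq[of "(1 / a ^ 3) *\<^sub>R (v - w)" "(1 / a ^ 3 - 1 / b ^ 3) *\<^sub>R w"] by (simp add: b_def)
  also have "\<dots> \<le> 1 / \<delta> ^ 3 * norm (v - w) + norm (v - w) * (3 / \<delta> ^ 3)"
    unfolding eq using inv ba sum3 ab \<delta>(1) by (intro add_mono mult_mono) auto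
  also have "\<dots> = 4 / \<delta> ^ 3 * norm (v - w)" by simp
  finally show ?thesis by (simp add: v_def w_def)
qed

lemma norm_sum_squared_le:
  fixes u v :: "'a::real_inner"
  assumes "\<theta> > 0"
  shows "(norm (u + v))\<^sup>2 \<le> (1 + \<theta>) * (norm u)\<^sup>2 + (1 + 1 / \<theta>) * (norm v)\<^sup>2"
proof -
  have "0 \<le> (norm (\<theta> *\<^sub>R u - v))\<^sup>2 / \<theta>" using assms by simp
  also have "(norm (\<theta> *\<^sub>R u - v))\<^sup>2 = \<theta>\<^sup>2 * (u \<bullet> u) - 2 * \<theta> * (u \<bullet> v) + v \<bullet> v"
    unfolding power2_norm_eq_inner by (simp add: inner_diff_left inner_diff_right inner_commute power2_eq_square algebra_simps)
  also have "\<dots> / \<theta> = \<theta> * (u \<bullet> u) - 2 * (u \<bullet> v) + (v \<bullet> v) / \<theta>" using assms by (simp add: add_divide_distrib diff_divide_distrib power2_eq_square)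
  finally have "2 * (u \<bullet> v) \<le> \<theta> * (u \<bullet> u) + (v \<bullet> v) / \<theta>" by linarith
  moreover have "(norm (u + v))\<^sup>2 = u \<bullet> u + 2 * (u \<bullet> v) + v \<bullet> v"
    by (simp add: power2_norm_eq_inner inner_add_left inner_add_right inner_commute)
  ultimately show ?thesis by (simp add: power2_norm_eq_inner distrib_right)
qed

lemma L2_norm_sq_perturb:
  assumes \<theta>: "\<theta> > 0" and u: "integrable M (\<lambda>p. (norm (u p))\<^sup>2)" and v: "integrable M (\<lambda>p. (b p :: real))"
    and le: "\<And>p. p \<in> space M \<Longrightarrow> (norm (w p - u p))\<^sup>2 \<le> b p"
  shows "L2_norm_sq M w \<le> (1 + \<theta>) * L2_norm_sq M u + (1 + 1 / \<theta>) * (LINT p|M. b p)"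
proof -
  have "L2_norm_sq M w \<le> (LINT p|M. (1 + \<theta>) * (norm (u p))\<^sup>2 + (1 + 1 / \<theta>) * b p)"
    unfolding L2_norm_sq_def
  proof (rule integral_mono')
    show "integrable M (\<lambda>p. (1 + \<theta>) * (norm (u p))\<^sup>2 + (1 + 1 / \<theta>) * b p)" using u v by simp
    fix p assume p: "p \<in> space M"
    have "(norm (w p))\<^sup>2 \<le> (1 + \<theta>) * (norm (u p))\<^sup>2 + (1 + 1 / \<theta>) * (norm (w p - u p))\<^sup>2"
      using norm_sum_squared_le[OF \<theta>, of "u p" "w p - u p"] by simp
    also have "\<dots> \<le> (1 + \<theta>) * (norm (u p))\<^sup>2 + (1 + 1 / \<theta>) * b p"
      using le[OF p] \<theta> by (intro add_left_mono mult_left_mono) auto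
    finally show "(norm (w p))\<^sup>2 \<le> (1 + \<theta>) * (norm (u p))\<^sup>2 + (1 + 1 / \<theta>) * b p" .
    then show "0 \<le> (1 + \<theta>) * (norm (u p))\<^sup>2 + (1 + 1 / \<theta>) * b p" using zero_le_power2 order_trans by blast
  qed
  also have "\<dots> = (1 + \<theta>) * L2_norm_sq M u + (1 + 1 / \<theta>) * (LINT p|M. b p)"
    unfolding L2_norm_sq_def using u v by simp
  finally show ?thesis .
qed

definition energy :: "space3 set \<Rightarrow> (space3 \<Rightarrow> space3) \<Rightarrow> real \<Rightarrow> space3 set \<Rightarrow> (space3 \<Rightarrow> space3) \<Rightarrow> real" where
  "energy P T \<Lambda> S j = L2_norm_sq (lebesgue_on P) (\<lambda>y. BS S j y - T y) + \<Lambda> * L2_norm_sq (surface_measure S) j"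

lemma L2_norm_sq_nonneg: "0 \<le> L2_norm_sq M u"
  unfolding L2_norm_sq_def by (rule integral_nonneg_AE) simp

locale cost_surface =
  fixes P :: "space3 set" and T :: "space3 \<Rightarrow> space3" and \<Lambda> \<delta> :: real and S :: "space3 set" and M :: real
  assumes P: "open P" "bounded P" and T: "T \<in> borel_measurable (lebesgue_on P)" "integrable (lebesgue_on P) (\<lambda>y. (norm (T y))\<^sup>2)"
    and \<Lambda>: "\<Lambda> > 0" and \<delta>: "\<delta> > 0"
    and S: "compact S" and M: "hausdorff2 S \<le> ennreal M" "M \<ge> 0"
    and far: "\<And>x y. x \<in> S \<Longrightarrow> y \<in> P \<Longrightarrow> \<delta> \<le> dist x y"
begin

abbreviation "\<mu> \<equiv> surface_measure S"

lemma P_meas: "P \<in> lmeasurable" "P \<in> sets lebesgue"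
  using P by (auto intro: bounded_set_imp_lmeasurable)

lemma emeasure_S: "emeasure \<mu> S \<le> ennreal M"
  using emeasure_surface_measure_le_hausdorff2[OF compact_imp_closed[OF S]] M(1) by (rule order_trans)

lemma finite: "finite_measure \<mu>"
  by (rule finite_measureI) (use emeasure_S in \<open>auto simp: top_unique\<close>)

sublocale finite_measure \<mu> by (rule finite)

lemma measure_S: "measure \<mu> S \<le> M"
  using emeasure_S M(2) unfolding measure_def by (metis enn2real_leI)

lemma sets_eq: "sets \<mu> = sets (restrict_space borel S)"
  using sets_surface_measure[OF compact_imp_closed[OF S]] borel_closed[OF compact_imp_closed[OF S]]
  by (auto simp: sets_restrict_space_iff)

lemma continuous_measurable:
  fixes f :: "space3 \<Rightarrow> 'b::topological_space"
  assumes "continuous_on S f"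
  shows "f \<in> borel_measurable \<mu>"
  using borel_measurable_continuous_on_restrict[OF assms] measurable_cong_sets[OF sets_eq refl] by blast

lemma norm_integrable:
  assumes X: "X \<in> borel_measurable \<mu>" "integrable \<mu> (\<lambda>p. (norm (X p))\<^sup>2)" and \<eta>: "\<eta> > 0"
  shows "integrable \<mu> (\<lambda>p. norm (X p :: space3))" "(LINT p|\<mu>. norm (X p)) \<le> \<eta> * M + L2_norm_sq \<mu> X / \<eta>"
proof -
  have le: "norm (X p) \<le> \<eta> + (norm (X p))\<^sup>2 / \<eta>" for p
  proof (cases "norm (X p) \<le> \<eta>")
    case True then show ?thesis using \<eta> by (simp add: add_increasing2)
  next
    case False
    then have "norm (X p) * \<eta> \<le> norm (X p) * norm (X p)" by (intro mult_left_mono) auto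
    then have "norm (X p) \<le> (norm (X p))\<^sup>2 / \<eta>" using \<eta> by (simp add: pos_le_divide_eq power2_eq_square)
    then show ?thesis using \<eta> by linarith
  qed
  have i: "integrable \<mu> (\<lambda>p. \<eta> + (norm (X p))\<^sup>2 / \<eta>)" using X(2) by simp
  show I: "integrable \<mu> (\<lambda>p. norm (X p))"
  proof (rule Bochner_Integration.integrable_bound[OF i])
    show "(\<lambda>p. norm (X p)) \<in> borel_measurable \<mu>" using X(1) by simp
    show "AE p in \<mu>. norm (norm (X p)) \<le> norm (\<eta> + (norm (X p))\<^sup>2 / \<eta>)" using le \<eta> by (intro AE_I2) (simp add: abs_of_nonneg)
  qed
  have "(LINT p|\<mu>. norm (X p)) \<le> (LINT p|\<mu>. \<eta> + (norm (X p))\<^sup>2 / \<eta>)" by (rule integral_mono[OF I i]) (rule le)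
  also have "\<dots> = \<eta> * measure \<mu> S + L2_norm_sq \<mu> X / \<eta>" using X(2) by (simp add: L2_norm_sq_def)
  also have "\<dots> \<le> \<eta> * M + L2_norm_sq \<mu> X / \<eta>" using measure_S \<eta> by (intro add_right_mono mult_left_mono) auto
  finally show "(LINT p|\<mu>. norm (X p)) \<le> \<eta> * M + L2_norm_sq \<mu> X / \<eta>" .
qed

lemma regular_L2:
  assumes "regular_tangent_field S X"
  shows "X \<in> L2_tangent_fields S"
proof -
  obtain L where "L-lipschitz_on S X" using assms by (auto simp: regular_tangent_field_def)
  then have c: "continuous_on S X" by (rule lipschitz_on_continuous_on)
  obtain B where B: "\<And>p. p \<in> S \<Longrightarrow> norm (X p) \<le> B"
    using compact_imp_bounded[OF compact_continuous_image[OF c S]] unfolding bounded_iff by blast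
  have "integrable \<mu> (\<lambda>p. (norm (X p))\<^sup>2)"
  proof (rule integrable_const_bound[where B="B\<^sup>2"])
    show "AE p in \<mu>. norm ((norm (X p))\<^sup>2) \<le> B\<^sup>2" using B by (intro AE_I2) (auto intro!: power_mono)
    show "(\<lambda>p. (norm (X p))\<^sup>2) \<in> borel_measurable \<mu>" using continuous_measurable[OF c] by simp
  qed
  then show ?thesis
    using continuous_measurable[OF c] assms by (auto simp: L2_tangent_fields_def regular_tangent_field_def)
qed

lemma regular_divfree: "regular_tangent_field S X \<Longrightarrow> divergence_free S X \<Longrightarrow> X \<in> L2_divfree_fields S"
  using regular_L2 by (auto simp: L2_divfree_fields_def L2_norm_sq_def intro!: exI[of _ X])

lemma kernel_continuous: "y \<in> P \<Longrightarrow> continuous_on S (\<lambda>x. BS_kernel x y)"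
  unfolding BS_kernel_def using far \<delta> by (intro continuous_intros) fastforce

lemma cross_integrable:
  assumes X: "X \<in> borel_measurable \<mu>" "integrable \<mu> (\<lambda>p. norm (X p))" and k: "k \<in> borel_measurable \<mu>" "\<And>x. x \<in> S \<Longrightarrow> norm (k x) \<le> B"
  shows "integrable \<mu> (\<lambda>x. cross3 (k x) (X x))" "norm (LINT x|\<mu>. cross3 (k x) (X x)) \<le> B * (LINT x|\<mu>. norm (X x))"
proof -
  have le: "norm (cross3 (k x) (X x)) \<le> B * norm (X x)" if "x \<in> S" for x
    using norm_cross3_le[of "k x" "X x"] mult_right_mono[OF k(2)[OF that] norm_ge_zero] by (rule order_trans)
  have i: "integrable \<mu> (\<lambda>x. B * norm (X x))" using X(2) by simp
  have "continuous_on UNIV (\<lambda>z :: space3 \<times> space3. cross3 (fst z) (snd z))"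
    by (intro bounded_bilinear.continuous_on[OF bounded_bilinear_cross3] continuous_intros)
  then have "(\<lambda>x. cross3 (k x) (X x)) \<in> borel_measurable \<mu>"
    by (rule borel_measurable_continuous_Pair[OF k(1) X(1)])
  then show I: "integrable \<mu> (\<lambda>x. cross3 (k x) (X x))"
    by (rule Bochner_Integration.integrable_bound[OF i]) (use le in \<open>auto intro!: AE_I2 intro: order_trans[OF _ abs_ge_self]\<close>)
  have "norm (LINT x|\<mu>. cross3 (k x) (X x)) \<le> (LINT x|\<mu>. norm (cross3 (k x) (X x)))" by (rule integral_norm_bound)
  also have "\<dots> \<le> (LINT x|\<mu>. B * norm (X x))" using I i le by (intro integral_mono) auto
  finally show "norm (LINT x|\<mu>. cross3 (k x) (X x)) \<le> B * (LINT x|\<mu>. norm (X x))" by simp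
qed

lemma BS_integrable:
  assumes X: "X \<in> borel_measurable \<mu>" "integrable \<mu> (\<lambda>p. norm (X p))" and y: "y \<in> P"
  shows "integrable \<mu> (\<lambda>x. cross3 (BS_kernel x y) (X x))" "norm (BS S X y) \<le> 1 / \<delta>\<^sup>2 * (LINT x|\<mu>. norm (X x))"
proof -
  have k: "norm (BS_kernel x y) \<le> 1 / \<delta>\<^sup>2" if "x \<in> S" for x by (rule BS_kernel_norm[OF \<delta> far[OF that y]])
  note km = continuous_measurable[OF kernel_continuous[OF y]]
  show "integrable \<mu> (\<lambda>x. cross3 (BS_kernel x y) (X x))" by (rule cross_integrable(1)[OF X km k])
  show "norm (BS S X y) \<le> 1 / \<delta>\<^sup>2 * (LINT x|\<mu>. norm (X x))"
    unfolding BS_def by (rule cross_integrable(2)[OF X km k])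
qed

lemma BS_lipschitz:
  assumes X: "X \<in> borel_measurable \<mu>" "integrable \<mu> (\<lambda>p. norm (X p))" and y: "y \<in> P" "y' \<in> P"
  shows "norm (BS S X y - BS S X y') \<le> (4 / \<delta> ^ 3 * (LINT x|\<mu>. norm (X x))) * norm (y - y')"
proof -
  have "BS S X y - BS S X y' = (LINT x|\<mu>. cross3 (BS_kernel x y - BS_kernel x y') (X x))"
    unfolding BS_def cross3_diff using BS_integrable(1)[OF X] y by simp
  also have "norm \<dots> \<le> (4 / \<delta> ^ 3 * norm (y - y')) * (LINT x|\<mu>. norm (X x))"
  proof (rule cross_integrable(2)[OF X])
    show "(\<lambda>x. BS_kernel x y - BS_kernel x y') \<in> borel_measurable \<mu>"
      by (intro continuous_measurable continuous_on_diff kernel_continuous y)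
    fix x assume "x \<in> S"
    then show "norm (BS_kernel x y - BS_kernel x y') \<le> 4 / \<delta> ^ 3 * norm (y - y')"
      using BS_kernel_lipschitz[OF \<delta> far far, of x y x y'] y by (simp add: norm_minus_commute)
  qed
  finally show ?thesis by (simp add: mult_ac)
qed

lemma misfit_integrable:
  assumes X: "X \<in> borel_measurable \<mu>" "integrable \<mu> (\<lambda>p. norm (X p))"
  shows "integrable (lebesgue_on P) (\<lambda>y. (norm (BS S X y - T y))\<^sup>2)"
proof -
  define I where "I = (LINT x|\<mu>. norm (X x))"
  have I: "0 \<le> I" unfolding I_def by (rule integral_nonneg_AE) simp
  interpret P: finite_measure "lebesgue_on P" by (rule finite_measure_lebesgue_on[OF P_meas(1)])
  have "(4 / \<delta> ^ 3 * I)-lipschitz_on P (BS S X)"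
    by (rule lipschitz_onI) (use BS_lipschitz[OF X] I \<delta> in \<open>auto simp: dist_norm I_def\<close>)
  then have m: "BS S X \<in> borel_measurable (lebesgue_on P)"
    by (intro continuous_imp_measurable_on_sets_lebesgue P_meas) (rule lipschitz_on_continuous_on)
  show ?thesis
  proof (rule Bochner_Integration.integrable_bound)
    show "integrable (lebesgue_on P) (\<lambda>y. 2 * (1 / \<delta>\<^sup>2 * I)\<^sup>2 + 2 * (norm (T y))\<^sup>2)" using T(2) by simp
    show "(\<lambda>y. (norm (BS S X y - T y))\<^sup>2) \<in> borel_measurable (lebesgue_on P)" using m T(1) by simp
    show "AE y in lebesgue_on P. norm ((norm (BS S X y - T y))\<^sup>2) \<le> norm (2 * (1 / \<delta>\<^sup>2 * I)\<^sup>2 + 2 * (norm (T y))\<^sup>2)"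
    proof (rule AE_I2)
      fix y assume "y \<in> space (lebesgue_on P)"
      then have y: "y \<in> P" by simp
      have "(norm (BS S X y - T y))\<^sup>2 \<le> 2 * (norm (BS S X y))\<^sup>2 + 2 * (norm (T y))\<^sup>2"
        using norm_sum_squared_le[of 1 "BS S X y" "- T y"] by simp
      also have "(norm (BS S X y))\<^sup>2 \<le> (1 / \<delta>\<^sup>2 * I)\<^sup>2" using BS_integrable(2)[OF X y] by (intro power_mono) (auto simp: I_def)
      finally show "norm ((norm (BS S X y - T y))\<^sup>2) \<le> norm (2 * (1 / \<delta>\<^sup>2 * I)\<^sup>2 + 2 * (norm (T y))\<^sup>2)" by simp
    qed
  qed
qed

lemma misfit_perturb:
  assumes X: "X \<in> borel_measurable \<mu>" "integrable \<mu> (\<lambda>p. norm (X p))" and \<theta>: "\<theta> > 0"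
    and le: "\<And>y. y \<in> P \<Longrightarrow> norm (W y - BS S X y) \<le> a"
  shows "L2_norm_sq (lebesgue_on P) (\<lambda>y. W y - T y)
    \<le> (1 + \<theta>) * L2_norm_sq (lebesgue_on P) (\<lambda>y. BS S X y - T y) + (1 + 1 / \<theta>) * (a\<^sup>2 * measure lebesgue P)"
proof -
  interpret P: finite_measure "lebesgue_on P" by (rule finite_measure_lebesgue_on[OF P_meas(1)])
  have "L2_norm_sq (lebesgue_on P) (\<lambda>y. W y - T y)
    \<le> (1 + \<theta>) * L2_norm_sq (lebesgue_on P) (\<lambda>y. BS S X y - T y) + (1 + 1 / \<theta>) * (LINT y|lebesgue_on P. a\<^sup>2)"
  proof (rule L2_norm_sq_perturb[OF \<theta> misfit_integrable[OF X]])
    fix y assume "y \<in> space (lebesgue_on P)"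
    then show "(norm (W y - T y - (BS S X y - T y)))\<^sup>2 \<le> a\<^sup>2" using le[of y] by (auto intro!: power_mono)
  qed simp
  moreover have "measure (lebesgue_on P) P = measure lebesgue P" using P_meas by (simp add: measure_restrict_space)
  ultimately show ?thesis by (simp add: mult.commute)
qed

lemma energy_nonneg: "0 \<le> energy P T \<Lambda> S j"
  unfolding energy_def using L2_norm_sq_nonneg \<Lambda> by (simp add: add_nonneg_nonneg)

lemma cost_le_energy: "j \<in> L2_divfree_fields S \<Longrightarrow> cost P T \<Lambda> S \<le> energy P T \<Lambda> S j"
  unfolding cost_def energy_def[symmetric] using energy_nonneg by (intro cINF_lower bdd_belowI[of _ 0]) auto

lemma cost_nonneg:
  assumes "L2_divfree_fields S \<noteq> {}"
  shows "0 \<le> cost P T \<Lambda> S"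
  unfolding cost_def energy_def[symmetric] using energy_nonneg assms by (intro cINF_greatest) auto

lemma regular_approximation:
  assumes j: "j \<in> L2_divfree_fields S" and e: "e > 0"
  shows "\<exists>X. regular_tangent_field S X \<and> divergence_free S X \<and> energy P T \<Lambda> S X \<le> (1 + e) * energy P T \<Lambda> S j + e"
proof -
  define Q where "Q = (1 / \<delta>\<^sup>2 * (M + 1))\<^sup>2 * measure lebesgue P + \<Lambda>"
  have Q: "Q > 0" using \<Lambda> by (simp add: Q_def add_nonneg_pos)
  define \<kappa> where "\<kappa> = e / ((1 + 1 / e) * Q)"
  have \<kappa>: "\<kappa> > 0" using e Q by (simp add: \<kappa>_def add_pos_pos)
  define \<eta> where "\<eta> = sqrt \<kappa>"
  have \<eta>: "\<eta> > 0" "\<eta>\<^sup>2 = \<kappa>" using \<kappa> by (auto simp: \<eta>_def)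
  obtain X where X: "regular_tangent_field S X" "divergence_free S X" and close: "L2_norm_sq \<mu> (\<lambda>p. j p - X p) < \<kappa>"
    using j \<kappa> unfolding L2_divfree_fields_def by blast
  have jm: "j \<in> borel_measurable \<mu>" "integrable \<mu> (\<lambda>p. (norm (j p))\<^sup>2)"
    using j by (auto simp: L2_divfree_fields_def L2_tangent_fields_def)
  have Xm: "X \<in> borel_measurable \<mu>" "integrable \<mu> (\<lambda>p. (norm (X p))\<^sup>2)"
    using regular_L2[OF X(1)] by (auto simp: L2_tangent_fields_def)
  have dm: "(\<lambda>p. X p - j p) \<in> borel_measurable \<mu>" "integrable \<mu> (\<lambda>p. (norm (X p - j p))\<^sup>2)"
  proof -
    show m: "(\<lambda>p. X p - j p) \<in> borel_measurable \<mu>" using Xm jm by simp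
    show "integrable \<mu> (\<lambda>p. (norm (X p - j p))\<^sup>2)"
    proof (rule Bochner_Integration.integrable_bound)
      show "integrable \<mu> (\<lambda>p. 2 * (norm (X p))\<^sup>2 + 2 * (norm (j p))\<^sup>2)" using Xm jm by simp
      show "AE p in \<mu>. norm ((norm (X p - j p))\<^sup>2) \<le> norm (2 * (norm (X p))\<^sup>2 + 2 * (norm (j p))\<^sup>2)"
      proof (rule AE_I2)
        fix p
        show "norm ((norm (X p - j p))\<^sup>2) \<le> norm (2 * (norm (X p))\<^sup>2 + 2 * (norm (j p))\<^sup>2)"
          using norm_sum_squared_le[of 1 "X p" "- j p"] by simp
      qed
    qed (use m in simp)
  qed
  have close': "L2_norm_sq \<mu> (\<lambda>p. X p - j p) \<le> \<kappa>" using close by (simp add: L2_norm_sq_def norm_minus_commute)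
  have jn: "integrable \<mu> (\<lambda>p. norm (j p))" and Xn: "integrable \<mu> (\<lambda>p. norm (X p))"
    by (rule norm_integrable(1)[OF jm \<eta>(1)], rule norm_integrable(1)[OF Xm \<eta>(1)])
  have "(LINT p|\<mu>. norm (X p - j p)) \<le> \<eta> * M + L2_norm_sq \<mu> (\<lambda>p. X p - j p) / \<eta>"
    by (rule norm_integrable(2)[OF dm \<eta>(1)])
  also have "\<dots> \<le> \<eta> * M + \<eta>\<^sup>2 / \<eta>" using close' \<eta> by (intro add_left_mono divide_right_mono) auto
  also have "\<dots> = (M + 1) * \<eta>" using \<eta>(1) by (simp add: power2_eq_square algebra_simps)
  finally have small: "(LINT p|\<mu>. norm (X p - j p)) \<le> (M + 1) * \<eta>" .
  define a where "a = 1 / \<delta>\<^sup>2 * ((M + 1) * \<eta>)"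
  have diff: "norm (BS S X y - BS S j y) \<le> a" if y: "y \<in> P" for y
  proof -
    have "BS S X y - BS S j y = BS S (\<lambda>p. X p - j p) y"
      unfolding BS_def cross3_diff using BS_integrable(1)[OF Xm(1) Xn y] BS_integrable(1)[OF jm(1) jn y] by simp
    also have "norm \<dots> \<le> 1 / \<delta>\<^sup>2 * (LINT p|\<mu>. norm (X p - j p))"
      by (rule BS_integrable(2)[OF dm(1) norm_integrable(1)[OF dm \<eta>(1)] y])
    also have "\<dots> \<le> a" unfolding a_def using small by (intro mult_left_mono) auto
    finally show ?thesis .
  qed
  have 1: "L2_norm_sq (lebesgue_on P) (\<lambda>y. BS S X y - T y)
    \<le> (1 + e) * L2_norm_sq (lebesgue_on P) (\<lambda>y. BS S j y - T y) + (1 + 1 / e) * (a\<^sup>2 * measure lebesgue P)"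
    by (rule misfit_perturb[OF jm(1) jn e diff])
  have "L2_norm_sq \<mu> X \<le> (1 + e) * L2_norm_sq \<mu> j + (1 + 1 / e) * (LINT p|\<mu>. (norm (X p - j p))\<^sup>2)"
    by (rule L2_norm_sq_perturb[OF e jm(2) dm(2)]) simp
  also have "\<dots> \<le> (1 + e) * L2_norm_sq \<mu> j + (1 + 1 / e) * \<kappa>"
    using close' e unfolding L2_norm_sq_def by (intro add_left_mono mult_left_mono) auto
  finally have 2: "\<Lambda> * L2_norm_sq \<mu> X \<le> \<Lambda> * ((1 + e) * L2_norm_sq \<mu> j + (1 + 1 / e) * \<kappa>)"
    using \<Lambda> by (intro mult_left_mono) auto
  have "a\<^sup>2 = (1 / \<delta>\<^sup>2 * (M + 1))\<^sup>2 * \<kappa>" unfolding a_def \<eta>(2)[symmetric] power2_eq_square by (simp only: ac_simps)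
  then have "(1 + 1 / e) * (a\<^sup>2 * measure lebesgue P) + \<Lambda> * ((1 + 1 / e) * \<kappa>) = (1 + 1 / e) * Q * \<kappa>"
    unfolding Q_def by (simp only: distrib_left distrib_right ac_simps)
  also have "\<dots> = e"
  proof -
    have "(1 + 1 / e) * Q > 0" using e Q by (simp add: add_pos_pos)
    then show ?thesis unfolding \<kappa>_def by (metis less_irrefl nonzero_mult_div_cancel_left times_divide_eq_right)
  qed
  finally have 3: "(1 + 1 / e) * (a\<^sup>2 * measure lebesgue P) + \<Lambda> * ((1 + 1 / e) * \<kappa>) = e" .
  have "energy P T \<Lambda> S X \<le> (1 + e) * energy P T \<Lambda> S j + e"
  proof -
    have "\<Lambda> * ((1 + e) * L2_norm_sq \<mu> j + (1 + 1 / e) * \<kappa>) = (1 + e) * (\<Lambda> * L2_norm_sq \<mu> j) + \<Lambda> * ((1 + 1 / e) * \<kappa>)"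
      by (simp only: distrib_left mult.left_commute)
    then show ?thesis using 1 2 3 unfolding energy_def distrib_left[of "1 + e"] by linarith
  qed
  then show ?thesis using X by blast
qed

end

context bilipschitz
begin

lemma pushforward_integrable:
  fixes f :: "space3 \<Rightarrow> 'b::{banach, second_countable_topology}"
  assumes f: "integrable (surface_measure S) f"
  shows "integrable \<nu> f"
proof (rule integrableI_bounded)
  have m: "f \<in> borel_measurable (surface_measure S)" using f by (rule borel_measurable_integrable)
  then show "f \<in> borel_measurable \<nu>" by simp
  have "(\<integral>\<^sup>+x. ennreal (norm (f x)) \<partial>\<nu>) \<le> ennreal (L\<^sup>2) * (\<integral>\<^sup>+x. ennreal (norm (f x)) \<partial>surface_measure S)"
    by (rule nn_integral_le_scaled) (use m emeasure_compare(1) in auto)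
  also have "\<dots> < \<infinity>" using f by (simp add: integrable_iff_bounded ennreal_mult_less_top)
  finally show "(\<integral>\<^sup>+x. ennreal (norm (f x)) \<partial>\<nu>) < \<infinity>" .
qed

lemma integral_compare:
  assumes f: "integrable (surface_measure S) f" and nn: "\<And>x. 0 \<le> (f x :: real)"
  shows "integral\<^sup>L \<nu> f \<le> L\<^sup>2 * integral\<^sup>L (surface_measure S) f"
    and "integral\<^sup>L (surface_measure S) f \<le> L\<^sup>2 * integral\<^sup>L \<nu> f"
proof -
  have m: "f \<in> borel_measurable (surface_measure S)" using f by (rule borel_measurable_integrable)
  have I: "0 \<le> integral\<^sup>L \<nu> f" "0 \<le> integral\<^sup>L (surface_measure S) f" using nn by simp_all
  have 1: "(\<integral>\<^sup>+x. ennreal (f x) \<partial>\<nu>) \<le> ennreal (L\<^sup>2) * (\<integral>\<^sup>+x. ennreal (f x) \<partial>surface_measure S)"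
    by (rule nn_integral_le_scaled) (use m emeasure_compare(1) in auto)
  have 2: "(\<integral>\<^sup>+x. ennreal (f x) \<partial>surface_measure S) \<le> ennreal (L\<^sup>2) * (\<integral>\<^sup>+x. ennreal (f x) \<partial>\<nu>)"
    by (rule nn_integral_le_scaled) (use m emeasure_compare(2) in auto)
  have e: "(\<integral>\<^sup>+x. ennreal (f x) \<partial>\<nu>) = ennreal (integral\<^sup>L \<nu> f)"
    "(\<integral>\<^sup>+x. ennreal (f x) \<partial>surface_measure S) = ennreal (integral\<^sup>L (surface_measure S) f)"
    by (rule nn_integral_eq_integral[OF pushforward_integrable[OF f]], use nn in simp)
      (rule nn_integral_eq_integral[OF f], use nn in simp)
  show "integral\<^sup>L \<nu> f \<le> L\<^sup>2 * integral\<^sup>L (surface_measure S) f"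
    using 1 I unfolding e by (simp flip: ennreal_mult)
  show "integral\<^sup>L (surface_measure S) f \<le> L\<^sup>2 * integral\<^sup>L \<nu> f"
    using 2 I unfolding e by (simp flip: ennreal_mult)
qed

lemma integral_difference_nonneg:
  assumes f: "integrable (surface_measure S) f" and nn: "\<And>x. 0 \<le> (f x :: real)"
  shows "\<bar>integral\<^sup>L \<nu> f - integral\<^sup>L (surface_measure S) f\<bar> \<le> (L\<^sup>2 - 1) * integral\<^sup>L (surface_measure S) f"
proof -
  define u v where "u = integral\<^sup>L (surface_measure S) f" and "v = integral\<^sup>L \<nu> f"
  have uv: "v \<le> L\<^sup>2 * u" "u \<le> L\<^sup>2 * v" "0 \<le> u" "0 \<le> v"
    unfolding u_def v_def using integral_compare[OF f nn] nn by simp_all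
  have L2: "0 \<le> L\<^sup>2 - 1" using L by (simp add: one_le_power)
  have "u - v \<le> (L\<^sup>2 - 1) * u"
  proof (cases "v \<le> u")
    case True
    then have "(L\<^sup>2 - 1) * v \<le> (L\<^sup>2 - 1) * u" using L2 by (rule mult_left_mono)
    then show ?thesis using uv by (simp add: left_diff_distrib)
  next
    case False
    moreover have "0 \<le> (L\<^sup>2 - 1) * u" using L2 uv by simp
    ultimately show ?thesis by linarith
  qed
  then show ?thesis using uv(1) unfolding u_def[symmetric] v_def[symmetric] by (simp add: left_diff_distrib abs_le_iff)
qed

lemma integral_difference_real:
  assumes f: "integrable (surface_measure S) (f :: space3 \<Rightarrow> real)"
  shows "\<bar>integral\<^sup>L \<nu> f - integral\<^sup>L (surface_measure S) f\<bar> \<le> (L\<^sup>2 - 1) * (LINT x|surface_measure S. \<bar>f x\<bar>)"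
proof -
  define p q where "p = (\<lambda>x. max 0 (f x))" and "q = (\<lambda>x. max 0 (- f x))"
  have pq: "f = (\<lambda>x. p x - q x)" "(\<lambda>x. \<bar>f x\<bar>) = (\<lambda>x. p x + q x)" "\<And>x. 0 \<le> p x" "\<And>x. 0 \<le> q x"
    by (auto simp: p_def q_def fun_eq_iff)
  have i: "integrable (surface_measure S) p" "integrable (surface_measure S) q" using f by (auto simp: p_def q_def)
  note j = i[THEN pushforward_integrable]
  have "integral\<^sup>L \<nu> f - integral\<^sup>L (surface_measure S) f = (integral\<^sup>L \<nu> p - integral\<^sup>L (surface_measure S) p)
    - (integral\<^sup>L \<nu> q - integral\<^sup>L (surface_measure S) q)"
    unfolding pq(1) using i j by simp
  moreover have "(L\<^sup>2 - 1) * (LINT x|surface_measure S. \<bar>f x\<bar>)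
    = (L\<^sup>2 - 1) * integral\<^sup>L (surface_measure S) p + (L\<^sup>2 - 1) * integral\<^sup>L (surface_measure S) q"
    unfolding pq(2) using i by (simp add: distrib_left)
  ultimately show ?thesis
    using integral_difference_nonneg[OF i(1) pq(3)] integral_difference_nonneg[OF i(2) pq(4)] by linarith
qed

lemma integral_difference:
  fixes F :: "space3 \<Rightarrow> space3"
  assumes F: "integrable (surface_measure S) F"
  shows "norm (integral\<^sup>L \<nu> F - integral\<^sup>L (surface_measure S) F) \<le> (L\<^sup>2 - 1) * (LINT x|surface_measure S. norm (F x))"
proof -
  define d where "d = integral\<^sup>L \<nu> F - integral\<^sup>L (surface_measure S) F"
  define w where "w = sgn d"
  have w: "norm w \<le> 1" by (simp add: w_def norm_sgn)
  have L2: "0 \<le> L\<^sup>2 - 1" using L by (simp add: one_le_power)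
  have i: "integrable (surface_measure S) (\<lambda>x. F x \<bullet> w)" using F by simp
  have "norm d = d \<bullet> w"
  proof (cases "d = 0")
    case False
    then have "d \<bullet> w = (norm d * norm d) / norm d"
      unfolding w_def sgn_div_norm inner_scaleR_right power2_norm_eq_inner[symmetric] power2_eq_square
      by (simp add: field_simps)
    then show ?thesis using False by simp
  qed simp
  also have "d \<bullet> w = (LINT x|\<nu>. F x \<bullet> w) - (LINT x|surface_measure S. F x \<bullet> w)"
    unfolding d_def inner_diff_left using F pushforward_integrable[OF F] by simp
  also have "\<dots> \<le> (L\<^sup>2 - 1) * (LINT x|surface_measure S. \<bar>F x \<bullet> w\<bar>)"
    using integral_difference_real[OF i] by linarith
  also have "\<dots> \<le> (L\<^sup>2 - 1) * (LINT x|surface_measure S. norm (F x))"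
  proof (intro mult_left_mono[OF _ L2] integral_mono)
    fix x
    have "\<bar>F x \<bullet> w\<bar> \<le> norm (F x) * norm w" by (rule Cauchy_Schwarz_ineq2)
    also have "\<dots> \<le> norm (F x) * 1" using w by (intro mult_left_mono) auto
    finally show "\<bar>F x \<bullet> w\<bar> \<le> norm (F x)" by simp
  qed (use F i in auto)
  finally show ?thesis by (simp add: d_def)
qed

end

context transport
begin

lemma energy_piola:
  assumes c0: "cost_surface P T \<Lambda> \<delta> S0 M0" and c1: "cost_surface P T \<Lambda> \<delta> S1 M"
    and X: "regular_tangent_field S1 X" and eps0: "\<epsilon> > 0"
    and c: "c = 4 * (28 / \<delta> ^ 3 + 12 / \<delta>\<^sup>2) + 6 / \<delta>\<^sup>2"
  shows "energy P T \<Lambda> S0 (piola X) \<le> (1 + 12 * \<epsilon>) ^ 4 * energy P T \<Lambda> S1 X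
    + 2 * \<epsilon> * (c * (M + energy P T \<Lambda> S1 X / \<Lambda>))\<^sup>2 * measure lebesgue P"
proof -
  interpret C0: cost_surface P T \<Lambda> \<delta> S0 M0 by (rule c0)
  interpret C1: cost_surface P T \<Lambda> \<delta> S1 M by (rule c1)
  note \<delta> = C1.\<delta>
  have Xm: "X \<in> borel_measurable C1.\<mu>" "integrable C1.\<mu> (\<lambda>p. (norm (X p))\<^sup>2)"
    using C1.regular_L2[OF X] by (auto simp: L2_tangent_fields_def)
  have Xn: "integrable C1.\<mu> (\<lambda>p. norm (X p))" by (rule C1.norm_integrable(1)[OF Xm zero_less_one])
  have Ym: "piola X \<in> borel_measurable C0.\<mu>" "integrable C0.\<mu> (\<lambda>p. (norm (piola X p))\<^sup>2)"
    using C0.regular_L2[OF piola_regular[OF X]] by (auto simp: L2_tangent_fields_def)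
  have Yn: "integrable C0.\<mu> (\<lambda>p. norm (piola X p))" by (rule C0.norm_integrable(1)[OF Ym zero_less_one])
  define I where "I = (LINT x|C1.\<mu>. norm (X x))"
  have I0: "0 \<le> I" unfolding I_def by (rule integral_nonneg_AE) simp
  define E where "E = energy P T \<Lambda> S1 X"
  have LE: "L2_norm_sq C1.\<mu> X \<le> E / \<Lambda>"
    using C1.\<Lambda> L2_norm_sq_nonneg[of "lebesgue_on P" "\<lambda>y. BS S1 X y - T y"]
    by (simp add: E_def energy_def pos_le_divide_eq mult.commute)
  have I1: "I \<le> M + E / \<Lambda>" using C1.norm_integrable(2)[OF Xm zero_less_one] LE unfolding I_def by simp
  have a: "(1 + 2 * \<epsilon>)\<^sup>2 - 1 \<le> 6 * \<epsilon>" "(1 + 2 * \<epsilon>)\<^sup>2 \<le> 4"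
  proof -
    have "\<epsilon> * \<epsilon> \<le> \<epsilon> * (1 / 2)" using eps eps0 by (intro mult_left_mono) auto
    then show 1: "(1 + 2 * \<epsilon>)\<^sup>2 - 1 \<le> 6 * \<epsilon>" by (simp add: power2_eq_square algebra_simps)
    show "(1 + 2 * \<epsilon>)\<^sup>2 \<le> 4" using 1 eps by simp
  qed
  have push: "integrable C0.\<mu> (\<lambda>x. f (\<Phi> x))" "(LINT x|C0.\<mu>. f (\<Phi> x)) = integral\<^sup>L B.\<nu> f"
    if f: "integrable C1.\<mu> f" for f :: "space3 \<Rightarrow> 'b::{banach, second_countable_topology}"
    using integrable_distr[OF B.measurable B.pushforward_integrable[OF f]]
      integral_distr[OF B.measurable borel_measurable_integrable[OF f]] by simp_all
  have near7: "norm (piola X x) \<le> (1 + 12 * \<epsilon>) * norm (X (\<Phi> x))" for x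
    using piola_near[of X x] norm_triangle_sub[of "piola X x" "X (\<Phi> x)"] by (simp add: distrib_right)
  define b where "b = 28 / \<delta> ^ 3 + 12 / \<delta>\<^sup>2"
  have b0: "0 \<le> b" using \<delta> by (simp add: b_def)
  have diff: "norm (BS S0 (piola X) y - BS S1 X y) \<le> \<epsilon> * c * I" if y: "y \<in> P" for y
  proof -
    define F where "F = (\<lambda>x. cross3 (BS_kernel x y) (X x))"
    have F: "integrable C1.\<mu> F" unfolding F_def by (rule C1.BS_integrable(1)[OF Xm(1) Xn y])
    have H: "integrable C0.\<mu> (\<lambda>x. cross3 (BS_kernel x y) (piola X x))" by (rule C0.BS_integrable(1)[OF Ym(1) Yn y])
    have pt: "norm (cross3 (BS_kernel x y) (piola X x) - F (\<Phi> x)) \<le> \<epsilon> * b * norm (X (\<Phi> x))" if x: "x \<in> S0" for x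
    proof -
      have Sx: "\<Phi> x \<in> S1" using x zero_iff by simp
      define k k' where "k = BS_kernel x y" and "k' = BS_kernel (\<Phi> x) y"
      have "norm (k - k') \<le> 4 / \<delta> ^ 3 * norm ((x - y) - (\<Phi> x - y))"
        unfolding k_def k'_def by (rule BS_kernel_lipschitz[OF \<delta> C0.far[OF x y] C1.far[OF Sx y]])
      also have "\<dots> \<le> 4 / \<delta> ^ 3 * \<epsilon>" using \<Phi>_near[of x] \<delta> by (intro mult_left_mono) (auto simp: norm_minus_commute)
      finally have kk: "norm (k - k') \<le> 4 / \<delta> ^ 3 * \<epsilon>" .
      have k': "norm k' \<le> 1 / \<delta>\<^sup>2" unfolding k'_def by (rule BS_kernel_norm[OF \<delta> C1.far[OF Sx y]])
      have n7: "norm (piola X x) \<le> 7 * norm (X (\<Phi> x))"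
      proof -
        have "(1 + 12 * \<epsilon>) * norm (X (\<Phi> x)) \<le> 7 * norm (X (\<Phi> x))" using eps by (intro mult_right_mono) auto
        then show ?thesis using near7[of x] by linarith
      qed
      have "cross3 k (piola X x) - F (\<Phi> x) = cross3 (k - k') (piola X x) + cross3 k' (piola X x - X (\<Phi> x))"
        by (simp add: F_def k'_def cross3_diff)
      then have "norm (cross3 k (piola X x) - F (\<Phi> x)) \<le> norm (k - k') * norm (piola X x) + norm k' * norm (piola X x - X (\<Phi> x))"
        using norm_triangle_ineq[of "cross3 (k - k') (piola X x)" "cross3 k' (piola X x - X (\<Phi> x))"]
          norm_cross3_le[of "k - k'" "piola X x"] norm_cross3_le[of k' "piola X x - X (\<Phi> x)"] by simp
      also have "\<dots> \<le> (4 / \<delta> ^ 3 * \<epsilon>) * (7 * norm (X (\<Phi> x))) + 1 / \<delta>\<^sup>2 * (12 * \<epsilon> * norm (X (\<Phi> x)))"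
        using kk k' n7 piola_near[of X x] \<delta> eps0 by (intro add_mono mult_mono) auto
      also have "\<dots> = \<epsilon> * b * norm (X (\<Phi> x))" by (simp add: b_def algebra_simps)
      finally show ?thesis by (simp add: k_def)
    qed
    have "norm (BS S0 (piola X) y - integral\<^sup>L B.\<nu> F) = norm (LINT x|C0.\<mu>. cross3 (BS_kernel x y) (piola X x) - F (\<Phi> x))"
      unfolding BS_def push(2)[OF F, symmetric] using H push(1)[OF F] by simp
    also have "\<dots> \<le> (LINT x|C0.\<mu>. norm (cross3 (BS_kernel x y) (piola X x) - F (\<Phi> x)))" by (rule integral_norm_bound)
    also have "\<dots> \<le> (LINT x|C0.\<mu>. \<epsilon> * b * norm (X (\<Phi> x)))"
      using H push(1)[OF F] push(1)[OF Xn] pt by (intro integral_mono) auto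
    also have "\<dots> = \<epsilon> * b * (LINT x|B.\<nu>. norm (X x))" using push(2)[OF Xn] by simp
    also have "\<dots> \<le> \<epsilon> * b * (4 * I)"
    proof (intro mult_left_mono)
      have "(LINT x|B.\<nu>. norm (X x)) \<le> (1 + 2 * \<epsilon>)\<^sup>2 * I" unfolding I_def by (rule B.integral_compare(1)[OF Xn]) simp
      also have "\<dots> \<le> 4 * I" using a(2) I0 by (rule mult_right_mono)
      finally show "(LINT x|B.\<nu>. norm (X x)) \<le> 4 * I" .
    qed (use eps0 b0 in simp)
    finally have 1: "norm (BS S0 (piola X) y - integral\<^sup>L B.\<nu> F) \<le> \<epsilon> * b * (4 * I)" .
    have "norm (integral\<^sup>L B.\<nu> F - BS S1 X y) \<le> ((1 + 2 * \<epsilon>)\<^sup>2 - 1) * (LINT x|C1.\<mu>. norm (F x))"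
      using B.integral_difference[OF F] by (simp add: BS_def F_def)
    also have "\<dots> \<le> (6 * \<epsilon>) * (1 / \<delta>\<^sup>2 * I)"
    proof (rule mult_mono[OF a(1)])
      have "(LINT x|C1.\<mu>. norm (F x)) \<le> (LINT x|C1.\<mu>. 1 / \<delta>\<^sup>2 * norm (X x))"
      proof (rule integral_mono)
        fix x assume "x \<in> space C1.\<mu>"
        then have x: "x \<in> S1" by simp
        have "norm (F x) \<le> norm (BS_kernel x y) * norm (X x)" unfolding F_def by (rule norm_cross3_le)
        also have "\<dots> \<le> 1 / \<delta>\<^sup>2 * norm (X x)" by (intro mult_right_mono BS_kernel_norm[OF \<delta> C1.far[OF x y]]) simp
        finally show "norm (F x) \<le> 1 / \<delta>\<^sup>2 * norm (X x)" .
      qed (use F Xn in auto)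
      then show "(LINT x|C1.\<mu>. norm (F x)) \<le> 1 / \<delta>\<^sup>2 * I" using Xn by (simp add: I_def)
    qed (use eps0 in \<open>auto intro: integral_nonneg_AE\<close>)
    finally have 2: "norm (integral\<^sup>L B.\<nu> F - BS S1 X y) \<le> (6 * \<epsilon>) * (1 / \<delta>\<^sup>2 * I)" .
    have "norm (BS S0 (piola X) y - BS S1 X y) \<le> \<epsilon> * b * (4 * I) + (6 * \<epsilon>) * (1 / \<delta>\<^sup>2 * I)"
      using norm_triangle_ineq[of "BS S0 (piola X) y - integral\<^sup>L B.\<nu> F" "integral\<^sup>L B.\<nu> F - BS S1 X y"] 1 2 by simp
    also have "\<dots> = \<epsilon> * c * I" by (simp add: c b_def algebra_simps)
    finally show ?thesis .
  qed
  have vol: "0 \<le> measure lebesgue P" by simp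
  have c0': "0 \<le> c" using \<delta> by (simp add: c)
  have A: "L2_norm_sq (lebesgue_on P) (\<lambda>y. BS S0 (piola X) y - T y)
    \<le> (1 + \<epsilon>) * L2_norm_sq (lebesgue_on P) (\<lambda>y. BS S1 X y - T y) + (1 + 1 / \<epsilon>) * ((\<epsilon> * c * I)\<^sup>2 * measure lebesgue P)"
    by (rule C1.misfit_perturb[OF Xm(1) Xn eps0 diff])
  have "(1 + 1 / \<epsilon>) * ((\<epsilon> * c * I)\<^sup>2 * measure lebesgue P) = (\<epsilon>\<^sup>2 + \<epsilon>) * ((c * I)\<^sup>2 * measure lebesgue P)"
    using eps0 by (simp add: power2_eq_square field_simps)
  also have "\<dots> \<le> (2 * \<epsilon>) * ((c * (M + E / \<Lambda>))\<^sup>2 * measure lebesgue P)"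
  proof (rule mult_mono)
    have "\<epsilon>\<^sup>2 \<le> \<epsilon> * 1" unfolding power2_eq_square using eps eps0 by (intro mult_left_mono) auto
    then show "\<epsilon>\<^sup>2 + \<epsilon> \<le> 2 * \<epsilon>" by simp
    show "(c * I)\<^sup>2 * measure lebesgue P \<le> (c * (M + E / \<Lambda>))\<^sup>2 * measure lebesgue P"
      using I0 I1 c0' by (intro mult_right_mono power_mono mult_left_mono) auto
  qed (use eps0 in auto)
  finally have A': "(1 + 1 / \<epsilon>) * ((\<epsilon> * c * I)\<^sup>2 * measure lebesgue P) \<le> 2 * \<epsilon> * (c * (M + E / \<Lambda>))\<^sup>2 * measure lebesgue P"
    by (simp only: mult.assoc)
  have "L2_norm_sq C0.\<mu> (piola X) \<le> (LINT x|C0.\<mu>. (1 + 12 * \<epsilon>)\<^sup>2 * (norm (X (\<Phi> x)))\<^sup>2)"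
    unfolding L2_norm_sq_def
  proof (rule integral_mono[OF Ym(2)])
    show "integrable C0.\<mu> (\<lambda>x. (1 + 12 * \<epsilon>)\<^sup>2 * (norm (X (\<Phi> x)))\<^sup>2)" using push(1)[OF Xm(2)] by simp
    show "(norm (piola X x))\<^sup>2 \<le> (1 + 12 * \<epsilon>)\<^sup>2 * (norm (X (\<Phi> x)))\<^sup>2" for x
      using power_mono[OF near7[of x] norm_ge_zero, of 2] by (simp only: power_mult_distrib)
  qed
  also have "\<dots> = (1 + 12 * \<epsilon>)\<^sup>2 * (LINT x|B.\<nu>. (norm (X x))\<^sup>2)" using push(2)[OF Xm(2)] by simp
  also have "\<dots> \<le> (1 + 12 * \<epsilon>)\<^sup>2 * ((1 + 12 * \<epsilon>)\<^sup>2 * L2_norm_sq C1.\<mu> X)"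
  proof (intro mult_left_mono)
    have "(LINT x|B.\<nu>. (norm (X x))\<^sup>2) \<le> (1 + 2 * \<epsilon>)\<^sup>2 * L2_norm_sq C1.\<mu> X"
      unfolding L2_norm_sq_def by (rule B.integral_compare(1)[OF Xm(2)]) simp
    also have "\<dots> \<le> (1 + 12 * \<epsilon>)\<^sup>2 * L2_norm_sq C1.\<mu> X"
      using eps0 by (intro mult_right_mono power_mono L2_norm_sq_nonneg) auto
    finally show "(LINT x|B.\<nu>. (norm (X x))\<^sup>2) \<le> (1 + 12 * \<epsilon>)\<^sup>2 * L2_norm_sq C1.\<mu> X" .
  qed simp
  also have "\<dots> = (1 + 12 * \<epsilon>) ^ 4 * L2_norm_sq C1.\<mu> X"
  proof -
    have "(1 + 12 * \<epsilon>)\<^sup>2 * (1 + 12 * \<epsilon>)\<^sup>2 = (1 + 12 * \<epsilon>) ^ 4" by (simp flip: power_add)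
    then show ?thesis by (simp only: mult.assoc[symmetric])
  qed
  finally have "\<Lambda> * L2_norm_sq C0.\<mu> (piola X) \<le> \<Lambda> * ((1 + 12 * \<epsilon>) ^ 4 * L2_norm_sq C1.\<mu> X)"
    using C1.\<Lambda> by (intro mult_left_mono) auto
  moreover have "(1 + \<epsilon>) * L2_norm_sq (lebesgue_on P) (\<lambda>y. BS S1 X y - T y) \<le> (1 + 12 * \<epsilon>) ^ 4 * L2_norm_sq (lebesgue_on P) (\<lambda>y. BS S1 X y - T y)"
  proof (rule mult_right_mono[OF _ L2_norm_sq_nonneg])
    have "1 + \<epsilon> \<le> (1 + 12 * \<epsilon>) ^ 1" using eps0 by simp
    also have "\<dots> \<le> (1 + 12 * \<epsilon>) ^ 4" using eps0 by (intro power_increasing) auto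
    finally show "1 + \<epsilon> \<le> (1 + 12 * \<epsilon>) ^ 4" .
  qed
  moreover have "(1 + 12 * \<epsilon>) ^ 4 * E = (1 + 12 * \<epsilon>) ^ 4 * L2_norm_sq (lebesgue_on P) (\<lambda>y. BS S1 X y - T y)
      + \<Lambda> * ((1 + 12 * \<epsilon>) ^ 4 * L2_norm_sq C1.\<mu> X)"
    unfolding E_def energy_def by (simp only: distrib_left mult.left_commute)
  ultimately show ?thesis using A A' unfolding E_def[symmetric] energy_def[of P T \<Lambda> S0] by linarith
qed

end

lemma defining_pair_limit:
  fixes gs :: "nat \<Rightarrow> space3 \<Rightarrow> real" and Gs :: "nat \<Rightarrow> space3 \<Rightarrow> space3"
  assumes dp: "\<And>n. defining_pair K C R m (gs n) (Gs n)"
  obtains k g G where "strict_mono (k :: nat \<Rightarrow> nat)" "defining_pair K C R m g G"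
    "\<And>\<eta>. \<eta> > 0 \<Longrightarrow> \<exists>N. \<forall>n\<ge>N. \<forall>x. \<bar>gs (k n) x - g x\<bar> \<le> \<eta> \<and> norm (Gs (k n) x - G x) \<le> \<eta>"
proof -
  have D: "defining K C R m (gs n) (Gs n)" for n by (rule defining.intro[OF dp])
  have K0: "0 \<le> K" by (rule defining.K_nonneg[OF D])
  define F where "F = (\<lambda>n x. (gs n x, Gs n x))"
  have bound: "norm (F n x) \<le> \<bar>m\<bar> + 2 * \<bar>R\<bar> + 1" if x: "x \<in> cball 0 R" for n x
  proof -
    define z :: space3 where "z = \<bar>R\<bar> *\<^sub>R axis 1 1"
    have z: "norm z = \<bar>R\<bar>" by (simp add: z_def)
    have "\<bar>gs n x - gs n z\<bar> \<le> norm (x - z)" by (rule defining.g_lipschitz[OF D])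
    also have "norm (x - z) \<le> norm x + norm z" by (rule norm_triangle_ineq4)
    finally have "\<bar>gs n x - gs n z\<bar> \<le> norm x + \<bar>R\<bar>" by (simp only: z)
    moreover have "gs n z = m" by (rule defining.far(1)[OF D]) (simp add: z)
    moreover have "norm x \<le> \<bar>R\<bar>" using x by simp
    ultimately have "\<bar>gs n x\<bar> \<le> \<bar>m\<bar> + 2 * \<bar>R\<bar>" by linarith
    moreover have "norm (Gs n x) \<le> 1" by (rule defining.G_le_1[OF D])
    moreover have "norm (F n x) \<le> norm (gs n x) + norm (Gs n x)" unfolding F_def by (rule norm_Pair_le)
    ultimately show ?thesis by simp
  qed
  have lip: "norm (F n x - F n y) \<le> (1 + 6 * K) * norm (x - y)" for n x y
  proof -
    have "norm (F n x - F n y) \<le> norm (gs n x - gs n y) + norm (Gs n x - Gs n y)"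
      unfolding F_def diff_Pair by (rule norm_Pair_le)
    also have "\<dots> \<le> norm (x - y) + 6 * K * norm (x - y)"
      using defining.g_lipschitz[OF D, of n x y] defining.G_lipschitz[OF D, of n x y] by simp
    finally show ?thesis by (simp add: distrib_right)
  qed
  have K1: "1 + 6 * K > 0" using K0 by simp
  have equi: "\<exists>d. 0 < d \<and> (\<forall>n y. y \<in> cball 0 R \<and> norm (x - y) < d \<longrightarrow> norm (F n x - F n y) < e)" if e: "0 < e" for x :: space3 and e
  proof (intro exI[of _ "e / (1 + 6 * K)"] conjI allI impI)
    show "0 < e / (1 + 6 * K)" using e K1 by simp
    fix n y assume "y \<in> cball 0 R \<and> norm (x - y) < e / (1 + 6 * K)"
    then have "(1 + 6 * K) * norm (x - y) < e" using K1 by (simp add: pos_less_divide_eq mult.commute)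
    then show "norm (F n x - F n y) < e" using lip[of n x y] by linarith
  qed
  obtain h k where k: "strict_mono (k :: nat \<Rightarrow> nat)"
    and conv: "\<And>e. 0 < e \<Longrightarrow> \<exists>N. \<forall>n x. n \<ge> N \<and> x \<in> cball 0 R \<longrightarrow> norm (F (k n) x - h x) < e"
    by (rule Arzela_Ascoli[OF compact_cball[of 0 R], of F "\<bar>m\<bar> + 2 * \<bar>R\<bar> + 1"]) (use bound equi in \<open>blast+\<close>)
  define g where "g = (\<lambda>x. if norm x \<le> R then fst (h x) else m)"
  define G where "G = (\<lambda>x. if norm x \<le> R then snd (h x) else 0)"
  have uni: "\<exists>N. \<forall>n\<ge>N. \<forall>x. \<bar>gs (k n) x - g x\<bar> \<le> \<eta> \<and> norm (Gs (k n) x - G x) \<le> \<eta>" if \<eta>: "\<eta> > 0" for \<eta>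
  proof -
    obtain N where N: "\<And>n x. n \<ge> N \<Longrightarrow> x \<in> cball 0 R \<Longrightarrow> norm (F (k n) x - h x) < \<eta>" using conv[OF \<eta>] by blast
    have "\<bar>gs (k n) x - g x\<bar> \<le> \<eta> \<and> norm (Gs (k n) x - G x) \<le> \<eta>" if n: "n \<ge> N" for n x
    proof (cases "norm x \<le> R")
      case True
      then have "norm (F (k n) x - h x) < \<eta>" using N[OF n] by simp
      moreover have "F (k n) x - h x = (gs (k n) x - g x, Gs (k n) x - G x)" using True by (simp add: F_def g_def G_def prod_eq_iff)
      ultimately show ?thesis
        using norm_fst_le[of "gs (k n) x - g x" "Gs (k n) x - G x"] norm_snd_le[of "Gs (k n) x - G x" "gs (k n) x - g x"] by simp
    next
      case False
      then show ?thesis using defining.far[OF D, of x "k n"] \<eta> by (simp add: g_def G_def)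
    qed
    then show ?thesis by blast
  qed
  have lg: "(\<lambda>n. gs (k n) x) \<longlonglongrightarrow> g x" and lG: "(\<lambda>n. Gs (k n) x) \<longlonglongrightarrow> G x" for x
  proof -
    show "(\<lambda>n. gs (k n) x) \<longlonglongrightarrow> g x"
    proof (rule LIMSEQ_I)
      fix e :: real assume "0 < e"
      then obtain N where N: "\<And>n. n \<ge> N \<Longrightarrow> \<bar>gs (k n) x - g x\<bar> \<le> e / 2" using uni[of "e / 2"] by auto
      have "norm (gs (k n) x - g x) < e" if "n \<ge> N" for n using N[OF that] \<open>0 < e\<close> by simp
      then show "\<exists>no. \<forall>n\<ge>no. norm (gs (k n) x - g x) < e" by blast
    qed
    show "(\<lambda>n. Gs (k n) x) \<longlonglongrightarrow> G x"
    proof (rule LIMSEQ_I)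
      fix e :: real assume "0 < e"
      then obtain N where N: "\<And>n. n \<ge> N \<Longrightarrow> norm (Gs (k n) x - G x) \<le> e / 2" using uni[of "e / 2"] by auto
      have "norm (Gs (k n) x - G x) < e" if "n \<ge> N" for n using N[OF that] \<open>0 < e\<close> by linarith
      then show "\<exists>no. \<forall>n\<ge>no. norm (Gs (k n) x - G x) < e" by blast
    qed
  qed
  have "defining_pair K C R m g G"
    unfolding defining_pair_def
  proof (intro conjI allI impI)
    show "\<bar>g x - g y - G y \<bullet> (x - y)\<bar> \<le> K * (norm (x - y))\<^sup>2" for x y
    proof (rule LIMSEQ_le_const2)
      show "(\<lambda>n. \<bar>gs (k n) x - gs (k n) y - Gs (k n) y \<bullet> (x - y)\<bar>) \<longlonglongrightarrow> \<bar>g x - g y - G y \<bullet> (x - y)\<bar>"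
        by (intro tendsto_intros lg lG)
    qed (use defining.quad[OF D] in blast)
    show "norm (G x) \<le> 1" for x
      by (rule LIMSEQ_le_const2[OF tendsto_norm[OF lG]]) (use defining.G_le_1[OF D] in blast)
    show "1 - norm (G x) \<le> C * (g x)\<^sup>2" for x
    proof (rule LIMSEQ_le)
      show "(\<lambda>n. 1 - norm (Gs (k n) x)) \<longlonglongrightarrow> 1 - norm (G x)" by (intro tendsto_intros lG)
      show "(\<lambda>n. C * (gs (k n) x)\<^sup>2) \<longlonglongrightarrow> C * (g x)\<^sup>2" by (intro tendsto_intros lg)
    qed (use defining.G_defect[OF D] in blast)
    fix x :: space3 assume x: "R \<le> norm x"
    have "(\<lambda>n. gs (k n) x) = (\<lambda>_. m)" "(\<lambda>n. Gs (k n) x) = (\<lambda>_. 0)" using defining.far[OF D x] by simp_all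
    then show "g x = m" "G x = 0" using lg[of x] lG[of x] by (simp_all add: LIMSEQ_const_iff)
  qed
  then show ?thesis using k uni by (intro that[of k g G])
qed

lemma (in defining) zero_field:
  "regular_tangent_field {x. g x = 0} (\<lambda>_. 0)" "divergence_free {x. g x = 0} (\<lambda>_. 0)"
proof -
  have "0 \<in> tangent_space S p" if "p \<in> S" for p using tangent_space_eq[of p] that by simp
  then show "regular_tangent_field {x. g x = 0} (\<lambda>_. 0)"
    unfolding regular_tangent_field_def by (auto intro!: exI[of _ 0] lipschitz_onI)
  have "has_surface_divergence S (\<lambda>_. 0) 0 p" if p: "p \<in> S" for p
  proof -
    have gp: "g p = 0" using p by simp
    obtain u v where "norm u = 1" "norm v = 1" "u \<bullet> v = 0" "span {u, v} = {w. G p \<bullet> w = 0}"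
      by (rule orthonormal_frame[OF G_unit[OF gp]]) (rule that)
    then show ?thesis unfolding has_surface_divergence_def tangent_space_eq[OF gp]
      by (intro exI[of _ "\<lambda>_. 0"] exI[of _ u] exI[of _ v]) simp
  qed
  then show "divergence_free {x. g x = 0} (\<lambda>_. 0)" unfolding divergence_free_def by (intro AE_I2) simp
qed

lemma admissible_far:
  assumes "S \<in> admissible P D \<delta> r Pm" "x \<in> S" "y \<in> P"
  shows "\<delta> \<le> dist x y"
  using assms setdist_le_dist[of x S y P] by (auto simp: admissible_def)

lemma admissible_defining_pair:
  assumes S: "S \<in> admissible P D \<delta> r Pm" and D: "D \<subseteq> cball 0 R" and r: "r > 0"
  shows "\<exists>g G. defining_pair (8 / r) (9 / r\<^sup>2) (R + r) (r / 3) g G \<and> S = {x. g x = 0}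
    \<and> toroidal_domain {x. g x < 0} \<and> P \<subseteq> {x. g x < 0}"
proof -
  obtain V where V: "toroidal_domain V" "S = frontier V" "P \<subseteq> V" and S': "S \<subseteq> D" "embedded_surface C11_on S" "reach S \<ge> ereal r"
    using S unfolding admissible_def by blast
  have tor: "S homeomorphic (sphere (0::complex) 1 \<times> sphere (0::complex) 1)"
    using V by (simp add: toroidal_domain_def toroidal_surface_def)
  have "connected (sphere (0::complex) 1)" by (rule connected_sphere) simp
  then have con: "connected S" using homeomorphic_connectedness[OF tor] connected_Times by blast
  have "(1, 1) \<in> sphere (0::complex) 1 \<times> sphere (0::complex) 1" by simp
  then have "S \<noteq> {}" using homeomorphic_empty(2)[of "sphere (0::complex) 1 \<times> sphere (0::complex) 1"] tor
    by (metis empty_iff homeomorphic_empty(1) homeomorphic_sym)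
  then have "V \<noteq> {}" using V(2) by auto
  then interpret reach_domain V r
    using V con S' r by unfold_locales (auto simp: toroidal_domain_def)
  obtain g G where g: "defining_pair (8 / r) (9 / r\<^sup>2) (R + r) (r / 3) g G" "\<And>x. g x < 0 \<longleftrightarrow> x \<in> V" "\<And>x. g x = 0 \<longleftrightarrow> x \<in> frontier V"
    using defining_pair_exists[of R] V(2) S'(1) D by blast
  then have "{x. g x < 0} = V" "{x. g x = 0} = S" using V by auto
  then show ?thesis using g(1) V by blast
qed

lemma admissible_cost_surface:
  assumes S: "S \<in> admissible P D \<delta> r Pm" and P: "toroidal_domain P" and D: "compact D" and \<delta>: "\<delta> > 0" and Pm: "Pm > 0"
    and \<Lambda>: "\<Lambda> > 0" and T: "T \<in> borel_measurable (lebesgue_on P)" "integrable (lebesgue_on P) (\<lambda>y. (norm (T y))\<^sup>2)"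
  shows "cost_surface P T \<Lambda> \<delta> S Pm"
proof
  have "closed S" "S \<subseteq> D" using S by (auto simp: admissible_def)
  then have "compact (D \<inter> S)" using D by (intro compact_Int_closed)
  moreover have "D \<inter> S = S" using \<open>S \<subseteq> D\<close> by blast
  ultimately show "compact S" by simp
  show "\<delta> \<le> dist x y" if "x \<in> S" "y \<in> P" for x y by (rule admissible_far[OF S that])
qed (use assms in \<open>auto simp: toroidal_domain_def admissible_def\<close>)

lemma limit_admissible:
  assumes dp0: "defining_pair K C R m g0 G0" and D: "compact D" and \<delta>: "\<delta> > 0" and r: "r > 0" and Pm: "Pm > 0"
    and approx: "\<And>\<epsilon>. 0 < \<epsilon> \<Longrightarrow> \<epsilon> \<le> 1 / 2 \<Longrightarrow> \<exists>\<Phi> A g G. transport \<epsilon> \<Phi> A K C R m g0 G0 g G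
      \<and> {x. g x = 0} \<in> admissible P D \<delta> r Pm \<and> toroidal_domain {x. g x < 0} \<and> P \<subseteq> {x. g x < 0} \<and> (\<forall>x. \<bar>g x - g0 x\<bar> \<le> \<epsilon>)"
  shows "{x. g0 x = 0} \<in> admissible P D \<delta> r Pm"
proof -
  interpret D0: defining K C R m g0 G0 by (rule defining.intro[OF dp0])
  define S0 where "S0 = {x. g0 x = 0}"
  have near: "\<exists>\<Phi> S. S \<in> admissible P D \<delta> r Pm \<and> \<Phi> ` S0 = S \<and> (\<forall>x. norm (\<Phi> x - x) \<le> \<epsilon>) \<and> P \<noteq> {}
      \<and> hausdorff2 S0 \<le> ennreal ((1 + 2 * \<epsilon>)\<^sup>2 * Pm) \<and> (\<forall>y\<in>P. g0 y \<le> \<epsilon>) \<and> closed S \<and> S \<noteq> {}"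
    if e: "0 < \<epsilon>" "\<epsilon> \<le> 1 / 2" for \<epsilon>
  proof -
    obtain \<Phi> A g G where "transport \<epsilon> \<Phi> A K C R m g0 G0 g G" and S: "{x. g x = 0} \<in> admissible P D \<delta> r Pm"
      and PV: "P \<subseteq> {x. g x < 0}" and close: "\<forall>x. \<bar>g x - g0 x\<bar> \<le> \<epsilon>" using approx[OF e] by blast
    then interpret T: transport \<epsilon> \<Phi> A K C R m g0 G0 g G by blast
    have ne: "{x. g x = 0} \<noteq> {}" "P \<noteq> {}" using S \<delta> by (auto simp: admissible_def)
    have "hausdorff2 S0 \<le> ennreal ((1 + 2 * \<epsilon>)\<^sup>2) * hausdorff2 {x. g x = 0}"
      using T.B.hausdorff2_le_image[of S0] T.image_zero by (simp add: S0_def)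
    also have "\<dots> \<le> ennreal ((1 + 2 * \<epsilon>)\<^sup>2) * ennreal Pm" using S by (intro mult_left_mono) (auto simp: admissible_def)
    also have "\<dots> = ennreal ((1 + 2 * \<epsilon>)\<^sup>2 * Pm)" using Pm by (simp add: ennreal_mult)
    finally have h: "hausdorff2 S0 \<le> ennreal ((1 + 2 * \<epsilon>)\<^sup>2 * Pm)" .
    have "g0 y \<le> \<epsilon>" if "y \<in> P" for y
    proof -
      have "g y < 0" using PV that by blast
      then show ?thesis using close[rule_format, of y] by linarith
    qed
    then show ?thesis using S T.image_zero T.\<Phi>_near ne h T.D.closed_S unfolding S0_def
      by (intro exI[of _ \<Phi>] exI[of _ "{x. g x = 0}"]) simp
  qed
  have small: "\<exists>e'. 0 < e' \<and> e' \<le> 1 / 2 \<and> e' \<le> e" if "e > 0" for e :: real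
  proof (cases "e \<le> 1 / 2")
    case True then show ?thesis using that by (intro exI[of _ e]) simp
  next
    case False then show ?thesis by (intro exI[of _ "1 / 2"]) simp
  qed
  have pt: "\<exists>z S. S \<in> admissible P D \<delta> r Pm \<and> z \<in> S \<and> norm (z - x) \<le> e" if x: "x \<in> S0" and e: "e > 0" for x e
  proof -
    obtain e' where e': "0 < e'" "e' \<le> 1 / 2" "e' \<le> e" using small[OF e] by blast
    obtain \<Phi> S where S: "S \<in> admissible P D \<delta> r Pm" "\<Phi> ` S0 = S" "\<forall>x. norm (\<Phi> x - x) \<le> e'"
      using near[OF e'(1,2)] by blast
    then show ?thesis using x e'(3) order_trans by (intro exI[of _ "\<Phi> x"] exI[of _ S]) blast
  qed
  have sub: "S0 \<subseteq> D"
  proof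
    fix x assume x: "x \<in> S0"
    have "x \<in> closure D" unfolding closure_approachable
    proof (intro allI impI)
      fix e :: real assume "0 < e"
      then obtain z S where "S \<in> admissible P D \<delta> r Pm" "z \<in> S" "norm (z - x) \<le> e / 2" using pt[OF x, of "e / 2"] by auto
      then show "\<exists>y\<in>D. dist y x < e" using \<open>0 < e\<close> by (intro bexI[of _ z]) (auto simp: admissible_def dist_norm)
    qed
    then show "x \<in> D" using compact_imp_closed[OF D] by simp
  qed
  have dist: "\<delta> \<le> dist x y" if x: "x \<in> S0" and y: "y \<in> P" for x y
  proof (rule field_le_epsilon)
    fix e :: real assume "0 < e"
    then obtain z S where z: "S \<in> admissible P D \<delta> r Pm" "z \<in> S" "norm (z - x) \<le> e" using pt[OF x] by blast
    have "\<delta> \<le> dist z y" by (rule admissible_far[OF z(1,2) y])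
    also have "\<dots> \<le> dist z x + dist x y" by (rule dist_triangle)
    finally show "\<delta> \<le> dist x y + e" using z(3) by (simp add: dist_norm)
  qed
  obtain \<Phi> A g G where "transport (1 / 2) \<Phi> A K C R m g0 G0 g G" and S: "{x. g x = 0} \<in> admissible P D \<delta> r Pm"
    and V: "toroidal_domain {x. g x < 0}" using approx[of "1 / 2"] by auto
  then interpret T: transport "1 / 2" \<Phi> A K C R m g0 G0 g G by blast
  have ne: "S0 \<noteq> {}" "P \<noteq> {}"
    using near[of "1 / 2"] by auto
  have V0: "toroidal_domain {x. g0 x < 0}"
    unfolding toroidal_domain_def
  proof (intro conjI)
    show "open {x. g0 x < 0}" using D0.g_continuous[of UNIV] by (intro open_Collect_less) auto
    have eq: "{x. g0 x < 0} = inv \<Phi> ` {x. g x < 0}"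
    proof
      show "{x. g0 x < 0} \<subseteq> inv \<Phi> ` {x. g x < 0}"
      proof
        fix x assume "x \<in> {x. g0 x < 0}"
        then have "\<Phi> x \<in> {x. g x < 0}" using T.neg_iff by simp
        moreover have "x = inv \<Phi> (\<Phi> x)" using T.bij by (simp add: bij_is_inj)
        ultimately show "x \<in> inv \<Phi> ` {x. g x < 0}" by blast
      qed
      show "inv \<Phi> ` {x. g x < 0} \<subseteq> {x. g0 x < 0}" using T.neg_iff by (auto simp: surj_f_inv_f[OF T.surj] simp flip: T.neg_iff)
    qed
    have "continuous_on {x. g x < 0} (inv \<Phi>)" using T.homeomorphism continuous_on_subset by (auto simp: homeomorphism_def)
    then show "connected {x. g0 x < 0}" unfolding eq using V by (intro connected_continuous_image) (auto simp: toroidal_domain_def)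
    obtain B where B: "\<And>x. g x < 0 \<Longrightarrow> norm x \<le> B" using V by (auto simp: toroidal_domain_def bounded_iff)
    have "norm x \<le> B + 1" if "g0 x < 0" for x
    proof -
      have "norm (\<Phi> x) \<le> B" using B that T.neg_iff by blast
      then show ?thesis using T.\<Phi>_near[of x] norm_triangle_ineq4[of "\<Phi> x" "\<Phi> x - x"] by simp
    qed
    then show "bounded {x. g0 x < 0}" by (auto simp: bounded_iff)
    have "homeomorphism S0 {x. g x = 0} \<Phi> (inv \<Phi>)"
      by (rule homeomorphism_of_subsets[OF T.homeomorphism]) (use T.image_zero in \<open>auto simp: S0_def\<close>)
    then have "S0 homeomorphic {x. g x = 0}" by (auto simp: homeomorphic_def)
    moreover have "toroidal_surface {x. g x = 0}" using V T.D.frontier_negative by (simp add: toroidal_domain_def)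
    ultimately show "toroidal_surface (frontier {x. g0 x < 0})"
      unfolding D0.frontier_negative toroidal_surface_def S0_def[symmetric] by (rule homeomorphic_trans)
  qed
  have PV: "P \<subseteq> {x. g0 x < 0}"
  proof
    fix y assume y: "y \<in> P"
    have "g0 y \<le> 0"
    proof (rule field_le_epsilon)
      fix e :: real assume "0 < e"
      then obtain e' where e': "0 < e'" "e' \<le> 1 / 2" "e' \<le> e" using small by blast
      have "g0 y \<le> e'" using near[OF e'(1,2)] y by blast
      then show "g0 y \<le> 0 + e" using e'(3) by simp
    qed
    moreover have "g0 y \<noteq> 0" using dist[of y y] y \<delta> by (auto simp: S0_def)
    ultimately show "y \<in> {x. g0 x < 0}" by simp
  qed
  have reach: "reach S0 \<ge> ereal r"
  proof (rule reach_limit[OF r])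
    show "closed S0" unfolding S0_def by (rule D0.closed_S)
    then have cl0: "closed S0" .
    show "S0 \<noteq> {}" by (rule ne)
    fix e :: real assume e: "e > 0"
    obtain e' where e': "0 < e'" "e' \<le> 1 / 2" "e' \<le> e" using small[OF e] by blast
    obtain \<Phi> S where S: "S \<in> admissible P D \<delta> r Pm" "\<Phi> ` S0 = S" "\<And>x. norm (\<Phi> x - x) \<le> e" "closed S" "S \<noteq> {}"
    proof -
      obtain \<Phi> S where S: "S \<in> admissible P D \<delta> r Pm" "\<Phi> ` S0 = S" "\<forall>x. norm (\<Phi> x - x) \<le> e'" "closed S" "S \<noteq> {}"
        using near[OF e'(1,2)] by blast
      then show ?thesis using e'(3) order_trans by (intro that[of S \<Phi>]) blast+
    qed
    have "\<bar>infdist y S - infdist y S0\<bar> \<le> e" for y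
    proof -
      obtain a where a: "a \<in> S0" "infdist y S0 = dist y a" using infdist_attains_inf[OF cl0 ne(1), of y] by blast
      have "infdist y S \<le> dist y (\<Phi> a)" using a S(2) by (intro infdist_le) auto
      also have "\<dots> \<le> dist y a + e" using dist_triangle[of y "\<Phi> a" a] S(3)[of a] by (simp add: dist_norm norm_minus_commute)
      finally have 1: "infdist y S \<le> infdist y S0 + e" using a by simp
      obtain b where b: "b \<in> S" "infdist y S = dist y b" using infdist_attains_inf[OF S(4,5), of y] by blast
      then obtain c where c: "c \<in> S0" "b = \<Phi> c" using S(2) by blast
      have "infdist y S0 \<le> dist y c" using c by (intro infdist_le)
      also have "\<dots> \<le> dist y b + e" using dist_triangle[of y c b] S(3)[of c] c by (simp add: dist_norm)
      finally show ?thesis using 1 b by linarith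
    qed
    then show "\<exists>S. closed S \<and> S \<noteq> {} \<and> reach S \<ge> ereal r \<and> (\<forall>y. \<bar>infdist y S - infdist y S0\<bar> \<le> e)"
      using S by (intro exI[of _ S]) (auto simp: admissible_def)
  qed
  have haus: "hausdorff2 S0 \<le> ennreal Pm"
  proof (rule tendsto_lowerbound)
    have "((\<lambda>\<epsilon>. (1 + 2 * \<epsilon>)\<^sup>2 * Pm) \<longlongrightarrow> (1 + 2 * 0)\<^sup>2 * Pm) (at_right (0::real))" by (intro tendsto_intros)
    then show "((\<lambda>\<epsilon>. ennreal ((1 + 2 * \<epsilon>)\<^sup>2 * Pm)) \<longlongrightarrow> ennreal Pm) (at_right (0::real))" by (intro tendsto_ennrealI) simp
    have "\<forall>\<^sub>F \<epsilon> in at_right (0::real). \<epsilon> \<in> {0<..<1 / 2}" by (rule eventually_at_right_real) simp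
    then show "\<forall>\<^sub>F \<epsilon> in at_right (0::real). hausdorff2 S0 \<le> ennreal ((1 + 2 * \<epsilon>)\<^sup>2 * Pm)"
    proof (rule eventually_mono)
      fix \<epsilon> :: real assume "\<epsilon> \<in> {0<..<1 / 2}"
      then show "hausdorff2 S0 \<le> ennreal ((1 + 2 * \<epsilon>)\<^sup>2 * Pm)" using near[of \<epsilon>] by auto
    qed
  qed simp
  have sd: "\<delta> \<le> setdist S0 P" using dist ne by (intro le_setdistI) auto
  have "S0 = frontier {x. g0 x < 0}" unfolding D0.frontier_negative S0_def ..
  then show ?thesis
    unfolding admissible_def S0_def[symmetric] using sub V0 PV D0.embedded_surface_zero_set reach sd haus unfolding S0_def by blast
qed

lemma (in transport) cost_transport:
  assumes c0: "cost_surface P T \<Lambda> \<delta> S0 M0" and c1: "cost_surface P T \<Lambda> \<delta> S1 M" and eps0: "\<epsilon> > 0"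
    and c: "c = 4 * (28 / \<delta> ^ 3 + 12 / \<delta>\<^sup>2) + 6 / \<delta>\<^sup>2"
    and cost: "cost P T \<Lambda> S1 \<le> \<kappa>" and E: "E = (1 + \<epsilon>) * (\<kappa> + \<epsilon>) + \<epsilon>"
  shows "cost P T \<Lambda> S0 \<le> (1 + 12 * \<epsilon>) ^ 4 * E + 2 * \<epsilon> * (c * (M + E / \<Lambda>))\<^sup>2 * measure lebesgue P"
proof -
  interpret C0: cost_surface P T \<Lambda> \<delta> S0 M0 by (rule c0)
  interpret C1: cost_surface P T \<Lambda> \<delta> S1 M by (rule c1)
  have ne: "L2_divfree_fields S1 \<noteq> {}" using C1.regular_divfree[OF D.zero_field] by blast
  have "cost P T \<Lambda> S1 < \<kappa> + \<epsilon>" using cost eps0 by linarith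
  then obtain j where j: "j \<in> L2_divfree_fields S1" "energy P T \<Lambda> S1 j < \<kappa> + \<epsilon>"
    unfolding cost_def energy_def[symmetric] using cINF_less_iff[OF ne] C1.energy_nonneg
    by (metis (no_types, lifting) bdd_belowI2)
  obtain X where X: "regular_tangent_field S1 X" "divergence_free S1 X" "energy P T \<Lambda> S1 X \<le> (1 + \<epsilon>) * energy P T \<Lambda> S1 j + \<epsilon>"
    using C1.regular_approximation[OF j(1) eps0] by blast
  have "(1 + \<epsilon>) * energy P T \<Lambda> S1 j \<le> (1 + \<epsilon>) * (\<kappa> + \<epsilon>)" using j(2) eps0 by (intro mult_left_mono) auto
  then have EX: "energy P T \<Lambda> S1 X \<le> E" using X(3) unfolding E by linarith
  have c0': "0 \<le> c" using C1.\<delta> by (simp add: c)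
  have "cost P T \<Lambda> S0 \<le> energy P T \<Lambda> S0 (piola X)"
    by (rule C0.cost_le_energy[OF C0.regular_divfree[OF piola_regular[OF X(1)] piola_divergence_free[OF X(1,2)]]])
  also have "\<dots> \<le> (1 + 12 * \<epsilon>) ^ 4 * energy P T \<Lambda> S1 X + 2 * \<epsilon> * (c * (M + energy P T \<Lambda> S1 X / \<Lambda>))\<^sup>2 * measure lebesgue P"
    by (rule energy_piola[OF c0 c1 X(1) eps0 c])
  also have "\<dots> \<le> (1 + 12 * \<epsilon>) ^ 4 * E + 2 * \<epsilon> * (c * (M + E / \<Lambda>))\<^sup>2 * measure lebesgue P"
    using EX eps0 c0' C1.energy_nonneg[of X] C1.\<Lambda> C1.M(2)
    by (intro add_mono mult_mono mult_left_mono mult_right_mono power_mono divide_right_mono) auto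
  finally show ?thesis .
qed

theorem theorem1:
  fixes P D :: "(real^3) set" and B\<^sub>T :: "real^3 \<Rightarrow> real^3"
    and \<delta> r_min P_max \<Lambda> :: real
  assumes "smooth_toroidal_domain P"
    and "compact D"
    and "\<delta> > 0" and "r_min > 0" and "P_max > 0" and "\<Lambda> > 0"
    and "B\<^sub>T \<in> borel_measurable (lebesgue_on P)"
    and "integrable (lebesgue_on P) (\<lambda>y. (norm (B\<^sub>T y))\<^sup>2)"
    and "admissible P D \<delta> r_min P_max \<noteq> {}"
  shows "\<exists>S0 \<in> admissible P D \<delta> r_min P_max.
           cost P B\<^sub>T \<Lambda> S0 = (INF S \<in> admissible P D \<delta> r_min P_max. cost P B\<^sub>T \<Lambda> S)"
proof -
  define \<O> where "\<O> = admissible P D \<delta> r_min P_max"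
  define \<iota> where "\<iota> = (INF S \<in> \<O>. cost P B\<^sub>T \<Lambda> S)"
  have P: "toroidal_domain P" using assms(1) by (simp add: smooth_toroidal_domain_def)
  have cs: "cost_surface P B\<^sub>T \<Lambda> \<delta> S P_max" if "S \<in> \<O>" for S
    using that unfolding \<O>_def by (rule admissible_cost_surface) (use assms P in auto)
  obtain R where "\<forall>x\<in>D. norm x \<le> R" using compact_imp_bounded[OF assms(2)] unfolding bounded_iff by blast
  then have R: "D \<subseteq> cball 0 R" by auto
  define K C R' m where "K = 8 / r_min" and "C = 9 / r_min\<^sup>2" and "R' = R + r_min" and "m = r_min / 3"
  have pair: "\<exists>g G. defining_pair K C R' m g G \<and> S = {x. g x = 0} \<and> toroidal_domain {x. g x < 0} \<and> P \<subseteq> {x. g x < 0}" if "S \<in> \<O>" for S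
    using admissible_defining_pair[OF that[unfolded \<O>_def] R assms(4)] by (simp only: K_def C_def R'_def m_def)
  have nonneg: "0 \<le> cost P B\<^sub>T \<Lambda> S" if S: "S \<in> \<O>" for S
  proof -
    obtain g G where gG: "defining_pair K C R' m g G" "S = {x. g x = 0}" using pair[OF S] by blast
    interpret cost_surface P B\<^sub>T \<Lambda> \<delta> S P_max by (rule cs[OF S])
    have "(\<lambda>_. 0) \<in> L2_divfree_fields S"
      using defining.zero_field[OF defining.intro[OF gG(1)]] unfolding gG(2)[symmetric] by (rule regular_divfree)
    then show ?thesis by (intro cost_nonneg) blast
  qed
  then have bdd: "bdd_below (cost P B\<^sub>T \<Lambda> ` \<O>)" by (intro bdd_belowI2)
  have ne: "\<O> \<noteq> {}" using assms(9) by (simp add: \<O>_def)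
  have "\<exists>S\<in>\<O>. cost P B\<^sub>T \<Lambda> S < \<iota> + 1 / real (Suc n)" for n
    unfolding \<iota>_def by (subst cINF_less_iff[OF ne bdd, symmetric]) simp
  then obtain Ss where Ss: "\<And>n. Ss n \<in> \<O>" "\<And>n. cost P B\<^sub>T \<Lambda> (Ss n) < \<iota> + 1 / real (Suc n)" by metis
  have "\<forall>n. \<exists>gG. defining_pair K C R' m (fst gG) (snd gG) \<and> Ss n = {x. fst gG x = 0}
      \<and> toroidal_domain {x. fst gG x < 0} \<and> P \<subseteq> {x. fst gG x < 0}"
    using pair[OF Ss(1)] by simp
  then obtain gG where gG: "\<And>n. defining_pair K C R' m (fst (gG n)) (snd (gG n))" "\<And>n. Ss n = {x. fst (gG n) x = 0}"
    "\<And>n. toroidal_domain {x. fst (gG n) x < 0}" "\<And>n. P \<subseteq> {x. fst (gG n) x < 0}" by metis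
  obtain k g0 G0 where k: "strict_mono (k :: nat \<Rightarrow> nat)" and dp0: "defining_pair K C R' m g0 G0"
    and uni: "\<And>\<eta>. \<eta> > 0 \<Longrightarrow> \<exists>N. \<forall>n\<ge>N. \<forall>x. \<bar>fst (gG (k n)) x - g0 x\<bar> \<le> \<eta> \<and> norm (snd (gG (k n)) x - G0 x) \<le> \<eta>"
    by (rule defining_pair_limit[OF gG(1)]) (rule that)
  have C: "C > 0" and m: "m > 0" using assms(4) by (simp_all add: C_def m_def)
  define S0 where "S0 = {x. g0 x = 0}"
  have approx: "\<exists>\<Phi> A g G. transport \<epsilon> \<Phi> A K C R' m g0 G0 g G \<and> {x. g x = 0} \<in> \<O> \<and> toroidal_domain {x. g x < 0}
      \<and> P \<subseteq> {x. g x < 0} \<and> (\<forall>x. \<bar>g x - g0 x\<bar> \<le> \<epsilon>) \<and> cost P B\<^sub>T \<Lambda> {x. g x = 0} \<le> \<iota> + \<epsilon>" if e: "0 < \<epsilon>" "\<epsilon> \<le> 1 / 2" for \<epsilon>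
  proof -
    have "\<exists>\<eta>>0. \<forall>g G. defining_pair K C R' m g G \<longrightarrow> (\<forall>x. \<bar>g x - g0 x\<bar> \<le> \<eta>) \<longrightarrow>
      (\<forall>x. norm (G x - G0 x) \<le> \<eta>) \<longrightarrow> (\<exists>\<Phi> A. near_identity \<epsilon> \<Phi> A \<and> intertwines g0 G0 g G \<Phi> A)"
    proof (rule near_identity_diffeo[OF dp0 C e(1)])
      fix \<eta> :: real
      assume \<eta>: "0 < \<eta>" and *: "\<And>g G. defining_pair K C R' m g G \<Longrightarrow> (\<And>x. \<bar>g x - g0 x\<bar> \<le> \<eta>) \<Longrightarrow>
        (\<And>x. norm (G x - G0 x) \<le> \<eta>) \<Longrightarrow> \<exists>\<Phi> A. near_identity \<epsilon> \<Phi> A \<and> intertwines g0 G0 g G \<Phi> A"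
      show ?thesis
      proof (intro exI[of _ \<eta>] conjI allI impI \<eta>)
        fix g G assume a: "defining_pair K C R' m g G" "\<forall>x. \<bar>g x - g0 x\<bar> \<le> \<eta>" "\<forall>x. norm (G x - G0 x) \<le> \<eta>"
        show "\<exists>\<Phi> A. near_identity \<epsilon> \<Phi> A \<and> intertwines g0 G0 g G \<Phi> A"
          by (rule *) (use a in simp_all)
      qed
    qed
    then obtain \<eta> where \<eta>: "\<eta> > 0" "\<And>g G. defining_pair K C R' m g G \<Longrightarrow> (\<forall>x. \<bar>g x - g0 x\<bar> \<le> \<eta>) \<Longrightarrow>
      (\<forall>x. norm (G x - G0 x) \<le> \<eta>) \<Longrightarrow> \<exists>\<Phi> A. near_identity \<epsilon> \<Phi> A \<and> intertwines g0 G0 g G \<Phi> A"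
      by metis
    obtain N where N: "\<And>n x. n \<ge> N \<Longrightarrow> \<bar>fst (gG (k n)) x - g0 x\<bar> \<le> min \<eta> \<epsilon> \<and> norm (snd (gG (k n)) x - G0 x) \<le> min \<eta> \<epsilon>"
      using uni[of "min \<eta> \<epsilon>"] \<eta>(1) e(1) by auto
    obtain N' where N': "1 / real (Suc N') < \<epsilon>" using reals_Archimedean[OF e(1)] by (auto simp: inverse_eq_divide)
    define n where "n = max N N'"
    define g G where "g = fst (gG (k n))" and "G = snd (gG (k n))"
    have close: "\<bar>g x - g0 x\<bar> \<le> min \<eta> \<epsilon>" "norm (G x - G0 x) \<le> min \<eta> \<epsilon>" for x
      using N[of n x] by (simp_all add: n_def g_def G_def)
    have dp: "defining_pair K C R' m g G" unfolding g_def G_def by (rule gG(1))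
    have "\<exists>\<Phi> A. near_identity \<epsilon> \<Phi> A \<and> intertwines g0 G0 g G \<Phi> A"
      by (rule \<eta>(2)[OF dp]) (use close in auto)
    then obtain \<Phi> A where \<Phi>: "near_identity \<epsilon> \<Phi> A" "intertwines g0 G0 g G \<Phi> A" by blast
    have "transport \<epsilon> \<Phi> A K C R' m g0 G0 g G"
      by (intro transport.intro near_id.intro defining.intro transport_axioms.intro \<Phi> e dp dp0 m)
    moreover have "{x. g x = 0} \<in> \<O>" unfolding g_def gG(2)[symmetric] by (rule Ss)
    moreover have "cost P B\<^sub>T \<Lambda> {x. g x = 0} \<le> \<iota> + \<epsilon>"
    proof -
      have "N' \<le> k n" using seq_suble[OF k, of n] by (simp add: n_def)
      then have "1 / real (Suc (k n)) \<le> 1 / real (Suc N')" by (intro divide_left_mono) auto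
      then show ?thesis using Ss(2)[of "k n"] N' unfolding g_def gG(2)[symmetric] by linarith
    qed
    ultimately show ?thesis using gG(3,4)[of "k n"] close unfolding g_def[symmetric]
      by (intro exI[of _ \<Phi>] exI[of _ A] exI[of _ g] exI[of _ G]) simp
  qed
  have adm: "S0 \<in> \<O>"
    unfolding S0_def \<O>_def
    by (rule limit_admissible[OF dp0 assms(2,3,4,5)]) (use approx in \<open>unfold \<O>_def, blast\<close>)
  define c where "c = 4 * (28 / \<delta> ^ 3 + 12 / \<delta>\<^sup>2) + 6 / \<delta>\<^sup>2"
  define f where "f = (\<lambda>\<epsilon>. (1 + 12 * \<epsilon>) ^ 4 * ((1 + \<epsilon>) * (\<iota> + \<epsilon> + \<epsilon>) + \<epsilon>)
    + 2 * \<epsilon> * (c * (P_max + ((1 + \<epsilon>) * (\<iota> + \<epsilon> + \<epsilon>) + \<epsilon>) / \<Lambda>))\<^sup>2 * measure lebesgue P)"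
  have "cost P B\<^sub>T \<Lambda> S0 \<le> \<iota>"
  proof (rule tendsto_lowerbound)
    have "(f \<longlongrightarrow> f 0) (at_right 0)" unfolding f_def using assms(6) by (intro tendsto_intros) auto
    then show "(f \<longlongrightarrow> \<iota>) (at_right 0)" by (simp add: f_def)
    have "\<forall>\<^sub>F \<epsilon> in at_right (0::real). \<epsilon> \<in> {0<..<1 / 2}" by (rule eventually_at_right_real) simp
    then show "\<forall>\<^sub>F \<epsilon> in at_right (0::real). cost P B\<^sub>T \<Lambda> S0 \<le> f \<epsilon>"
    proof (rule eventually_mono)
      fix \<epsilon> :: real assume "\<epsilon> \<in> {0<..<1 / 2}"
      then have e: "0 < \<epsilon>" "\<epsilon> \<le> 1 / 2" by auto
      obtain \<Phi> A g G where T: "transport \<epsilon> \<Phi> A K C R' m g0 G0 g G" "{x. g x = 0} \<in> \<O>" "cost P B\<^sub>T \<Lambda> {x. g x = 0} \<le> \<iota> + \<epsilon>"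
        using approx[OF e] by blast
      show "cost P B\<^sub>T \<Lambda> S0 \<le> f \<epsilon>"
        unfolding f_def S0_def
        by (rule transport.cost_transport[OF T(1) cs[OF adm[unfolded S0_def]] cs[OF T(2)] e(1) c_def T(3) refl])
    qed
  qed simp
  moreover have "\<iota> \<le> cost P B\<^sub>T \<Lambda> S0" unfolding \<iota>_def by (rule cINF_lower[OF bdd adm])
  ultimately have "cost P B\<^sub>T \<Lambda> S0 = \<iota>" by (rule antisym)
  then show ?thesis using adm unfolding \<iota>_def \<O>_def by blast
qed

end
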